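(* Let $d\ge1$ be an integer, $X\subset\mathbb{R}^d$ compact and convex, and $1-\frac1d<\alpha<1$. Let $\mathbf{P}$ be an optimal traffic plan for the mailing problem, i.e. $\mathbf{P}\in\mathbf{OTP}(\pi_{\mathbf{P}})$, and assume that there exists $C>0$ such that $$\int_0^\infty|\dot\gamma(t)|\,dt\ge C\qquad\text{for }\mathbf{P}\text{-a.e. }\gamma.$$ Then: (1) for every $x\in\mathbb{R}^d\setminus(\mathrm{supp}(\mu^-_{\mathbf{P}})\cup\mathrm{supp}(\mu^+_{\mathbf{P}}))$, $\mathbf{P}$ has a finite number of connected components in $\mathbb{R}^d\setminus\{x\}$; (2) $\mathbf{P}$ has a finite number of connected components in $\mathbb{R}^d$.
   Context: $\mathrm{Lip}_1$ is the space of $1$-Lipschitz curves $\gamma:[0,\infty)\to X$, with the metric of uniform convergence on compact subsets of $[0,\infty)$. The stopping time is $T(\gamma):=\inf\{t\ge0:\dot\gamma(s)=0\text{ for a.e. }s\ge t\}$. A traffic plan is a finite positive Radon measure $\mathbf{P}$ on $\mathrm{Lip}_1$ giving full measure to $\{\gamma:T(\gamma)<\infty\}$. For such curves $e_0(\gamma)=\gamma(0)$, $e_\infty(\gamma)=\gamma(T(\gamma))$. The coupling of $\mathbf{P}$ is $\pi_{\mathbf{P}}:=(e_0,e_\infty)_\sharp\mathbf{P}$; $\mu^-_{\mathbf{P}}:=(e_0)_\sharp\mathbf{P}$, $\mu^+_{\mathbf{P}}:=(e_\infty)_\sharp\mathbf{P}$. $\mathbf{TP}(\pi)$ is the set of traffic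 plans with coupling $\pi$. Multiplicity: $|x|_{\mathbf{P}}:=\mathbf{P}(\{\gamma:\gamma(t)=x\text{ for some }t\ge0\})$. Energy: $\mathcal{E}^\alpha(\mathbf{P}):=\int_{\mathrm{Lip}_1}\int_0^\infty|\gamma(t)|_{\mathbf{P}}^{\alpha-1}|\dot\gamma(t)|\,dt\,d\mathbf{P}(\gamma)$, with $0^{\alpha-1}=+\infty$. $\mathbf{OTP}(\pi)$ is the set of $\mathbf{P}\in\mathbf{TP}(\pi)$ with $\mathcal{E}^\alpha(\mathbf{P})\le\mathcal{E}^\alpha(\mathbf{P}')$ for all $\mathbf{P}'\in\mathbf{TP}(\pi)$. For $t_1\le t_2$, $\mathrm{res}_{t_1,t_2}(\gamma)$ is the curve equal to $\gamma(t_1)$ for $t\le t_1$, to $\gamma(t)$ for $t_1<t<t_2$, and to $\gamma(t_2)$ for $t\ge t_2$. A curve $\gamma$ is simple if there are no times $t_1<t_2<t_3$ with $\gamma(t_1)=\gamma(t_3)\ne\gamma(t_2)$. For $x,y\in X$, let $A_{x,y}$ be the set of simple $\gamma\in\mathrm{Lip}_1$ for which there are $t_1\le t_2$ with $\gamma(t_1)=x$, $\gamma(t_2)=y$. For $\gamma\in A_{x,y}$ let $t_x,t_y$ be the first times at which $\gamma$ passes through $x$, $y$ respectively. Set $\mathbf{P}_{x,y}:=(\mathrm{res}_{t_x,t_y})_\sharp(\mathbf{P}\llcorner A_{x,y})$ and $$\Gamma_{x,y}:=\{p:|p|_{\mathbf{P}_{x,y}}>0\}\cup\{p:|p|_{\mathbf{P}_{y,x}}>0\},\qquad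 \Gamma_{\mathbf{P}}:=\{x:|x|_{\mathbf{P}}>0\}.$$ Connected components: let $\mathbf{P}\in\mathbf{OTP}(\pi_{\mathbf{P}})$ and let $U\subset\mathbb{R}^d$ be open. Two points $x,y$ are connected in $U$ if there is a chain $x_1=x,\dots,x_l=y$ such that $\emptyset\ne\Gamma_{x_i,x_{i+1}}\subset U$ for each $i$. This is regarded as an equivalence relation on $\Gamma_{\mathbf{P}}$; a connected component of $\mathbf{P}$ in $U$ is a set $F\subset\Gamma_{\mathbf{P}}$ that is an equivalence class of this relation. *)

theory Defs
  imports "HOL-Analysis.Analysis"
begin

section \<open>The space of 1-Lipschitz curves\<close>

text \<open>
  A curve \<open>[0,\<infinity>) \<rightarrow> X\<close> is a function on \<open>real\<close> that is \<open>undefined\<close> at negative times,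
  so that equality of functions is equality of curves.
\<close>

definition Lip1 :: "'a::euclidean_space set \<Rightarrow> (real \<Rightarrow> 'a) set" where
  "Lip1 X = {\<gamma> \<in> {0..} \<rightarrow>\<^sub>E X. 1-lipschitz_on {0..} \<gamma>}"

text \<open>
  The topology of uniform convergence on compact subsets of \<open>[0,\<infinity>)\<close>; only the topology, not a
  particular metric inducing it, matters below.
\<close>

definition Lip1_open :: "'a::euclidean_space set \<Rightarrow> (real \<Rightarrow> 'a) set \<Rightarrow> bool" where
  "Lip1_open X U \<longleftrightarrow> U \<subseteq> Lip1 X \<and>
     (\<forall>\<gamma>\<in>U. \<exists>K \<epsilon>. compact K \<and> K \<subseteq> {0..} \<and> 0 < \<epsilon> \<and>
        (\<forall>\<eta>\<in>Lip1 X. (\<forall>t\<in>K. dist (\<gamma> t) (\<eta> t) < \<epsilon>) \<longrightarrow> \<eta> \<in> U))"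

definition Lip1_topology :: "'a::euclidean_space set \<Rightarrow> (real \<Rightarrow> 'a) topology" where
  "Lip1_topology X = topology (Lip1_open X)"

lemma istopology_Lip1_open: "istopology (Lip1_open X)"
  unfolding istopology_def
proof (intro conjI allI impI)
  fix S T assume S: "Lip1_open X S" and T: "Lip1_open X T"
  show "Lip1_open X (S \<inter> T)"
    unfolding Lip1_open_def
  proof (intro conjI ballI)
    show "S \<inter> T \<subseteq> Lip1 X"
      using S by (auto simp: Lip1_open_def)
    fix \<gamma> assume g: "\<gamma> \<in> S \<inter> T"
    obtain K \<epsilon> where K: "compact K" "K \<subseteq> {0..}" "0 < \<epsilon>"
      "\<And>\<eta>. \<eta> \<in> Lip1 X \<Longrightarrow> (\<forall>t\<in>K. dist (\<gamma> t) (\<eta> t) < \<epsilon>) \<Longrightarrow> \<eta> \<in> S"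
      using S g unfolding Lip1_open_def by (metis IntD1)
    obtain L \<delta> where L: "compact L" "L \<subseteq> {0..}" "0 < \<delta>"
      "\<And>\<eta>. \<eta> \<in> Lip1 X \<Longrightarrow> (\<forall>t\<in>L. dist (\<gamma> t) (\<eta> t) < \<delta>) \<Longrightarrow> \<eta> \<in> T"
      using T g unfolding Lip1_open_def by (metis IntD2)
    show "\<exists>K \<epsilon>. compact K \<and> K \<subseteq> {0..} \<and> 0 < \<epsilon> \<and>
        (\<forall>\<eta>\<in>Lip1 X. (\<forall>t\<in>K. dist (\<gamma> t) (\<eta> t) < \<epsilon>) \<longrightarrow> \<eta> \<in> S \<inter> T)"
      using K L by (intro exI[of _ "K \<union> L"] exI[of _ "min \<epsilon> \<delta>"]) (auto intro: compact_Un)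
  qed
next
  fix \<K> assume "\<forall>K\<in>\<K>. Lip1_open X K"
  then show "Lip1_open X (\<Union>\<K>)"
    unfolding Lip1_open_def by (simp add: Sup_le_iff) (meson UnionI)
qed

lemma openin_Lip1_topology: "openin (Lip1_topology X) U \<longleftrightarrow> Lip1_open X U"
  by (simp add: Lip1_topology_def istopology_Lip1_open topology_inverse')

lemma topspace_Lip1_topology: "topspace (Lip1_topology X) = Lip1 X"
proof
  show "topspace (Lip1_topology X) \<subseteq> Lip1 X"
    by (auto simp: topspace_def openin_Lip1_topology Lip1_open_def)
  have "Lip1_open X (Lip1 X)"
    unfolding Lip1_open_def
    by (auto intro!: exI[of _ "{}"] exI[of _ "1::real"])
  then show "Lip1 X \<subseteq> topspace (Lip1_topology X)"
    by (simp add: openin_Lip1_topology openin_subset)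
qed

definition Lip1_borel :: "'a::euclidean_space set \<Rightarrow> (real \<Rightarrow> 'a) measure" where
  "Lip1_borel X = sigma (Lip1 X) {U. openin (Lip1_topology X) U}"

section \<open>Traffic plans\<close>

definition speed :: "(real \<Rightarrow> 'a::euclidean_space) \<Rightarrow> real \<Rightarrow> real" where
  "speed \<gamma> t = norm (vector_derivative \<gamma> (at t within {0..}))"

text \<open>The infimum of the empty set is \<open>\<infinity>\<close>.\<close>

definition stopping_time :: "(real \<Rightarrow> 'a::euclidean_space) \<Rightarrow> ereal" where
  "stopping_time \<gamma> = Inf (ereal ` {t. 0 \<le> t \<and>
     (AE s in lborel. t \<le> s \<longrightarrow> (\<gamma> has_vector_derivative 0) (at s within {0..}))})"

definition e0 :: "(real \<Rightarrow> 'a::euclidean_space) \<Rightarrow> 'a" where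
  "e0 \<gamma> = \<gamma> 0"

text \<open>Only meaningful when \<open>stopping_time \<gamma> < \<infinity>\<close>.\<close>

definition einf :: "(real \<Rightarrow> 'a::euclidean_space) \<Rightarrow> 'a" where
  "einf \<gamma> = \<gamma> (real_of_ereal (stopping_time \<gamma>))"

text \<open>The last conjunct but one (inner regularity) says that the finite Borel measure is Radon.\<close>

definition traffic_plan :: "'a::euclidean_space set \<Rightarrow> (real \<Rightarrow> 'a) measure \<Rightarrow> bool" where
  "traffic_plan X P \<longleftrightarrow>
     space P = Lip1 X \<and> sets P = sets (Lip1_borel X) \<and> finite_measure P \<and>
     (\<forall>A\<in>sets P. emeasure P A = (SUP K\<in>{K. compactin (Lip1_topology X) K \<and> K \<subseteq> A}. emeasure P K)) \<and>
     (AE \<gamma> in P. stopping_time \<gamma> < \<infinity>)"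

definition coupling :: "(real \<Rightarrow> 'a::euclidean_space) measure \<Rightarrow> ('a \<times> 'a) measure" where
  "coupling P = distr P borel (\<lambda>\<gamma>. (e0 \<gamma>, einf \<gamma>))"

definition mu_minus :: "(real \<Rightarrow> 'a::euclidean_space) measure \<Rightarrow> 'a measure" where
  "mu_minus P = distr P borel e0"

definition mu_plus :: "(real \<Rightarrow> 'a::euclidean_space) measure \<Rightarrow> 'a measure" where
  "mu_plus P = distr P borel einf"

definition supp :: "'a::topological_space measure \<Rightarrow> 'a set" where
  "supp \<mu> = {x. \<forall>U. open U \<longrightarrow> x \<in> U \<longrightarrow> emeasure \<mu> U > 0}"

definition TP :: "'a::euclidean_space set \<Rightarrow> ('a \<times> 'a) measure \<Rightarrow> (real \<Rightarrow> 'a) measure set" where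
  "TP X \<pi> = {P. traffic_plan X P \<and> coupling P = \<pi>}"

definition multiplicity_at :: "(real \<Rightarrow> 'a::euclidean_space) measure \<Rightarrow> 'a \<Rightarrow> real" where
  "multiplicity_at P x = measure P {\<gamma> \<in> space P. \<exists>t\<ge>0. \<gamma> t = x}"

text \<open>\<open>m\<^sup>\<alpha>\<^sup>-\<^sup>1\<close> with the convention \<open>0\<^sup>\<alpha>\<^sup>-\<^sup>1 = \<infinity>\<close>, unlike \<open>powr\<close>.\<close>

definition weight :: "real \<Rightarrow> real \<Rightarrow> ennreal" where
  "weight \<alpha> m = (if m = 0 then \<infinity> else ennreal (m powr (\<alpha> - 1)))"

definition energy :: "real \<Rightarrow> (real \<Rightarrow> 'a::euclidean_space) measure \<Rightarrow> ennreal" where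
  "energy \<alpha> P =
     (\<integral>\<^sup>+\<gamma>. (\<integral>\<^sup>+t\<in>{0..}. weight \<alpha> (multiplicity_at P (\<gamma> t)) * ennreal (speed \<gamma> t) \<partial>lborel) \<partial>P)"

definition OTP ::
  "'a::euclidean_space set \<Rightarrow> real \<Rightarrow> ('a \<times> 'a) measure \<Rightarrow> (real \<Rightarrow> 'a) measure set" where
  "OTP X \<alpha> \<pi> = {P \<in> TP X \<pi>. \<forall>P'\<in>TP X \<pi>. energy \<alpha> P \<le> energy \<alpha> P'}"

section \<open>Connected components\<close>

definition res :: "real \<Rightarrow> real \<Rightarrow> (real \<Rightarrow> 'a::euclidean_space) \<Rightarrow> (real \<Rightarrow> 'a)" where
  "res t1 t2 \<gamma> = (\<lambda>t\<in>{0..}. if t \<le> t1 then \<gamma> t1 else if t < t2 then \<gamma> t else \<gamma> t2)"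

definition simple_curve :: "(real \<Rightarrow> 'a::euclidean_space) \<Rightarrow> bool" where
  "simple_curve \<gamma> \<longleftrightarrow>
     \<not> (\<exists>t1 t2 t3. 0 \<le> t1 \<and> t1 < t2 \<and> t2 < t3 \<and> \<gamma> t1 = \<gamma> t3 \<and> \<gamma> t3 \<noteq> \<gamma> t2)"

definition passing :: "'a::euclidean_space set \<Rightarrow> 'a \<Rightarrow> 'a \<Rightarrow> (real \<Rightarrow> 'a) set" where
  "passing X x y = {\<gamma> \<in> Lip1 X. simple_curve \<gamma> \<and>
     (\<exists>t1 t2. 0 \<le> t1 \<and> t1 \<le> t2 \<and> \<gamma> t1 = x \<and> \<gamma> t2 = y)}"

definition first_time :: "'a::euclidean_space \<Rightarrow> (real \<Rightarrow> 'a) \<Rightarrow> real" where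
  "first_time x \<gamma> = Inf {t. 0 \<le> t \<and> \<gamma> t = x}"

text \<open>\<open>restrict_space P A\<close> stands for the restricted measure \<open>P \<llcorner> A\<close>, carried by \<open>A\<close> itself.\<close>

definition plan_between ::
  "'a::euclidean_space set \<Rightarrow> (real \<Rightarrow> 'a) measure \<Rightarrow> 'a \<Rightarrow> 'a \<Rightarrow> (real \<Rightarrow> 'a) measure" where
  "plan_between X P x y = distr (restrict_space P (passing X x y)) (Lip1_borel X)
     (\<lambda>\<gamma>. res (first_time x \<gamma>) (first_time y \<gamma>) \<gamma>)"

definition Gamma_between ::
  "'a::euclidean_space set \<Rightarrow> (real \<Rightarrow> 'a) measure \<Rightarrow> 'a \<Rightarrow> 'a \<Rightarrow> 'a set" where
  "Gamma_between X P x y =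
     {p. multiplicity_at (plan_between X P x y) p > 0} \<union>
     {p. multiplicity_at (plan_between X P y x) p > 0}"

definition Gamma_plan :: "(real \<Rightarrow> 'a::euclidean_space) measure \<Rightarrow> 'a set" where
  "Gamma_plan P = {x. multiplicity_at P x > 0}"

text \<open>
  The one-point chain is allowed, so every point is connected to itself. This makes the relation
  below reflexive on all of \<open>Gamma_plan P\<close>; a point of \<open>Gamma_plan P\<close> outside \<open>U\<close> is a class of its own.
\<close>

definition connected_via ::
  "'a::euclidean_space set \<Rightarrow> (real \<Rightarrow> 'a) measure \<Rightarrow> 'a set \<Rightarrow> 'a \<Rightarrow> 'a \<Rightarrow> bool" where
  "connected_via X P U x y \<longleftrightarrow>
     (\<exists>xs. xs \<noteq> [] \<and> hd xs = x \<and> last xs = y \<and>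
        (\<forall>i. Suc i < length xs \<longrightarrow>
           Gamma_between X P (xs ! i) (xs ! Suc i) \<noteq> {} \<and>
           Gamma_between X P (xs ! i) (xs ! Suc i) \<subseteq> U))"

definition connection_rel ::
  "'a::euclidean_space set \<Rightarrow> (real \<Rightarrow> 'a) measure \<Rightarrow> 'a set \<Rightarrow> ('a \<times> 'a) set" where
  "connection_rel X P U =
     {(x, y). x \<in> Gamma_plan P \<and> y \<in> Gamma_plan P \<and> connected_via X P U x y}"

definition connected_components ::
  "'a::euclidean_space set \<Rightarrow> (real \<Rightarrow> 'a) measure \<Rightarrow> 'a set \<Rightarrow> 'a set set" where
  "connected_components X P U = Gamma_plan P // connection_rel X P U"

lemma Gamma_between_commute: "Gamma_between X P x y = Gamma_between X P y x"
  by (auto simp: Gamma_between_def)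

lemma connected_via_sym:
  assumes "connected_via X P U x y"
  shows "connected_via X P U y x"
proof -
  obtain xs where xs: "xs \<noteq> []" "hd xs = x" "last xs = y"
    and ch: "\<And>i. Suc i < length xs \<Longrightarrow> Gamma_between X P (xs ! i) (xs ! Suc i) \<noteq> {} \<and>
      Gamma_between X P (xs ! i) (xs ! Suc i) \<subseteq> U"
    using assms unfolding connected_via_def by blast
  have "Gamma_between X P (rev xs ! i) (rev xs ! Suc i) \<noteq> {} \<and>
      Gamma_between X P (rev xs ! i) (rev xs ! Suc i) \<subseteq> U" if i: "Suc i < length (rev xs)" for i
  proof -
    define j where "j = length xs - Suc (Suc i)"
    have "rev xs ! i = xs ! Suc j" "rev xs ! Suc i = xs ! j" "Suc j < length xs"
      using i by (auto simp: rev_nth j_def Suc_diff_Suc)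
    then show ?thesis
      using ch[of j] by (simp add: Gamma_between_commute)
  qed
  then show ?thesis
    unfolding connected_via_def using xs
    by (intro exI[of _ "rev xs"]) (auto simp: hd_rev last_rev)
qed

lemma connected_via_trans:
  assumes "connected_via X P U x y" "connected_via X P U y z"
  shows "connected_via X P U x z"
proof -
  define Q where "Q a b \<longleftrightarrow> Gamma_between X P a b \<noteq> {} \<and> Gamma_between X P a b \<subseteq> U" for a b
  have succ: "connected_via X P U a b \<longleftrightarrow>
      (\<exists>xs. xs \<noteq> [] \<and> hd xs = a \<and> last xs = b \<and> successively Q xs)" for a b
    by (simp add: connected_via_def successively_conv_nth Q_def)
  obtain xs where xs: "xs \<noteq> []" "hd xs = x" "last xs = y" "successively Q xs"
    using assms(1) succ by blast
  obtain ys where ys: "ys \<noteq> []" "hd ys = y" "last ys = z" "successively Q ys"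
    using assms(2) succ by blast
  obtain ys' where ys': "ys = y # ys'"
    using ys by (cases ys) auto
  have "successively Q (xs @ ys')"
    using xs ys unfolding ys' by (cases ys') (auto simp: successively_append_iff)
  moreover have "last (xs @ ys') = z"
    using xs ys unfolding ys' by (cases ys') auto
  ultimately show ?thesis
    using xs succ by (metis append_is_Nil_conv hd_append2)
qed

lemma equiv_connection_rel: "equiv (Gamma_plan P) (connection_rel X P U)"
proof (rule equivI)
  show "connection_rel X P U \<subseteq> Gamma_plan P \<times> Gamma_plan P"
    by (auto simp: connection_rel_def)
  have "connected_via X P U x x" for x
    unfolding connected_via_def by (intro exI[of _ "[x]"]) auto
  then show "refl_on (Gamma_plan P) (connection_rel X P U)"
    by (auto simp: refl_on_def connection_rel_def)
  show "sym (connection_rel X P U)"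
    by (auto simp: sym_def connection_rel_def intro: connected_via_sym)
  show "trans (connection_rel X P U)"
    by (auto simp: trans_def connection_rel_def intro: connected_via_trans)
qed

end

theory Submission
  imports Defs
begin

text \<open>
  Write \<open>\<theta>\<close> for the multiplicity. Erasing loops does not increase the energy, so an optimal plan charges only
  simple curves. The main tool is a surgery inequality: if half of the mass is rerouted from segments of the
  curves to paths \<open>\<pi>\<close>, then \<open>\<theta>\<close> drops at most to \<open>\<theta> / 2\<close>, and optimality bounds \<open>\<alpha>\<close> times the energy carried by
  the segments by the integral of \<open>(max \<theta> \<theta>\<^sub>\<pi> / 2) powr (\<alpha> - 1)\<close> along the paths.

  Applied to the curves that go from \<open>y\<close> to \<open>z\<close> through \<open>x\<close>, it shows that there are none as soon as some curve
  of the plan joins \<open>y\<close> to \<open>z\<close> at a cost that is small compared with \<open>dist y x\<close>. Hence all points of a curve on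
  the same side of \<open>x\<close> lie in one component, and a curve meets at most two of them.

  Applied to all curves through a point \<open>y\<close> of almost maximal multiplicity in its component, rerouted along
  dyadic paths (total cost at most \<open>\<delta> * \<theta> y powr \<alpha>\<close> with \<open>\<delta>\<close> as small as we like, since \<open>\<alpha> > 1 - 1 / d\<close>) and then
  along finitely many fixed curves of the plan (total cost \<open>O(\<theta> y)\<close>), it bounds \<open>\<theta> y\<close> from below, because the
  removed segments have length bounded below. So there are finitely many components away from \<open>x\<close>. Choosing
  \<open>x\<close> outside \<open>X\<close> gives the second claim.
\<close>

section \<open>The measurable space of curves\<close>

text \<open>The usual formula for the energy, the integral of \<open>\<theta> powr \<alpha>\<close>
  with respect to length over the network, would require rectifiability of the network. It is
  replaced by a statement about two curves: on the common trace a simple curve is not longer than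
  the other one (\<open>lint_trace_le\<close>). Integrated over pairs of curves this becomes the
  exchange inequality \<open>lint_mass_le\<close>; hence the insistence on simple curves. Exchange
  also turns a property that holds for each point and almost every curve through it into one that
  holds for almost every curve at almost every moving time (\<open>AE_swap\<close>), although the
  points are uncountably many. Half of the mass stays in place because
  \<open>\<theta> powr (\<alpha> - 1)\<close> blows up at small multiplicities, whereas halving
  costs only the factor \<open>cc\<close>. Two points of one curve need not share a set of curves of
  positive mass, so links are made at generic times and chained. Convexity of \<open>X\<close> keeps
  the dyadic paths inside \<open>X\<close>, and \<open>\<alpha> > 1 - 1 / d\<close> is equivalent to
  \<open>qq < 1\<close>, the convergence of the geometric series of level costs.\<close>

lemma dist_triangle4: "dist a b \<le> dist a c + dist c d + dist d (b :: 'a::metric_space)"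
  using dist_triangle[of a b c] dist_triangle[of c b d] by linarith

lemma Lip1_in: "c \<in> Lip1 X \<Longrightarrow> 0 \<le> t \<Longrightarrow> c t \<in> X"
  by (auto simp: Lip1_def PiE_def Pi_def)

lemma Lip1_dist: "c \<in> Lip1 X \<Longrightarrow> 0 \<le> s \<Longrightarrow> 0 \<le> t \<Longrightarrow> dist (c s) (c t) \<le> \<bar>s - t\<bar>"
  by (auto simp: Lip1_def lipschitz_on_def dist_real_def)

lemma Lip1_undef: "c \<in> Lip1 X \<Longrightarrow> t < 0 \<Longrightarrow> c t = undefined"
  by (auto simp: Lip1_def PiE_def extensional_def)

lemma Lip1_I:
  assumes "\<And>t. 0 \<le> t \<Longrightarrow> c t \<in> X" "\<And>t. t < 0 \<Longrightarrow> c t = undefined"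
    "\<And>s t. 0 \<le> s \<Longrightarrow> s \<le> t \<Longrightarrow> dist (c s) (c t) \<le> t - s"
  shows "c \<in> Lip1 X"
proof -
  have "dist (c s) (c t) \<le> \<bar>s - t\<bar>" if "0 \<le> s" "0 \<le> t" for s t
    using assms(3)[of s t] assms(3)[of t s] that by (cases "s \<le> t") (auto simp: dist_commute)
  then show ?thesis
    using assms(1,2) unfolding Lip1_def lipschitz_on_def
    by (auto simp: PiE_def extensional_def dist_real_def)
qed

lemma Lip1_continuous_on: "c \<in> Lip1 X \<Longrightarrow> continuous_on {0..} c"
  by (auto simp: Lip1_def intro: lipschitz_on_continuous_on)

lemma Lip1_tendsto:
  assumes "c \<in> Lip1 X" "0 \<le> t" "\<And>n. 0 \<le> s n" "s \<longlonglongrightarrow> t"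
  shows "(\<lambda>n. c (s n)) \<longlonglongrightarrow> c t"
  using continuous_on_tendsto_compose[OF Lip1_continuous_on[OF assms(1)] assms(4)] assms by auto

lemma Lip1_ext:
  assumes "c \<in> Lip1 X" "\<eta> \<in> Lip1 Y" "\<And>t. 0 \<le> t \<Longrightarrow> c t = \<eta> t"
  shows "c = \<eta>"
proof
  fix t show "c t = \<eta> t"
    using assms Lip1_undef[OF assms(1)] Lip1_undef[OF assms(2)] by (cases "0 \<le> t") auto
qed

lemma space_Lip1_borel [simp]: "space (Lip1_borel X) = Lip1 X"
  unfolding Lip1_borel_def by (rule space_measure_of) (auto simp: openin_Lip1_topology Lip1_open_def)

lemma sets_Lip1_borel: "sets (Lip1_borel X) = sigma_sets (Lip1 X) {U. openin (Lip1_topology X) U}"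
  unfolding Lip1_borel_def by (rule sets_measure_of) (auto simp: openin_Lip1_topology Lip1_open_def)

lemma measurable_eval:
  assumes "0 \<le> t" shows "(\<lambda>c. c t) \<in> borel_measurable (Lip1_borel X)"
proof (rule borel_measurableI)
  fix S :: "'a set" assume S: "open S"
  have "Lip1_open X ((\<lambda>c. c t) -` S \<inter> Lip1 X)"
    unfolding Lip1_open_def
  proof (intro conjI ballI)
    fix c assume g: "c \<in> (\<lambda>c. c t) -` S \<inter> Lip1 X"
    then obtain e where "e > 0" "\<And>y. dist y (c t) < e \<Longrightarrow> y \<in> S"
      using S unfolding open_dist by auto
    then show "\<exists>K \<epsilon>. compact K \<and> K \<subseteq> {0..} \<and> 0 < \<epsilon> \<and>
        (\<forall>\<eta>\<in>Lip1 X. (\<forall>t\<in>K. dist (c t) (\<eta> t) < \<epsilon>) \<longrightarrow> \<eta> \<in> (\<lambda>c. c t) -` S \<inter> Lip1 X)"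
      using assms by (intro exI[of _ "{t}"] exI[of _ e]) (auto simp: dist_commute)
  qed auto
  then show "(\<lambda>c. c t) -` S \<inter> space (Lip1_borel X) \<in> sets (Lip1_borel X)"
    by (simp add: sets_Lip1_borel openin_Lip1_topology)
qed

definition Lip1_basic :: "'a::euclidean_space set \<Rightarrow> nat \<Rightarrow> 'a list \<Rightarrow> (real \<Rightarrow> 'a) set" where
  "Lip1_basic X m v = {\<eta>\<in>Lip1 X. \<forall>i<length v. dist (\<eta> (real i / real (Suc m))) (v ! i) < 1 / real (Suc m)}"

text \<open>Curves are 1-Lipschitz, so closeness up to \<open>1 / real (Suc m)\<close> to prescribed
  values at the times of a grid of that mesh confines two curves to distance four times as large on
  the whole interval covered by the grid. Finite lists over a countable dense set therefore give a
  countable base of the topology.\<close>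

lemma Lip1_open_basic:
  fixes X :: "'a::euclidean_space set"
  assumes "countable D" "closure D = (UNIV :: 'a set)" "Lip1_open X U" "c \<in> U"
  shows "\<exists>m v. set v \<subseteq> D \<and> c \<in> Lip1_basic X m v \<and> Lip1_basic X m v \<subseteq> U"
proof -
  obtain K e where K: "compact K" "K \<subseteq> {0..}" "0 < e"
    "\<And>\<eta>. \<eta> \<in> Lip1 X \<Longrightarrow> (\<forall>t\<in>K. dist (c t) (\<eta> t) < e) \<Longrightarrow> \<eta> \<in> U"
    using assms(3,4) unfolding Lip1_open_def by metis
  have g: "c \<in> Lip1 X" using assms(3,4) by (auto simp: Lip1_open_def)
  obtain N where N: "\<And>t. t \<in> K \<Longrightarrow> t \<le> real N"
  proof -
    obtain B where "\<forall>t\<in>K. \<bar>t\<bar> \<le> B" using compact_imp_bounded[OF K(1)] by (auto simp: bounded_iff)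
    then show ?thesis using real_arch_simple[of B] that by (meson abs_le_D1 order_trans)
  qed
  obtain m where "4 / e < real m" using reals_Archimedean2 by blast
  then have m: "4 / real (Suc m) < e" using K(3)
    by (simp add: field_simps)
  define M where "M = real (Suc m)"
  have M: "M > 0" "4 / M < e" using m by (auto simp: M_def)
  have ex: "\<exists>x\<in>D. dist (c (real i / M)) x < 1 / M" for i
  proof -
    have "c (real i / M) \<in> closure D" using assms(2) by simp
    then show ?thesis using M(1) unfolding closure_approachable
      by (metis dist_commute zero_less_divide_1_iff)
  qed
  then obtain d where d: "\<And>i. d i \<in> D" "\<And>i. dist (c (real i / M)) (d i) < 1 / M" by metis
  define v where "v = map d [0..<Suc (N * Suc m)]"
  have "c \<in> Lip1_basic X m v"
    unfolding Lip1_basic_def using g d(2) by (auto simp: v_def M_def nth_append simp del: upt_Suc)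
  moreover have "Lip1_basic X m v \<subseteq> U"
  proof
    fix \<eta> assume h: "\<eta> \<in> Lip1_basic X m v"
    then have h1: "\<eta> \<in> Lip1 X" by (auto simp: Lip1_basic_def)
    have "dist (c t) (\<eta> t) < e" if t: "t \<in> K" for t
    proof -
      have t0: "0 \<le> t" "t \<le> real N" using K(2) N t by auto
      define i where "i = nat \<lfloor>t * M\<rfloor>"
      have i: "real i \<le> t * M" "t * M \<le> real i + 1"
        using t0(1) M(1) by (auto simp: i_def)
      have "t * M \<le> real N * M" using t0 M by (intro mult_right_mono) auto
      then have "real i \<le> real N * real (Suc m)" using i(1) unfolding M_def by linarith
      then have "real i \<le> real (N * Suc m)" by (simp only: of_nat_mult)
      then have iN: "i \<le> N * Suc m" by linarith
      define s where "s = real i / M"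
      have s: "0 \<le> s" "\<bar>t - s\<bar> \<le> 1 / M"
      proof -
        have "s \<le> t" "t \<le> (real i + 1) / M"
          unfolding s_def using i M(1) by (simp_all only: pos_divide_le_eq pos_le_divide_eq)
        then show "\<bar>t - s\<bar> \<le> 1 / M" by (simp add: s_def add_divide_distrib)
        show "0 \<le> s" using M(1) by (simp add: s_def)
      qed
      have a1: "dist (\<eta> s) (d i) < 1 / M"
        using h iN by (auto simp: Lip1_basic_def v_def s_def M_def simp del: upt_Suc)
      have a2: "dist (c s) (d i) < 1 / M" using d(2)[of i] by (simp add: s_def)
      have a3: "dist (c t) (c s) \<le> 1 / M" "dist (\<eta> t) (\<eta> s) \<le> 1 / M"
        using Lip1_dist[OF g t0(1) s(1)] Lip1_dist[OF h1 t0(1) s(1)] s(2) by linarith+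
      have "dist (c t) (\<eta> t) \<le> dist (c t) (c s) + dist (c s) (d i) + dist (\<eta> s) (d i) + dist (\<eta> t) (\<eta> s)"
        using dist_triangle4[of "c t" "\<eta> t" "c s" "\<eta> s"] dist_triangle2[of "c s" "\<eta> s" "d i"]
          dist_commute[of "\<eta> s" "\<eta> t"] by linarith
      also have "\<dots> < 4 * (1 / M)" using a1 a2 a3 by linarith
      also have "\<dots> < e" using M by simp
      finally show ?thesis .
    qed
    then show "\<eta> \<in> U" using K(4) h1 by blast
  qed
  ultimately show ?thesis using d(1) by (intro exI[of _ m] exI[of _ v]) (auto simp: v_def)
qed

lemma countable_dense_closure: "\<exists>D :: 'a::euclidean_space set. countable D \<and> closure D = UNIV"
proof -
  obtain D :: "'a set" where D: "countable D" "\<And>X. open X \<Longrightarrow> X \<noteq> {} \<Longrightarrow> \<exists>d\<in>D. d \<in> X"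
    using countable_dense_exists[where 'a='a] by blast
  have "x \<in> closure D" for x
    unfolding closure_approachable
  proof (intro allI impI)
    fix e :: real assume "e > 0"
    then show "\<exists>y\<in>D. dist y x < e" using D(2)[of "ball x e"] by (auto simp: dist_commute)
  qed
  then show ?thesis using D(1) by blast
qed

text \<open>By second countability an open set of curves is a countable union of sets that constrain
  finitely many values. Measurability of the later constructions on curves is thereby reduced to
  that of their values at fixed times.\<close>

lemma measurable_into_Lip1:
  fixes f :: "'b \<Rightarrow> real \<Rightarrow> 'a::euclidean_space"
  assumes "\<And>w. w \<in> space N \<Longrightarrow> f w \<in> Lip1 X"
    and ev: "\<And>t. 0 \<le> t \<Longrightarrow> (\<lambda>w. f w t) \<in> borel_measurable N"
  shows "f \<in> measurable N (Lip1_borel X)"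
  unfolding Lip1_borel_def
proof (rule measurable_measure_of)
  show "{U. openin (Lip1_topology X) U} \<subseteq> Pow (Lip1 X)"
    by (auto simp: openin_Lip1_topology Lip1_open_def)
  show "f \<in> space N \<rightarrow> Lip1 X" using assms by auto
  fix U assume "U \<in> {U. openin (Lip1_topology X) U}"
  then have U: "Lip1_open X U" by (simp add: openin_Lip1_topology)
  obtain D :: "'a set" where D: "countable D" "closure D = UNIV"
    using countable_dense_closure by blast
  define S where "S = {(m, v). v \<in> lists D \<and> Lip1_basic X m v \<subseteq> U}"
  have "S \<subseteq> UNIV \<times> lists D" by (auto simp: S_def)
  then have cS: "countable S"
    by (rule countable_subset) (intro countable_SIGMA countable_lists D(1) countableI_type)
  have UU: "U = (\<Union>(m, v)\<in>S. Lip1_basic X m v)"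
    using Lip1_open_basic[OF D U] by (fastforce simp: S_def in_lists_conv_set)
  have [measurable]: "(\<lambda>w. f w (real i / real (Suc m))) \<in> borel_measurable N" for i m
    by (rule ev) auto
  have "f -` Lip1_basic X m v \<inter> space N \<in> sets N" for m v
  proof -
    have "f -` Lip1_basic X m v \<inter> space N =
      {w\<in>space N. \<forall>i<length v. dist (f w (real i / real (Suc m))) (v ! i) < 1 / real (Suc m)}"
      using assms(1) by (auto simp: Lip1_basic_def)
    also have "\<dots> \<in> sets N" by measurable
    finally show ?thesis .
  qed
  then have "(\<Union>x\<in>S. f -` (case x of (m, v) \<Rightarrow> Lip1_basic X m v) \<inter> space N) \<in> sets N"
    by (intro sets.countable_UN'[OF cS]) auto
  moreover have "f -` U \<inter> space N = (\<Union>x\<in>S. f -` (case x of (m, v) \<Rightarrow> Lip1_basic X m v) \<inter> space N)"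
    unfolding UU by blast
  ultimately show "f -` U \<inter> space N \<in> sets N" by simp
qed

lemma measurable_Lip1_eval_compose:
  assumes "f \<in> measurable N (Lip1_borel X)" "0 \<le> t"
  shows "(\<lambda>w. f w t) \<in> borel_measurable N"
  using measurable_compose[OF assms(1) measurable_eval[OF assms(2)]] .

text \<open>Evaluation at a variable time is the pointwise limit of evaluations at this time rounded
  down to a multiple of \<open>1 / real (Suc n)\<close>, which takes only countably many
  values.\<close>

lemma measurable_Lip1_joint:
  assumes f: "f \<in> measurable N (Lip1_borel X)" and \<tau>[measurable]: "\<tau> \<in> borel_measurable N"
    and "\<And>\<omega>. \<omega> \<in> space N \<Longrightarrow> 0 \<le> \<tau> \<omega>"
  shows "(\<lambda>\<omega>. f \<omega> (\<tau> \<omega>)) \<in> borel_measurable N"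
proof (rule borel_measurable_LIMSEQ_metric)
  define k where "k n \<omega> = nat \<lfloor>\<tau> \<omega> * real (Suc n)\<rfloor>" for n \<omega>
  have [measurable]: "k n \<in> measurable N (count_space UNIV)" for n unfolding k_def by measurable
  show "(\<lambda>\<omega>. f \<omega> (real (k n \<omega>) / real (Suc n))) \<in> borel_measurable N" for n
    by (rule measurable_compose_countable[where f="\<lambda>i \<omega>. f \<omega> (real i / real (Suc n))"])
      (auto intro!: measurable_Lip1_eval_compose[OF f])
  fix \<omega> assume w: "\<omega> \<in> space N"
  have "(\<lambda>n. real (k n \<omega>) / real (Suc n)) \<longlonglongrightarrow> \<tau> \<omega>"
  proof (rule LIMSEQ_I)
    fix r :: real assume "r > 0"
    then obtain n0 where n0: "1 / real (Suc n0) < r" using nat_approx_posE by blast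
    show "\<exists>no. \<forall>n\<ge>no. norm (real (k n \<omega>) / real (Suc n) - \<tau> \<omega>) < r"
    proof (intro exI allI impI)
      fix n assume "n0 \<le> n"
      then have "1 / real (Suc n) \<le> 1 / real (Suc n0)" by (simp add: field_simps)
      moreover have "\<bar>real (k n \<omega>) / real (Suc n) - \<tau> \<omega>\<bar> \<le> 1 / real (Suc n)"
      proof -
        have "real (k n \<omega>) \<le> \<tau> \<omega> * real (Suc n)" "\<tau> \<omega> * real (Suc n) \<le> real (k n \<omega>) + 1"
          using assms(3)[OF w] by (auto simp: k_def simp del: of_nat_Suc)
        then have "real (k n \<omega>) / real (Suc n) \<le> \<tau> \<omega>" "\<tau> \<omega> \<le> (real (k n \<omega>) + 1) / real (Suc n)"
          by (simp_all only: pos_divide_le_eq pos_le_divide_eq of_nat_0_less_iff zero_less_Suc)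
        then show ?thesis by (simp add: add_divide_distrib)
      qed
      ultimately show "norm (real (k n \<omega>) / real (Suc n) - \<tau> \<omega>) < r" using n0 by simp
    qed
  qed
  then show "(\<lambda>n. f \<omega> (real (k n \<omega>) / real (Suc n))) \<longlonglongrightarrow> f \<omega> (\<tau> \<omega>)"
    using measurable_space[OF f w] assms(3)[OF w] by (intro Lip1_tendsto[of _ X]) auto
qed

section \<open>Compactness and regularity\<close>

lemma fun_tendsto_iff:
  fixes f :: "nat \<Rightarrow> 'i \<Rightarrow> 'a::topological_space"
  shows "f \<longlonglongrightarrow> l \<longleftrightarrow> (\<forall>i. (\<lambda>n. f n i) \<longlonglongrightarrow> l i)"
proof -
  have "f \<longlonglongrightarrow> l \<longleftrightarrow> limitin (product_topology (\<lambda>i. euclidean) UNIV) f l sequentially"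
    by (simp add: euclidean_product_topology)
  then show ?thesis by (simp add: limitin_componentwise)
qed

lemma compact_fun_PiE:
  fixes S :: "'i \<Rightarrow> 'a::topological_space set"
  assumes "\<And>i. compact (S i)" shows "compact {f. \<forall>i. f i \<in> S i}"
proof -
  have "compactin (product_topology (\<lambda>i::'i. euclidean :: 'a topology) UNIV) (PiE UNIV S)"
    using assms by (simp add: compactin_PiE)
  moreover have "PiE UNIV S = {f. \<forall>i. f i \<in> S i}" by (auto simp: PiE_def)
  ultimately show ?thesis by (simp add: euclidean_product_topology)
qed

text \<open>A curve is coded by its values at rational times, a point of a Polish space.\<close>

definition rat_time :: "rat \<Rightarrow> real" where "rat_time r = \<bar>of_rat r\<bar>"

definition code_curve :: "(real \<Rightarrow> 'a) \<Rightarrow> rat \<Rightarrow> 'a" where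
  "code_curve c = (\<lambda>r. c (rat_time r))"

lemma rat_time_nonneg [simp]: "0 \<le> rat_time r" by (simp add: rat_time_def)

lemma rat_time_dense:
  assumes "0 \<le> a" "a < b" shows "\<exists>r. a < rat_time r \<and> rat_time r < b"
proof -
  obtain r where "a < of_rat r" "of_rat r < b" using of_rat_dense[OF assms(2)] by blast
  then show ?thesis using assms(1) unfolding rat_time_def by (intro exI[of _ r]) linarith
qed

lemma rat_time_seq:
  assumes "0 \<le> t" shows "\<exists>q. (\<lambda>n. rat_time (q n)) \<longlonglongrightarrow> t"
proof -
  have "\<exists>r. t < rat_time r \<and> rat_time r < t + 1 / real (Suc n)" for n
    by (rule rat_time_dense) (use assms in auto)
  then obtain q where q: "\<And>n. t < rat_time (q n)" "\<And>n. rat_time (q n) < t + 1 / real (Suc n)" by metis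
  have "(\<lambda>n. t + 1 / real (Suc n)) \<longlonglongrightarrow> t + 0"
    by (intro tendsto_intros LIMSEQ_Suc[OF lim_1_over_n])
  then have lim: "(\<lambda>n. t + 1 / real (Suc n)) \<longlonglongrightarrow> t" by simp
  have "(\<lambda>n. rat_time (q n)) \<longlonglongrightarrow> t"
  proof (rule tendsto_sandwich[OF _ _ tendsto_const lim])
    show "\<forall>\<^sub>F n in sequentially. t \<le> rat_time (q n)"
      using q(1) by (intro always_eventually allI less_imp_le)
    show "\<forall>\<^sub>F n in sequentially. rat_time (q n) \<le> t + 1 / real (Suc n)"
      using q(2) by (intro always_eventually allI less_imp_le)
  qed
  then show ?thesis by blast
qed

text \<open>Arzela-Ascoli: a countable power of \<open>X\<close> is sequentially compact, which
  gives convergence at the rational times; the common Lipschitz constant extends it to all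
  times.\<close>

lemma Lip1_seq_compact:
  fixes X :: "'a::euclidean_space set"
  assumes X: "compact X" and g: "\<And>n. g n \<in> Lip1 X"
  shows "\<exists>c r. c \<in> Lip1 X \<and> strict_mono (r :: nat \<Rightarrow> nat) \<and> (\<forall>t\<ge>0. (\<lambda>n. g (r n) t) \<longlonglongrightarrow> c t)"
proof -
  have "compact {f :: rat \<Rightarrow> 'a. \<forall>i. f i \<in> X}" by (rule compact_fun_PiE) (rule X)
  then have "seq_compact {f :: rat \<Rightarrow> 'a. \<forall>i. f i \<in> X}" by (simp add: compact_eq_seq_compact_metric)
  moreover have "\<forall>n. code_curve (g n) \<in> {f. \<forall>i. f i \<in> X}"
    using Lip1_in[OF g] by (auto simp: code_curve_def)
  ultimately obtain l r where "strict_mono (r :: nat \<Rightarrow> nat)" "((\<lambda>n. code_curve (g n)) \<circ> r) \<longlonglongrightarrow> l"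
    by (rule seq_compactE) blast
  then have lr: "strict_mono r" "(\<lambda>n. code_curve (g (r n))) \<longlonglongrightarrow> l" by (auto simp: o_def)
  have conv: "(\<lambda>n. g (r n) (rat_time q)) \<longlonglongrightarrow> l q" for q
    using lr(2) by (auto simp: fun_tendsto_iff code_curve_def)
  have "convergent (\<lambda>n. g (r n) t)" if t: "0 \<le> t" for t
  proof (rule Cauchy_convergent, rule metric_CauchyI)
    fix e :: real assume e: "e > 0"
    obtain q where q: "t < rat_time q" "rat_time q < t + e / 3"
      using rat_time_dense[OF t, of "t + e / 3"] e by auto
    have "Cauchy (\<lambda>n. g (r n) (rat_time q))" using conv LIMSEQ_imp_Cauchy by blast
    then obtain N where N: "\<And>m n. m \<ge> N \<Longrightarrow> n \<ge> N \<Longrightarrow> dist (g (r m) (rat_time q)) (g (r n) (rat_time q)) < e / 3"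
      using e unfolding Cauchy_def by (metis divide_pos_pos zero_less_numeral)
    have "dist (g (r m) t) (g (r n) t) < e" if "m \<ge> N" "n \<ge> N" for m n
    proof -
      have "dist (g (r m) t) (g (r m) (rat_time q)) < e / 3" "dist (g (r n) t) (g (r n) (rat_time q)) < e / 3"
        using Lip1_dist[OF g t rat_time_nonneg[of q], of "r m"] Lip1_dist[OF g t rat_time_nonneg[of q], of "r n"] q
        by linarith+
      moreover have "dist (g (r m) t) (g (r n) t) \<le> dist (g (r m) t) (g (r m) (rat_time q))
          + dist (g (r m) (rat_time q)) (g (r n) (rat_time q)) + dist (g (r n) (rat_time q)) (g (r n) t)"
        by (rule dist_triangle4)
      moreover have "dist (g (r n) (rat_time q)) (g (r n) t) = dist (g (r n) t) (g (r n) (rat_time q))"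
        by (rule dist_commute)
      ultimately show ?thesis using N[OF that] by linarith
    qed
    then show "\<exists>M. \<forall>m\<ge>M. \<forall>n\<ge>M. dist (g (r m) t) (g (r n) t) < e" by blast
  qed
  then have L: "(\<lambda>n. g (r n) t) \<longlonglongrightarrow> lim (\<lambda>n. g (r n) t)" if "0 \<le> t" for t
    using that convergent_LIMSEQ_iff by blast
  define c where "c = (\<lambda>t\<in>{0..}. lim (\<lambda>n. g (r n) t))"
  have "c \<in> Lip1 X"
  proof (rule Lip1_I)
    fix t :: real assume t: "0 \<le> t"
    have "lim (\<lambda>n. g (r n) t) \<in> X"
      by (rule closed_sequentially[OF compact_imp_closed[OF X] _ L[OF t]]) (rule Lip1_in[OF g t])
    then show "c t \<in> X" using t by (simp add: c_def)
  next
    fix s t :: real assume st: "0 \<le> s" "s \<le> t"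
    have "dist (lim (\<lambda>n. g (r n) s)) (lim (\<lambda>n. g (r n) t)) \<le> t - s"
    proof (rule tendsto_upperbound[OF tendsto_dist[OF L L]])
      show "\<forall>\<^sub>F n in sequentially. dist (g (r n) s) (g (r n) t) \<le> t - s"
        using Lip1_dist[OF g, of s t] st by (intro always_eventually allI) auto
    qed (use st in auto)
    then show "dist (c s) (c t) \<le> t - s" using st by (simp add: c_def)
  qed (auto simp: c_def)
  then show ?thesis using lr(1) L by (intro exI[of _ c] exI[of _ r]) (auto simp: c_def)
qed

lemma code_curve_inj: "inj_on code_curve (Lip1 X)"
proof (rule inj_onI)
  fix c \<eta> assume g: "c \<in> Lip1 X" "\<eta> \<in> Lip1 X" and eq: "code_curve c = code_curve \<eta>"
  show "c = \<eta>"
  proof (rule Lip1_ext[OF g])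
    fix t :: real assume t: "0 \<le> t"
    obtain q where q: "(\<lambda>n. rat_time (q n)) \<longlonglongrightarrow> t" using rat_time_seq[OF t] by blast
    have "c (rat_time (q n)) = \<eta> (rat_time (q n))" for n
      using fun_cong[OF eq, of "q n"] by (simp add: code_curve_def)
    then show "c t = \<eta> t"
      using Lip1_tendsto[OF g(1) t _ q] Lip1_tendsto[OF g(2) t _ q] LIMSEQ_unique by auto
  qed
qed

lemma compact_code_image:
  fixes X :: "'a::euclidean_space set"
  assumes X: "compact X"
    and S: "S \<subseteq> Lip1 X" "\<And>g c. (\<And>n. g n \<in> S) \<Longrightarrow> c \<in> Lip1 X \<Longrightarrow> (\<And>t. 0 \<le> t \<Longrightarrow> (\<lambda>n::nat. g n t) \<longlonglongrightarrow> c t) \<Longrightarrow> c \<in> S"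
  shows "compact (code_curve ` S)"
  unfolding compact_eq_seq_compact_metric seq_compact_def
proof (intro allI impI)
  fix f :: "nat \<Rightarrow> rat \<Rightarrow> 'a" assume "\<forall>n. f n \<in> code_curve ` S"
  then have "\<forall>n. \<exists>h. h \<in> S \<and> f n = code_curve h" by blast
  then obtain g where g: "\<And>n. g n \<in> S" "\<And>n. f n = code_curve (g n)" by metis
  obtain c r where r: "c \<in> Lip1 X" "strict_mono (r :: nat \<Rightarrow> nat)" "\<forall>t\<ge>0. (\<lambda>n. g (r n) t) \<longlonglongrightarrow> c t"
    using Lip1_seq_compact[OF X, of g] g(1) S(1) by blast
  have "c \<in> S" using S(2)[of "\<lambda>n. g (r n)" c] g r by auto
  moreover have "(f \<circ> r) \<longlonglongrightarrow> code_curve c"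
    using r(3) by (auto simp: fun_tendsto_iff g(2) code_curve_def)
  ultimately show "\<exists>l\<in>code_curve ` S. \<exists>r. strict_mono r \<and> (f \<circ> r) \<longlonglongrightarrow> l"
    using r(2) by (intro bexI[of _ "code_curve c"] exI[of _ r]) auto
qed

lemma measurable_code_curve [measurable]: "code_curve \<in> borel_measurable (Lip1_borel X)"
  by (rule measurable_coordinatewise_then_product) (auto simp: code_curve_def intro: measurable_eval)

text \<open>Closedness under pointwise limits makes the set of codes compact, and the code is
  injective on \<open>Lip1 X\<close>. This proves sets of curves Borel that are awkward to describe
  by countably many evaluations, namely those in the selection of shortcuts and the set of simple
  curves.\<close>

lemma seq_closed_sets_Lip1:
  fixes X :: "'a::euclidean_space set"
  assumes X: "compact X"
    and S: "S \<subseteq> Lip1 X" "\<And>g c. (\<And>n. g n \<in> S) \<Longrightarrow> c \<in> Lip1 X \<Longrightarrow> (\<And>t. 0 \<le> t \<Longrightarrow> (\<lambda>n::nat. g n t) \<longlonglongrightarrow> c t) \<Longrightarrow> c \<in> S"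
  shows "S \<in> sets (Lip1_borel X)"
proof -
  have "code_curve ` S \<in> sets borel"
    by (rule borel_compact, rule compact_code_image[OF X S(1)]) (rule S(2))
  then have "code_curve -` (code_curve ` S) \<inter> space (Lip1_borel X) \<in> sets (Lip1_borel X)"
    by (rule measurable_sets[OF measurable_code_curve])
  moreover have "code_curve -` (code_curve ` S) \<inter> space (Lip1_borel X) = S"
    using S(1) code_curve_inj[of X] by (auto simp: inj_on_def)
  ultimately show ?thesis by simp
qed

text \<open>A value at an arbitrary time is a limit of values at rational times, so the code
  generates the whole \<sigma>-algebra.\<close>

lemma sets_Lip1_borel_code:
  assumes "A \<in> sets (Lip1_borel X)"
  shows "\<exists>B\<in>sets borel. A = code_curve -` B \<inter> Lip1 X"
proof -
  let ?V = "vimage_algebra (Lip1 X) code_curve borel"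
  have [measurable]: "code_curve \<in> measurable ?V borel"
    by (rule measurable_vimage_algebra1) auto
  have "(\<lambda>c. c) \<in> measurable ?V (Lip1_borel X)"
  proof (rule measurable_into_Lip1)
    fix t :: real assume t: "0 \<le> t"
    obtain q where q: "(\<lambda>n. rat_time (q n)) \<longlonglongrightarrow> t" using rat_time_seq[OF t] by blast
    show "(\<lambda>c. c t) \<in> borel_measurable ?V"
    proof (rule borel_measurable_LIMSEQ_metric)
      have "(\<lambda>c. code_curve c (q n)) \<in> borel_measurable ?V" for n
        by (rule measurable_compose[OF \<open>code_curve \<in> measurable ?V borel\<close>])
          (auto intro: borel_measurable_continuous_onI)
      then show "(\<lambda>c. c (rat_time (q n))) \<in> borel_measurable ?V" for n
        by (simp add: code_curve_def)
      show "(\<lambda>n. c (rat_time (q n))) \<longlonglongrightarrow> c t" if "c \<in> space ?V" for c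
        using that t q by (intro Lip1_tendsto[of _ X]) auto
    qed
  qed auto
  then have "(\<lambda>c. c) -` A \<inter> space ?V \<in> sets ?V" using assms by (rule measurable_sets)
  moreover have "A \<subseteq> Lip1 X" using sets.sets_into_space[OF assms] by simp
  ultimately show ?thesis by (auto simp: sets_vimage_algebra2 Int_absorb2)
qed

text \<open>The inverse of the code is continuous on \<open>K\<close>, because the grid times that
  occur in \<open>Lip1_basic\<close> are rational.\<close>

lemma compactin_Lip1_code:
  fixes X :: "'a::euclidean_space set"
  assumes X: "compact X" and K: "compact K" "K \<subseteq> code_curve ` Lip1 X"
  shows "compactin (Lip1_topology X) (code_curve -` K \<inter> Lip1 X)"
proof -
  let ?d = "inv_into (Lip1 X) code_curve"
  have d: "?d (code_curve c) = c" if "c \<in> Lip1 X" for c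
    using that by (simp add: code_curve_inj)
  obtain D :: "'a set" where D: "countable D" "closure D = UNIV"
    using countable_dense_closure by blast
  have "continuous_map (top_of_set K) (Lip1_topology X) ?d"
    unfolding continuous_map_def
  proof (intro conjI allI impI)
    show "?d \<in> topspace (top_of_set K) \<rightarrow> topspace (Lip1_topology X)"
      using K(2) inv_into_into[of _ code_curve "Lip1 X"] by (auto simp: topspace_Lip1_topology)
    fix U assume "openin (Lip1_topology X) U"
    then have U: "Lip1_open X U" by (simp add: openin_Lip1_topology)
    show "openin (top_of_set K) {x \<in> topspace (top_of_set K). ?d x \<in> U}"
    proof (subst openin_subopen, intro ballI)
      fix f assume "f \<in> {x \<in> topspace (top_of_set K). ?d x \<in> U}"
      then have f: "f \<in> K" "?d f \<in> U" by auto
      then obtain m v where mv: "?d f \<in> Lip1_basic X m v" "Lip1_basic X m v \<subseteq> U"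
        using Lip1_open_basic[OF D U] by metis
      define r where "r i = (of_nat i / of_nat (Suc m) :: rat)" for i
      have r: "rat_time (r i) = real i / real (Suc m)" for i
        by (simp add: rat_time_def r_def of_rat_divide of_rat_add)
      define W where "W = (\<Inter>i<length v. {f. dist (f (r i)) (v ! i) < 1 / real (Suc m)})"
      have "open W" unfolding W_def
        by (intro open_INT ballI open_Collect_less continuous_intros) auto
      moreover have iff: "h \<in> W \<longleftrightarrow> ?d h \<in> Lip1_basic X m v" if hK: "h \<in> K" for h
      proof -
        obtain c where g: "c \<in> Lip1 X" "h = code_curve c" using K(2) hK by blast
        show ?thesis unfolding g(2) d[OF g(1)] W_def Lip1_basic_def
          using g(1) r by (auto simp: code_curve_def)
      qed
      ultimately show "\<exists>T. openin (top_of_set K) T \<and> f \<in> T \<and> T \<subseteq> {x \<in> topspace (top_of_set K). ?d x \<in> U}"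
        using mv f by (intro exI[of _ "K \<inter> W"]) (auto simp: openin_open)
    qed
  qed
  then have "compactin (Lip1_topology X) (?d ` K)"
    using K(1) by (intro image_compactin[of "top_of_set K"]) (auto simp: compactin_subtopology)
  moreover have "?d ` K = code_curve -` K \<inter> Lip1 X"
    using K(2) d by (force simp: image_iff)
  ultimately show ?thesis by simp
qed

text \<open>Finite Borel measures on the Polish space of codes are inner regular, and this is
  transported back to curves. Competitors built as image measures are thereby Radon, as membership
  in \<open>TP\<close> demands.\<close>

lemma Lip1_inner_regular:
  fixes X :: "'a::euclidean_space set"
  assumes X: "compact X" and M: "finite_measure M" "sets M = sets (Lip1_borel X)" and A: "A \<in> sets M"
  shows "emeasure M A = (SUP K\<in>{K. compactin (Lip1_topology X) K \<and> K \<subseteq> A}. emeasure M K)"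
proof (rule antisym)
  interpret finite_measure M by (rule M)
  have sp: "space M = Lip1 X" using sets_eq_imp_space_eq[OF M(2)] by simp
  have cm[measurable]: "code_curve \<in> borel_measurable M" using measurable_code_curve M(2)
    by (simp cong: measurable_cong_sets)
  define C where "C = code_curve ` Lip1 X"
  have C: "compact C" unfolding C_def by (rule compact_code_image[OF X]) auto
  obtain B where B: "B \<in> sets borel" "A = code_curve -` B \<inter> Lip1 X"
    using sets_Lip1_borel_code A M(2) by blast
  let ?N = "distr M borel code_curve"
  have e: "emeasure ?N S = emeasure M (code_curve -` S \<inter> Lip1 X)" if "S \<in> sets borel" for S
    using that by (simp add: emeasure_distr sp)
  have BC: "B \<inter> C \<in> sets borel" using B C by (auto intro: borel_compact)
  have "emeasure M A = emeasure ?N (B \<inter> C)"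
    unfolding e[OF BC] B(2) by (rule arg_cong[where f="emeasure M"]) (auto simp: C_def)
  also have "\<dots> = (SUP K \<in> {K. K \<subseteq> B \<inter> C \<and> compact K}. emeasure ?N K)"
    by (rule inner_regular) (use BC in \<open>auto simp: emeasure_distr\<close>)
  also have "\<dots> \<le> (SUP K\<in>{K. compactin (Lip1_topology X) K \<and> K \<subseteq> A}. emeasure M K)"
  proof (rule SUP_mono)
    fix K assume K: "K \<in> {K. K \<subseteq> B \<inter> C \<and> compact K}"
    show "\<exists>L\<in>{K. compactin (Lip1_topology X) K \<and> K \<subseteq> A}. emeasure ?N K \<le> emeasure M L"
      using K compactin_Lip1_code[OF X, of K] e[of K]
      by (intro bexI[of _ "code_curve -` K \<inter> Lip1 X"]) (auto simp: C_def B(2) borel_compact)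
  qed
  finally show "emeasure M A \<le> (SUP K\<in>{K. compactin (Lip1_topology X) K \<and> K \<subseteq> A}. emeasure M K)" .
  show "(SUP K\<in>{K. compactin (Lip1_topology X) K \<and> K \<subseteq> A}. emeasure M K) \<le> emeasure M A"
    by (intro SUP_least emeasure_mono A) auto
qed

section \<open>Almost everywhere differentiability of Lipschitz curves\<close>

lemma emeasure_interval_measure_Ioo:
  assumes "a \<le> b" "\<And>x y. x \<le> y \<Longrightarrow> F x \<le> F y" "continuous_on UNIV F"
  shows "emeasure (interval_measure F) {a<..<b} = ennreal (F b - F a)"
proof -
  have "emeasure (interval_measure F) {c} = 0" for c
    using emeasure_interval_measure_Icc[of c c F] assms by simp
  then have "{a} \<union> {b} \<in> null_sets (interval_measure F)" by (intro null_sets.Un null_setsI) auto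
  then have n: "{a, b} \<in> null_sets (interval_measure F)" by (simp add: insert_commute)
  have "emeasure (interval_measure F) {a<..<b} = emeasure (interval_measure F) ({a<..<b} \<union> {a, b})"
    by (rule emeasure_Un_null_set[symmetric]) (use n in auto)
  also have "{a<..<b} \<union> {a, b} = {a..b}" using assms(1) by auto
  finally show ?thesis using emeasure_interval_measure_Icc[of a b F] assms by simp
qed

text \<open>Since \<open>(x + f x) / 2\<close> and \<open>(x - f x) / 2\<close> are nondecreasing with sum \<open>x\<close>, the
  Stieltjes measure of the first one is dominated by Lebesgue measure.\<close>

lemma lipschitz_density:
  fixes f :: "real \<Rightarrow> real"
  assumes f: "\<And>x y. \<bar>f x - f y\<bar> \<le> \<bar>x - y\<bar>"
  obtains r where "r \<in> borel_measurable borel" "\<And>a b. a \<le> b \<Longrightarrow> (r has_integral (f b - f a)) {a..b}"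
proof -
  have cont: "continuous_on UNIV f"
  proof (rule lipschitz_on_continuous_on[of 1])
    show "1-lipschitz_on UNIV f" using f by (auto simp: lipschitz_on_def dist_real_def)
  qed
  define F where "F x = (x + f x) / 2" for x
  define G where "G x = (x - f x) / 2" for x
  have F: "\<And>x y. x \<le> y \<Longrightarrow> F x \<le> F y" "continuous_on UNIV F"
  proof -
    show "\<And>x y. x \<le> y \<Longrightarrow> F x \<le> F y"
    proof -
      fix x y :: real assume "x \<le> y" then show "F x \<le> F y" using f[of x y] by (simp add: F_def abs_le_iff)
    qed
    show "continuous_on UNIV F" unfolding F_def by (intro continuous_intros cont) simp
  qed
  have G: "\<And>x y. x \<le> y \<Longrightarrow> G x \<le> G y" "continuous_on UNIV G"
  proof -
    show "\<And>x y. x \<le> y \<Longrightarrow> G x \<le> G y"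
    proof -
      fix x y :: real assume "x \<le> y" then show "G x \<le> G y" using f[of x y] by (simp add: G_def abs_le_iff)
    qed
    show "continuous_on UNIV G" unfolding G_def by (intro continuous_intros cont) simp
  qed
  let ?M = "interval_measure F" and ?M' = "interval_measure G"
  define N where "N = measure_of (UNIV :: real set) (sets borel) (\<lambda>A. emeasure ?M A + emeasure ?M' A)"
  have sN: "sets N = sets borel" unfolding N_def
    by (metis sets.sigma_sets_eq sets_measure_of sets.space_closed space_borel)
  have eN: "emeasure N A = emeasure ?M A + emeasure ?M' A" if "A \<in> sets borel" for A
  proof (rule emeasure_measure_of[OF N_def])
    show "countably_additive (sets N) (\<lambda>A. emeasure ?M A + emeasure ?M' A)"
      unfolding countably_additive_def sN
      by (auto simp: suminf_add[symmetric] suminf_emeasure)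
  qed (use that in \<open>auto simp: positive_def sN\<close>)
  have "lborel = N"
  proof (rule lborel_eqI[OF _ sN])
    fix l u :: real assume "\<And>b. b \<in> Basis \<Longrightarrow> l \<bullet> b \<le> u \<bullet> b"
    then have lu: "l \<le> u" by simp
    have "emeasure N {l<..<u} = ennreal (F u - F l) + ennreal (G u - G l)"
      using F G lu by (simp add: eN emeasure_interval_measure_Ioo)
    also have "\<dots> = ennreal (u - l)"
      using F(1)[OF lu] G(1)[OF lu]
      by (subst ennreal_plus[symmetric]) (auto simp: F_def G_def field_simps)
    finally show "emeasure N (box l u) = ennreal (\<Prod>b\<in>Basis. (u - l) \<bullet> b)" by (simp add: box_real)
  qed
  then have le: "emeasure ?M A \<le> emeasure lborel A" if "A \<in> sets borel" for A
    using eN[OF that] by simp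
  have ac: "absolutely_continuous lborel ?M"
    unfolding absolutely_continuous_def null_sets_def
    using le by (auto simp: le_zero_eq[symmetric] simp del: le_zero_eq) (metis le order_antisym zero_le)
  obtain g where g: "g \<in> borel_measurable lborel" "density lborel g = ?M"
    using sigma_finite_measure.Radon_Nikodym[OF sigma_finite_lborel ac] by auto
  have [measurable]: "g \<in> borel_measurable borel" using g(1) by simp
  have gint: "(\<integral>\<^sup>+x. g x * indicator {a..b} x \<partial>lborel) = ennreal (F b - F a)" if "a \<le> b" for a b
    using emeasure_interval_measure_Icc[OF that F] by (simp add: g(2)[symmetric] emeasure_density)
  have fin: "AE x in lborel. x \<in> {a..b} \<longrightarrow> g x \<noteq> \<infinity>" if "a \<le> b" for a b
  proof -
    have "AE x in lborel. g x * indicator {a..b} x \<noteq> \<infinity>"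
      by (rule nn_integral_PInf_AE) (auto simp: gint[OF that])
    then show ?thesis by eventually_elim (auto simp: indicator_def)
  qed
  \<comment> \<open>\<open>g\<close> is the density of the Stieltjes measure of \<open>F\<close>,
    and \<open>f x = 2 * F x - x\<close>.\<close>
  define r where "r x = 2 * enn2real (g x) - 1" for x
  have [measurable]: "r \<in> borel_measurable borel" unfolding r_def by measurable
  have "(r has_integral (f b - f a)) {a..b}" if ab: "a \<le> b" for a b
  proof -
    have "(\<integral>\<^sup>+x. ennreal (enn2real (g x) * indicator {a..b} x) \<partial>lborel) = ennreal (F b - F a)"
      unfolding gint[OF ab, symmetric]
      by (rule nn_integral_cong_AE, use fin[OF ab] in eventually_elim)
        (auto simp: indicator_def top.not_eq_extremum ennreal_enn2real_if)
    then have "((\<lambda>x. enn2real (g x) * indicator {a..b} x) has_integral (F b - F a)) UNIV"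
      using F(1)[OF ab] by (intro nn_integral_has_integral) auto
    then have "((\<lambda>x. if x \<in> {a..b} then enn2real (g x) else 0) has_integral (F b - F a)) UNIV"
      by (rule has_integral_eq[rotated]) (auto simp: indicator_def)
    then have "((\<lambda>x. enn2real (g x)) has_integral (F b - F a)) {a..b}"
      by (rule has_integral_restrict_UNIV[THEN iffD1])
    then have "((\<lambda>x. 2 * enn2real (g x) - 1) has_integral (2 * (F b - F a) - 1 * (b - a))) {a..b}"
      using ab by (intro has_integral_diff has_integral_mult_right) (auto intro: has_integral_const_real[THEN has_integral_eq_rhs])
    moreover have "2 * (F b - F a) - 1 * (b - a) = f b - f a" by (simp add: F_def field_simps)
    ultimately show ?thesis unfolding r_def by (simp only:)
  qed
  then show ?thesis using that[of r] by simp
qed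

text \<open>Lebesgue's differentiation theorem, applied to averages of \<open>r\<close> over
  intervals to the right of \<open>x\<close>.\<close>

lemma lipschitz_AE_deriv_right:
  fixes f :: "real \<Rightarrow> real"
  assumes "\<And>a b. a \<le> b \<Longrightarrow> (r has_integral (f b - f a)) {a..b}"
  shows "AE x in lborel. ((\<lambda>h. (f (x + h) - f x) / h) \<longlongrightarrow> r x) (at_right 0)"
proof -
  have int: "r integrable_on cbox a b" for a b :: real
    using assms[of a b] by (cases "a \<le> b") auto
  obtain N where N: "negligible N" "\<And>x e. x \<notin> N \<Longrightarrow> 0 < e \<Longrightarrow>
      \<exists>d>0. \<forall>h. 0 < h \<and> h < d \<longrightarrow> norm (integral (cbox x (x + h *\<^sub>R One)) r /\<^sub>R h ^ DIM(real) - r x) < e"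
    using integrable_ccontinuous_explicit[of r] int by metis
  have "AE x in lebesgue. x \<notin> N"
    using N(1) by (intro AE_not_in) (simp add: negligible_iff_null_sets)
  then have "AE x in lborel. x \<notin> N" by (simp add: AE_completion_iff)
  then show ?thesis
  proof eventually_elim
    case (elim x)
    show ?case
    proof (rule tendstoI)
      fix e :: real assume "e > 0"
      then obtain d where d: "d > 0" "\<And>h. 0 < h \<Longrightarrow> h < d \<Longrightarrow>
          norm (integral (cbox x (x + h *\<^sub>R One)) r /\<^sub>R h ^ DIM(real) - r x) < e" using N(2)[OF elim] by metis
      have "dist ((f (x + h) - f x) / h) (r x) < e" if "0 < h" "h < d" for h
        using d(2)[OF that] integral_unique[OF assms[of x "x + h"]] that
        by (simp add: dist_norm divide_inverse mult.commute)
      then show "\<forall>\<^sub>F h in at_right 0. dist ((f (x + h) - f x) / h) (r x) < e"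
        using d(1) unfolding eventually_at_right[OF d(1)] by blast
    qed
  qed
qed

lemma AE_lborel_reflect:
  assumes "AE x :: real in lborel. P x" shows "AE x in lborel. P (- x)"
proof -
  have "AE x in distr lborel borel uminus. P x"
    using assms by (subst lborel_distr_uminus)
  then show ?thesis by (rule AE_distrD[rotated]) simp
qed

text \<open>The left derivative comes from the right one: the latter is applied to the reflected
  function \<open>- f (- x)\<close>, whose density is \<open>r (- x)\<close>, and the exceptional
  null set is reflected back.\<close>

lemma lipschitz_AE_deriv:
  fixes f :: "real \<Rightarrow> real"
  assumes f: "\<And>x y. \<bar>f x - f y\<bar> \<le> \<bar>x - y\<bar>"
  obtains r where "r \<in> borel_measurable borel" "\<And>a b. a \<le> b \<Longrightarrow> (r has_integral (f b - f a)) {a..b}"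
    "AE x in lborel. (f has_real_derivative r x) (at x)"
proof -
  obtain r where r: "r \<in> borel_measurable borel" "\<And>a b. a \<le> b \<Longrightarrow> (r has_integral (f b - f a)) {a..b}"
    using lipschitz_density[OF f] by metis
  have R: "AE x in lborel. ((\<lambda>h. (f (x + h) - f x) / h) \<longlongrightarrow> r x) (at_right 0)"
    by (rule lipschitz_AE_deriv_right[OF r(2)])
  have "((\<lambda>x. r (- x)) has_integral (- f (- b) - (- f (- a)))) {a..b}" if "a \<le> b" for a b
    using r(2)[of "-b" "-a"] that has_integral_reflect_real[of r "f (-a) - f (-b)" "-a" "-b"] by simp
  then have "AE x in lborel. ((\<lambda>h. (- f (- (x + h)) - - f (- x)) / h) \<longlongrightarrow> r (- x)) (at_right 0)"
    by (rule lipschitz_AE_deriv_right)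
  from AE_lborel_reflect[OF this]
  have L: "AE x in lborel. ((\<lambda>h. (f x - f (x - h)) / h) \<longlongrightarrow> r x) (at_right 0)" by simp
  have "AE x in lborel. (f has_real_derivative r x) (at x)"
    using L R
  proof eventually_elim
    case (elim x)
    have "((\<lambda>h. (f (x + h) - f x) / h) \<longlongrightarrow> r x) (at_left 0)"
    proof -
      have "(\<lambda>h. (f (x + - h) - f x) / - h) = (\<lambda>h. (f x - f (x - h)) / h)"
      proof
        fix h
        have "(f (x + - h) - f x) / - h = - (f x - f (x - h)) / - h" by simp
        also have "\<dots> = (f x - f (x - h)) / h" by (rule minus_divide_divide)
        finally show "(f (x + - h) - f x) / - h = (f x - f (x - h)) / h" .
      qed
      with elim(1) show ?thesis by (simp only: filterlim_at_left_to_right minus_zero)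
    qed
    with elim(2) show ?case unfolding DERIV_def
      by (simp add: filterlim_split_at)
  qed
  then show ?thesis using that r by metis
qed

text \<open>A version of the speed that is jointly measurable in the curve and the time, being the
  norm of a limit along one fixed sequence of difference quotients. It agrees with
  \<open>speed\<close> at almost every nonnegative time (\<open>Lip1_AE_speed\<close>).\<close>

definition sp :: "(real \<Rightarrow> 'a::euclidean_space) \<Rightarrow> real \<Rightarrow> real" where
  "sp c t = norm (lim (\<lambda>n. real (Suc n) *\<^sub>R (c (t + 1 / real (Suc n)) - c t)))"

lemma sp_nonneg [simp]: "0 \<le> sp c t" by (simp add: sp_def)

lemma has_vector_derivative_sp:
  assumes "(c has_vector_derivative D) (at t)" shows "sp c t = norm D"
proof -
  have lim0: "(\<lambda>n. t + 1 / real (Suc n)) \<longlonglongrightarrow> t"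
    using tendsto_add[OF tendsto_const[of t] LIMSEQ_Suc[OF lim_1_over_n]] by simp
  have "filterlim (\<lambda>n. t + 1 / real (Suc n)) (at t) sequentially"
    using lim0 by (auto simp: filterlim_at simp del: of_nat_Suc intro!: always_eventually)
  moreover have "((\<lambda>y. norm (c y - c t - (y - t) *\<^sub>R D) / norm (y - t)) \<longlongrightarrow> 0) (at t)"
    using assms by (simp add: has_vector_derivative_def has_derivative_iff_norm)
  ultimately have "(\<lambda>n. norm (c (t + 1 / real (Suc n)) - c t - (1 / real (Suc n)) *\<^sub>R D) / norm (1 / real (Suc n))) \<longlonglongrightarrow> 0"
    using filterlim_compose[where g="\<lambda>y. norm (c y - c t - (y - t) *\<^sub>R D) / norm (y - t)"] by fastforce
  moreover have "norm (c (t + 1 / real (Suc n)) - c t - (1 / real (Suc n)) *\<^sub>R D) / norm (1 / real (Suc n))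
     = norm (real (Suc n) *\<^sub>R (c (t + 1 / real (Suc n)) - c t) - D)" for n
  proof -
    have "real (Suc n) *\<^sub>R (c (t + 1 / real (Suc n)) - c t) - D
        = real (Suc n) *\<^sub>R (c (t + 1 / real (Suc n)) - c t - (1 / real (Suc n)) *\<^sub>R D)"
      by (simp add: scaleR_diff_right del: of_nat_Suc)
    then show ?thesis by (simp del: of_nat_Suc)
  qed
  ultimately have "(\<lambda>n. real (Suc n) *\<^sub>R (c (t + 1 / real (Suc n)) - c t) - D) \<longlonglongrightarrow> 0"
    by (simp only: tendsto_norm_zero_iff)
  then show ?thesis unfolding sp_def by (simp only: limI[OF LIM_zero_cancel])
qed

text \<open>Freezing the curve at negative times by \<open>max 0\<close> yields functions on the
  whole line, to which the differentiation results for real functions apply.\<close>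

lemma Lip1_component:
  fixes c :: "real \<Rightarrow> 'a::euclidean_space"
  assumes "c \<in> Lip1 X" "norm v \<le> 1"
  shows "\<bar>c (max 0 x) \<bullet> v - c (max 0 y) \<bullet> v\<bar> \<le> \<bar>x - y\<bar>"
proof -
  have "\<bar>c (max 0 x) \<bullet> v - c (max 0 y) \<bullet> v\<bar> = \<bar>(c (max 0 x) - c (max 0 y)) \<bullet> v\<bar>" by (simp add: inner_diff_left)
  also have "\<dots> \<le> norm (c (max 0 x) - c (max 0 y)) * norm v" by (rule Cauchy_Schwarz_ineq2)
  also have "\<dots> \<le> norm (c (max 0 x) - c (max 0 y)) * 1" using assms(2) by (intro mult_left_mono) auto
  also have "\<dots> \<le> \<bar>x - y\<bar>"
    using Lip1_dist[OF assms(1), of "max 0 x" "max 0 y"] by (simp add: dist_norm)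
  finally show ?thesis .
qed

lemma Lip1_AE_differentiable:
  fixes c :: "real \<Rightarrow> 'a::euclidean_space"
  assumes g: "c \<in> Lip1 X"
  shows "AE t in lborel. 0 \<le> t \<longrightarrow> 0 < t \<and> (\<exists>D. (c has_vector_derivative D) (at t))"
proof -
  have "AE t in lborel. \<forall>b\<in>Basis. \<exists>d. ((\<lambda>x. c (max 0 x) \<bullet> b) has_real_derivative d) (at t)"
  proof (rule AE_finite_allI)
    fix b :: 'a assume b: "b \<in> Basis"
    then have "\<bar>c (max 0 x) \<bullet> b - c (max 0 y) \<bullet> b\<bar> \<le> \<bar>x - y\<bar>" for x y
      by (intro Lip1_component[OF g]) simp
    then obtain r where "AE x in lborel. ((\<lambda>x. c (max 0 x) \<bullet> b) has_real_derivative r x) (at x)"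
      by (rule lipschitz_AE_deriv[of "\<lambda>x. c (max 0 x) \<bullet> b"]) blast
    then show "AE t in lborel. \<exists>d. ((\<lambda>x. c (max 0 x) \<bullet> b) has_real_derivative d) (at t)"
      by eventually_elim blast
  qed simp
  moreover have "AE t in lborel. t \<noteq> (0::real)" by (rule AE_lborel_singleton)
  ultimately show ?thesis
  proof eventually_elim
    case (elim t)
    show ?case
    proof (intro impI conjI)
      assume "0 \<le> t" then show t: "0 < t" using elim by simp
      obtain d where d: "\<And>b. b \<in> Basis \<Longrightarrow> ((\<lambda>x. c (max 0 x) \<bullet> b) has_real_derivative d b) (at t)"
        using elim(1) by metis
      have "((\<lambda>x. \<Sum>b\<in>Basis. (c (max 0 x) \<bullet> b) *\<^sub>R b) has_vector_derivative (\<Sum>b\<in>Basis. d b *\<^sub>R b)) (at t)"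
      proof (rule has_vector_derivative_sum)
        fix b :: 'a assume "b \<in> Basis"
        from d[OF this] have "((\<lambda>x. c (max 0 x) \<bullet> b) has_vector_derivative d b) (at t)"
          by (simp add: has_real_derivative_iff_has_vector_derivative)
        then show "((\<lambda>x. (c (max 0 x) \<bullet> b) *\<^sub>R b) has_vector_derivative d b *\<^sub>R b) (at t)"
          by (intro bounded_linear.has_vector_derivative[OF bounded_linear_scaleR_left])
      qed
      then have "((\<lambda>x. c (max 0 x)) has_vector_derivative (\<Sum>b\<in>Basis. d b *\<^sub>R b)) (at t)"
        by (simp add: euclidean_representation)
      then have "(c has_vector_derivative (\<Sum>b\<in>Basis. d b *\<^sub>R b)) (at t)"
        by (rule has_vector_derivative_transform_within_open[of _ _ _ "{0<..}"]) (use t in auto)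
      then show "\<exists>D. (c has_vector_derivative D) (at t)" by blast
    qed
  qed
qed

lemma has_vector_derivative_Lip1_le:
  assumes g: "c \<in> Lip1 X" and t: "0 < t" and D: "(c has_vector_derivative D) (at t)"
  shows "norm D \<le> 1"
proof -
  have "norm D \<le> 1"
  proof (rule ccontr)
    assume "\<not> norm D \<le> 1"
    then have e: "norm D - 1 > 0" by simp
    have "((\<lambda>y. norm (c y - c t - (y - t) *\<^sub>R D) / norm (y - t)) \<longlongrightarrow> 0) (at t)"
      using D by (simp add: has_vector_derivative_def has_derivative_iff_norm)
    from tendstoD[OF this e] obtain d where d: "d > 0" "\<And>y. y \<noteq> t \<Longrightarrow> dist y t < d \<Longrightarrow>
        norm (c y - c t - (y - t) *\<^sub>R D) / norm (y - t) < norm D - 1"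
      unfolding eventually_at by (auto simp: dist_norm)
    define y where "y = t + d / 2"
    have y: "y \<noteq> t" "dist y t < d" "y - t = d / 2" using d(1) by (auto simp: y_def dist_norm)
    have "norm (c y - c t - (y - t) *\<^sub>R D) < (norm D - 1) * (d / 2)"
      using d(2)[OF y(1,2)] d(1) unfolding y(3) by (simp add: field_simps)
    moreover have "norm ((y - t) *\<^sub>R D) = (d / 2) * norm D" using d(1) y by simp
    moreover have "norm (c y - c t) \<le> d / 2"
      using Lip1_dist[OF g, of y t] t d(1) y by (auto simp: dist_norm y_def)
    moreover have "norm ((y - t) *\<^sub>R D) \<le> norm (c y - c t) + norm (c y - c t - (y - t) *\<^sub>R D)"
      by (metis norm_minus_commute norm_triangle_sub add.commute)
    ultimately show False by (simp add: algebra_simps)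
  qed
  then show ?thesis .
qed

lemma vector_derivative_within_nonneg:
  assumes "0 < t" shows "(at t within {0..}) = at (t::real)"
  by (rule at_within_interior) (use assms in \<open>auto simp: interior_real_atLeast\<close>)

lemma Lip1_AE_speed:
  assumes g: "c \<in> Lip1 X"
  shows "AE t in lborel. 0 \<le> t \<longrightarrow> speed c t = sp c t \<and> sp c t \<le> 1 \<and> 0 < t \<and>
    (\<exists>D. (c has_vector_derivative D) (at t) \<and> sp c t = norm D)"
  using Lip1_AE_differentiable[OF g]
proof eventually_elim
  case (elim t)
  then show ?case
    using has_vector_derivative_sp[of c _ t] has_vector_derivative_Lip1_le[OF g, of t]
    by (auto simp: speed_def vector_derivative_within_nonneg vector_derivative_at)
qed

lemma measurable_sp:
  fixes f :: "'b \<Rightarrow> real \<Rightarrow> 'a::euclidean_space"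
  assumes f: "f \<in> measurable N (Lip1_borel X)" and t[measurable]: "\<tau> \<in> borel_measurable N"
    and nn: "\<And>w. w \<in> space N \<Longrightarrow> 0 \<le> \<tau> w"
  shows "(\<lambda>w. sp (f w) (\<tau> w)) \<in> borel_measurable N"
proof -
  have [measurable]: "(\<lambda>w. f w (\<tau> w)) \<in> borel_measurable N"
      "(\<lambda>w. f w (\<tau> w + 1 / real (Suc n))) \<in> borel_measurable N" for n
    using nn by (auto intro!: measurable_Lip1_joint[OF f] add_nonneg_nonneg)
  show ?thesis unfolding sp_def by measurable
qed

lemma measurable_sp_fixed [measurable]:
  assumes "c \<in> Lip1 X" shows "(\<lambda>t. sp c (max 0 t)) \<in> borel_measurable borel"
  by (rule measurable_sp[where f="\<lambda>_. c" and X=X]) (use assms in auto)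

text \<open>Projection to the direction \<open>v\<close> of the chord reduces the claim to a real
  function: its increment is the integral of its derivative \<open>D \<bullet> v\<close>, which is
  at most \<open>norm D\<close>.\<close>

lemma Lip1_dist_le_sp:
  fixes c :: "real \<Rightarrow> 'a::euclidean_space"
  assumes g: "c \<in> Lip1 X" and st: "0 \<le> s" "s \<le> t"
  shows "ennreal (dist (c s) (c t)) \<le> (\<integral>\<^sup>+x\<in>{s..t}. ennreal (sp c x) \<partial>lborel)"
proof -
  define v where "v = sgn (c t - c s)"
  have v: "norm v \<le> 1" by (simp add: v_def norm_sgn)
  have vd: "(c t - c s) \<bullet> v = dist (c s) (c t)"
    by (cases "c t = c s")
      (auto simp: v_def sgn_div_norm dist_norm norm_minus_commute power2_norm_eq_inner[symmetric] power2_eq_square)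
  obtain r where r: "r \<in> borel_measurable borel"
    "\<And>a b. a \<le> b \<Longrightarrow> (r has_integral (c (max 0 b) \<bullet> v - c (max 0 a) \<bullet> v)) {a..b}"
    "AE x in lborel. ((\<lambda>x. c (max 0 x) \<bullet> v) has_real_derivative r x) (at x)"
    by (rule lipschitz_AE_deriv[of "\<lambda>x. c (max 0 x) \<bullet> v"]) (rule Lip1_component[OF g v], blast)
  have [measurable]: "r \<in> borel_measurable borel" by (rule r)
  have AE: "AE x in lborel. 0 \<le> x \<longrightarrow> r x \<le> sp c x"
    using r(3) Lip1_AE_speed[OF g]
  proof eventually_elim
    case (elim x)
    show ?case
    proof
      assume "0 \<le> x"
      then obtain D where D: "0 < x" "(c has_vector_derivative D) (at x)" "sp c x = norm D" using elim(2) by auto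
      have "((\<lambda>x. c x \<bullet> v) has_vector_derivative (D \<bullet> v)) (at x)"
        by (rule bounded_linear.has_vector_derivative[OF bounded_linear_inner_left D(2)])
      moreover have "((\<lambda>x. c x \<bullet> v) has_vector_derivative r x) (at x)"
        using elim(1) unfolding has_real_derivative_iff_has_vector_derivative
        by (rule has_vector_derivative_transform_within_open[of _ _ _ "{0<..}"]) (use D in auto)
      ultimately have "r x = D \<bullet> v" using vector_derivative_unique_at by blast
      also have "\<dots> \<le> norm D * norm v" by (rule norm_cauchy_schwarz)
      also have "\<dots> \<le> norm D" using v by (simp add: mult_left_le)
      finally show "r x \<le> sp c x" using D by simp
    qed
  qed
  have hi: "(r has_integral dist (c s) (c t)) {s..t}"
    using r(2)[of s t] st vd by (simp add: inner_diff_left max_def)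
  define h where "h x = max 0 (r x) * indicator {s..t} x" for x
  have [measurable]: "h \<in> borel_measurable borel" unfolding h_def by measurable
  have "ennreal (dist (c s) (c t)) \<le> (\<integral>\<^sup>+x. ennreal (h x) \<partial>lborel)"
  proof (cases "\<integral>\<^sup>+x. ennreal (h x) \<partial>lborel")
    case (real v)
    have hv: "(h has_integral v) UNIV"
      by (rule nn_integral_has_integral) (use real in \<open>auto simp: h_def\<close>)
    have "((\<lambda>x. if x \<in> {s..t} then r x else 0) has_integral dist (c s) (c t)) UNIV"
      using hi by (rule has_integral_restrict_UNIV[THEN iffD2])
    from has_integral_le[OF this hv] have "dist (c s) (c t) \<le> v" by (auto simp: h_def)
    then show ?thesis using real by (simp add: ennreal_leI)
  qed simp
  also have "\<dots> \<le> (\<integral>\<^sup>+x\<in>{s..t}. ennreal (sp c x) \<partial>lborel)"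
    by (rule nn_integral_mono_AE, use AE in eventually_elim)
      (use st in \<open>auto simp: h_def indicator_def intro!: ennreal_leI\<close>)
  finally show ?thesis .
qed

section \<open>Stopping times\<close>

lemma eq_if_dist_le: "(\<And>e. 0 < e \<Longrightarrow> dist a b \<le> e) \<Longrightarrow> a = (b :: 'a::metric_space)"
  using field_le_epsilon[of "dist a b" 0] by simp

text \<open>For curves in \<open>Lip1 X\<close> this is finiteness of the stopping time
  (\<open>stopping_time_finite_iff\<close>), in a form that is easily checked after cutting and
  joining curves.\<close>

definition fin :: "(real \<Rightarrow> 'a) \<Rightarrow> bool" where
  "fin c \<longleftrightarrow> (\<exists>T\<ge>0. \<forall>t\<ge>T. c t = c T)"

lemma AE_zero_derivative_imp_const:
  assumes g: "c \<in> Lip1 X" and T: "0 \<le> T"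
    and z: "AE s in lborel. T \<le> s \<longrightarrow> (c has_vector_derivative 0) (at s within {0..})"
    and t: "T \<le> t"
  shows "c t = c T"
proof -
  have "ennreal (dist (c T) (c t)) \<le> (\<integral>\<^sup>+x\<in>{T..t}. ennreal (sp c x) \<partial>lborel)"
    by (rule Lip1_dist_le_sp[OF g T t])
  also have "\<dots> = (\<integral>\<^sup>+(x::real). 0 \<partial>lborel)"
  proof (rule nn_integral_cong_AE)
    show "AE x in lborel. ennreal (sp c x) * indicator {T..t} x = 0"
      using z AE_lborel_singleton[of "0::real"]
    proof eventually_elim
      case (elim x)
      then show ?case using T has_vector_derivative_sp[of c 0 x]
        by (auto simp: indicator_def vector_derivative_within_nonneg)
    qed
  qed
  finally show ?thesis by simp
qed

lemma const_imp_zero_derivative: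
  assumes T: "0 \<le> T" and c: "\<And>t. T \<le> t \<Longrightarrow> \<gamma> t = c"
  shows "AE s in lborel. T \<le> s \<longrightarrow> (\<gamma> has_vector_derivative 0) (at s within {0..})"
  using AE_lborel_singleton[of T]
proof eventually_elim
  case (elim s)
  have "(\<gamma> has_vector_derivative 0) (at s)" if "T < s"
    by (rule has_vector_derivative_transform_within_open[of "\<lambda>_. c" _ _ "{T<..}"]) (use that c in auto)
  then show ?case using elim by (auto intro: has_vector_derivative_at_within)
qed

lemma stopping_time_finite_iff:
  assumes g: "c \<in> Lip1 X" shows "stopping_time c < \<infinity> \<longleftrightarrow> fin c"
proof
  assume fi: "stopping_time c < \<infinity>"
  have "{t. 0 \<le> t \<and> (AE s in lborel. t \<le> s \<longrightarrow> (c has_vector_derivative 0) (at s within {0..}))} \<noteq> {}" (is "?S \<noteq> {}")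
  proof
    assume "?S = {}"
    then have "stopping_time c = Inf (ereal ` {})" unfolding stopping_time_def by (rule arg_cong)
    then show False using fi by (simp add: top_ereal_def)
  qed
  then show "fin c" using AE_zero_derivative_imp_const[OF g] unfolding fin_def by blast
next
  assume "fin c"
  then obtain T where T: "0 \<le> T" "\<And>t. T \<le> t \<Longrightarrow> c t = c T" by (auto simp: fin_def)
  have "stopping_time c \<le> ereal T" unfolding stopping_time_def
    by (rule Inf_lower) (use const_imp_zero_derivative[OF T] T in auto)
  then show "stopping_time c < \<infinity>" by (rule order_le_less_trans) simp
qed

lemma einf_eqI:
  assumes g: "\<gamma> \<in> Lip1 X" and T: "0 \<le> T" and c: "\<And>t. T \<le> t \<Longrightarrow> \<gamma> t = c"
  shows "einf \<gamma> = c"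
proof -
  let ?S = "{t. 0 \<le> t \<and> (AE s in lborel. t \<le> s \<longrightarrow> (\<gamma> has_vector_derivative 0) (at s within {0..}))}"
  have TS: "T \<in> ?S" using const_imp_zero_derivative[OF T c] T by auto
  have le: "stopping_time \<gamma> \<le> ereal T" unfolding stopping_time_def
    by (rule Inf_lower) (use TS in auto)
  have ge: "0 \<le> stopping_time \<gamma>" unfolding stopping_time_def
    by (rule Inf_greatest) auto
  obtain \<tau> where \<tau>: "stopping_time \<gamma> = ereal \<tau>" "0 \<le> \<tau>" "\<tau> \<le> T"
    using le ge by (cases "stopping_time \<gamma>") auto
  \<comment> \<open>Times after which the derivative vanishes almost everywhere exist arbitrarily
    close above the infimum \<open>\<tau>\<close>. At each of them the curve already has its final
    value, and the Lipschitz bound passes this on to \<open>\<tau>\<close>.\<close>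
  have "dist (\<gamma> \<tau>) c \<le> e" if e: "e > 0" for e
  proof -
    have "Inf (ereal ` ?S) < ereal (\<tau> + e)" using \<tau>(1) e by (simp add: stopping_time_def)
    then obtain t where t: "t \<in> ?S" "t < \<tau> + e" unfolding Inf_less_iff by auto
    have "ereal \<tau> \<le> ereal t" unfolding \<tau>(1)[symmetric] stopping_time_def by (rule Inf_lower) (use t in auto)
    then have "\<tau> \<le> t" by simp
    have "\<gamma> (max t T) = \<gamma> t" using t by (intro AE_zero_derivative_imp_const[OF g]) auto
    then have "\<gamma> t = c" using c[of "max t T"] by simp
    then show ?thesis using Lip1_dist[OF g \<tau>(2), of t] t \<open>\<tau> \<le> t\<close> \<tau>(2) by auto
  qed
  then have "\<gamma> \<tau> = c" by (rule eq_if_dist_le)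
  then show ?thesis by (simp add: einf_def \<tau>(1))
qed

text \<open>\<open>real_of_ereal \<infinity>\<close> is 0. This default value is one of the two
  cases in the measurability of \<open>einf\<close> on all of \<open>Lip1 X\<close>.\<close>

lemma einf_not_fin:
  assumes "c \<in> Lip1 X" "\<not> fin c" shows "einf c = c 0"
proof -
  have "stopping_time c = \<infinity>" using stopping_time_finite_iff[OF assms(1)] assms(2) by (simp add: less_top[symmetric] top_ereal_def)
  then show ?thesis by (simp add: einf_def)
qed

lemma fin_iff_nat_rat:
  assumes g: "c \<in> Lip1 X"
  shows "fin c \<longleftrightarrow> (\<exists>n::nat. \<forall>q. real n \<le> rat_time q \<longrightarrow> c (rat_time q) = c (real n))"
proof
  assume "fin c"
  then obtain T where T: "0 \<le> T" "\<And>t. T \<le> t \<Longrightarrow> c t = c T" by (auto simp: fin_def)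
  obtain n :: nat where "T \<le> real n" using real_arch_simple by blast
  then show "\<exists>n::nat. \<forall>q. real n \<le> rat_time q \<longrightarrow> c (rat_time q) = c (real n)"
  proof (intro exI[of _ n] allI impI)
    fix q assume "real n \<le> rat_time q"
    then have "T \<le> rat_time q" using \<open>T \<le> real n\<close> by linarith
    then show "c (rat_time q) = c (real n)"
      using T(2)[of "rat_time q"] T(2)[of "real n"] \<open>T \<le> real n\<close> by metis
  qed
next
  assume "\<exists>n::nat. \<forall>q. real n \<le> rat_time q \<longrightarrow> c (rat_time q) = c (real n)"
  then obtain n :: nat where n: "\<And>q. real n \<le> rat_time q \<Longrightarrow> c (rat_time q) = c (real n)" by blast
  have "c t = c (real n)" if t: "real n \<le> t" for t
  proof -
    have "dist (c t) (c (real n)) \<le> e" if e0: "e > 0" for e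
    proof -
      obtain q where q: "t < rat_time q" "rat_time q < t + e" using rat_time_dense[of t "t + e"] t e0 by (meson less_add_same_cancel1 of_nat_0_le_iff order_trans)
      then show ?thesis using n[of q] t Lip1_dist[OF g, of t "rat_time q"] by auto
    qed
    then show ?thesis by (rule eq_if_dist_le)
  qed
  then show "fin c" unfolding fin_def by (intro exI[of _ "real n"] conjI allI impI) (simp, blast)
qed

text \<open>An integer upper bound for the stopping time of an eventually constant curve. It is
  expressed by rational times so that it is measurable, and it has countably many values, so that
  constructions may depend on it.\<close>

definition stop_nat :: "(real \<Rightarrow> 'a) \<Rightarrow> nat" where
  "stop_nat c = (LEAST n. \<forall>q. real n \<le> rat_time q \<longrightarrow> c (rat_time q) = c (real n))"

lemma stop_nat:
  assumes g: "c \<in> Lip1 X" "fin c" and t: "real (stop_nat c) \<le> t"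
  shows "c t = einf c"
proof -
  let ?n = "stop_nat c"
  have n: "real ?n \<le> rat_time q \<Longrightarrow> c (rat_time q) = c (real ?n)" for q
  proof -
    have "\<exists>n::nat. \<forall>q. real n \<le> rat_time q \<longrightarrow> c (rat_time q) = c (real n)"
      using g fin_iff_nat_rat[OF g(1)] by simp
    then have "\<forall>q. real ?n \<le> rat_time q \<longrightarrow> c (rat_time q) = c (real ?n)"
      unfolding stop_nat_def by (rule LeastI_ex)
    then show "real ?n \<le> rat_time q \<Longrightarrow> c (rat_time q) = c (real ?n)" by (elim allE impE)
  qed
  have e: "c t = c (real ?n)" if t: "real ?n \<le> t" for t
  proof -
    have "dist (c t) (c (real ?n)) \<le> e" if e0: "e > 0" for e
    proof -
      obtain q where q: "t < rat_time q" "rat_time q < t + e" using rat_time_dense[of t "t + e"] t e0 by (meson less_add_same_cancel1 of_nat_0_le_iff order_trans)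
      then show ?thesis using n[of q] t Lip1_dist[OF g(1), of t "rat_time q"] by auto
    qed
    then show ?thesis by (rule eq_if_dist_le)
  qed
  have "einf c = c (real ?n)" by (rule einf_eqI[OF g(1), of "real ?n"], simp) (rule e)
  then show ?thesis using e[OF t] by simp
qed

lemma measurable_stop_nat_pred:
  "{c\<in>space (Lip1_borel X). \<forall>q. real n \<le> rat_time q \<longrightarrow> c (rat_time q) = c (real n)} \<in> sets (Lip1_borel X)"
proof -
  have "{c\<in>space (Lip1_borel X). c (rat_time q) = c (real n)} \<in> sets (Lip1_borel X)" for q
  proof -
    have "(\<lambda>c. dist (c (rat_time q)) (c (real n))) \<in> borel_measurable (Lip1_borel X)"
      by (rule borel_measurable_dist; rule measurable_eval; simp)
    then have "{c\<in>space (Lip1_borel X). dist (c (rat_time q)) (c (real n)) \<le> 0} \<in> sets (Lip1_borel X)"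
      by (rule borel_measurable_le) simp
    then show ?thesis by (simp only: dist_le_zero_iff)
  qed
  then show ?thesis
    by (intro sets.sets_Collect_countable_All sets.sets_Collect_imp sets.sets_Collect_const)
qed

lemma sets_fin: "{c\<in>Lip1 X. fin c} \<in> sets (Lip1_borel X)"
proof -
  have "{c\<in>Lip1 X. fin c} = {c\<in>space (Lip1_borel X). \<exists>n::nat. \<forall>q. real n \<le> rat_time q \<longrightarrow> c (rat_time q) = c (real n)}"
    by (rule Collect_cong) (simp add: fin_iff_nat_rat cong: conj_cong)
  also have "\<dots> \<in> sets (Lip1_borel X)"
    by (intro sets.sets_Collect_countable_Ex measurable_stop_nat_pred)
  finally show ?thesis .
qed

lemma measurable_stop_nat [measurable]: "stop_nat \<in> measurable (Lip1_borel X) (count_space UNIV)"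
  unfolding stop_nat_def[abs_def]
  by (intro measurable_Least iffD2[OF pred_def] measurable_stop_nat_pred)

lemma measurable_e0 [measurable]: "e0 \<in> borel_measurable (Lip1_borel X)"
  unfolding e0_def[abs_def] by (rule measurable_eval) simp

lemma measurable_einf [measurable]: "einf \<in> borel_measurable (Lip1_borel X)"
proof -
  have "(\<lambda>c. if c \<in> {c\<in>Lip1 X. fin c} then c (real (stop_nat c)) else c 0) \<in> borel_measurable (Lip1_borel X)"
  proof (rule measurable_If_set)
    show "(\<lambda>c. c (real (stop_nat c))) \<in> borel_measurable (Lip1_borel X)"
      by (rule measurable_Lip1_joint[where f="\<lambda>c. c" and X=X]) auto
    show "(\<lambda>c. c 0) \<in> borel_measurable (Lip1_borel X)" by (rule measurable_eval) simp
    show "{c\<in>Lip1 X. fin c} \<inter> space (Lip1_borel X) \<in> sets (Lip1_borel X)"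
      by (intro sets.Int sets_fin sets.top)
  qed
  then show ?thesis
    by (rule measurable_cong[THEN iffD1, rotated]) (auto simp: stop_nat einf_not_fin)
qed

section \<open>Line integrals and concatenation of curves\<close>

text \<open>The integral of \<open>f\<close> along the curve with respect to arc length:
  \<open>lint c (\<lambda>_. 1)\<close> is the length, and with the weight of a plan for
  \<open>f\<close> it is the contribution of \<open>c\<close> to the energy.\<close>

definition lint :: "(real \<Rightarrow> 'a::euclidean_space) \<Rightarrow> ('a \<Rightarrow> ennreal) \<Rightarrow> ennreal" where
  "lint c f = (\<integral>\<^sup>+t\<in>{0..}. f (c t) * ennreal (sp c t) \<partial>lborel)"

definition ctrace :: "(real \<Rightarrow> 'a) \<Rightarrow> 'a set" where
  "ctrace c = c ` {0..}"

lemma lint_alt: "lint c f = (\<integral>\<^sup>+t. f (c (max 0 t)) * ennreal (sp c (max 0 t)) * indicator {0..} t \<partial>lborel)"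
  unfolding lint_def by (intro nn_integral_cong) (auto simp: indicator_def max_def)

lemma measurable_Lip1_max [measurable]:
  assumes "c \<in> Lip1 X" shows "(\<lambda>t. c (max 0 t)) \<in> borel_measurable borel"
  by (rule measurable_Lip1_joint[where f="\<lambda>_. c" and X=X]) (use assms in auto)

lemma measurable_line_integrand:
  assumes g: "c \<in> Lip1 X" and f[measurable]: "f \<in> borel_measurable borel" and A: "A \<in> sets borel" "A \<subseteq> {0..}"
  shows "(\<lambda>t. f (c t) * ennreal (sp c t) * indicator A t) \<in> borel_measurable lborel"
proof -
  note [measurable] = measurable_Lip1_max[OF g] measurable_sp_fixed[OF g] A(1)
  have "(\<lambda>t. f (c (max 0 t)) * ennreal (sp c (max 0 t)) * indicator A t) \<in> borel_measurable lborel"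
    by measurable
  moreover have "f (c (max 0 t)) * ennreal (sp c (max 0 t)) * indicator A t = f (c t) * ennreal (sp c t) * indicator A t" for t
    using A(2) by (auto simp: indicator_def max_def)
  ultimately show ?thesis by simp
qed

lemma lint_split:
  assumes g: "c \<in> Lip1 X" and f: "f \<in> borel_measurable borel" and L: "0 \<le> L"
  shows "lint c f = (\<integral>\<^sup>+t\<in>{0..<L}. f (c t) * ennreal (sp c t) \<partial>lborel) + (\<integral>\<^sup>+t\<in>{L..}. f (c t) * ennreal (sp c t) \<partial>lborel)"
proof -
  have "lint c f = (\<integral>\<^sup>+t. f (c t) * ennreal (sp c t) * indicator {0..<L} t + f (c t) * ennreal (sp c t) * indicator {L..} t \<partial>lborel)"
    unfolding lint_def by (intro nn_integral_cong) (use L in \<open>auto simp: indicator_def\<close>)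
  also have "\<dots> = (\<integral>\<^sup>+t\<in>{0..<L}. f (c t) * ennreal (sp c t) \<partial>lborel) + (\<integral>\<^sup>+t\<in>{L..}. f (c t) * ennreal (sp c t) \<partial>lborel)"
    by (intro nn_integral_add measurable_line_integrand[OF g f]) (use L in auto)
  finally show ?thesis .
qed

lemma lint_mono: "(\<And>t. 0 \<le> t \<Longrightarrow> f (c t) \<le> g (c t)) \<Longrightarrow> lint c f \<le> lint c g"
  unfolding lint_def by (intro nn_integral_mono) (auto simp: indicator_def intro!: mult_right_mono)

lemma lint_mono_AE:
  "(AE t in lborel. 0 \<le> t \<longrightarrow> 0 < sp c t \<longrightarrow> f (c t) \<le> g (c t)) \<Longrightarrow> lint c f \<le> lint c g"
  unfolding lint_def
proof (rule nn_integral_mono_AE, elim eventually_mono)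
  fix t assume *: "0 \<le> t \<longrightarrow> 0 < sp c t \<longrightarrow> f (c t) \<le> g (c t)"
  show "f (c t) * ennreal (sp c t) * indicator {0..} t \<le> g (c t) * ennreal (sp c t) * indicator {0..} t"
    using * sp_nonneg[of c t] by (cases "sp c t = 0") (auto simp: indicator_def intro!: mult_right_mono)
qed

lemma lint_cmult:
  assumes g: "\<gamma> \<in> Lip1 X" and f: "f \<in> borel_measurable borel"
  shows "lint \<gamma> (\<lambda>y. c * f y) = c * lint \<gamma> f"
proof -
  have "lint \<gamma> (\<lambda>y. c * f y) = (\<integral>\<^sup>+t. c * (f (\<gamma> t) * ennreal (sp \<gamma> t) * indicator {0..} t) \<partial>lborel)"
    unfolding lint_def by (simp add: mult.assoc)
  also have "\<dots> = c * lint \<gamma> f" unfolding lint_def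
    by (intro nn_integral_cmult measurable_line_integrand[OF g f]) auto
  finally show ?thesis .
qed

lemma lint_add:
  assumes g: "c \<in> Lip1 X" and f: "f \<in> borel_measurable borel" "h \<in> borel_measurable borel"
  shows "lint c (\<lambda>y. f y + h y) = lint c f + lint c h"
proof -
  have "lint c (\<lambda>y. f y + h y) = (\<integral>\<^sup>+t. f (c t) * ennreal (sp c t) * indicator {0..} t + h (c t) * ennreal (sp c t) * indicator {0..} t \<partial>lborel)"
    unfolding lint_def by (simp add: distrib_right)
  also have "\<dots> = lint c f + lint c h" unfolding lint_def
    by (intro nn_integral_add measurable_line_integrand[OF g]) (use f in auto)
  finally show ?thesis .
qed

lemma lint_eq_0_iff:
  assumes g: "c \<in> Lip1 X" and f: "f \<in> borel_measurable borel"
  shows "lint c f = 0 \<longleftrightarrow> (AE t in lborel. 0 \<le> t \<longrightarrow> 0 < sp c t \<longrightarrow> f (c t) = 0)"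
proof -
  have "lint c f = 0 \<longleftrightarrow> (AE t in lborel. f (c t) * ennreal (sp c t) * indicator {0..} t = 0)"
    unfolding lint_def by (intro nn_integral_0_iff_AE measurable_line_integrand[OF g f]) auto
  also have "(\<lambda>t. f (c t) * ennreal (sp c t) * indicator {0..} t = 0) = (\<lambda>t. 0 \<le> t \<longrightarrow> 0 < sp c t \<longrightarrow> f (c t) = 0)"
  proof
    fix t show "(f (c t) * ennreal (sp c t) * indicator {0..} t = 0) = (0 \<le> t \<longrightarrow> 0 < sp c t \<longrightarrow> f (c t) = 0)"
      using sp_nonneg[of c t] by (auto simp: indicator_def ennreal_eq_0_iff)
  qed
  finally show ?thesis .
qed

lemma lim_cong_eventually:
  "eventually (\<lambda>n. f n = g n) sequentially \<Longrightarrow> lim f = lim g"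
  unfolding lim_def by (rule arg_cong[where f=The], rule ext) (simp add: filterlim_cong)

text \<open>\<open>sp\<close> uses difference quotients to the right only, so agreement to the right
  of \<open>t\<close> suffices. The speed of a cut or joined curve is thus known at the cutting
  times as well.\<close>

lemma sp_cong:
  assumes "0 < e" "\<And>x. t \<le> x \<Longrightarrow> x < t + e \<Longrightarrow> c x = \<eta> x" shows "sp c t = sp \<eta> t"
proof -
  obtain n0 where n0: "1 / real (Suc n0) < e" using nat_approx_posE[OF assms(1)] by blast
  have "eventually (\<lambda>n. real (Suc n) *\<^sub>R (c (t + 1 / real (Suc n)) - c t) = real (Suc n) *\<^sub>R (\<eta> (t + 1 / real (Suc n)) - \<eta> t)) sequentially"
    unfolding eventually_sequentially
  proof (intro exI allI impI)
    fix n assume "n0 \<le> n"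
    then have "1 / real (Suc n) \<le> 1 / real (Suc n0)" by (simp add: field_simps)
    then have "t + 1 / real (Suc n) < t + e" using n0 by linarith
    then show "real (Suc n) *\<^sub>R (c (t + 1 / real (Suc n)) - c t) = real (Suc n) *\<^sub>R (\<eta> (t + 1 / real (Suc n)) - \<eta> t)"
      using assms by (simp del: of_nat_Suc)
  qed
  then show ?thesis unfolding sp_def by (simp only: lim_cong_eventually)
qed

lemma sp_const:
  assumes "0 < e" "\<And>x. t \<le> x \<Longrightarrow> x < t + e \<Longrightarrow> \<gamma> x = c" shows "sp \<gamma> t = 0"
proof -
  have "sp \<gamma> t = sp (\<lambda>_. c) t" by (rule sp_cong[OF assms])
  then show ?thesis by (simp add: sp_def)
qed

section \<open>Cutting, joining and reversing curves\<close>

definition pre :: "real \<Rightarrow> (real \<Rightarrow> 'a::euclidean_space) \<Rightarrow> real \<Rightarrow> 'a" where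
  "pre L c = (\<lambda>t\<in>{0..}. c (min t L))"

definition suf :: "real \<Rightarrow> (real \<Rightarrow> 'a::euclidean_space) \<Rightarrow> real \<Rightarrow> 'a" where
  "suf a c = (\<lambda>t\<in>{0..}. c (a + t))"

definition seg :: "real \<Rightarrow> real \<Rightarrow> (real \<Rightarrow> 'a::euclidean_space) \<Rightarrow> real \<Rightarrow> 'a" where
  "seg a b c = pre (b - a) (suf a c)"

definition join :: "real \<Rightarrow> (real \<Rightarrow> 'a::euclidean_space) \<Rightarrow> (real \<Rightarrow> 'a) \<Rightarrow> real \<Rightarrow> 'a" where
  "join L c1 c2 = (\<lambda>t\<in>{0..}. if t \<le> L then c1 t else c2 (t - L))"

definition rev_curve :: "real \<Rightarrow> (real \<Rightarrow> 'a::euclidean_space) \<Rightarrow> real \<Rightarrow> 'a" where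
  "rev_curve L c = (\<lambda>t\<in>{0..}. c (max 0 (L - t)))"

definition cst :: "'a::euclidean_space \<Rightarrow> real \<Rightarrow> 'a" where
  "cst x = (\<lambda>t\<in>{0..}. x)"

lemma pre_Lip1: "c \<in> Lip1 X \<Longrightarrow> 0 \<le> L \<Longrightarrow> pre L c \<in> Lip1 X"
proof (rule Lip1_I)
  fix s t :: real assume g: "c \<in> Lip1 X" "0 \<le> L" and st: "0 \<le> s" "s \<le> t"
  have "dist (c (min s L)) (c (min t L)) \<le> \<bar>min s L - min t L\<bar>"
    using g st by (intro Lip1_dist) auto
  also have "\<dots> \<le> t - s" using st by auto
  finally show "dist (pre L c s) (pre L c t) \<le> t - s" using st by (simp add: pre_def)
qed (auto simp: pre_def Lip1_in)

lemma suf_Lip1: "c \<in> Lip1 X \<Longrightarrow> 0 \<le> a \<Longrightarrow> suf a c \<in> Lip1 X"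
proof (rule Lip1_I)
  fix s t :: real assume g: "c \<in> Lip1 X" "0 \<le> a" and st: "0 \<le> s" "s \<le> t"
  then show "dist (suf a c s) (suf a c t) \<le> t - s"
    using Lip1_dist[OF g(1), of "a + s" "a + t"] by (simp add: suf_def)
qed (auto simp: suf_def Lip1_in)

lemma seg_Lip1: "c \<in> Lip1 X \<Longrightarrow> 0 \<le> a \<Longrightarrow> a \<le> b \<Longrightarrow> seg a b c \<in> Lip1 X"
  unfolding seg_def by (intro pre_Lip1 suf_Lip1) auto

lemma join_Lip1:
  assumes c: "c1 \<in> Lip1 X" "c2 \<in> Lip1 X" "0 \<le> L" "c1 L = c2 0" shows "join L c1 c2 \<in> Lip1 X"
proof (rule Lip1_I)
  fix s t :: real assume st: "0 \<le> s" "s \<le> t"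
  consider "t \<le> L" | "s \<le> L" "L < t" | "L < s" by linarith
  then show "dist (join L c1 c2 s) (join L c1 c2 t) \<le> t - s"
  proof cases
    case 1 then show ?thesis using Lip1_dist[OF c(1), of s t] st by (simp add: join_def)
  next
    case 2
    have "dist (c1 s) (c2 (t - L)) \<le> dist (c1 s) (c1 L) + dist (c2 0) (c2 (t - L))"
      using dist_triangle[of "c1 s" "c2 (t - L)" "c1 L"] c(4) by simp
    then show ?thesis using Lip1_dist[OF c(1), of s L] Lip1_dist[OF c(2), of 0 "t - L"] st 2 c(3)
      by (simp add: join_def)
  next
    case 3 then show ?thesis using Lip1_dist[OF c(2), of "s - L" "t - L"] st by (simp add: join_def)
  qed
qed (use c in \<open>auto simp: join_def Lip1_in\<close>)

lemma rev_curve_Lip1: "c \<in> Lip1 X \<Longrightarrow> rev_curve L c \<in> Lip1 X"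
proof (rule Lip1_I)
  fix s t :: real assume g: "c \<in> Lip1 X" and st: "0 \<le> s" "s \<le> t"
  have "dist (c (max 0 (L - s))) (c (max 0 (L - t))) \<le> \<bar>max 0 (L - s) - max 0 (L - t)\<bar>"
    using g st by (intro Lip1_dist) auto
  also have "\<dots> \<le> t - s" using st by auto
  finally show "dist (rev_curve L c s) (rev_curve L c t) \<le> t - s" using st by (simp add: rev_curve_def)
qed (auto simp: rev_curve_def Lip1_in)

lemma measurable_pre:
  assumes f: "f \<in> measurable N (Lip1_borel X)" and L[measurable]: "L \<in> borel_measurable N"
    and nn: "\<And>w. w \<in> space N \<Longrightarrow> 0 \<le> L w"
  shows "(\<lambda>w. pre (L w) (f w)) \<in> measurable N (Lip1_borel X)"
proof (rule measurable_into_Lip1)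
  show "pre (L w) (f w) \<in> Lip1 X" if "w \<in> space N" for w
    using measurable_space[OF f that] nn[OF that] by (simp add: pre_Lip1)
  fix t :: real assume t: "0 \<le> t"
  have "(\<lambda>w. f w (min t (L w))) \<in> borel_measurable N"
    by (rule measurable_Lip1_joint[OF f]) (use t nn in auto)
  then show "(\<lambda>w. pre (L w) (f w) t) \<in> borel_measurable N" using t by (simp add: pre_def)
qed

lemma measurable_suf:
  assumes f: "f \<in> measurable N (Lip1_borel X)" and L[measurable]: "L \<in> borel_measurable N"
    and nn: "\<And>w. w \<in> space N \<Longrightarrow> 0 \<le> L w"
  shows "(\<lambda>w. suf (L w) (f w)) \<in> measurable N (Lip1_borel X)"
proof (rule measurable_into_Lip1)
  show "suf (L w) (f w) \<in> Lip1 X" if "w \<in> space N" for w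
    using measurable_space[OF f that] nn[OF that] by (simp add: suf_Lip1)
  fix t :: real assume t: "0 \<le> t"
  have "(\<lambda>w. f w (L w + t)) \<in> borel_measurable N"
    by (rule measurable_Lip1_joint[OF f]) (use t nn in auto)
  then show "(\<lambda>w. suf (L w) (f w) t) \<in> borel_measurable N" using t by (simp add: suf_def)
qed

lemma measurable_seg:
  assumes f: "f \<in> measurable N (Lip1_borel X)" and L[measurable]: "a \<in> borel_measurable N" "b \<in> borel_measurable N"
    and nn: "\<And>w. w \<in> space N \<Longrightarrow> 0 \<le> a w" "\<And>w. w \<in> space N \<Longrightarrow> a w \<le> b w"
  shows "(\<lambda>w. seg (a w) (b w) (f w)) \<in> measurable N (Lip1_borel X)"
  unfolding seg_def by (intro measurable_pre measurable_suf f) (use nn in auto)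

lemma measurable_join:
  assumes f: "f \<in> measurable N (Lip1_borel X)" and g: "g \<in> measurable N (Lip1_borel X)"
    and L[measurable]: "L \<in> borel_measurable N"
    and nn: "\<And>w. w \<in> space N \<Longrightarrow> 0 \<le> L w" "\<And>w. w \<in> space N \<Longrightarrow> f w (L w) = g w 0"
  shows "(\<lambda>w. join (L w) (f w) (g w)) \<in> measurable N (Lip1_borel X)"
proof (rule measurable_into_Lip1)
  show "join (L w) (f w) (g w) \<in> Lip1 X" if "w \<in> space N" for w
    using measurable_space[OF f that] measurable_space[OF g that] nn[OF that] by (simp add: join_Lip1)
  fix t :: real assume t: "0 \<le> t"
  have [measurable]: "(\<lambda>w. g w (max 0 (t - L w))) \<in> borel_measurable N"
    by (rule measurable_Lip1_joint[OF g]) auto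
  have [measurable]: "(\<lambda>w. f w t) \<in> borel_measurable N"
    by (rule measurable_Lip1_eval_compose[OF f t])
  have "(\<lambda>w. if t \<le> L w then f w t else g w (max 0 (t - L w))) \<in> borel_measurable N" by measurable
  then show "(\<lambda>w. join (L w) (f w) (g w) t) \<in> borel_measurable N"
    using t by (simp add: join_def max_def cong: if_cong)
qed

lemma measurable_rev_curve:
  assumes f: "f \<in> measurable N (Lip1_borel X)"
  shows "(\<lambda>w. rev_curve L (f w)) \<in> measurable N (Lip1_borel X)"
proof (rule measurable_into_Lip1)
  show "rev_curve L (f w) \<in> Lip1 X" if "w \<in> space N" for w
    using measurable_space[OF f that] by (simp add: rev_curve_Lip1)
  fix t :: real assume t: "0 \<le> t"
  then show "(\<lambda>w. rev_curve L (f w) t) \<in> borel_measurable N"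
    by (simp add: rev_curve_def measurable_Lip1_eval_compose[OF f])
qed

lemma sp_suf: "0 \<le> a \<Longrightarrow> 0 \<le> t \<Longrightarrow> sp (suf a c) t = sp c (a + t)"
  by (simp add: sp_def suf_def add.assoc)

text \<open>\<open>c1\<close> has to rest after time \<open>L\<close>, because
  \<open>lint c1\<close> integrates over all times whereas the joined curve leaves \<open>c1\<close>
  at \<open>L\<close>.\<close>

lemma lint_join:
  assumes c: "c1 \<in> Lip1 X" "c2 \<in> Lip1 X" "0 \<le> L" "c1 L = c2 0" and const: "\<And>t. L \<le> t \<Longrightarrow> c1 t = c1 L"
    and f: "f \<in> borel_measurable borel"
  shows "lint (join L c1 c2) f = lint c1 f + lint c2 f"
proof -
  let ?j = "join L c1 c2"
  have j: "?j \<in> Lip1 X" by (rule join_Lip1[OF c])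
  have "lint ?j f = (\<integral>\<^sup>+t\<in>{0..<L}. f (?j t) * ennreal (sp ?j t) \<partial>lborel) + (\<integral>\<^sup>+t\<in>{L..}. f (?j t) * ennreal (sp ?j t) \<partial>lborel)"
    by (rule lint_split[OF j f c(3)])
  also have "(\<integral>\<^sup>+t\<in>{0..<L}. f (?j t) * ennreal (sp ?j t) \<partial>lborel) = (\<integral>\<^sup>+t\<in>{0..<L}. f (c1 t) * ennreal (sp c1 t) \<partial>lborel)"
  proof (rule nn_integral_cong)
    fix t :: real
    have "sp ?j t = sp c1 t" "?j t = c1 t" if "0 \<le> t" "t < L"
      by (rule sp_cong[of "L - t"]) (use that in \<open>auto simp: join_def\<close>)
    then show "f (?j t) * ennreal (sp ?j t) * indicator {0..<L} t = f (c1 t) * ennreal (sp c1 t) * indicator {0..<L} t"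
      by (cases "t \<in> {0..<L}") simp_all
  qed
  also have "\<dots> = lint c1 f"
  proof -
    have "sp c1 t = 0" if "L \<le> t" for t
      by (rule sp_const[of 1 _ _ "c1 L"], simp) (rule const, use that in linarith)
    then have "(\<integral>\<^sup>+t\<in>{L..}. f (c1 t) * ennreal (sp c1 t) \<partial>lborel) = (\<integral>\<^sup>+(t::real). 0 \<partial>lborel)"
      by (intro nn_integral_cong) (auto simp: indicator_def)
    then show ?thesis using lint_split[OF c(1) f c(3)] by simp
  qed
  also have "(\<integral>\<^sup>+t\<in>{L..}. f (?j t) * ennreal (sp ?j t) \<partial>lborel) = lint c2 f"
  proof -
    have "(\<integral>\<^sup>+t\<in>{L..}. f (?j t) * ennreal (sp ?j t) \<partial>lborel) =
       ennreal \<bar>1\<bar> * (\<integral>\<^sup>+t. (f (?j (L + 1 * t)) * ennreal (sp ?j (L + 1 * t)) * indicator {L..} (L + 1 * t)) \<partial>lborel)"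
      by (rule nn_integral_real_affine) (use measurable_line_integrand[OF j f, of "{L..}"] c(3) in auto)
    also have "\<dots> = lint c2 f" unfolding lint_def
    proof (simp, rule nn_integral_cong)
      fix t :: real
      have ev: "?j (L + t) = c2 t" if "0 \<le> t" for t using that c(3,4) by (auto simp: join_def)
      have "sp ?j (L + t) = sp c2 t" if "0 \<le> t"
        using ev that by (simp add: sp_def add.assoc)
      then show "f (?j (L + t)) * ennreal (sp ?j (L + t)) * indicator {L..} (L + t) = f (c2 t) * ennreal (sp c2 t) * indicator {0..} t"
        using ev by (auto simp: indicator_def)
    qed
    finally show ?thesis .
  qed
  finally show ?thesis .
qed

lemma trace_join:
  assumes c: "0 \<le> L" "c1 L = c2 0" and const: "\<And>t. L \<le> t \<Longrightarrow> c1 t = c1 L"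
  shows "ctrace (join L c1 c2) = ctrace c1 \<union> ctrace c2"
proof
  show "ctrace (join L c1 c2) \<subseteq> ctrace c1 \<union> ctrace c2" by (auto simp: ctrace_def join_def)
  have "c1 t \<in> ctrace (join L c1 c2)" if "0 \<le> t" for t
    unfolding ctrace_def by (rule image_eqI[of _ _ "min t L"])
      (use that c const[of t] in \<open>auto simp: join_def min_def\<close>)
  moreover have "c2 t \<in> ctrace (join L c1 c2)" if "0 \<le> t" for t
    unfolding ctrace_def by (rule image_eqI[of _ _ "L + t"]) (use that c in \<open>auto simp: join_def\<close>)
  ultimately show "ctrace c1 \<union> ctrace c2 \<subseteq> ctrace (join L c1 c2)" by (auto simp: ctrace_def)
qed

lemma join_pre_suf:
  assumes "c \<in> Lip1 X" "0 \<le> L" shows "join L (pre L c) (suf L c) = c"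
  using assms by (intro Lip1_ext[of _ X _ X] join_Lip1 pre_Lip1 suf_Lip1) (auto simp: pre_def suf_def join_def)

lemma lint_pre_suf:
  assumes g: "c \<in> Lip1 X" and L: "0 \<le> L" and f: "f \<in> borel_measurable borel"
  shows "lint c f = lint (pre L c) f + lint (suf L c) f"
proof -
  have "lint (join L (pre L c) (suf L c)) f = lint (pre L c) f + lint (suf L c) f"
    by (rule lint_join[OF pre_Lip1 suf_Lip1 L _ _ f]) (use g L in \<open>auto simp: pre_def suf_def\<close>)
  then show ?thesis using join_pre_suf[OF g L] by simp
qed

lemma trace_pre_suf:
  assumes g: "c \<in> Lip1 X" and L: "0 \<le> L"
  shows "ctrace c = ctrace (pre L c) \<union> ctrace (suf L c)"
proof -
  have "ctrace (join L (pre L c) (suf L c)) = ctrace (pre L c) \<union> ctrace (suf L c)"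
    by (rule trace_join[OF L]) (use L in \<open>auto simp: pre_def suf_def\<close>)
  then show ?thesis using join_pre_suf[OF g L] by simp
qed

lemma suf_eq_join_seg:
  assumes "c \<in> Lip1 X" "0 \<le> a" "a \<le> b" shows "suf (b - a) (suf a c) = suf b c"
  using assms by (intro Lip1_ext[of _ X _ X] suf_Lip1) (auto simp: suf_def)

lemma lint_pre_seg_suf:
  assumes g: "c \<in> Lip1 X" and ab: "0 \<le> a" "a \<le> b" and f: "f \<in> borel_measurable borel"
  shows "lint c f = lint (pre a c) f + lint (seg a b c) f + lint (suf b c) f"
  using lint_pre_suf[OF g ab(1) f] lint_pre_suf[OF suf_Lip1[OF g ab(1)], of "b - a" f] ab f
    suf_eq_join_seg[OF g ab] by (simp add: seg_def add.assoc)

lemma trace_pre_seg_suf: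
  assumes g: "c \<in> Lip1 X" and ab: "0 \<le> a" "a \<le> b"
  shows "ctrace c = ctrace (pre a c) \<union> ctrace (seg a b c) \<union> ctrace (suf b c)"
  using trace_pre_suf[OF g ab(1)] trace_pre_suf[OF suf_Lip1[OF g ab(1)], of "b - a"] ab
    suf_eq_join_seg[OF g ab] by (auto simp: seg_def)

lemma trace_seg: "0 \<le> a \<Longrightarrow> a \<le> b \<Longrightarrow> ctrace (seg a b c) = c ` {a..b}"
proof (intro equalityI subsetI)
  fix y assume ab: "0 \<le> a" "a \<le> b" and "y \<in> c ` {a..b}"
  then obtain t where "y = c t" "a \<le> t" "t \<le> b" by auto
  then show "y \<in> ctrace (seg a b c)" using ab
    unfolding ctrace_def by (intro image_eqI[of _ _ "t - a"]) (auto simp: seg_def pre_def suf_def)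
qed (auto simp: ctrace_def seg_def pre_def suf_def)

lemma sp_seg:
  assumes "0 \<le> a" "0 \<le> t" "t < b - a" shows "sp (seg a b c) t = sp c (a + t)"
proof -
  have "sp (seg a b c) t = sp (suf a c) t" unfolding seg_def
    by (rule sp_cong[of "b - a - t"]) (use assms in \<open>auto simp: pre_def suf_def\<close>)
  then show ?thesis using assms by (simp add: sp_suf)
qed

lemma lint_seg:
  assumes g: "c \<in> Lip1 X" and ab: "0 \<le> a" "a \<le> b" and f: "f \<in> borel_measurable borel"
  shows "lint (seg a b c) f = (\<integral>\<^sup>+t\<in>{a..b}. f (c t) * ennreal (sp c t) \<partial>lborel)"
proof -
  have m: "(\<lambda>t. f (c t) * ennreal (sp c t) * indicator {a..<b} t) \<in> borel_measurable lborel"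
    by (rule measurable_line_integrand[OF g f]) (use ab in auto)
  have "(\<integral>\<^sup>+t\<in>{a..b}. f (c t) * ennreal (sp c t) \<partial>lborel) = (\<integral>\<^sup>+t\<in>{a..<b}. f (c t) * ennreal (sp c t) \<partial>lborel)"
    by (rule nn_integral_cong_AE, use AE_lborel_singleton[of b] in eventually_elim) (auto simp: indicator_def)
  also have "\<dots> = ennreal \<bar>1\<bar> * (\<integral>\<^sup>+t. (f (c (a + 1 * t)) * ennreal (sp c (a + 1 * t)) * indicator {a..<b} (a + 1 * t)) \<partial>lborel)"
    by (rule nn_integral_real_affine) (use m in auto)
  also have "\<dots> = (\<integral>\<^sup>+t\<in>{0..<b - a}. f (seg a b c t) * ennreal (sp (seg a b c) t) \<partial>lborel)"
    by (simp, rule nn_integral_cong) (use ab sp_seg[OF ab(1), of _ b c] in \<open>auto simp: indicator_def seg_def pre_def suf_def\<close>)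
  also have "\<dots> = lint (seg a b c) f"
  proof -
    have "sp (seg a b c) t = 0" if "b - a \<le> t" for t
      by (rule sp_const[of 1 _ _ "c b"]) (use that ab in \<open>auto simp: seg_def pre_def suf_def\<close>)
    then have "(\<integral>\<^sup>+t\<in>{b - a..}. f (seg a b c t) * ennreal (sp (seg a b c) t) \<partial>lborel) = (\<integral>\<^sup>+(t::real). 0 \<partial>lborel)"
      by (intro nn_integral_cong) (auto simp: indicator_def)
    then show ?thesis using lint_split[OF seg_Lip1[OF g ab] f, of "b - a"] ab by simp
  qed
  finally show ?thesis by simp
qed

lemma lint_cst: "lint (cst x) f = 0"
proof -
  have "sp (cst x) t = 0" if "0 \<le> t" for t
    by (rule sp_const[of 1 _ _ x]) (use that in \<open>auto simp: cst_def\<close>)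
  then have "lint (cst x) f = (\<integral>\<^sup>+(t::real). 0 \<partial>lborel)"
    unfolding lint_def by (intro nn_integral_cong) (auto simp: indicator_def)
  then show ?thesis by simp
qed

lemma lint_le_of_const:
  assumes c: "c \<in> Lip1 X" and L: "0 \<le> L" and const: "\<And>t. L \<le> t \<Longrightarrow> c t = c L"
  shows "lint c f \<le> (\<integral>\<^sup>+t\<in>{0..L}. f (c t) \<partial>lborel)"
proof -
  have z: "sp c t = 0" if "L \<le> t" for t
    by (rule sp_const[of 1 _ _ "c L"], simp) (rule const, use that in linarith)
  show ?thesis unfolding lint_def
  proof (rule nn_integral_mono_AE, use Lip1_AE_speed[OF c] in eventually_elim)
    fix t assume t: "0 \<le> t \<longrightarrow> speed c t = sp c t \<and> sp c t \<le> 1 \<and> 0 < t \<and> (\<exists>D. (c has_vector_derivative D) (at t) \<and> sp c t = norm D)"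
    have "f (c t) * ennreal (sp c t) \<le> f (c t) * 1" if "0 \<le> t"
      using t that by (intro mult_left_mono) (auto simp: ennreal_le_1)
    then show "f (c t) * ennreal (sp c t) * indicator {0..} t \<le> f (c t) * indicator {0..L} t"
      using z[of t] by (auto simp: indicator_def)
  qed
qed

lemma lint_ge_dist:
  assumes g: "c \<in> Lip1 X" and ab: "0 \<le> s" "s \<le> t"
  shows "ennreal (dist (c s) (c t)) \<le> lint (seg s t c) (\<lambda>_. 1)"
  using Lip1_dist_le_sp[OF g ab] by (simp add: lint_seg[OF g ab])

lemma fin_pre: "0 \<le> L \<Longrightarrow> fin (pre L c)"
  unfolding fin_def by (intro exI[of _ L]) (auto simp: pre_def)

lemma fin_suf: "fin c \<Longrightarrow> 0 \<le> a \<Longrightarrow> fin (suf a c)"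
proof -
  assume a: "fin c" "0 \<le> a"
  then obtain T where T: "T \<ge> 0" "\<And>t. t \<ge> T \<Longrightarrow> c t = c T" by (auto simp: fin_def)
  show "fin (suf a c)" unfolding fin_def
  proof (intro exI[of _ T] conjI allI impI T(1))
    fix t assume "T \<le> t"
    then show "suf a c t = suf a c T" using T(1) a(2) T(2)[of "a + t"] T(2)[of "a + T"] by (simp add: suf_def)
  qed
qed

lemma fin_seg: "0 \<le> a \<Longrightarrow> a \<le> b \<Longrightarrow> fin (seg a b c)"
  unfolding seg_def by (intro fin_pre) auto

lemma simple_seg:
  assumes "simple_curve c" "0 \<le> a" "a \<le> b" shows "simple_curve (seg a b c)"
  unfolding simple_curve_def
proof (intro notI, elim exE conjE)
  fix t1 t2 t3 assume t: "0 \<le> t1" "t1 < t2" "t2 < t3" "seg a b c t1 = seg a b c t3" "seg a b c t3 \<noteq> seg a b c t2"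
  let ?m = "\<lambda>t. a + min t (b - a)"
  have e: "seg a b c t = c (?m t)" if "0 \<le> t" for t using that assms by (auto simp: seg_def pre_def suf_def)
  have v: "c (?m t1) = c (?m t3)" "c (?m t3) \<noteq> c (?m t2)"
    using t e[of t1] e[of t2] e[of t3] by simp_all
  then have "?m t1 \<noteq> ?m t2" "?m t2 \<noteq> ?m t3" by metis+
  moreover have "?m t1 \<le> ?m t2" "?m t2 \<le> ?m t3" "0 \<le> ?m t1" using t assms by auto
  ultimately have "0 \<le> ?m t1 \<and> ?m t1 < ?m t2 \<and> ?m t2 < ?m t3" by linarith
  then show False using assms(1) v unfolding simple_curve_def by blast
qed

lemma einf_suf:
  assumes "c \<in> Lip1 X" "fin c" "0 \<le> a" shows "einf (suf a c) = einf c"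
  by (rule einf_eqI[OF suf_Lip1[OF assms(1,3)], of "real (stop_nat c)"])
    (use assms stop_nat[OF assms(1,2)] in \<open>auto simp: suf_def\<close>)

lemma einf_join:
  assumes "c1 \<in> Lip1 X" "c2 \<in> Lip1 X" "0 \<le> L" "c1 L = c2 0" "fin c2"
  shows "einf (join L c1 c2) = einf c2" "fin (join L c1 c2)"
proof -
  let ?T = "L + real (stop_nat c2) + 1"
  have c: "join L c1 c2 t = einf c2" if "?T \<le> t" for t
    using that assms(3) stop_nat[OF assms(2,5), of "t - L"] by (auto simp: join_def)
  show "einf (join L c1 c2) = einf c2"
    by (rule einf_eqI[OF join_Lip1[OF assms(1-4)], of ?T]) (use assms(3) c in auto)
  show "fin (join L c1 c2)" unfolding fin_def
    by (intro exI[of _ ?T]) (use assms(3) c in auto)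
qed

lemma join_0: "0 \<le> L \<Longrightarrow> join L c1 c2 0 = c1 0"
  by (simp add: join_def)

section \<open>Comparison of the lengths of two curves on their intersection\<close>

lemma borel_trace:
  assumes g: "c \<in> Lip1 X" shows "ctrace c \<in> sets borel"
proof -
  have "ctrace c = (\<Union>n::nat. c ` {0..real n})"
  proof (intro equalityI subsetI)
    fix y assume "y \<in> ctrace c"
    then obtain t where t: "0 \<le> t" "y = c t" by (auto simp: ctrace_def)
    obtain n :: nat where "t \<le> real n" using real_arch_simple by blast
    then have "y \<in> c ` {0..real n}" using t by auto
    then show "y \<in> (\<Union>n::nat. c ` {0..real n})" by blast
  qed (auto simp: ctrace_def)
  moreover have "c ` {0..real n} \<in> sets borel" for n
    by (rule borel_compact, rule compact_continuous_image) (auto intro: continuous_on_subset[OF Lip1_continuous_on[OF g]])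
  ultimately show ?thesis by (simp add: sets.countable_UN)
qed

lemma first_time_props:
  assumes g: "c \<in> Lip1 X" and y: "y \<in> ctrace c"
  shows "0 \<le> first_time y c" "c (first_time y c) = y" "\<And>t. 0 \<le> t \<Longrightarrow> c t = y \<Longrightarrow> first_time y c \<le> t"
proof -
  let ?S = "{t. 0 \<le> t \<and> c t = y}"
  have ne: "?S \<noteq> {}" using y by (auto simp: ctrace_def)
  have bdd: "bdd_below ?S" by (rule bdd_belowI[of _ 0]) auto
  have "closed ({0..} \<inter> c -` {y})"
    by (rule continuous_closed_preimage[OF Lip1_continuous_on[OF g] closed_atLeast closed_singleton])
  then have "closed ?S" by (rule back_subst[where P=closed]) auto
  then have "first_time y c \<in> ?S"
    unfolding first_time_def by (rule closed_contains_Inf[OF ne bdd])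
  then show "0 \<le> first_time y c" "c (first_time y c) = y" by auto
  show "\<And>t. 0 \<le> t \<Longrightarrow> c t = y \<Longrightarrow> first_time y c \<le> t"
    unfolding first_time_def using bdd by (auto intro: cInf_lower)
qed

text \<open>On the trace the sublevel sets are compact images of time intervals; off the trace the
  first time is the constant \<open>Inf {}\<close>.\<close>

lemma measurable_first_time_point [measurable]:
  assumes g: "\<gamma> \<in> Lip1 X" shows "(\<lambda>y. first_time y \<gamma>) \<in> borel_measurable borel"
proof (rule borel_measurable_iff_le[THEN iffD2, rule_format])
  fix c :: real
  have cl: "\<gamma> ` {0..c} \<in> sets borel"
    by (rule borel_compact, rule compact_continuous_image)
      (auto intro: continuous_on_subset[OF Lip1_continuous_on[OF g]])
  have out: "first_time y \<gamma> = Inf {}" if "y \<notin> ctrace \<gamma>" for y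
  proof -
    have "{t. 0 \<le> t \<and> \<gamma> t = y} = {}" using that by (auto simp: ctrace_def)
    then show ?thesis unfolding first_time_def by (rule arg_cong)
  qed
  have iff: "first_time y \<gamma> \<le> c \<longleftrightarrow> y \<in> \<gamma> ` {0..c}" if "y \<in> ctrace \<gamma>" for y
  proof
    assume "first_time y \<gamma> \<le> c"
    then show "y \<in> \<gamma> ` {0..c}"
      using first_time_props[OF g that] by (intro image_eqI[of _ _ "first_time y \<gamma>"]) auto
  next
    assume "y \<in> \<gamma> ` {0..c}" then show "first_time y \<gamma> \<le> c"
      using first_time_props(3)[OF g that] by force
  qed
  have "{y \<in> space borel. first_time y \<gamma> \<le> c} =
     (\<gamma> ` {0..c} \<inter> ctrace \<gamma>) \<union> (if Inf {} \<le> c then - ctrace \<gamma> else {})"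
  proof (intro set_eqI)
    fix y show "y \<in> {y \<in> space borel. first_time y \<gamma> \<le> c} \<longleftrightarrow>
      y \<in> (\<gamma> ` {0..c} \<inter> ctrace \<gamma>) \<union> (if Inf {} \<le> c then - ctrace \<gamma> else {})"
      using out[of y] iff[of y] by (cases "y \<in> ctrace \<gamma>") auto
  qed
  also have "\<dots> \<in> sets borel" using cl borel_trace[OF g] by auto
  finally show "{y \<in> space borel. first_time y \<gamma> \<le> c} \<in> sets borel" .
qed

text \<open>\<open>simple_curve\<close> permits resting: two visits to a point enclose a rest at it,
  since any excursion would be a loop.\<close>

lemma simple_const_between:
  assumes "simple_curve c" "0 \<le> u" "u < t" "c u = c t" "u \<le> x" "x \<le> t" shows "c x = c t"
proof (cases "x = u \<or> x = t")
  case False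
  then show ?thesis using assms unfolding simple_curve_def by (metis order_le_less)
qed (use assms in auto)

lemma deriv_zero_if_const_side:
  assumes D: "(\<gamma> has_vector_derivative D) (at t)" and e: "0 < e"
    and c: "(\<forall>x\<in>{t - e..t}. \<gamma> x = \<gamma> t) \<or> (\<forall>x\<in>{t..t + e}. \<gamma> x = \<gamma> t)"
  shows "D = 0"
  using c
proof
  assume *: "\<forall>x\<in>{t - e..t}. \<gamma> x = \<gamma> t"
  have "(\<gamma> has_vector_derivative D) (at t within {t - e..t})"
    using D by (rule has_vector_derivative_at_within)
  moreover have "(\<gamma> has_vector_derivative 0) (at t within {t - e..t})"
    by (rule has_vector_derivative_transform[of _ _ _ "\<lambda>_. \<gamma> t"]) (use e in simp, erule *[rule_format], simp)
  ultimately show ?thesis using vector_derivative_unique_within_closed_interval[of "t - e" t t \<gamma> D 0] e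
    by (simp add: box_real)
next
  assume *: "\<forall>x\<in>{t..t + e}. \<gamma> x = \<gamma> t"
  have "(\<gamma> has_vector_derivative D) (at t within {t..t + e})"
    using D by (rule has_vector_derivative_at_within)
  moreover have "(\<gamma> has_vector_derivative 0) (at t within {t..t + e})"
    by (rule has_vector_derivative_transform[of _ _ _ "\<lambda>_. \<gamma> t"]) (use e in simp, erule *[rule_format], simp)
  ultimately show ?thesis using vector_derivative_unique_within_closed_interval[of t "t + e" t \<gamma> D 0] e
    by (simp add: box_real)
qed

text \<open>A second visit would force a rest on one side of \<open>t\<close>, and the derivative at
  \<open>t\<close> would vanish.\<close>

lemma simple_moving_unique:
  assumes s: "simple_curve \<gamma>" and D: "(\<gamma> has_vector_derivative D) (at t)" "D \<noteq> 0" and t: "0 \<le> t"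
    and u: "0 \<le> u" "\<gamma> u = \<gamma> t"
  shows "u = t"
proof (rule ccontr)
  assume "u \<noteq> t"
  then consider "u < t" | "t < u" by linarith
  then show False
  proof cases
    case 1
    have "\<forall>x\<in>{t - (t - u)..t}. \<gamma> x = \<gamma> t"
      by (intro ballI simple_const_between[OF s u(1) 1 u(2)]) auto
    then have "D = 0" by (intro deriv_zero_if_const_side[OF D(1), of "t - u"] disjI1) (use 1 in simp)
    then show False using D(2) by simp
  next
    case 2
    have c: "\<gamma> x = \<gamma> u" if "t \<le> x" "x \<le> u" for x
      by (rule simple_const_between[OF s t 2 u(2)[symmetric] that])
    have "\<forall>x\<in>{t..t + (u - t)}. \<gamma> x = \<gamma> t"
      by (intro ballI trans[OF c u(2)]) auto
    then have "D = 0" by (intro deriv_zero_if_const_side[OF D(1), of "u - t"] disjI2) (use 2 in simp)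
    then show False using D(2) by simp
  qed
qed

text \<open>Since \<open>c t\<close> is visited only at \<open>t\<close>, it has positive distance
  from the compact image of the times in \<open>[0, T]\<close> that are at least \<open>e\<close>
  away from \<open>t\<close>.\<close>

lemma simple_moving_inverse_cont:
  assumes g: "c \<in> Lip1 X" and s: "simple_curve c"
    and D: "(c has_vector_derivative D) (at t)" "D \<noteq> 0" and t: "0 \<le> t" and e: "0 < e"
  shows "\<exists>d>0. \<forall>u. 0 \<le> u \<and> u \<le> T \<and> dist (c u) (c t) < d \<longrightarrow> \<bar>u - t\<bar> < e"
proof -
  let ?C = "{0..T} - {t - e<..<t + e}"
  have "closed (c ` ?C)"
  proof (rule compact_imp_closed, rule compact_continuous_image)
    show "continuous_on ?C c" by (rule continuous_on_subset[OF Lip1_continuous_on[OF g]]) auto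
    show "compact ?C" by (rule compact_diff) auto
  qed
  moreover have "c t \<notin> c ` ?C"
    using simple_moving_unique[OF s D t] e by fastforce
  ultimately obtain d where d: "d > 0" "ball (c t) d \<subseteq> - c ` ?C"
    using openE[of "- c ` ?C" "c t"] by (metis ComplI open_Compl)
  have "\<bar>u - t\<bar> < e" if "0 \<le> u" "u \<le> T" "dist (c u) (c t) < d" for u
  proof (rule ccontr)
    assume "\<not> \<bar>u - t\<bar> < e"
    then have "u \<in> ?C" using that by auto
    moreover have "c u \<in> ball (c t) d" using that by (simp add: dist_commute)
    ultimately show False using d(2) by auto
  qed
  then show ?thesis using d(1) by blast
qed

lemma set_nn_integral_absolutely_integrable:
  fixes f :: "real \<Rightarrow> real"
  assumes f: "f absolutely_integrable_on S" and nn: "\<And>x. x \<in> S \<Longrightarrow> 0 \<le> f x"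
  shows "(\<integral>\<^sup>+x. ennreal (f x) * indicator S x \<partial>lebesgue) = ennreal (integral S f)"
proof -
  have i: "integrable lebesgue (\<lambda>x. indicator S x *\<^sub>R f x)" using f unfolding set_integrable_def .
  have "(\<integral>\<^sup>+x. ennreal (f x) * indicator S x \<partial>lebesgue) = (\<integral>\<^sup>+x. ennreal (indicator S x *\<^sub>R f x) \<partial>lebesgue)"
    by (intro nn_integral_cong) (auto simp: indicator_def)
  also have "\<dots> = ennreal (LINT x|lebesgue. indicator S x *\<^sub>R f x)"
    by (rule nn_integral_eq_integral[OF i]) (use nn in \<open>auto simp: indicator_def\<close>)
  also have "(LINT x|lebesgue. indicator S x *\<^sub>R f x) = integral S f"
    using set_lebesgue_integral_eq_integral(2)[OF f] unfolding set_lebesgue_integral_def .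
  finally show ?thesis .
qed

text \<open>Both sides measure \<open>R \<inter> ctrace c \<inter> ctrace \<eta>\<close>: a simple
  curve counts each of its points once, the other curve at least once. The two parametrizations are
  compared directly, through the map \<open>hh\<close> from times of \<open>\<eta>\<close> to times
  of \<open>c\<close> and the change of variables formula on the real line.\<close>

lemma lint_trace_le_set:
  fixes c \<eta> :: "real \<Rightarrow> 'a::euclidean_space"
  assumes g: "c \<in> Lip1 X" and s: "simple_curve c" and fg: "fin c" and h: "\<eta> \<in> Lip1 X"
    and R: "R \<in> sets borel"
  shows "lint c (indicator (R \<inter> ctrace \<eta>)) \<le> lint \<eta> (indicator (R \<inter> ctrace c))"
proof -
  obtain T where T: "0 \<le> T" "\<And>t. T \<le> t \<Longrightarrow> c t = c T" using fg by (auto simp: fin_def)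
  define S where "S = R \<inter> ctrace c \<inter> ctrace \<eta>"
  have S[measurable]: "S \<in> sets borel" unfolding S_def using R borel_trace[OF g] borel_trace[OF h] by auto
  obtain Ng where Ng: "Ng \<in> null_sets lborel" "\<And>t. 0 \<le> t \<Longrightarrow> t \<notin> Ng \<Longrightarrow>
      0 < t \<and> sp c t \<le> 1 \<and> (\<exists>D. (c has_vector_derivative D) (at t) \<and> sp c t = norm D)"
    using Lip1_AE_speed[OF g] by (auto elim!: AE_E simp: null_sets_def) blast
  obtain Nh where Nh: "Nh \<in> null_sets lborel" "\<And>t. 0 \<le> t \<Longrightarrow> t \<notin> Nh \<Longrightarrow>
      0 < t \<and> (\<exists>D. (\<eta> has_vector_derivative D) (at t) \<and> sp \<eta> t = norm D)"
    using Lip1_AE_speed[OF h] by (auto elim!: AE_E simp: null_sets_def) blast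
  have [measurable]: "Ng \<in> sets borel" "Nh \<in> sets borel" using Ng(1) Nh(1) by (auto simp: null_sets_def)
  note [measurable] = measurable_Lip1_max[OF g] measurable_Lip1_max[OF h] measurable_sp_fixed[OF g] measurable_sp_fixed[OF h]
    measurable_first_time_point[OF g] measurable_first_time_point[OF h]
  \<comment> \<open>Times at which \<open>c\<close> moves inside the common set. A point
    \<open>c t\<close> with \<open>t \<in> E\<close> is visited by \<open>c\<close> only at
    \<open>t\<close>.\<close>
  define E where "E = {t. 0 \<le> t \<and> t \<notin> Ng \<and> c (max 0 t) \<in> S \<and> 0 < sp c (max 0 t)}"
  have E[measurable]: "E \<in> sets borel" unfolding E_def by measurable
  define hh where "hh s = first_time (\<eta> (max 0 s)) c" for s
  define kk where "kk t = first_time (c (max 0 t)) \<eta>" for t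
  have [measurable]: "hh \<in> borel_measurable borel" "kk \<in> borel_measurable borel"
    unfolding hh_def kk_def by measurable
  \<comment> \<open>Only the first visit of \<open>\<eta>\<close> to each point is kept, so that
    \<open>hh\<close> is a bijection from \<open>G0\<close> onto \<open>E\<close> with inverse
    \<open>kk\<close>.\<close>
  define G0 where "G0 = {s. 0 \<le> s \<and> \<eta> (max 0 s) \<in> S \<and> s = first_time (\<eta> (max 0 s)) \<eta> \<and> hh s \<in> E}"
  define G where "G = {s\<in>G0. s \<notin> Nh}"
  have G0[measurable]: "G0 \<in> sets borel" unfolding G0_def by measurable
  have G[measurable]: "G \<in> sets borel" unfolding G_def by measurable
  define E' where "E' = {t\<in>E. kk t \<notin> Nh}"
  have E'[measurable]: "E' \<in> sets borel" unfolding E'_def by measurable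
  have Emov: "\<exists>D. (c has_vector_derivative D) (at t) \<and> D \<noteq> 0 \<and> sp c t = norm D" "0 < t" "c t \<in> S" "t \<le> T" "sp c t \<le> 1"
    if "t \<in> E" for t
  proof -
    have t: "0 \<le> t" "t \<notin> Ng" "c t \<in> S" "0 < sp c t" using that by (auto simp: E_def)
    show "\<exists>D. (c has_vector_derivative D) (at t) \<and> D \<noteq> 0 \<and> sp c t = norm D" using Ng(2)[OF t(1,2)] t(4) by auto
    show "0 < t" "sp c t \<le> 1" using Ng(2)[OF t(1,2)] by auto
    show "c t \<in> S" by (rule t)
    show "t \<le> T"
    proof (rule ccontr)
      assume "\<not> t \<le> T"
      then have "sp c t = 0" by (intro sp_const[of 1 _ _ "c T"] T(2)) auto
      then show False using t by simp
    qed
  qed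
  have hE: "first_time (c t) c = t" if tE: "t \<in> E" for t
  proof -
    obtain D where D: "(c has_vector_derivative D) (at t)" "D \<noteq> 0" using Emov(1)[OF tE] by blast
    have "c t \<in> ctrace c" using Emov(3)[OF tE] by (auto simp: S_def)
    from first_time_props[OF g this] simple_moving_unique[OF s D] Emov(2)[OF tE]
    show ?thesis by simp
  qed
  have hG: "c (hh s) = \<eta> s" "hh s \<in> E" "0 \<le> s" "\<eta> s \<in> S" if "s \<in> G0" for s
    using that first_time_props(2)[OF g, of "\<eta> s"] by (auto simp: G0_def hh_def S_def)
  have kE: "kk t \<in> G0" "hh (kk t) = t" if "t \<in> E" for t
  proof -
    have tt: "c t \<in> ctrace \<eta>" "0 < t" using Emov[OF that] by (auto simp: S_def)
    have k: "0 \<le> kk t" "\<eta> (kk t) = c t" using first_time_props[OF h tt(1)] tt(2) by (auto simp: kk_def)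
    show 1: "hh (kk t) = t" using k hE[OF that] by (simp add: hh_def)
    show "kk t \<in> G0" using k 1 that Emov[OF that] by (auto simp: G0_def kk_def)
  qed
  have kG: "kk (hh s) = s" if "s \<in> G0" for s
    using hG[OF that] Emov(2)[OF hG(2)[OF that]] that by (auto simp: kk_def G0_def)
  have img: "hh ` G = E'"
  proof
    show "hh ` G \<subseteq> E'" using hG kG by (auto simp: G_def E'_def)
    show "E' \<subseteq> hh ` G" using kE by (auto simp: G_def E'_def intro!: image_eqI[of _ hh "kk _"])
  qed
  have inj: "inj_on hh G" by (rule inj_on_inverseI[of _ kk]) (auto simp: G_def kG)
  have near: "\<exists>d>0. \<forall>r\<in>G0. \<bar>r - q\<bar> < d \<longrightarrow> \<bar>hh r - hh q\<bar> < e" if q: "q \<in> G0" and e: "0 < e" for q e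
  proof -
    obtain D where D: "(c has_vector_derivative D) (at (hh q))" "D \<noteq> 0" using Emov(1)[OF hG(2)[OF q]] by blast
    obtain d where d: "d > 0" "\<And>u. 0 \<le> u \<Longrightarrow> u \<le> T \<Longrightarrow> dist (c u) (c (hh q)) < d \<Longrightarrow> \<bar>u - hh q\<bar> < e"
      using simple_moving_inverse_cont[OF g s D _ e, of T] Emov(2)[OF hG(2)[OF q]] by (meson less_imp_le)
    have "\<bar>hh r - hh q\<bar> < e" if r: "r \<in> G0" "\<bar>r - q\<bar> < d" for r
    proof (rule d(2))
      show "0 \<le> hh r" "hh r \<le> T" using Emov(2,4)[OF hG(2)[OF r(1)]] by auto
      show "dist (c (hh r)) (c (hh q)) < d"
        using Lip1_dist[OF h hG(3)[OF r(1)] hG(3)[OF q]] r(2) hG(1)[OF r(1)] hG(1)[OF q] by simp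
    qed
    then show ?thesis using d(1) by blast
  qed
  \<comment> \<open>The null set of times at which \<open>\<eta>\<close> may fail to be
    differentiable must stay null under \<open>hh\<close>. Near \<open>hh q\<close> the displacement
    of \<open>c\<close> is at least \<open>norm D / 2\<close> times the elapsed time, while
    \<open>\<eta>\<close> is 1-Lipschitz; so \<open>hh\<close> is Lipschitz at \<open>q\<close> with
    constant \<open>2 / norm D\<close>.\<close>
  have negl: "negligible (hh ` (G0 \<inter> Nh))"
  proof (rule negligible_locally_Lipschitz_image)
    have "Nh \<in> null_sets lebesgue" using Nh(1) by (rule null_sets_completionI)
    then have "negligible Nh" by (simp add: negligible_iff_null_sets)
    then show "negligible (G0 \<inter> Nh)" by (rule negligible_subset) auto
    fix q assume "q \<in> G0 \<inter> Nh"
    then have q: "q \<in> G0" by auto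
    obtain D where D: "(c has_vector_derivative D) (at (hh q))" "D \<noteq> 0" using Emov(1)[OF hG(2)[OF q]] by blast
    have "((\<lambda>y. norm (c y - c (hh q) - (y - hh q) *\<^sub>R D) / norm (y - hh q)) \<longlongrightarrow> 0) (at (hh q))"
      using D(1) by (simp add: has_vector_derivative_def has_derivative_iff_norm)
    from tendstoD[OF this, of "norm D / 2"] D(2) obtain e where e: "e > 0"
      "\<And>y. y \<noteq> hh q \<Longrightarrow> \<bar>y - hh q\<bar> < e \<Longrightarrow> norm (c y - c (hh q) - (y - hh q) *\<^sub>R D) / \<bar>y - hh q\<bar> < norm D / 2"
      unfolding eventually_at by (auto simp: dist_real_def)
    obtain d where d: "d > 0" "\<And>r. r \<in> G0 \<Longrightarrow> \<bar>r - q\<bar> < d \<Longrightarrow> \<bar>hh r - hh q\<bar> < e" using near[OF q e(1)] by blast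
    have "norm (hh r - hh q) \<le> 2 / norm D * norm (r - q)" if r: "r \<in> G0" "\<bar>r - q\<bar> < d" for r
    proof (cases "hh r = hh q")
      case False
      have "norm (c (hh r) - c (hh q) - (hh r - hh q) *\<^sub>R D) < norm D / 2 * \<bar>hh r - hh q\<bar>"
        using e(2)[OF False d(2)[OF r]] False by (simp add: pos_divide_less_eq)
      moreover have "norm ((hh r - hh q) *\<^sub>R D) \<le> norm (c (hh r) - c (hh q)) + norm (c (hh r) - c (hh q) - (hh r - hh q) *\<^sub>R D)"
        by (metis norm_minus_commute norm_triangle_sub add.commute)
      moreover have "norm (c (hh r) - c (hh q)) \<le> \<bar>r - q\<bar>"
        using Lip1_dist[OF h hG(3)[OF r(1)] hG(3)[OF q]] hG(1)[OF r(1)] hG(1)[OF q] by (simp add: dist_norm)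
      ultimately have "\<bar>hh r - hh q\<bar> * norm D \<le> 2 * \<bar>r - q\<bar>" by (simp add: mult.commute)
      then show ?thesis using D(2) by (simp add: field_simps)
    qed simp
    then show "\<exists>T B. open T \<and> q \<in> T \<and> (\<forall>y\<in>G0 \<inter> Nh \<inter> T. norm (hh y - hh q) \<le> B * norm (y - q))"
      using d(1) by (intro exI[of _ "ball q d"] exI[of _ "2 / norm D"]) (auto simp: dist_real_def abs_minus_commute)
  qed simp
  have EE': "AE t in lborel. t \<in> E \<longrightarrow> t \<in> E'"
  proof -
    have "AE t in lebesgue. t \<notin> hh ` (G0 \<inter> Nh)"
      by (rule AE_not_in) (use negl in \<open>simp add: negligible_iff_null_sets\<close>)
    then have "AE t in lborel. t \<notin> hh ` (G0 \<inter> Nh)" by (simp add: AE_completion_iff)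
    then show ?thesis
    proof eventually_elim
      case (elim t)
      show ?case
      proof
        assume t: "t \<in> E"
        have "kk t \<notin> Nh" using elim kE[OF t] by (metis IntI imageI)
        then show "t \<in> E'" using t by (simp add: E'_def)
      qed
    qed
  qed
  define Dg where "Dg t = (SOME D. (c has_vector_derivative D) (at t) \<and> D \<noteq> 0 \<and> sp c t = norm D)" for t
  have Dg: "(c has_vector_derivative Dg t) (at t)" "Dg t \<noteq> 0" "sp c t = norm (Dg t)" if "t \<in> E" for t
    using someI_ex[OF Emov(1)[OF that]] unfolding Dg_def by blast+
  define Dh where "Dh t = (SOME D. (\<eta> has_vector_derivative D) (at t) \<and> sp \<eta> t = norm D)" for t
  have Dh: "(\<eta> has_vector_derivative Dh t) (at t)" "sp \<eta> t = norm (Dh t)" if "t \<in> G" for t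
  proof -
    have "\<exists>D. (\<eta> has_vector_derivative D) (at t) \<and> sp \<eta> t = norm D" using that Nh(2)[of t] hG(3)[of t] by (auto simp: G_def)
    from someI_ex[OF this] show "(\<eta> has_vector_derivative Dh t) (at t)" "sp \<eta> t = norm (Dh t)" unfolding Dh_def by blast+
  qed
  \<comment> \<open>The derivative of \<open>hh\<close>, found by differentiating
    \<open>c (hh q) = \<eta> q\<close> and projecting to the direction of \<open>c\<close>.\<close>
  define h' where "h' q = (Dh q \<bullet> Dg (hh q)) / (norm (Dg (hh q)))\<^sup>2" for q
  have der: "(hh has_field_derivative h' q) (at q within G)" if q: "q \<in> G" for q
  proof -
    have q0: "q \<in> G0" using q by (simp add: G_def)
    let ?t = "hh q" let ?v = "Dg ?t" let ?w = "(1 / (norm ?v)\<^sup>2) *\<^sub>R ?v"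
    note v = Dg[OF hG(2)[OF q0]]
    have "((\<lambda>u. c u \<bullet> ?w) has_vector_derivative ?v \<bullet> ?w) (at ?t)"
      by (rule bounded_linear.has_vector_derivative[OF bounded_linear_inner_left v(1)])
    moreover have "?v \<bullet> ?w = 1" using v(2) by (simp add: power2_norm_eq_inner)
    ultimately have a: "((\<lambda>u. c u \<bullet> ?w) has_field_derivative 1) (at ?t)"
      by (simp only: has_real_derivative_iff_has_vector_derivative)
    have "((\<lambda>u. \<eta> u \<bullet> ?w) has_vector_derivative Dh q \<bullet> ?w) (at q)"
      by (rule bounded_linear.has_vector_derivative[OF bounded_linear_inner_left Dh(1)[OF q]])
    then have "((\<lambda>u. \<eta> u \<bullet> ?w) has_field_derivative h' q) (at q)"
      by (simp add: has_real_derivative_iff_has_vector_derivative h'_def)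
    then have b: "((\<lambda>u. \<eta> u \<bullet> ?w) has_field_derivative h' q) (at q within G)"
      by (rule has_field_derivative_at_within)
    \<comment> \<open>Caratheodory's form of the derivative can be evaluated at \<open>hh y\<close>
      without dividing by \<open>hh y - hh q\<close>.\<close>
    obtain ga where ga: "\<And>z. c z \<bullet> ?w - c ?t \<bullet> ?w = ga z * (z - ?t)" "isCont ga ?t" "ga ?t = 1"
      using a unfolding CARAT_DERIV by blast
    have lb: "((\<lambda>y. (\<eta> y \<bullet> ?w - \<eta> q \<bullet> ?w) / (y - q)) \<longlongrightarrow> h' q) (at q within G)"
      using b unfolding has_field_derivative_iff .
    have "(hh \<longlongrightarrow> ?t) (at q within G)"
    proof (rule tendstoI)
      fix e :: real assume "e > 0"
      then show "\<forall>\<^sub>F r in at q within G. dist (hh r) ?t < e"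
        using near[OF q0] unfolding eventually_at by (auto simp: dist_real_def G_def) blast
    qed
    then have gl: "((\<lambda>y. ga (hh y)) \<longlongrightarrow> 1) (at q within G)"
      using isCont_tendsto_compose[OF ga(2)] ga(3) by metis
    have ev: "\<forall>\<^sub>F y in at q within G. y \<in> G \<and> y \<noteq> q" by (simp add: eventually_at_filter)
    have ev2: "\<forall>\<^sub>F y in at q within G. ga (hh y) \<noteq> 0"
      using order_tendstoD(1)[OF gl, of 0] by (auto elim: eventually_mono)
    have "((\<lambda>y. ((\<eta> y \<bullet> ?w - \<eta> q \<bullet> ?w) / (y - q)) / ga (hh y)) \<longlongrightarrow> h' q / 1) (at q within G)"
      by (rule tendsto_divide[OF lb gl]) simp
    then have "((\<lambda>y. (hh y - hh q) / (y - q)) \<longlongrightarrow> h' q / 1) (at q within G)"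
    proof (rule Lim_transform_eventually)
      show "\<forall>\<^sub>F y in at q within G. (\<eta> y \<bullet> ?w - \<eta> q \<bullet> ?w) / (y - q) / ga (hh y) = (hh y - hh q) / (y - q)"
        using ev ev2
      proof eventually_elim
        case (elim y)
        then have "y \<in> G0" by (simp add: G_def)
        have "\<eta> y \<bullet> ?w - \<eta> q \<bullet> ?w = ga (hh y) * (hh y - ?t)"
          using ga(1)[of "hh y"] hG(1)[OF \<open>y \<in> G0\<close>] hG(1)[OF q0] by simp
        then show ?case using elim by simp
      qed
    qed
    then show ?thesis unfolding has_field_derivative_iff by simp
  qed
  have int: "(\<lambda>t. sp c t) absolutely_integrable_on E'"
  proof -
    have sub: "E' \<subseteq> {0..T}" using Emov(2,4) by (force simp: E'_def)
    have "emeasure lborel E' \<le> emeasure lborel {0..T}" by (intro emeasure_mono sub) auto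
    also have "\<dots> < \<infinity>" using T(1) by simp
    finally have fin: "emeasure lborel E' < \<infinity>" .
    have m: "(\<lambda>t. indicat_real E' t *\<^sub>R sp c (max 0 t)) \<in> borel_measurable lborel" by measurable
    have "integrable lborel (\<lambda>t. indicat_real E' t *\<^sub>R sp c (max 0 t))"
    proof (rule integrableI_bounded_set_indicator[where B=1])
      show "AE t\<in>E' in lborel. norm (sp c (max 0 t)) \<le> 1"
        using Emov(2,5) by (intro AE_I2) (auto simp: E'_def max_def dest: less_imp_le)
    qed (use fin in auto)
    then have "integrable lebesgue (\<lambda>t. indicat_real E' t *\<^sub>R sp c (max 0 t))"
      using m by (simp add: integrable_completion)
    moreover have "(\<lambda>t. indicat_real E' t *\<^sub>R sp c (max 0 t)) = (\<lambda>t. indicat_real E' t *\<^sub>R sp c t)"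
      by (rule ext) (auto simp: indicator_def E'_def E_def max_def)
    ultimately show ?thesis unfolding set_integrable_def by simp
  qed
  have cv: "(\<lambda>q. \<bar>h' q\<bar> * sp c (hh q)) absolutely_integrable_on G \<and>
      integral G (\<lambda>q. \<bar>h' q\<bar> * sp c (hh q)) = integral E' (\<lambda>t. sp c t)"
  proof -
    have Gl: "G \<in> sets lebesgue" by (rule sets_completionI_sets) (simp add: G)
    note cov = has_absolute_integral_change_of_variables_1'[where S=G and g=hh and g'=h' and f="sp c"
        and b="integral E' (sp c)", OF Gl _ inj]
    have rhs: "sp c absolutely_integrable_on hh ` G \<and> integral (hh ` G) (sp c) = integral E' (sp c)"
      unfolding img by (intro conjI refl int)
    show ?thesis by (rule iffD2[OF cov]) (erule der, rule rhs)
  qed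
  have "lint c (indicator (R \<inter> ctrace \<eta>)) = (\<integral>\<^sup>+t. ennreal (sp c t) * indicator E' t \<partial>lborel)"
    unfolding lint_def
  proof (rule nn_integral_cong_AE, use EE' AE_not_in[OF Ng(1)] in eventually_elim)
    case (elim t)
    show ?case
    proof (cases "t \<in> E")
      case True
      then have "0 \<le> t" "c t \<in> R \<inter> ctrace \<eta>" "t \<in> E'" using elim by (auto simp: E_def S_def)
      then show ?thesis by simp
    next
      case False
      have "t < 0 \<or> c t \<notin> R \<inter> ctrace \<eta> \<or> sp c t = 0"
      proof (rule ccontr)
        assume *: "\<not> (t < 0 \<or> c t \<notin> R \<inter> ctrace \<eta> \<or> sp c t = 0)"
        then have "c t \<in> ctrace c" by (auto simp: ctrace_def)
        then show False using * elim(2) False sp_nonneg[of c t] by (auto simp: E_def S_def)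
      qed
      moreover have "t \<notin> E'" using False by (simp add: E'_def)
      ultimately show ?thesis by auto
    qed
  qed
  also have "\<dots> = (\<integral>\<^sup>+t. ennreal (sp c t) * indicator E' t \<partial>lebesgue)" by (simp add: nn_integral_completion)
  also have "\<dots> = ennreal (integral E' (\<lambda>t. sp c t))"
    by (rule set_nn_integral_absolutely_integrable[OF int]) simp
  also have "\<dots> = (\<integral>\<^sup>+q. ennreal (\<bar>h' q\<bar> * sp c (hh q)) * indicator G q \<partial>lebesgue)"
    using set_nn_integral_absolutely_integrable[OF conjunct1[OF cv]] cv by simp
  also have "\<dots> \<le> (\<integral>\<^sup>+q. ennreal (sp \<eta> q) * indicator G q \<partial>lebesgue)"
  proof (rule nn_integral_mono)
    fix q
    have "\<bar>h' q\<bar> * sp c (hh q) \<le> sp \<eta> q" if "q \<in> G"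
    proof -
      have v: "Dg (hh q) \<noteq> 0" "sp c (hh q) = norm (Dg (hh q))" using Dg[OF hG(2)] that by (auto simp: G_def)
      have "\<bar>h' q\<bar> * sp c (hh q) = \<bar>Dh q \<bullet> Dg (hh q)\<bar> / norm (Dg (hh q))"
        using v by (simp add: h'_def power2_eq_square)
      also have "\<dots> \<le> norm (Dh q)"
        using v(1) Cauchy_Schwarz_ineq2[of "Dh q" "Dg (hh q)"] by (simp add: pos_divide_le_eq)
      finally show ?thesis using Dh(2)[OF that] by simp
    qed
    then show "ennreal (\<bar>h' q\<bar> * sp c (hh q)) * indicator G q \<le> ennreal (sp \<eta> q) * indicator G q"
      by (auto simp: indicator_def intro!: ennreal_leI)
  qed
  also have "\<dots> = (\<integral>\<^sup>+q. ennreal (sp \<eta> q) * indicator G q \<partial>lborel)" by (simp add: nn_integral_completion)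
  also have "\<dots> \<le> lint \<eta> (indicator (R \<inter> ctrace c))"
    unfolding lint_def
    by (intro nn_integral_mono) (auto simp: indicator_def G_def G0_def S_def)
  finally show ?thesis .
qed

text \<open>The version for sets says that one pushed-forward arc-length measure is bounded by the
  other; integrals of nonnegative functions then compare in the same way.\<close>

lemma lint_trace_le:
  fixes \<gamma> \<eta> :: "real \<Rightarrow> 'a::euclidean_space"
  assumes g: "\<gamma> \<in> Lip1 X" and s: "simple_curve \<gamma>" and fg: "fin \<gamma>" and h: "\<eta> \<in> Lip1 X"
    and f: "f \<in> borel_measurable borel"
  shows "lint \<gamma> (\<lambda>y. f y * indicator (ctrace \<eta>) y) \<le> lint \<eta> (\<lambda>y. f y * indicator (ctrace \<gamma>) y)"
proof -
  define M where "M c K = distr (density lborel (\<lambda>t. indicator K (c (max 0 t)) * ennreal (sp c (max 0 t)) * indicator {0..} t)) borel (\<lambda>t. c (max 0 t))"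
    for c :: "real \<Rightarrow> 'a" and K
  have M: "nn_integral (M c K) u = lint c (\<lambda>y. u y * indicator K y)"
    if c: "c \<in> Lip1 X" and K[measurable]: "K \<in> sets borel" and u[measurable]: "u \<in> borel_measurable borel" for c K u
  proof -
    note [measurable] = measurable_Lip1_max[OF c] measurable_sp_fixed[OF c]
    have "nn_integral (M c K) u = (\<integral>\<^sup>+t. (indicator K (c (max 0 t)) * ennreal (sp c (max 0 t)) * indicator {0..} t) * u (c (max 0 t)) \<partial>lborel)"
      unfolding M_def by (simp add: nn_integral_distr nn_integral_density)
    also have "\<dots> = lint c (\<lambda>y. u y * indicator K y)"
      unfolding lint_alt by (intro nn_integral_cong) (auto simp: mult_ac)
    finally show ?thesis .
  qed
  note bg = borel_trace[OF g] and bh = borel_trace[OF h]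
  have em: "emeasure (M c K) A = lint c (indicator (A \<inter> K))"
    if "c \<in> Lip1 X" "K \<in> sets borel" "A \<in> sets borel" for c K A
  proof -
    have "emeasure (M c K) A = nn_integral (M c K) (indicator A)"
      using that by (intro nn_integral_indicator[symmetric]) (simp add: M_def)
    also have "\<dots> = lint c (\<lambda>y. indicator A y * indicator K y)" using that by (intro M) auto
    finally show ?thesis by (simp add: indicator_inter_arith[symmetric] lint_def)
  qed
  have "M \<gamma> (ctrace \<eta>) \<le> M \<eta> (ctrace \<gamma>)"
  proof (subst le_measure)
    show "sets (M \<gamma> (ctrace \<eta>)) = sets (M \<eta> (ctrace \<gamma>))" by (simp add: M_def)
    show "\<forall>A\<in>sets (M \<gamma> (ctrace \<eta>)). emeasure (M \<gamma> (ctrace \<eta>)) A \<le> emeasure (M \<eta> (ctrace \<gamma>)) A"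
    proof
      fix A assume "A \<in> sets (M \<gamma> (ctrace \<eta>))"
      then have A: "A \<in> sets borel" by (simp add: M_def)
      show "emeasure (M \<gamma> (ctrace \<eta>)) A \<le> emeasure (M \<eta> (ctrace \<gamma>)) A"
        unfolding em[OF g bh A] em[OF h bg A] by (rule lint_trace_le_set[OF g s fg h A])
    qed
  qed
  then have "nn_integral (M \<gamma> (ctrace \<eta>)) f \<le> nn_integral (M \<eta> (ctrace \<gamma>)) f"
    by (intro nn_integral_mono_measure) (auto simp: M_def)
  then show ?thesis by (simp only: M[OF g bh f] M[OF h bg f])
qed

section \<open>Families of curves\<close>

text \<open>Expresses a visit by countably many evaluations. The common bound \<open>n\<close> on
  the times matters: the image of \<open>[0, n]\<close> is compact, so points approximated by it are
  visited.\<close>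

lemma ctrace_iff_approx:
  assumes g: "c \<in> Lip1 X"
  shows "y \<in> ctrace c \<longleftrightarrow> (\<exists>n::nat. \<forall>k::nat. \<exists>q. rat_time q \<le> real n \<and> dist (c (rat_time q)) y < 1 / real (Suc k))"
proof
  assume "y \<in> ctrace c"
  then obtain t where t: "0 \<le> t" "y = c t" by (auto simp: ctrace_def)
  obtain n :: nat where n: "t + 1 \<le> real n" using real_arch_simple by blast
  have "\<exists>q. rat_time q \<le> real n \<and> dist (c (rat_time q)) y < 1 / real (Suc k)" for k
  proof -
    obtain q where q: "t < rat_time q" "rat_time q < t + 1 / real (Suc k)"
      using rat_time_dense[OF t(1), of "t + 1 / real (Suc k)"] by auto
    have "1 / real (Suc k) \<le> 1" by simp
    then have "rat_time q \<le> real n" using q n by linarith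
    moreover have "dist (c (rat_time q)) y < 1 / real (Suc k)"
      unfolding t(2) using Lip1_dist[OF g rat_time_nonneg t(1), of q] q by linarith
    ultimately show ?thesis by blast
  qed
  then show "\<exists>n::nat. \<forall>k::nat. \<exists>q. rat_time q \<le> real n \<and> dist (c (rat_time q)) y < 1 / real (Suc k)" by blast
next
  assume "\<exists>n::nat. \<forall>k::nat. \<exists>q. rat_time q \<le> real n \<and> dist (c (rat_time q)) y < 1 / real (Suc k)"
  then obtain n :: nat where n: "\<And>k::nat. \<exists>q. rat_time q \<le> real n \<and> dist (c (rat_time q)) y < 1 / real (Suc k)" by blast
  have "closed (c ` {0..real n})"
    by (rule compact_imp_closed, rule compact_continuous_image)
      (auto intro: continuous_on_subset[OF Lip1_continuous_on[OF g]])
  moreover have "y \<in> closure (c ` {0..real n})"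
    unfolding closure_approachable
  proof (intro allI impI)
    fix e :: real assume "e > 0"
    then obtain k :: nat where k: "1 / real (Suc k) < e" using nat_approx_posE by blast
    obtain q where "rat_time q \<le> real n" "dist (c (rat_time q)) y < 1 / real (Suc k)" using n by blast
    then show "\<exists>z\<in>c ` {0..real n}. dist z y < e"
      using k by (intro bexI[of _ "c (rat_time q)"] image_eqI[of _ _ "rat_time q"]) auto
  qed
  ultimately have "y \<in> c ` {0..real n}" by (simp add: closure_closed)
  then show "y \<in> ctrace c" by (auto simp: ctrace_def)
qed

lemma measurable_ctrace_pred:
  assumes f: "f \<in> measurable N (Lip1_borel X)" and y[measurable]: "y \<in> borel_measurable N"
  shows "{w\<in>space N. y w \<in> ctrace (f w)} \<in> sets N"
proof -
  have [measurable]: "(\<lambda>w. f w (rat_time q)) \<in> borel_measurable N" for q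
    by (rule measurable_Lip1_eval_compose[OF f]) simp
  have m: "{w\<in>space N. dist (f w (rat_time q)) (y w) < 1 / real (Suc k)} \<in> sets N" for q k
    by measurable
  have "{w\<in>space N. y w \<in> ctrace (f w)} =
     {w\<in>space N. \<exists>n::nat. \<forall>k::nat. \<exists>q. rat_time q \<le> real n \<and> dist (f w (rat_time q)) (y w) < 1 / real (Suc k)}"
  proof (rule Collect_cong)
    fix w show "(w \<in> space N \<and> y w \<in> ctrace (f w)) \<longleftrightarrow> (w \<in> space N \<and>
        (\<exists>n::nat. \<forall>k::nat. \<exists>q. rat_time q \<le> real n \<and> dist (f w (rat_time q)) (y w) < 1 / real (Suc k)))"
      using ctrace_iff_approx[of "f w" X "y w"] measurable_space[OF f, of w] by (simp only: space_Lip1_borel) blast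
  qed
  also have "\<dots> \<in> sets N"
    by (intro sets.sets_Collect_countable_Ex sets.sets_Collect_countable_All sets.sets_Collect_conj
        sets.sets_Collect_const m)
  finally show ?thesis .
qed

lemma measurable_ctrace_indicator:
  assumes f: "f \<in> measurable N (Lip1_borel X)" and y: "y \<in> borel_measurable N"
  shows "(\<lambda>w. indicator (ctrace (f w)) (y w) :: ennreal) \<in> borel_measurable N"
proof -
  have "(\<lambda>w. indicator {w\<in>space N. y w \<in> ctrace (f w)} w :: ennreal) \<in> borel_measurable N"
    by (intro borel_measurable_indicator measurable_ctrace_pred[OF f y])
  then show ?thesis
    by (rule measurable_cong[THEN iffD1, rotated]) (simp add: indicator_def)
qed

lemma measurable_lint:
  fixes f :: "'b \<Rightarrow> real \<Rightarrow> 'a::euclidean_space"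
  assumes f: "f \<in> measurable N (Lip1_borel X)"
    and F: "(\<lambda>(w, y). F w y) \<in> borel_measurable (N \<Otimes>\<^sub>M borel)"
  shows "(\<lambda>w. lint (f w) (F w)) \<in> borel_measurable N"
proof -
  have f2: "(\<lambda>(w, t). f w) \<in> measurable (N \<Otimes>\<^sub>M lborel) (Lip1_borel X)"
    using f by (simp add: split_beta')
  have j: "(\<lambda>x. f (fst x) (max 0 (snd x))) \<in> borel_measurable (N \<Otimes>\<^sub>M lborel)"
    using measurable_Lip1_joint[OF f2, of "\<lambda>x. max 0 (snd x)"] by (simp add: split_beta')
  have s: "(\<lambda>x. sp (f (fst x)) (max 0 (snd x))) \<in> borel_measurable (N \<Otimes>\<^sub>M lborel)"
    using measurable_sp[OF f2, of "\<lambda>x. max 0 (snd x)"] by (simp add: split_beta')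
  have "(\<lambda>x. (fst x, f (fst x) (max 0 (snd x)))) \<in> measurable (N \<Otimes>\<^sub>M lborel) (N \<Otimes>\<^sub>M borel)"
    using j by (intro measurable_Pair measurable_fst)
  from measurable_compose[OF this F]
  have Fj: "(\<lambda>x. F (fst x) (f (fst x) (max 0 (snd x)))) \<in> borel_measurable (N \<Otimes>\<^sub>M lborel)" by simp
  have "(\<lambda>x. F (fst x) (f (fst x) (max 0 (snd x))) * ennreal (sp (f (fst x)) (max 0 (snd x))) * indicator {0..} (snd x))
      \<in> borel_measurable (N \<Otimes>\<^sub>M lborel)"
    using Fj s by measurable
  then show ?thesis unfolding lint_alt
    by (intro lborel.borel_measurable_nn_integral) (simp add: split_beta')
qed

lemma measurable_lint_fixed:
  assumes "f \<in> measurable N (Lip1_borel X)" and [measurable]: "F \<in> borel_measurable borel"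
  shows "(\<lambda>w. lint (f w) F) \<in> borel_measurable N"
  by (rule measurable_lint[OF assms(1)]) measurable

lemma lint_nn_integral_swap:
  fixes c :: "real \<Rightarrow> 'a::euclidean_space"
  assumes g: "c \<in> Lip1 X" and N: "sigma_finite_measure N"
    and H[measurable]: "(\<lambda>(y, \<eta>). H y \<eta>) \<in> borel_measurable (borel \<Otimes>\<^sub>M N)"
  shows "lint c (\<lambda>y. \<integral>\<^sup>+\<eta>. H y \<eta> \<partial>N) = (\<integral>\<^sup>+\<eta>. lint c (\<lambda>y. H y \<eta>) \<partial>N)"
proof -
  interpret N: sigma_finite_measure N by fact
  interpret pair_sigma_finite lborel N ..
  note [measurable] = measurable_Lip1_max[OF g] measurable_sp_fixed[OF g]
  have m1: "(\<lambda>x. (c (max 0 (fst x)), snd x)) \<in> measurable (lborel \<Otimes>\<^sub>M N) (borel \<Otimes>\<^sub>M N)"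
  proof (rule measurable_Pair)
    have "(\<lambda>t. c (max 0 t)) \<in> borel_measurable lborel" using measurable_Lip1_max[OF g] by simp
    from measurable_compose[OF measurable_fst this]
    show "(\<lambda>x. c (max 0 (fst x))) \<in> borel_measurable (lborel \<Otimes>\<^sub>M N)" .
  qed simp
  have [measurable]: "(\<lambda>x. H (c (max 0 (fst x))) (snd x)) \<in> borel_measurable (lborel \<Otimes>\<^sub>M N)"
    using measurable_compose[OF m1 H] by simp
  have [measurable]: "(\<lambda>x. sp c (max 0 (fst x))) \<in> borel_measurable (lborel \<Otimes>\<^sub>M N)" by measurable
  have sec: "(\<lambda>\<eta>. H y \<eta>) \<in> borel_measurable N" for y
    using measurable_compose[OF measurable_Pair1'[of y borel N] H] by simp
  have "lint c (\<lambda>y. \<integral>\<^sup>+\<eta>. H y \<eta> \<partial>N) =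
     (\<integral>\<^sup>+t. \<integral>\<^sup>+\<eta>. H (c (max 0 t)) \<eta> * (ennreal (sp c (max 0 t)) * indicator {0..} t) \<partial>N \<partial>lborel)"
    unfolding lint_alt by (intro nn_integral_cong) (simp add: nn_integral_multc sec mult.assoc)
  also have "\<dots> = (\<integral>\<^sup>+\<eta>. \<integral>\<^sup>+t. H (c (max 0 t)) \<eta> * (ennreal (sp c (max 0 t)) * indicator {0..} t) \<partial>lborel \<partial>N)"
    by (rule Fubini'[symmetric]) (simp add: split_beta')
  also have "\<dots> = (\<integral>\<^sup>+\<eta>. lint c (\<lambda>y. H y \<eta>) \<partial>N)"
    unfolding lint_alt by (simp add: mult.assoc)
  finally show ?thesis .
qed

text \<open>The multiplicity of a family of curves indexed by a measure space. Competitors are built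
  as such families, over \<open>P\<close> or over \<open>P\<close> times a coin, before they become
  measures on curves.\<close>

definition mass :: "'b measure \<Rightarrow> ('b \<Rightarrow> real \<Rightarrow> 'a::euclidean_space) \<Rightarrow> 'a \<Rightarrow> ennreal" where
  "mass M c y = (\<integral>\<^sup>+w. indicator (ctrace (c w)) y \<partial>M)"

lemma mass_eq_emeasure:
  assumes c: "c \<in> measurable M (Lip1_borel X)"
  shows "mass M c y = emeasure M {w\<in>space M. y \<in> ctrace (c w)}"
proof -
  have "mass M c y = (\<integral>\<^sup>+w. indicator {w\<in>space M. y \<in> ctrace (c w)} w \<partial>M)"
    unfolding mass_def by (intro nn_integral_cong) (auto simp: indicator_def)
  then show ?thesis using measurable_ctrace_pred[OF c, of "\<lambda>_. y"] by simp
qed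

lemma ctrace_indicator_pair:
  assumes c: "c \<in> measurable M (Lip1_borel X)"
  shows "(\<lambda>(y, w). indicator (ctrace (c w)) y :: ennreal) \<in> borel_measurable (borel \<Otimes>\<^sub>M M)"
    and "(\<lambda>(w, y). indicator (ctrace (c w)) y :: ennreal) \<in> borel_measurable (M \<Otimes>\<^sub>M borel)"
  unfolding split_beta'
  using measurable_ctrace_indicator[OF measurable_compose[OF measurable_snd c] measurable_fst[of borel M]]
    measurable_ctrace_indicator[OF measurable_compose[OF measurable_fst c] measurable_snd[of M borel]] by auto

lemma measurable_mass [measurable]:
  assumes c: "c \<in> measurable M (Lip1_borel X)" and M: "sigma_finite_measure M"
  shows "mass M c \<in> borel_measurable borel"
  unfolding mass_def
  by (intro sigma_finite_measure.borel_measurable_nn_integral[OF M] ctrace_indicator_pair[OF c])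

text \<open>Double counting: the mass of the second family is opened as an integral, the two-curve
  inequality is applied to each pair, and Fubini collects the indicators of the first family.
  Simplicity enters for the curves whose arc length is on the left.\<close>

lemma lint_mass_le:
  fixes c :: "'b \<Rightarrow> real \<Rightarrow> 'a::euclidean_space" and c' :: "'c \<Rightarrow> real \<Rightarrow> 'a"
  assumes M: "sigma_finite_measure M" and N: "sigma_finite_measure N"
    and c: "c \<in> measurable M (Lip1_borel X)" and c': "c' \<in> measurable N (Lip1_borel X)"
    and s: "AE \<omega> in M. simple_curve (c \<omega>) \<and> fin (c \<omega>)"
    and F: "(\<lambda>(\<omega>, y). F \<omega> y) \<in> borel_measurable (M \<Otimes>\<^sub>M borel)"
  shows "(\<integral>\<^sup>+\<omega>. lint (c \<omega>) (\<lambda>y. F \<omega> y * mass N c' y) \<partial>M) \<le>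
     (\<integral>\<^sup>+\<eta>. lint (c' \<eta>) (\<lambda>y. \<integral>\<^sup>+\<omega>. F \<omega> y * indicator (ctrace (c \<omega>)) y \<partial>M) \<partial>N)"
proof -
  interpret M: sigma_finite_measure M by fact
  interpret N: sigma_finite_measure N by fact
  interpret pair_sigma_finite M N ..
  note ip = ctrace_indicator_pair[OF c] ctrace_indicator_pair[OF c']
  have Fs: "(\<lambda>y. F \<omega> y) \<in> borel_measurable borel" if "\<omega> \<in> space M" for \<omega>
    using measurable_compose[OF measurable_Pair1'[OF that] F] by simp
  have is': "(\<lambda>\<eta>. indicator (ctrace (c' \<eta>)) y :: ennreal) \<in> borel_measurable N" for y
    by (rule measurable_ctrace_indicator[OF c']) simp
  have "(\<integral>\<^sup>+\<omega>. lint (c \<omega>) (\<lambda>y. F \<omega> y * mass N c' y) \<partial>M) =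
      (\<integral>\<^sup>+\<omega>. \<integral>\<^sup>+\<eta>. lint (c \<omega>) (\<lambda>y. F \<omega> y * indicator (ctrace (c' \<eta>)) y) \<partial>N \<partial>M)"
  proof (rule nn_integral_cong)
    fix \<omega> assume w: "\<omega> \<in> space M"
    have "(\<lambda>(y, \<eta>). F \<omega> y * indicator (ctrace (c' \<eta>)) y) \<in> borel_measurable (borel \<Otimes>\<^sub>M N)"
      using ip(3) measurable_compose[OF measurable_fst Fs[OF w], of N] unfolding split_beta'
      by (intro borel_measurable_times_ennreal)
    from lint_nn_integral_swap[OF measurable_space[OF c w, simplified] N this]
    show "lint (c \<omega>) (\<lambda>y. F \<omega> y * mass N c' y) = (\<integral>\<^sup>+\<eta>. lint (c \<omega>) (\<lambda>y. F \<omega> y * indicator (ctrace (c' \<eta>)) y) \<partial>N)"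
      unfolding mass_def by (simp add: nn_integral_cmult is')
  qed
  also have "\<dots> \<le> (\<integral>\<^sup>+\<omega>. \<integral>\<^sup>+\<eta>. lint (c' \<eta>) (\<lambda>y. F \<omega> y * indicator (ctrace (c \<omega>)) y) \<partial>N \<partial>M)"
  proof (rule nn_integral_mono_AE, use s AE_space in eventually_elim)
    case (elim \<omega>)
    show ?case
    proof (rule nn_integral_mono)
      fix \<eta> assume "\<eta> \<in> space N"
      then show "lint (c \<omega>) (\<lambda>y. F \<omega> y * indicator (ctrace (c' \<eta>)) y) \<le> lint (c' \<eta>) (\<lambda>y. F \<omega> y * indicator (ctrace (c \<omega>)) y)"
        using elim measurable_space[OF c elim(2)] measurable_space[OF c'] Fs by (intro lint_trace_le[of _ X]) auto
    qed
  qed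
  also have "\<dots> = (\<integral>\<^sup>+\<eta>. \<integral>\<^sup>+\<omega>. lint (c' \<eta>) (\<lambda>y. F \<omega> y * indicator (ctrace (c \<omega>)) y) \<partial>M \<partial>N)"
  proof (rule Fubini'[symmetric])
    have m3: "(\<lambda>x. (fst (fst x), snd x)) \<in> measurable ((M \<Otimes>\<^sub>M N) \<Otimes>\<^sub>M borel) (M \<Otimes>\<^sub>M borel)"
      by measurable
    have a: "(\<lambda>x. F (fst (fst x)) (snd x)) \<in> borel_measurable ((M \<Otimes>\<^sub>M N) \<Otimes>\<^sub>M borel)"
      using measurable_compose[OF m3 F] by simp
    have b: "(\<lambda>x. indicator (ctrace (c (fst (fst x)))) (snd x) :: ennreal) \<in> borel_measurable ((M \<Otimes>\<^sub>M N) \<Otimes>\<^sub>M borel)"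
      using measurable_compose[OF m3 ip(2)] by simp
    have c2: "(\<lambda>x. c' (snd x)) \<in> measurable (M \<Otimes>\<^sub>M N) (Lip1_borel X)"
      by (rule measurable_compose[OF measurable_snd c'])
    have ab: "(\<lambda>(x, y). F (fst x) y * indicator (ctrace (c (fst x))) y) \<in> borel_measurable ((M \<Otimes>\<^sub>M N) \<Otimes>\<^sub>M borel)"
      using a b unfolding split_beta' by (intro borel_measurable_times_ennreal)
    show "(\<lambda>(\<omega>, \<eta>). lint (c' \<eta>) (\<lambda>y. F \<omega> y * indicator (ctrace (c \<omega>)) y)) \<in> borel_measurable (M \<Otimes>\<^sub>M N)"
      unfolding split_beta' by (rule measurable_lint[OF c2 ab])
  qed
  also have "\<dots> = (\<integral>\<^sup>+\<eta>. lint (c' \<eta>) (\<lambda>y. \<integral>\<^sup>+\<omega>. F \<omega> y * indicator (ctrace (c \<omega>)) y \<partial>M) \<partial>N)"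
  proof (rule nn_integral_cong)
    fix \<eta> assume e: "\<eta> \<in> space N"
    have sw: "(\<lambda>x. (snd x, fst x)) \<in> measurable (borel \<Otimes>\<^sub>M M) (M \<Otimes>\<^sub>M (borel :: 'a measure))" by measurable
    have "(\<lambda>(y, \<omega>). F \<omega> y * indicator (ctrace (c \<omega>)) y) \<in> borel_measurable (borel \<Otimes>\<^sub>M M)"
      using ip(1) measurable_compose[OF sw F] unfolding split_beta' fst_conv snd_conv
      by (intro borel_measurable_times_ennreal)
    from lint_nn_integral_swap[OF measurable_space[OF c' e, simplified] M this]
    show "(\<integral>\<^sup>+\<omega>. lint (c' \<eta>) (\<lambda>y. F \<omega> y * indicator (ctrace (c \<omega>)) y) \<partial>M) =
      lint (c' \<eta>) (\<lambda>y. \<integral>\<^sup>+\<omega>. F \<omega> y * indicator (ctrace (c \<omega>)) y \<partial>M)" by simp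
  qed
  finally show ?thesis .
qed

lemma lint_mass_le_fixed:
  fixes c :: "'b \<Rightarrow> real \<Rightarrow> 'a::euclidean_space" and c' :: "'c \<Rightarrow> real \<Rightarrow> 'a"
  assumes M: "sigma_finite_measure M" and N: "sigma_finite_measure N"
    and c: "c \<in> measurable M (Lip1_borel X)" and c': "c' \<in> measurable N (Lip1_borel X)"
    and s: "AE w in M. simple_curve (c w) \<and> fin (c w)"
    and F[measurable]: "F \<in> borel_measurable borel"
  shows "(\<integral>\<^sup>+w. lint (c w) (\<lambda>y. F y * mass N c' y) \<partial>M) \<le> (\<integral>\<^sup>+\<eta>. lint (c' \<eta>) (\<lambda>y. F y * mass M c y) \<partial>N)"
proof -
  have "(\<lambda>(w, y). F y) \<in> borel_measurable (M \<Otimes>\<^sub>M borel)" by measurable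
  from lint_mass_le[OF M N c c' s this]
  show ?thesis unfolding mass_def[of M c]
    by (simp add: nn_integral_cmult measurable_ctrace_indicator[OF c])
qed

section \<open>Plans\<close>

locale curve_plan = finite_measure P for X :: "'a::euclidean_space set" and P :: "(real \<Rightarrow> 'a) measure" +
  assumes X: "compact X" and sets_P: "sets P = sets (Lip1_borel X)"
begin

lemma space_P: "space P = Lip1 X"
  using sets_eq_imp_space_eq[OF sets_P] by simp

lemma id_P: "(\<lambda>c. c) \<in> measurable P (Lip1_borel X)"
  by (rule measurable_ident_sets[OF sets_P])

lemma measurable_P_iff: "measurable P N = measurable (Lip1_borel X) N"
  by (rule measurable_cong_sets[OF sets_P refl])

definition th :: "'a \<Rightarrow> real" where "th = multiplicity_at P"

lemma th_nonneg [simp]: "0 \<le> th y" by (simp add: th_def multiplicity_at_def)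

lemma hit_eq: "{c \<in> space P. \<exists>t\<ge>0. c t = y} = {c \<in> space P. y \<in> ctrace c}"
  by (auto simp: ctrace_def)

lemma sets_hit: "{c \<in> space P. y \<in> ctrace c} \<in> sets P"
  by (rule measurable_ctrace_pred[OF id_P]) simp

lemma th_eq: "th y = measure P {c \<in> space P. y \<in> ctrace c}"
  unfolding th_def multiplicity_at_def hit_eq ..

lemma ennreal_th: "ennreal (th y) = mass P (\<lambda>c. c) y"
  unfolding th_eq mass_eq_emeasure[OF id_P] by (simp add: emeasure_eq_measure)

lemma th_le: "th y \<le> measure P (space P)"
  unfolding th_eq by (rule bounded_measure)

lemma measurable_th [measurable]: "th \<in> borel_measurable borel"
proof -
  have "(\<lambda>y. enn2real (mass P (\<lambda>c. c) y)) \<in> borel_measurable borel"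
    using measurable_mass[OF id_P] sigma_finite_measure_axioms by measurable
  moreover have "(\<lambda>y. enn2real (mass P (\<lambda>c. c) y)) = th"
    by (rule ext) (simp add: ennreal_th[symmetric])
  ultimately show ?thesis by simp
qed

lemma measurable_weight [measurable]: "(\<lambda>m. weight \<alpha> m) \<in> borel_measurable borel"
  unfolding weight_def by measurable

lemma energy_eq: "energy \<alpha> P = (\<integral>\<^sup>+c. lint c (\<lambda>y. weight \<alpha> (th y)) \<partial>P)"
  unfolding energy_def
proof (rule nn_integral_cong)
  fix c assume "c \<in> space P"
  then have "c \<in> Lip1 X" by (simp add: space_P)
  from Lip1_AE_speed[OF this]
  show "(\<integral>\<^sup>+t\<in>{0..}. weight \<alpha> (multiplicity_at P (c t)) * ennreal (speed c t) \<partial>lborel) = lint c (\<lambda>y. weight \<alpha> (th y))"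
    unfolding lint_def th_def
    by (intro nn_integral_cong_AE) (auto elim!: eventually_mono simp: indicator_def)
qed

text \<open>The weight is infinite where the multiplicity vanishes, so finite energy forbids moving
  there.\<close>

lemma AE_moving_pos:
  assumes "energy \<alpha> P < \<infinity>"
  shows "AE c in P. AE t in lborel. 0 \<le> t \<longrightarrow> 0 < sp c t \<longrightarrow> 0 < th (c t)"
    and "AE c in P. lint c (\<lambda>y. weight \<alpha> (th y)) < \<infinity>"
proof -
  have m: "(\<lambda>c. lint c (\<lambda>y. weight \<alpha> (th y))) \<in> borel_measurable P"
    by (rule measurable_lint_fixed[OF id_P]) measurable
  have "AE c in P. lint c (\<lambda>y. weight \<alpha> (th y)) \<noteq> \<infinity>"
    by (rule nn_integral_PInf_AE[OF m]) (use assms in \<open>simp add: energy_eq less_top[symmetric]\<close>)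
  then show fi: "AE c in P. lint c (\<lambda>y. weight \<alpha> (th y)) < \<infinity>"
    by eventually_elim (simp add: less_top[symmetric])
  show "AE c in P. AE t in lborel. 0 \<le> t \<longrightarrow> 0 < sp c t \<longrightarrow> 0 < th (c t)"
    using fi AE_space
  proof eventually_elim
    case (elim c)
    then have g: "c \<in> Lip1 X" by (simp add: space_P)
    have "AE t in lborel. weight \<alpha> (th (c t)) * ennreal (sp c t) * indicator {0..} t \<noteq> \<infinity>"
    proof (rule nn_integral_PInf_AE)
      show "(\<lambda>t. weight \<alpha> (th (c t)) * ennreal (sp c t) * indicator {0..} t) \<in> borel_measurable lborel"
        by (rule measurable_line_integrand[OF g]) auto
    qed (use elim in \<open>simp add: lint_def\<close>)
    then show ?case
    proof eventually_elim
      case (elim t)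
      show ?case
      proof (intro impI)
        assume t: "0 \<le> t" "0 < sp c t"
        show "0 < th (c t)"
        proof (rule ccontr)
          assume "\<not> 0 < th (c t)"
          then have "th (c t) = 0" using th_nonneg[of "c t"] by linarith
          then show False using elim t by (simp add: weight_def ennreal_top_mult)
        qed
      qed
    qed
  qed
qed

text \<open>The exceptional set of curves in \<open>null\<close> depends on \<open>y\<close>, and
  uncountably many \<open>y\<close> occur. The exchange inequality bounds the integral of
  \<open>indicator V (c, y)\<close> times the multiplicity, taken along the curves, by an integral
  whose inner part vanishes for each \<open>y\<close>. By \<open>pos\<close> the factor given by the
  multiplicity can then be dropped.\<close>

lemma AE_swap:
  assumes s: "AE c in P. simple_curve c \<and> fin c"
    and pos: "AE c in P. AE t in lborel. 0 \<le> t \<longrightarrow> 0 < sp c t \<longrightarrow> 0 < th (c t)"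
    and V: "V \<in> sets (P \<Otimes>\<^sub>M borel)"
    and null: "\<And>y. AE c in P. y \<in> ctrace c \<longrightarrow> (c, y) \<notin> V"
  shows "AE c in P. AE t in lborel. 0 \<le> t \<longrightarrow> 0 < sp c t \<longrightarrow> (c, c t) \<notin> V"
proof -
  have Vm: "(\<lambda>(c, y). indicator V (c, y) :: ennreal) \<in> borel_measurable (P \<Otimes>\<^sub>M borel)"
    using V by simp
  have Vs: "(\<lambda>y. indicator V (c, y) :: ennreal) \<in> borel_measurable borel" if "c \<in> space P" for c
    using measurable_compose[OF measurable_Pair1'[OF that] Vm] by simp
  have mm: "mass P (\<lambda>c. c) \<in> borel_measurable borel"
    by (rule measurable_mass[OF id_P]) (rule sigma_finite_measure_axioms)
  have "(\<integral>\<^sup>+c. lint c (\<lambda>y. indicator V (c, y) * mass P (\<lambda>c. c) y) \<partial>P) \<le>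
     (\<integral>\<^sup>+\<eta>. lint \<eta> (\<lambda>y. \<integral>\<^sup>+c. indicator V (c, y) * indicator (ctrace c) y \<partial>P) \<partial>P)"
    by (rule lint_mass_le[OF sigma_finite_measure_axioms sigma_finite_measure_axioms id_P id_P s Vm])
  also have "\<dots> = (\<integral>\<^sup>+\<eta>. lint \<eta> (\<lambda>y. 0) \<partial>P)"
  proof -
    have "(\<integral>\<^sup>+c. indicator V (c, y) * indicator (ctrace c) y \<partial>P) = 0" for y
    proof -
      have "(\<integral>\<^sup>+c. indicator V (c, y) * indicator (ctrace c) y \<partial>P) = (\<integral>\<^sup>+c. 0 \<partial>P)"
        by (rule nn_integral_cong_AE, use null[of y] in eventually_elim) (auto simp: indicator_def)
      then show ?thesis by simp
    qed
    then show ?thesis by simp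
  qed
  also have "\<dots> = 0" by (simp add: lint_def)
  finally have z: "(\<integral>\<^sup>+c. lint c (\<lambda>y. indicator V (c, y) * mass P (\<lambda>c. c) y) \<partial>P) = 0" by simp
  have "(\<lambda>(c, y). indicator V (c, y) * mass P (\<lambda>c. c) y) \<in> borel_measurable (P \<Otimes>\<^sub>M borel)"
    using Vm mm by (simp add: split_beta')
  from measurable_lint[OF id_P this] z
  have "AE c in P. lint c (\<lambda>y. indicator V (c, y) * mass P (\<lambda>c. c) y) = 0"
    by (simp add: nn_integral_0_iff_AE)
  then show ?thesis using pos AE_space
  proof eventually_elim
    case (elim c)
    then have g: "c \<in> Lip1 X" by (simp add: space_P)
    have "(\<lambda>y. indicator V (c, y) * mass P (\<lambda>c. c) y) \<in> borel_measurable borel"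
      using Vs[OF elim(3)] mm by simp
    from elim(1)[unfolded lint_eq_0_iff[OF g this]] elim(2)
    show ?case by eventually_elim (auto simp: indicator_def ennreal_th[symmetric] split: if_splits)
  qed
qed

end

section \<open>Loop erasure\<close>

text \<open>\<open>g 0\<close> is minimized, then \<open>g 1\<close> among the minimizers, and so
  on; compactness leaves a point in the intersection. The minimal values are measurable because
  hitting a given compact set remains a measurable event for each of the successive sets of
  minimizers \<open>MM n\<close>.\<close>

lemma lexicographic_selection:
  fixes M :: "'w \<Rightarrow> 'z::metric_space set" and g :: "nat \<Rightarrow> 'z \<Rightarrow> real"
  assumes g: "\<And>n. continuous_on UNIV (g n)" and C: "compact C"
    and M: "\<And>\<omega>. \<omega> \<in> space N \<Longrightarrow> M \<omega> \<noteq> {} \<and> compact (M \<omega>) \<and> M \<omega> \<subseteq> C"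
    and meas: "\<And>K. compact K \<Longrightarrow> {\<omega>\<in>space N. M \<omega> \<inter> K \<noteq> {}} \<in> sets N"
  shows "\<exists>s. (\<forall>\<omega>\<in>space N. s \<omega> \<in> M \<omega> \<and> (\<forall>z\<in>M \<omega>. g 0 (s \<omega>) \<le> g 0 z)) \<and> (\<forall>n. (\<lambda>\<omega>. g n (s \<omega>)) \<in> borel_measurable N)"
proof -
  define MM where "MM = rec_nat M (\<lambda>n A \<omega>. {z\<in>A \<omega>. g n z = Inf (g n ` A \<omega>)})"
  have MM0: "MM 0 = M" and MMS: "MM (Suc n) = (\<lambda>\<omega>. {z\<in>MM n \<omega>. g n z = Inf (g n ` MM n \<omega>)})" for n
    by (simp_all add: MM_def)
  define v where "v n \<omega> = Inf (g n ` MM n \<omega>)" for n \<omega>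
  have att: "\<exists>z\<in>A. g n z = Inf (g n ` A) \<and> (\<forall>y\<in>A. g n z \<le> g n y)" if A: "compact A" "A \<noteq> {}" for A n
  proof -
    obtain z where z: "z \<in> A" "\<And>y. y \<in> A \<Longrightarrow> g n z \<le> g n y"
      using continuous_attains_inf[OF A continuous_on_subset[OF g[of n]]] by blast
    have "Inf (g n ` A) = g n z" by (rule cInf_eq_minimum) (use z in auto)
    then show ?thesis using z by auto
  qed
  have cl: "compact (A \<inter> {z. g n z \<le> c})" if "compact A" for A n c
    using that by (intro compact_Int_closed closed_Collect_le g continuous_on_const)
  have inv: "(\<forall>\<omega>\<in>space N. MM n \<omega> \<noteq> {} \<and> compact (MM n \<omega>) \<and> MM n \<omega> \<subseteq> C) \<and>
      (\<forall>K. compact K \<longrightarrow> {\<omega>\<in>space N. MM n \<omega> \<inter> K \<noteq> {}} \<in> sets N)" (is "?A n \<and> ?B n") for n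
  proof (induction n)
    case 0 then show ?case using M meas by (simp add: MM0)
  next
    case (Suc n)
    have A: "MM n \<omega> \<noteq> {}" "compact (MM n \<omega>)" "MM n \<omega> \<subseteq> C" if "\<omega> \<in> space N" for \<omega> using Suc that by auto
    have B: "{\<omega>\<in>space N. MM n \<omega> \<inter> K \<noteq> {}} \<in> sets N" if "compact K" for K using Suc that by auto
    have eq: "MM (Suc n) \<omega> = MM n \<omega> \<inter> {z. g n z \<le> v n \<omega>}" if w: "\<omega> \<in> space N" for \<omega>
    proof -
      have "v n \<omega> \<le> g n z" if "z \<in> MM n \<omega>" for z
        using att[OF A(2,1)[OF w], of n] that by (auto simp: v_def)
      then show ?thesis by (force simp: MMS v_def)
    qed
    have vm: "v n \<in> borel_measurable N"
    proof (rule borel_measurable_iff_le[THEN iffD2, rule_format])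
      fix c
      have "{\<omega>\<in>space N. v n \<omega> \<le> c} = {\<omega>\<in>space N. MM n \<omega> \<inter> (C \<inter> {z. g n z \<le> c}) \<noteq> {}}"
      proof (intro Collect_cong conj_cong refl)
        fix \<omega> assume w: "\<omega> \<in> space N"
        show "(v n \<omega> \<le> c) = (MM n \<omega> \<inter> (C \<inter> {z. g n z \<le> c}) \<noteq> {})"
          using att[OF A(2,1)[OF w], of n] A(3)[OF w] unfolding v_def by force
      qed
      then show "{\<omega>\<in>space N. v n \<omega> \<le> c} \<in> sets N" using B[OF cl[OF C]] by simp
    qed
    have "?A (Suc n)"
    proof (intro ballI conjI)
      fix \<omega> assume w: "\<omega> \<in> space N"
      show "MM (Suc n) \<omega> \<noteq> {}" using att[OF A(2,1)[OF w], of n] by (auto simp: MMS)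
      show "compact (MM (Suc n) \<omega>)" unfolding eq[OF w] by (rule cl[OF A(2)[OF w]])
      show "MM (Suc n) \<omega> \<subseteq> C" using A(3)[OF w] by (auto simp: MMS)
    qed
    moreover have "?B (Suc n)"
    proof (intro allI impI)
      fix K :: "'z set" assume K: "compact K"
      \<comment> \<open>By compactness the minimum \<open>v n \<omega>\<close> is attained in
        \<open>K\<close> as soon as values in \<open>K\<close> come arbitrarily close to it.
        Rational thresholds make this a combination of countably many events known to be
        measurable.\<close>
      have "{\<omega>\<in>space N. MM (Suc n) \<omega> \<inter> K \<noteq> {}} =
        {\<omega>\<in>space N. \<forall>k::nat. \<exists>r::rat. of_rat r < v n \<omega> + 1 / real (Suc k) \<and> MM n \<omega> \<inter> (K \<inter> {z. g n z \<le> of_rat r}) \<noteq> {}}"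
      proof (intro Collect_cong conj_cong refl iffI allI)
        fix \<omega> and k :: nat assume w: "\<omega> \<in> space N" and ne: "MM (Suc n) \<omega> \<inter> K \<noteq> {}"
        then obtain z where z: "z \<in> MM n \<omega>" "z \<in> K" "g n z \<le> v n \<omega>" using eq[OF w] by auto
        obtain r where "v n \<omega> < of_rat r" "of_rat r < v n \<omega> + 1 / real (Suc k)"
          using of_rat_dense[of "v n \<omega>" "v n \<omega> + 1 / real (Suc k)"] by auto
        then show "\<exists>r::rat. of_rat r < v n \<omega> + 1 / real (Suc k) \<and> MM n \<omega> \<inter> (K \<inter> {z. g n z \<le> of_rat r}) \<noteq> {}"
          using z by (intro exI[of _ r]) auto
      next
        fix \<omega> assume w: "\<omega> \<in> space N" and *: "\<forall>k::nat. \<exists>r::rat. of_rat r < v n \<omega> + 1 / real (Suc k) \<and> MM n \<omega> \<inter> (K \<inter> {z. g n z \<le> of_rat r}) \<noteq> {}"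
        have ex: "\<exists>z\<in>MM n \<omega> \<inter> K. g n z < v n \<omega> + 1 / real (Suc k)" for k
        proof -
          obtain r z where "of_rat r < v n \<omega> + 1 / real (Suc k)" "z \<in> MM n \<omega> \<inter> K" "g n z \<le> of_rat r"
            using *[rule_format, of k] by blast
          then show ?thesis by (intro bexI[of _ z]) auto
        qed
        have ne: "MM n \<omega> \<inter> K \<noteq> {}" using ex[of 0] by blast
        obtain z where z: "z \<in> MM n \<omega> \<inter> K" "\<forall>y\<in>MM n \<omega> \<inter> K. g n z \<le> g n y"
          using att[OF compact_Int[OF A(2)[OF w] K] ne, of n] by blast
        have "g n z \<le> v n \<omega> + e" if e0: "e > 0" for e
        proof -
          obtain k :: nat where k: "1 / real (Suc k) < e" using nat_approx_posE[OF e0] by blast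
          obtain y where y: "y \<in> MM n \<omega> \<inter> K" "g n y < v n \<omega> + 1 / real (Suc k)" using ex by blast
          have "g n z \<le> g n y" using z(2) y(1) by blast
          then show ?thesis using y(2) k by linarith
        qed
        then have "g n z \<le> v n \<omega>" by (rule field_le_epsilon)
        then show "MM (Suc n) \<omega> \<inter> K \<noteq> {}" using z(1) eq[OF w] by auto
      qed
      also have "\<dots> \<in> sets N"
      proof (intro sets.sets_Collect_countable_All sets.sets_Collect_countable_Ex sets.sets_Collect_conj)
        fix k :: nat and r :: rat
        show "{\<omega>\<in>space N. of_rat r < v n \<omega> + 1 / real (Suc k)} \<in> sets N" using vm by measurable
        show "{\<omega>\<in>space N. MM n \<omega> \<inter> (K \<inter> {z. g n z \<le> of_rat r}) \<noteq> {}} \<in> sets N" by (rule B[OF cl[OF K]])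
      qed
      finally show "{\<omega>\<in>space N. MM (Suc n) \<omega> \<inter> K \<noteq> {}} \<in> sets N" .
    qed
    ultimately show ?case ..
  qed
  have dec: "MM m \<omega> \<subseteq> MM n \<omega>" if "n \<le> m" for n m \<omega>
    using that by (induction rule: dec_induct) (auto simp: MMS)
  have ex: "\<exists>z. \<forall>n. z \<in> MM n \<omega>" if w: "\<omega> \<in> space N" for \<omega>
  proof -
    have "\<forall>n. \<exists>z. z \<in> MM n \<omega>" using inv w by blast
    then obtain z where z: "\<And>n. z n \<in> MM n \<omega>" by metis
    have "seq_compact (MM 0 \<omega>)" using inv[of 0] w by (simp add: compact_eq_seq_compact_metric)
    moreover have "\<forall>n. z n \<in> MM 0 \<omega>" using z dec[of 0] by blast
    ultimately obtain l r where lr: "strict_mono (r :: nat \<Rightarrow> nat)" "(z \<circ> r) \<longlonglongrightarrow> l"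
      by (rule seq_compactE) blast
    have "l \<in> MM n \<omega>" for n
    proof (rule closed_sequentially[of _ "\<lambda>k. z (r (k + n))"])
      show "closed (MM n \<omega>)" using inv[of n] w by (auto intro: compact_imp_closed)
      show "z (r (k + n)) \<in> MM n \<omega>" for k
        using z[of "r (k + n)"] dec[of n "r (k + n)"] seq_suble[OF lr(1), of "k + n"] by force
      show "(\<lambda>k. z (r (k + n))) \<longlonglongrightarrow> l"
        using LIMSEQ_ignore_initial_segment[OF lr(2), of n] by (simp add: o_def)
    qed
    then show ?thesis by blast
  qed
  define s where "s \<omega> = (SOME z. \<forall>n. z \<in> MM n \<omega>)" for \<omega>
  have s: "s \<omega> \<in> MM n \<omega>" if "\<omega> \<in> space N" for \<omega> n
    using someI_ex[OF ex[OF that]] by (simp add: s_def)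
  have gv: "g n (s \<omega>) = v n \<omega>" if "\<omega> \<in> space N" for \<omega> n
    using s[OF that, of "Suc n"] by (simp add: MMS v_def)
  have "(\<lambda>\<omega>. g n (s \<omega>)) \<in> borel_measurable N" for n
  proof -
    have "v n \<in> borel_measurable N"
    proof (rule borel_measurable_iff_le[THEN iffD2, rule_format])
      fix c
      have "{\<omega>\<in>space N. v n \<omega> \<le> c} = {\<omega>\<in>space N. MM n \<omega> \<inter> (C \<inter> {z. g n z \<le> c}) \<noteq> {}}"
      proof (intro Collect_cong conj_cong refl)
        fix \<omega> assume w: "\<omega> \<in> space N"
        have A: "MM n \<omega> \<noteq> {}" "compact (MM n \<omega>)" "MM n \<omega> \<subseteq> C" using inv w by auto
        show "(v n \<omega> \<le> c) = (MM n \<omega> \<inter> (C \<inter> {z. g n z \<le> c}) \<noteq> {})"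
          using att[OF A(2,1), of n] A(3) unfolding v_def by force
      qed
      then show "{\<omega>\<in>space N. v n \<omega> \<le> c} \<in> sets N" using inv[of n] cl[OF C] by simp
    qed
    then show ?thesis by (rule measurable_cong[THEN iffD1, rotated]) (simp add: gv)
  qed
  moreover have "s \<omega> \<in> M \<omega> \<and> (\<forall>z\<in>M \<omega>. g 0 (s \<omega>) \<le> g 0 z)" if w: "\<omega> \<in> space N" for \<omega>
  proof -
    have A: "M \<omega> \<noteq> {}" "compact (M \<omega>)" using M[OF w] by auto
    have "v 0 \<omega> \<le> g 0 z" if "z \<in> M \<omega>" for z
      using att[OF A(2,1), of 0] that by (auto simp: v_def MM0)
    then show ?thesis using s[OF w, of 0] gv[OF w, of 0] by (simp add: MM0)
  qed
  ultimately show ?thesis by blast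
qed

text \<open>The admissible pairs of the problem whose minimizer is the loop-erased curve. The
  arrival time \<open>\<tau>\<close> is minimized instead of the length: it passes to the limit
  together with \<open>\<eta>\<close>, and for 1-Lipschitz curves least time yields least length.
  The horizon \<open>N\<close> bounds \<open>\<tau>\<close>, which makes the admissible pairs
  compact.\<close>

definition shortcut :: "'a::euclidean_space set \<Rightarrow> nat \<Rightarrow> (real \<Rightarrow> 'a) \<Rightarrow> real \<Rightarrow> (real \<Rightarrow> 'a) \<Rightarrow> bool" where
  "shortcut X N c \<tau> \<eta> \<longleftrightarrow> 0 \<le> \<tau> \<and> \<tau> \<le> real N \<and> \<eta> \<in> Lip1 X \<and> \<eta> 0 = c 0 \<and>
     (\<forall>t\<ge>\<tau>. \<eta> t = c (real N)) \<and> ctrace \<eta> \<subseteq> c ` {0..real N}"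

text \<open>Closedness is joint in the pair and in the curve \<open>c\<close>. It makes the set of
  curves with a shortcut in a given compact set closed, hence Borel, as the selection
  requires.\<close>

lemma shortcut_limit:
  assumes sc: "\<And>n. shortcut X N (g n) (\<tau> n) (h n)" and gL: "\<And>n. g n \<in> Lip1 X"
    and g: "c \<in> Lip1 X" "\<And>t. 0 \<le> t \<Longrightarrow> (\<lambda>n::nat. g n t) \<longlonglongrightarrow> c t"
    and t: "\<tau> \<longlonglongrightarrow> s" and h: "\<eta> \<in> Lip1 X" "\<And>t. 0 \<le> t \<Longrightarrow> (\<lambda>n. h n t) \<longlonglongrightarrow> \<eta> t"
  shows "shortcut X N c s \<eta>"
proof -
  have sc': "0 \<le> \<tau> n" "\<tau> n \<le> real N" "h n 0 = g n 0" "\<tau> n \<le> t \<Longrightarrow> h n t = g n (real N)" "ctrace (h n) \<subseteq> g n ` {0..real N}" for n t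
    using sc[of n] by (auto simp: shortcut_def)
  have s: "0 \<le> s" "s \<le> real N"
    using LIMSEQ_le_const[OF t, of 0] LIMSEQ_le_const2[OF t, of "real N"] sc'(1,2) by auto
  have "\<eta> 0 = c 0" using LIMSEQ_unique[OF h(2)[of 0]] g(2)[of 0] by (simp add: sc'(3))
  have late: "\<eta> u = c (real N)" if u: "s < u" for u
  proof -
    have "eventually (\<lambda>n. \<tau> n < u) sequentially" using order_tendstoD(2)[OF t u] .
    then have "eventually (\<lambda>n. g n (real N) = h n u) sequentially"
      by eventually_elim (simp add: sc'(4))
    then have "(\<lambda>n. h n u) \<longlonglongrightarrow> c (real N)" by (rule Lim_transform_eventually[OF g(2)[OF of_nat_0_le_iff]])
    then show ?thesis using LIMSEQ_unique[OF h(2)[of u]] s(1) u by simp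
  qed
  have "\<eta> u = c (real N)" if u: "s \<le> u" for u
  proof (rule eq_if_dist_le)
    fix e :: real assume e: "0 < e"
    have "dist (\<eta> u) (\<eta> (u + e)) \<le> e" using Lip1_dist[OF h(1), of u "u + e"] s(1) u e by simp
    then show "dist (\<eta> u) (c (real N)) \<le> e" using late[of "u + e"] u e by simp
  qed
  moreover have "\<eta> u \<in> c ` {0..real N}" if u: "0 \<le> u" for u
  proof -
    have "\<exists>x. 0 \<le> x \<and> x \<le> real N \<and> h n u = g n x" for n
    proof -
      have "h n u \<in> ctrace (h n)" using u by (auto simp: ctrace_def)
      then have "h n u \<in> g n ` {0..real N}" using sc'(5)[of n] by (rule subsetD[rotated])
      then show ?thesis by auto
    qed
    then obtain x where x: "\<And>n. 0 \<le> x n" "\<And>n. x n \<le> real N" "\<And>n. h n u = g n (x n)" by metis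
    have "seq_compact {0..real N}" by (simp add: compact_imp_seq_compact)
    moreover have "\<forall>n. x n \<in> {0..real N}" using x by auto
    ultimately obtain l r where lr: "l \<in> {0..real N}" "strict_mono (r :: nat \<Rightarrow> nat)" "(x \<circ> r) \<longlonglongrightarrow> l"
      by (rule seq_compactE) blast
    have "(\<lambda>n. dist (g (r n) (x (r n))) (c l)) \<longlonglongrightarrow> 0"
    proof (rule tendsto_sandwich[OF _ _ tendsto_const])
      show "\<forall>\<^sub>F n in sequentially. 0 \<le> dist (g (r n) (x (r n))) (c l)" by simp
      have "dist (g (r n) (x (r n))) (c l) \<le> \<bar>x (r n) - l\<bar> + dist (g (r n) l) (c l)" for n
        using dist_triangle[of "g (r n) (x (r n))" "c l" "g (r n) l"] Lip1_dist[OF gL[of "r n"] x(1)[of "r n"], of l] lr(1) by auto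
      then show "\<forall>\<^sub>F n in sequentially. dist (g (r n) (x (r n))) (c l) \<le> \<bar>x (r n) - l\<bar> + dist (g (r n) l) (c l)" by simp
      have "(\<lambda>n. \<bar>x (r n) - l\<bar>) \<longlonglongrightarrow> 0"
        using lr(3) by (intro tendsto_rabs_zero LIM_zero) (simp add: o_def)
      moreover have "(\<lambda>n. dist (g (r n) l) (c l)) \<longlonglongrightarrow> 0"
        using LIMSEQ_subseq_LIMSEQ[OF g(2)[of l] lr(2)] lr(1) by (simp add: o_def tendsto_dist_iff[symmetric])
      ultimately show "(\<lambda>n. \<bar>x (r n) - l\<bar> + dist (g (r n) l) (c l)) \<longlonglongrightarrow> 0"
        using tendsto_add_zero by blast
    qed
    then have "(\<lambda>n. h (r n) u) \<longlonglongrightarrow> c l" by (simp add: x(3) tendsto_dist_iff[symmetric])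
    moreover have "(\<lambda>n. h (r n) u) \<longlonglongrightarrow> \<eta> u"
      using LIMSEQ_subseq_LIMSEQ[OF h(2)[OF u] lr(2)] by (simp add: o_def)
    ultimately have "\<eta> u = c l" using LIMSEQ_unique by blast
    then show ?thesis using lr(1) by blast
  qed
  ultimately show ?thesis using s \<open>\<eta> 0 = c 0\<close> h(1) by (auto simp: shortcut_def ctrace_def)
qed

lemma shortcut_pre: "c \<in> Lip1 X \<Longrightarrow> shortcut X N c (real N) (pre (real N) c)"
  using pre_Lip1[of c X "real N"] by (auto simp: shortcut_def ctrace_def) (auto simp: pre_def)

lemma shortcut_seq_compact:
  fixes X :: "'a::euclidean_space set"
  assumes X: "compact X" and sc: "\<And>n. shortcut X N (g n) (\<tau> n) (h n)" and gL: "\<And>n. g n \<in> Lip1 X"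
    and g: "c \<in> Lip1 X" "\<And>t. 0 \<le> t \<Longrightarrow> (\<lambda>n::nat. g n t) \<longlonglongrightarrow> c t"
  shows "\<exists>s \<eta> r. strict_mono (r :: nat \<Rightarrow> nat) \<and> shortcut X N c s \<eta> \<and> (\<lambda>n. (\<tau> (r n), code_curve (h (r n)))) \<longlonglongrightarrow> (s, code_curve \<eta>)"
proof -
  have hL: "h n \<in> Lip1 X" and tN: "\<tau> n \<in> {0..real N}" for n using sc[of n] by (auto simp: shortcut_def)
  obtain \<eta> r where r: "\<eta> \<in> Lip1 X" "strict_mono (r :: nat \<Rightarrow> nat)" "\<forall>t\<ge>0. (\<lambda>n. h (r n) t) \<longlonglongrightarrow> \<eta> t"
    using Lip1_seq_compact[where g=h, OF X hL] by blast
  have "seq_compact {0..real N}" by (simp add: compact_imp_seq_compact)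
  moreover have "\<forall>n. (\<tau> \<circ> r) n \<in> {0..real N}" using tN by auto
  ultimately obtain s q where q: "strict_mono (q :: nat \<Rightarrow> nat)" "((\<tau> \<circ> r) \<circ> q) \<longlonglongrightarrow> s"
    by (rule seq_compactE) blast
  have t: "(\<lambda>n. \<tau> (r (q n))) \<longlonglongrightarrow> s" using q(2) by (simp add: o_def)
  have h': "(\<lambda>n. h (r (q n)) t) \<longlonglongrightarrow> \<eta> t" if "0 \<le> t" for t
    using LIMSEQ_subseq_LIMSEQ[OF r(3)[rule_format, OF that] q(1)] by (simp add: o_def)
  have rq: "strict_mono (r \<circ> q)" using r(2) q(1) by (rule strict_mono_o)
  have g': "(\<lambda>n. g (r (q n)) t) \<longlonglongrightarrow> c t" if "0 \<le> t" for t
    using LIMSEQ_subseq_LIMSEQ[OF g(2)[OF that] rq] by (simp add: o_def)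
  have "shortcut X N c s \<eta>" 
    by (rule shortcut_limit[where g="\<lambda>n. g (r (q n))" and \<tau>="\<lambda>n. \<tau> (r (q n))" and h="\<lambda>n. h (r (q n))",
          OF sc gL g(1) g' t r(1) h'])
  moreover have "(\<lambda>n. (\<tau> (r (q n)), code_curve (h (r (q n))))) \<longlonglongrightarrow> (s, code_curve \<eta>)"
  proof (rule tendsto_Pair[OF t])
    show "(\<lambda>n. code_curve (h (r (q n)))) \<longlonglongrightarrow> code_curve \<eta>"
      unfolding fun_tendsto_iff code_curve_def by (intro allI h') simp
  qed
  ultimately show ?thesis using rq by (intro exI[of _ s] exI[of _ \<eta>] exI[of _ "r \<circ> q"]) (auto simp: o_def)
qed

text \<open>The selection minimizes the arrival time \<open>g 0\<close> and then the coordinates of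
  the values at all rational times. The latter are included to make the selected curve measurable,
  as the selection theorem controls exactly the values \<open>g n\<close> at the selected
  point.\<close>

lemma shortcut_selection:
  fixes X :: "'a::euclidean_space set"
  assumes X: "compact X"
  shows "\<exists>er. er \<in> measurable (Lip1_borel X) (Lip1_borel X) \<and>
     (\<forall>c\<in>Lip1 X. \<exists>\<tau>. shortcut X N c \<tau> (er c) \<and> (\<forall>s \<eta>. shortcut X N c s \<eta> \<longrightarrow> \<tau> \<le> s))"
proof -
  define M where "M c = {(\<tau>, code_curve \<eta>) | \<tau> \<eta>. shortcut X N c \<tau> \<eta>}" for c
  define C where "C = {0..real N} \<times> {f :: rat \<Rightarrow> 'a. \<forall>i. f i \<in> X}"
  have C: "compact C" unfolding C_def by (intro compact_Times compact_fun_PiE X) simp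
  define e where "e = from_nat_into (UNIV \<times> Basis :: (rat \<times> 'a) set)"
  have ce: "countable (UNIV \<times> Basis :: (rat \<times> 'a) set)" by (intro countable_SIGMA countableI_type) (simp add: countable_finite)
  define g :: "nat \<Rightarrow> real \<times> (rat \<Rightarrow> 'a) \<Rightarrow> real"
    where "g n z = (case n of 0 \<Rightarrow> fst z | Suc i \<Rightarrow> snd z (fst (e i)) \<bullet> snd (e i))" for n z
  have gc: "continuous_on UNIV (g n)" for n
  proof (cases n)
    case 0 then show ?thesis by (simp add: g_def[abs_def] continuous_on_fst continuous_on_id)
  next
    case (Suc i)
    have "continuous_on UNIV (\<lambda>z :: real \<times> (rat \<Rightarrow> 'a). snd z (fst (e i)))"
      by (rule continuous_on_product_then_coordinatewise) (intro continuous_intros)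
    then show ?thesis by (simp add: g_def[abs_def] Suc continuous_on_inner continuous_on_const)
  qed
  have Mc: "compact (M c)" if g: "c \<in> Lip1 X" for c
    unfolding compact_eq_seq_compact_metric seq_compact_def
  proof (intro allI impI)
    fix f :: "nat \<Rightarrow> real \<times> (rat \<Rightarrow> 'a)" assume "\<forall>n. f n \<in> M c"
    then have "\<forall>n. \<exists>\<tau> \<eta>. f n = (\<tau>, code_curve \<eta>) \<and> shortcut X N c \<tau> \<eta>" unfolding M_def by blast
    then obtain \<tau> h where f: "\<And>n. f n = (\<tau> n, code_curve (h n))" "\<And>n. shortcut X N c (\<tau> n) (h n)" by metis
    obtain s \<eta> r where "strict_mono (r :: nat \<Rightarrow> nat)" "shortcut X N c s \<eta>" "(\<lambda>n. (\<tau> (r n), code_curve (h (r n)))) \<longlonglongrightarrow> (s, code_curve \<eta>)"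
      using shortcut_seq_compact[where g="\<lambda>_. c" and \<tau>=\<tau> and h=h, OF X f(2) g g tendsto_const] by blast
    then show "\<exists>l\<in>M c. \<exists>r. strict_mono r \<and> (f \<circ> r) \<longlonglongrightarrow> l"
      unfolding M_def by (intro bexI[of _ "(s, code_curve \<eta>)"] exI[of _ r]) (auto simp: o_def f(1))
  qed
  have Mm: "{c \<in> space (Lip1_borel X). M c \<inter> K \<noteq> {}} \<in> sets (Lip1_borel X)" if K: "compact K" for K
  proof (rule seq_closed_sets_Lip1[OF X])
    fix gs c assume a: "\<And>n::nat. gs n \<in> {c \<in> space (Lip1_borel X). M c \<inter> K \<noteq> {}}" and g: "c \<in> Lip1 X"
      and lim: "\<And>t. 0 \<le> t \<Longrightarrow> (\<lambda>n. gs n t) \<longlonglongrightarrow> c t"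
    have gL: "gs n \<in> Lip1 X" for n using a[of n] by simp
    have "\<forall>n. \<exists>\<tau> \<eta>. shortcut X N (gs n) \<tau> \<eta> \<and> (\<tau>, code_curve \<eta>) \<in> K" using a unfolding M_def by fast
    then obtain \<tau> h where f: "\<And>n. shortcut X N (gs n) (\<tau> n) (h n)" "\<And>n. (\<tau> n, code_curve (h n)) \<in> K" by metis
    obtain s \<eta> r where r: "strict_mono (r :: nat \<Rightarrow> nat)" "shortcut X N c s \<eta>" "(\<lambda>n. (\<tau> (r n), code_curve (h (r n)))) \<longlonglongrightarrow> (s, code_curve \<eta>)"
      using shortcut_seq_compact[where g=gs and \<tau>=\<tau> and h=h, OF X f(1) gL g lim] by blast
    have "(s, code_curve \<eta>) \<in> K"
      by (rule closed_sequentially[OF compact_imp_closed[OF K] _ r(3)]) (rule f(2))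
    then show "c \<in> {c \<in> space (Lip1_borel X). M c \<inter> K \<noteq> {}}" using g r(2) by (auto simp: M_def)
  qed simp
  have MC: "M c \<noteq> {} \<and> compact (M c) \<and> M c \<subseteq> C" if "c \<in> space (Lip1_borel X)" for c
  proof (intro conjI)
    have g: "c \<in> Lip1 X" using that by simp
    show "M c \<noteq> {}" using shortcut_pre[OF g] by (auto simp: M_def)
    show "compact (M c)" by (rule Mc[OF g])
    show "M c \<subseteq> C" by (auto simp: M_def C_def shortcut_def code_curve_def Lip1_in)
  qed
  obtain s where s: "\<And>c. c \<in> Lip1 X \<Longrightarrow> s c \<in> M c \<and> (\<forall>z\<in>M c. g 0 (s c) \<le> g 0 z)"
    "\<And>n. (\<lambda>c. g n (s c)) \<in> borel_measurable (Lip1_borel X)"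
    using lexicographic_selection[where g=g and M=M and N="Lip1_borel X", OF gc C MC Mm] unfolding space_Lip1_borel by blast
  have "\<forall>c\<in>Lip1 X. \<exists>\<eta>. s c = (fst (s c), code_curve \<eta>) \<and> shortcut X N c (fst (s c)) \<eta>"
  proof
    fix c assume "c \<in> Lip1 X"
    then have "s c \<in> M c" using s(1) by blast
    then show "\<exists>\<eta>. s c = (fst (s c), code_curve \<eta>) \<and> shortcut X N c (fst (s c)) \<eta>" unfolding M_def by auto
  qed
  then obtain er where er: "\<And>c. c \<in> Lip1 X \<Longrightarrow> s c = (fst (s c), code_curve (er c)) \<and> shortcut X N c (fst (s c)) (er c)" by metis
  have erL: "er c \<in> Lip1 X" if "c \<in> Lip1 X" for c using er[OF that] by (simp add: shortcut_def)
  have ratm: "(\<lambda>c. er c (rat_time q)) \<in> borel_measurable (Lip1_borel X)" for q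
  proof (rule borel_measurable_euclidean_space[THEN iffD2, rule_format])
    fix b :: 'a assume b: "b \<in> Basis"
    obtain i where i: "e i = (q, b)" unfolding e_def using b from_nat_into_surj[OF ce, of "(q, b)"] by auto
    have "g (Suc i) (s c) = er c (rat_time q) \<bullet> b" if "c \<in> Lip1 X" for c
    proof -
      have "snd (s c) = code_curve (er c)" using er[OF that] by (metis snd_conv)
      then show ?thesis by (simp add: g_def i code_curve_def)
    qed
    then show "(\<lambda>c. er c (rat_time q) \<bullet> b) \<in> borel_measurable (Lip1_borel X)"
      by (intro measurable_cong[THEN iffD1, OF _ s(2)[of "Suc i"]]) simp
  qed
  have "er \<in> measurable (Lip1_borel X) (Lip1_borel X)"
  proof (rule measurable_into_Lip1)
    fix t :: real assume t: "0 \<le> t"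
    obtain q where q: "(\<lambda>n. rat_time (q n)) \<longlonglongrightarrow> t" using rat_time_seq[OF t] by blast
    show "(\<lambda>c. er c t) \<in> borel_measurable (Lip1_borel X)"
      by (rule borel_measurable_LIMSEQ_metric[OF ratm]) (rule Lip1_tendsto[OF _ t _ q], auto intro: erL)
  qed (simp add: erL)
  moreover have "\<exists>\<tau>. shortcut X N c \<tau> (er c) \<and> (\<forall>s \<eta>. shortcut X N c s \<eta> \<longrightarrow> \<tau> \<le> s)" if g: "c \<in> Lip1 X" for c
  proof (intro exI conjI allI impI)
    show "shortcut X N c (fst (s c)) (er c)" using er[OF g] by simp
    fix u \<eta> assume "shortcut X N c u \<eta>"
    then have "(u, code_curve \<eta>) \<in> M c" by (auto simp: M_def)
    then have "g 0 (s c) \<le> g 0 (u, code_curve \<eta>)" using s(1)[OF g] by blast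
    then show "fst (s c) \<le> u" by (simp add: g_def)
  qed
  ultimately show ?thesis by blast
qed

section \<open>Arc length and the properties of minimal shortcuts\<close>

lemma lint_one_seg:
  assumes g: "c \<in> Lip1 X" and ab: "0 \<le> a" "a \<le> b"
  shows "lint (seg a b c) (\<lambda>_. 1) \<le> ennreal (b - a)"
proof -
  have "lint (seg a b c) (\<lambda>_. 1) \<le> (\<integral>\<^sup>+t\<in>{0..b - a}. 1 \<partial>lborel)"
    by (rule lint_le_of_const[OF seg_Lip1[OF g ab]]) (use ab in \<open>auto simp: seg_def pre_def\<close>)
  also have "\<dots> = ennreal (b - a)" using ab by simp
  finally show ?thesis .
qed

lemma seg_0: "c \<in> Lip1 X \<Longrightarrow> 0 \<le> b \<Longrightarrow> seg 0 b c = pre b c"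
  by (rule Lip1_ext[OF seg_Lip1 pre_Lip1]) (auto simp: seg_def pre_def suf_def)

lemma lint_seg_add:
  assumes g: "\<gamma> \<in> Lip1 X" and ab: "0 \<le> a" "a \<le> b" "b \<le> c" and f: "f \<in> borel_measurable borel"
  shows "lint (seg a c \<gamma>) f = lint (seg a b \<gamma>) f + lint (seg b c \<gamma>) f"
proof -
  have m: "(\<lambda>t. f (\<gamma> t) * ennreal (sp \<gamma> t) * indicator {u..v} t) \<in> borel_measurable lborel" if "0 \<le> u" for u v
    by (rule measurable_line_integrand[OF g f]) (use that in auto)
  have "lint (seg a b \<gamma>) f + lint (seg b c \<gamma>) f =
     (\<integral>\<^sup>+t. f (\<gamma> t) * ennreal (sp \<gamma> t) * indicator {a..b} t + f (\<gamma> t) * ennreal (sp \<gamma> t) * indicator {b..c} t \<partial>lborel)"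
    unfolding lint_seg[OF g ab(1,2) f] lint_seg[OF g order_trans[OF ab(1,2)] ab(3) f]
    by (rule nn_integral_add[symmetric, OF m m]) (use ab in auto)
  also have "\<dots> = lint (seg a c \<gamma>) f"
    unfolding lint_seg[OF g ab(1) order_trans[OF ab(2,3)] f]
    by (rule nn_integral_cong_AE, use AE_lborel_singleton[of b] in eventually_elim)
      (use ab in \<open>auto simp: indicator_def\<close>)
  finally show ?thesis by simp
qed

lemma lint_seg_all:
  assumes g: "\<gamma> \<in> Lip1 X" and T: "0 \<le> T" "\<And>t. T \<le> t \<Longrightarrow> \<gamma> t = c" and f: "f \<in> borel_measurable borel"
  shows "lint (seg 0 T \<gamma>) f = lint \<gamma> f"
proof -
  have "suf T \<gamma> = cst c" by (rule ext) (use T in \<open>auto simp: suf_def cst_def\<close>)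
  then have "lint (suf T \<gamma>) f = 0" by (simp add: lint_cst)
  then show ?thesis using lint_pre_suf[OF g T(1) f] seg_0[OF g T(1)] by simp
qed

text \<open>Converts a bound on the length into a bound on the arrival time. \<open>\<eta> u\<close>
  is the point of \<open>\<zeta>\<close> at which the arc length \<open>S\<close> reaches
  \<open>u\<close>, found by the intermediate value theorem; the choice of the parameter
  \<open>g u\<close> is harmless because distances are bounded by differences of
  \<open>S\<close>.\<close>

lemma arclength_reparametrization:
  fixes \<zeta> :: "real \<Rightarrow> 'a::euclidean_space"
  assumes z: "\<zeta> \<in> Lip1 X" and T: "0 \<le> T" "\<And>t. T \<le> t \<Longrightarrow> \<zeta> t = c"
  shows "\<exists>\<eta>\<in>Lip1 X. \<eta> 0 = \<zeta> 0 \<and> (\<forall>t. lint \<zeta> (\<lambda>_. 1) \<le> ennreal t \<longrightarrow> 0 \<le> t \<longrightarrow> \<eta> t = c) \<and> ctrace \<eta> \<subseteq> ctrace \<zeta>"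
proof -
  define S where "S t = enn2real (lint (seg 0 t \<zeta>) (\<lambda>_. 1))" for t
  have fin: "lint (seg a b \<zeta>) (\<lambda>_. 1) < \<infinity>" if "0 \<le> a" "a \<le> b" for a b
    using lint_one_seg[OF z that] by (simp add: order_le_less_trans)
  have Sdiff: "ennreal (S t - S s) = lint (seg s t \<zeta>) (\<lambda>_. 1)" "S s \<le> S t" if st: "0 \<le> s" "s \<le> t" for s t
  proof -
    have a: "lint (seg 0 t \<zeta>) (\<lambda>_. 1) = lint (seg 0 s \<zeta>) (\<lambda>_. 1) + lint (seg s t \<zeta>) (\<lambda>_. 1)"
      by (rule lint_seg_add[OF z]) (use st in auto)
    have e: "S t = S s + enn2real (lint (seg s t \<zeta>) (\<lambda>_. 1))"
      unfolding S_def a by (rule enn2real_plus) (use fin[of 0 s] fin[OF st] st in auto)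
    then show "S s \<le> S t" by simp
    show "ennreal (S t - S s) = lint (seg s t \<zeta>) (\<lambda>_. 1)" using e fin[OF st] by simp
  qed
  have Sd: "dist (\<zeta> s) (\<zeta> t) \<le> \<bar>S t - S s\<bar>" if "0 \<le> s" "0 \<le> t" for s t
  proof (cases "s \<le> t")
    case True
    then have "ennreal (dist (\<zeta> s) (\<zeta> t)) \<le> ennreal (S t - S s)"
      using lint_ge_dist[OF z that(1) True] Sdiff(1)[OF that(1) True] by simp
    then show ?thesis using Sdiff(2)[OF that(1) True] by simp
  next
    case False
    then have ts: "t \<le> s" by simp
    then have "ennreal (dist (\<zeta> t) (\<zeta> s)) \<le> ennreal (S s - S t)"
      using lint_ge_dist[OF z that(2) ts] Sdiff(1)[OF that(2) ts] by simp
    then show ?thesis using Sdiff(2)[OF that(2) ts] by (simp add: dist_commute)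
  qed
  have Sl: "S t - S s \<le> t - s" if st: "0 \<le> s" "s \<le> t" for s t
  proof -
    have "ennreal (S t - S s) \<le> ennreal (t - s)" using lint_one_seg[OF z st] Sdiff(1)[OF st] by simp
    then show ?thesis using st by (subst (asm) ennreal_le_iff) auto
  qed
  have S0: "S 0 = 0" using lint_one_seg[OF z, of 0 0] by (simp add: S_def)
  have ST: "ennreal (S T) = lint \<zeta> (\<lambda>_. 1)"
    using Sdiff[OF _ T(1)] S0 lint_seg_all[OF z T, of "\<lambda>_. 1"] by simp
  have cont: "continuous_on {0..T} S"
  proof (rule lipschitz_on_continuous_on[of 1])
    have "\<bar>S s - S t\<bar> \<le> \<bar>s - t\<bar>" if "0 \<le> s" "0 \<le> t" for s t
      using Sl[of s t] Sl[of t s] Sdiff(2)[of s t] Sdiff(2)[of t s] that by (cases "s \<le> t") auto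
    then show "1-lipschitz_on {0..T} S" by (auto simp: lipschitz_on_def dist_real_def)
  qed
  have S_T0: "0 \<le> S T" using Sdiff(2)[OF _ T(1)] S0 by simp
  have "\<exists>x. 0 \<le> x \<and> x \<le> T \<and> S x = min u (S T)" if "0 \<le> u" for u
    by (rule IVT'[of S 0 "min u (S T)" T]) (use that S0 S_T0 T(1) cont in auto)
  then obtain g where g: "\<And>u. 0 \<le> u \<Longrightarrow> 0 \<le> g u" "\<And>u. 0 \<le> u \<Longrightarrow> S (g u) = min u (S T)" by metis
  define \<eta> where "\<eta> = (\<lambda>u\<in>{0..}. \<zeta> (g u))"
  have "\<eta> \<in> Lip1 X"
  proof (rule Lip1_I)
    fix s t :: real assume st: "0 \<le> s" "s \<le> t"
    have "dist (\<zeta> (g s)) (\<zeta> (g t)) \<le> \<bar>min t (S T) - min s (S T)\<bar>"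
      using Sd[of "g s" "g t"] g[of s] g[of t] st by simp
    also have "\<dots> \<le> t - s" using st by auto
    finally show "dist (\<eta> s) (\<eta> t) \<le> t - s" using st by (simp add: \<eta>_def)
  qed (use g in \<open>auto simp: \<eta>_def intro!: Lip1_in[OF z]\<close>)
  moreover have "\<eta> 0 = \<zeta> 0"
    using Sd[of "g 0" 0] g[of 0] S0 S_T0 by (simp add: \<eta>_def)
  moreover have "\<eta> t = c" if "lint \<zeta> (\<lambda>_. 1) \<le> ennreal t" "0 \<le> t" for t
  proof -
    have "S T \<le> t" using that ST[symmetric] by simp
    then have "S (g t) = S T" using g(2)[OF that(2)] by simp
    then have "\<zeta> (g t) = \<zeta> T" using Sd[of "g t" T] g(1)[OF that(2)] T(1) by simp
    then show ?thesis using that(2) T(2)[of T] by (simp add: \<eta>_def)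
  qed
  moreover have "ctrace \<eta> \<subseteq> ctrace \<zeta>" using g(1) by (auto simp: ctrace_def \<eta>_def)
  ultimately show ?thesis by blast
qed

text \<open>Cutting out a loop between two visits to one point gives a shortcut that arrives
  earlier.\<close>

lemma minimal_shortcut_simple:
  assumes g: "c \<in> Lip1 X" and sc: "shortcut X N c \<tau> \<eta>" and min: "\<And>s \<zeta>. shortcut X N c s \<zeta> \<Longrightarrow> \<tau> \<le> s"
  shows "simple_curve \<eta>"
  unfolding simple_curve_def
proof (intro notI, elim exE conjE)
  fix t1 t2 t3 assume t: "0 \<le> t1" "t1 < t2" "t2 < t3" "\<eta> t1 = \<eta> t3" "\<eta> t3 \<noteq> \<eta> t2"
  have h: "0 \<le> \<tau>" "\<tau> \<le> real N" "\<eta> \<in> Lip1 X" "\<eta> 0 = c 0" "ctrace \<eta> \<subseteq> c ` {0..real N}"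
    and late: "\<And>t. \<tau> \<le> t \<Longrightarrow> \<eta> t = c (real N)"
    using sc by (auto simp: shortcut_def)
  have t1: "t1 < \<tau>"
  proof (rule ccontr)
    assume "\<not> t1 < \<tau>"
    then show False using late[of t2] late[of t3] t by simp
  qed
  \<comment> \<open>The second visit may lie after the arrival. Then \<open>\<eta>\<close> already
    has the same value at \<open>\<tau>\<close>, and cutting up to \<open>\<tau>\<close> still saves
    time.\<close>
  define u where "u = min t3 \<tau>"
  have u: "t1 < u" "u \<le> \<tau>" "0 \<le> u" using t t1 by (auto simp: u_def)
  have eu: "\<eta> u = \<eta> t1" using late[of t3] late[of \<tau>] t(4) by (auto simp: u_def min_def)
  define \<zeta> where "\<zeta> = join t1 (pre t1 \<eta>) (suf u \<eta>)"
  have j: "pre t1 \<eta> \<in> Lip1 X" "suf u \<eta> \<in> Lip1 X" "pre t1 \<eta> t1 = suf u \<eta> 0"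
    using h(3) t(1) u eu by (auto simp: pre_Lip1 suf_Lip1) (auto simp: pre_def suf_def)
  have "shortcut X N c (\<tau> - (u - t1)) \<zeta>"
    unfolding shortcut_def
  proof (intro conjI allI impI)
    show "\<zeta> \<in> Lip1 X" unfolding \<zeta>_def by (rule join_Lip1[OF j(1,2) t(1) j(3)])
    show "\<zeta> 0 = c 0" using t(1) h(4) by (simp add: \<zeta>_def join_def pre_def)
    have "ctrace \<zeta> = ctrace (pre t1 \<eta>) \<union> ctrace (suf u \<eta>)"
      unfolding \<zeta>_def by (rule trace_join[of t1 "pre t1 \<eta>" "suf u \<eta>"]) (use t j in \<open>auto simp: pre_def\<close>)
    also have "\<dots> \<subseteq> ctrace \<eta>" using trace_pre_suf[OF h(3) t(1)] trace_pre_suf[OF h(3) u(3)] by blast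
    finally show "ctrace \<zeta> \<subseteq> c ` {0..real N}" using h(5) by blast
    fix t assume tt: "\<tau> - (u - t1) \<le> t"
    show "\<zeta> t = c (real N)"
    proof (cases "t \<le> t1")
      case True
      then have "t = t1" "u = \<tau>" using tt u by auto
      then show ?thesis using t(1) eu late[of \<tau>] by (simp add: \<zeta>_def join_def pre_def)
    next
      case False
      then show ?thesis using tt t(1) late[of "u + (t - t1)"] by (simp add: \<zeta>_def join_def suf_def)
    qed
  qed (use h u t1 t in auto)
  from min[OF this] u show False by simp
qed

text \<open>A 1-Lipschitz curve is not longer than its travel time, and \<open>\<zeta>\<close> can
  be reparametrized so that it arrives at a time equal to its length.\<close>

lemma minimal_shortcut_length:
  assumes g: "c \<in> Lip1 X" and sc: "shortcut X N c \<tau> \<eta>" and min: "\<And>s \<zeta>. shortcut X N c s \<zeta> \<Longrightarrow> \<tau> \<le> s"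
    and z: "\<zeta> \<in> Lip1 X" "0 \<le> T" "\<And>t. T \<le> t \<Longrightarrow> \<zeta> t = c (real N)" "\<zeta> 0 = c 0" "ctrace \<zeta> \<subseteq> c ` {0..real N}"
      "lint \<zeta> (\<lambda>_. 1) \<le> ennreal (real N)"
  shows "lint \<eta> (\<lambda>_. 1) \<le> lint \<zeta> (\<lambda>_. 1)"
proof -
  have h: "0 \<le> \<tau>" "\<eta> \<in> Lip1 X" and late: "\<And>t. \<tau> \<le> t \<Longrightarrow> \<eta> t = c (real N)"
    using sc by (auto simp: shortcut_def)
  define l where "l = enn2real (lint \<zeta> (\<lambda>_. 1))"
  have l: "ennreal l = lint \<zeta> (\<lambda>_. 1)" "0 \<le> l" using z(6) by (auto simp: l_def intro!: ennreal_enn2real order_le_less_trans[OF z(6)])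
  obtain \<xi> where x: "\<xi> \<in> Lip1 X" "\<xi> 0 = \<zeta> 0" "\<And>t. ennreal l \<le> ennreal t \<Longrightarrow> 0 \<le> t \<Longrightarrow> \<xi> t = c (real N)" "ctrace \<xi> \<subseteq> ctrace \<zeta>"
    using arclength_reparametrization[OF z(1-3)] unfolding l(1)[symmetric] by blast
  have "shortcut X N c l \<xi>"
    unfolding shortcut_def
  proof (intro conjI allI impI)
    show "l \<le> real N" using z(6) unfolding l(1)[symmetric] by simp
    show "\<xi> t = c (real N)" if "l \<le> t" for t using that l(2) by (intro x(3)) auto
  qed (use x z l in auto)
  then have "\<tau> \<le> l" by (rule min)
  have "lint \<eta> (\<lambda>_. 1) \<le> (\<integral>\<^sup>+t\<in>{0..\<tau>}. 1 \<partial>lborel)"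
    by (rule lint_le_of_const[OF h(2,1)]) (simp add: late)
  also have "\<dots> = ennreal \<tau>" using h by simp
  also have "\<dots> \<le> ennreal l" using \<open>\<tau> \<le> l\<close> by (rule ennreal_leI)
  finally show ?thesis using l by simp
qed

lemma stop_nat_image:
  assumes g: "c \<in> Lip1 X" "fin c" shows "c ` {0..real (stop_nat c)} = ctrace c"
proof
  show "ctrace c \<subseteq> c ` {0..real (stop_nat c)}"
  proof
    fix y assume "y \<in> ctrace c"
    then obtain t where t: "0 \<le> t" "y = c t" by (auto simp: ctrace_def)
    show "y \<in> c ` {0..real (stop_nat c)}"
    proof (cases "t \<le> real (stop_nat c)")
      case False
      then have "y = c (real (stop_nat c))" using t stop_nat[OF g, of t] stop_nat[OF g, of "real (stop_nat c)"] by simp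
      then show ?thesis by auto
    qed (use t in auto)
  qed
qed (auto simp: ctrace_def)

lemma loop_erasure:
  fixes X :: "'a::euclidean_space set"
  assumes X: "compact X"
  shows "\<exists>er. er \<in> measurable (Lip1_borel X) (Lip1_borel X) \<and>
    (\<forall>\<gamma>\<in>Lip1 X. fin \<gamma> \<longrightarrow> simple_curve (er \<gamma>) \<and> fin (er \<gamma>) \<and> er \<gamma> 0 = \<gamma> 0 \<and> einf (er \<gamma>) = einf \<gamma> \<and>
       ctrace (er \<gamma>) \<subseteq> ctrace \<gamma> \<and> (\<not> simple_curve \<gamma> \<longrightarrow> lint (er \<gamma>) (\<lambda>_. 1) < lint \<gamma> (\<lambda>_. 1)))"
proof -
  have "\<forall>N. \<exists>er. er \<in> measurable (Lip1_borel X) (Lip1_borel X) \<and>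
     (\<forall>\<gamma>\<in>Lip1 X. \<exists>\<tau>. shortcut X N \<gamma> \<tau> (er \<gamma>) \<and> (\<forall>s \<eta>. shortcut X N \<gamma> s \<eta> \<longrightarrow> \<tau> \<le> s))"
    using shortcut_selection[OF X] by blast
  then obtain e where e: "\<And>N. e N \<in> measurable (Lip1_borel X) (Lip1_borel X)"
    "\<And>N. \<forall>\<gamma>\<in>Lip1 X. \<exists>\<tau>. shortcut X N \<gamma> \<tau> (e N \<gamma>) \<and> (\<forall>s \<eta>. shortcut X N \<gamma> s \<eta> \<longrightarrow> \<tau> \<le> s)" by metis
  \<comment> \<open>The horizon is an integer time at which the curve has come to rest. Having
    countably many values, it lets \<open>er\<close> be assembled measurably from the selections
    \<open>e N\<close>.\<close>
  define er where "er \<gamma> = e (stop_nat \<gamma>) \<gamma>" for \<gamma>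
  have "er \<in> measurable (Lip1_borel X) (Lip1_borel X)"
    unfolding er_def[abs_def] by (rule measurable_compose_countable[OF e(1) measurable_stop_nat])
  moreover have "simple_curve (er \<gamma>) \<and> fin (er \<gamma>) \<and> er \<gamma> 0 = \<gamma> 0 \<and> einf (er \<gamma>) = einf \<gamma> \<and>
       ctrace (er \<gamma>) \<subseteq> ctrace \<gamma> \<and> (\<not> simple_curve \<gamma> \<longrightarrow> lint (er \<gamma>) (\<lambda>_. 1) < lint \<gamma> (\<lambda>_. 1))"
    if g: "\<gamma> \<in> Lip1 X" and f: "fin \<gamma>" for \<gamma>
  proof -
    let ?N = "stop_nat \<gamma>"
    obtain \<tau> where sc: "shortcut X ?N \<gamma> \<tau> (er \<gamma>)" and min: "\<And>s \<eta>. shortcut X ?N \<gamma> s \<eta> \<Longrightarrow> \<tau> \<le> s"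
      using e(2) g unfolding er_def by blast
    have h: "0 \<le> \<tau>" "er \<gamma> \<in> Lip1 X" "er \<gamma> 0 = \<gamma> 0" "ctrace (er \<gamma>) \<subseteq> ctrace \<gamma>" and late: "\<And>t. \<tau> \<le> t \<Longrightarrow> er \<gamma> t = einf \<gamma>"
      using sc stop_nat_image[OF g f] stop_nat[OF g f, of "real ?N"] by (auto simp: shortcut_def)
    have "fin (er \<gamma>)" unfolding fin_def by (intro exI[of _ \<tau>]) (simp add: h late)
    moreover have "einf (er \<gamma>) = einf \<gamma>" by (rule einf_eqI[OF h(2,1) late])
    moreover have "simple_curve (er \<gamma>)" by (rule minimal_shortcut_simple[OF g sc min])
    moreover have "lint (er \<gamma>) (\<lambda>_. 1) < lint \<gamma> (\<lambda>_. 1)" if ns: "\<not> simple_curve \<gamma>"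
    proof -
      obtain t1 t2 t3 where t: "0 \<le> t1" "t1 < t2" "t2 < t3" "\<gamma> t1 = \<gamma> t3" "\<gamma> t3 \<noteq> \<gamma> t2"
        using ns unfolding simple_curve_def by blast
      \<comment> \<open>\<open>\<gamma>\<close> with one loop removed: a strictly shorter curve with
        the same end points inside the same trace, and the erased curve is not longer than
        it.\<close>
      define \<zeta> where "\<zeta> = join t1 (pre t1 \<gamma>) (suf t3 \<gamma>)"
      have t3: "0 \<le> t3" "t1 \<le> t3" using t by auto
      have j: "pre t1 \<gamma> \<in> Lip1 X" "suf t3 \<gamma> \<in> Lip1 X" "pre t1 \<gamma> t1 = suf t3 \<gamma> 0"
        using g t by (auto simp: pre_Lip1 suf_Lip1) (auto simp: pre_def suf_def)
      have c: "pre t1 \<gamma> t = pre t1 \<gamma> t1" if "t1 \<le> t" for t using that t(1) by (simp add: pre_def)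
      have lz: "lint \<zeta> (\<lambda>_. 1) = lint (pre t1 \<gamma>) (\<lambda>_. 1) + lint (suf t3 \<gamma>) (\<lambda>_. 1)"
        unfolding \<zeta>_def by (rule lint_join[OF j(1,2) t(1) j(3) c]) auto
      have lg: "lint \<gamma> (\<lambda>_. 1) = lint (pre t1 \<gamma>) (\<lambda>_. 1) + lint (seg t1 t3 \<gamma>) (\<lambda>_. 1) + lint (suf t3 \<gamma>) (\<lambda>_. 1)"
        by (rule lint_pre_seg_suf[OF g t(1) t3(2)]) simp
      have lN: "lint \<gamma> (\<lambda>_. 1) \<le> ennreal (real ?N)"
        using lint_one_seg[OF g, of 0 "real ?N"] lint_seg_all[OF g, of "real ?N" "einf \<gamma>" "\<lambda>_. 1"] stop_nat[OF g f] by simp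
      have pos: "0 < lint (seg t1 t3 \<gamma>) (\<lambda>_. 1)"
      proof -
        have "0 < ennreal (dist (\<gamma> t1) (\<gamma> t2))" using t(4,5) by simp
        also have "\<dots> \<le> lint (seg t1 t2 \<gamma>) (\<lambda>_. 1)" by (rule lint_ge_dist[OF g t(1)]) (use t in simp)
        also have "\<dots> \<le> lint (seg t1 t3 \<gamma>) (\<lambda>_. 1)"
          using lint_seg_add[OF g t(1), of t2 t3 "\<lambda>_. 1"] t by simp
        finally show ?thesis .
      qed
      have fz: "lint \<zeta> (\<lambda>_. 1) \<noteq> \<infinity>" "lint \<zeta> (\<lambda>_. 1) \<le> lint \<gamma> (\<lambda>_. 1)"
      proof -
        show le: "lint \<zeta> (\<lambda>_. 1) \<le> lint \<gamma> (\<lambda>_. 1)" unfolding lz lg by (intro add_right_mono) simp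
        have "lint \<zeta> (\<lambda>_. 1) \<le> ennreal (real ?N)" using le lN by (rule order_trans)
        then show "lint \<zeta> (\<lambda>_. 1) \<noteq> \<infinity>" by (metis ennreal_neq_top infinity_ennreal_def top.extremum_uniqueI)
      qed
      have lt: "lint \<zeta> (\<lambda>_. 1) < lint \<gamma> (\<lambda>_. 1)"
      proof -
        have "lint \<zeta> (\<lambda>_. 1) + 0 < lint \<zeta> (\<lambda>_. 1) + lint (seg t1 t3 \<gamma>) (\<lambda>_. 1)"
          using fz(1) pos by (simp add: ennreal_add_left_cancel_less less_top[symmetric])
        then show ?thesis unfolding lz lg by (simp add: ac_simps)
      qed
      have "lint (er \<gamma>) (\<lambda>_. 1) \<le> lint \<zeta> (\<lambda>_. 1)"
      proof (rule minimal_shortcut_length[where \<zeta>=\<zeta> and T="t1 + real ?N", OF g sc min])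
        show "\<zeta> \<in> Lip1 X" unfolding \<zeta>_def by (rule join_Lip1[OF j(1,2) t(1) j(3)])
        show "\<zeta> 0 = \<gamma> 0" using t(1) by (simp add: \<zeta>_def join_def pre_def)
        have "ctrace \<zeta> = ctrace (pre t1 \<gamma>) \<union> ctrace (suf t3 \<gamma>)"
          unfolding \<zeta>_def by (rule trace_join[of t1 "pre t1 \<gamma>" "suf t3 \<gamma>"]) (rule t(1), rule j(3), erule c)
        also have "\<dots> \<subseteq> ctrace \<gamma>" using trace_pre_suf[OF g t(1)] trace_pre_suf[OF g t3(1)] by blast
        finally show "ctrace \<zeta> \<subseteq> \<gamma> ` {0..real ?N}" using stop_nat_image[OF g f] by simp
        show "lint \<zeta> (\<lambda>_. 1) \<le> ennreal (real ?N)" using fz(2) lN by (rule order_trans)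
        fix s assume s: "t1 + real ?N \<le> s"
        show "\<zeta> s = \<gamma> (real ?N)"
        proof (cases "s = t1")
          case True
          then have N0: "?N = 0" using s by simp
          have "\<gamma> t1 = einf \<gamma>" using stop_nat[OF g f, of t1] N0 t(1) by simp
          then show ?thesis using True t(1) stop_nat[OF g f, of "real ?N"] by (simp add: \<zeta>_def join_def pre_def)
        next
          case False
          then have "t1 < s" using s by (simp add: order_less_le)
          then show ?thesis using s t t3 stop_nat[OF g f, of "t3 + (s - t1)"] stop_nat[OF g f, of "real ?N"]
            by (simp add: \<zeta>_def join_def suf_def)
        qed
      qed (use t in auto)
      then show ?thesis using lt by (rule order_le_less_trans)
    qed
    ultimately show ?thesis using h by blast
  qed
  ultimately show ?thesis by blast
qed

section \<open>Competitors, and almost every curve is simple\<close>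

lemma traffic_planD:
  assumes "traffic_plan X P" "compact X"
  shows "curve_plan X P" "AE c in P. fin c"
proof -
  interpret finite_measure P using assms by (simp add: traffic_plan_def)
  show p: "curve_plan X P" by standard (use assms in \<open>auto simp: traffic_plan_def\<close>)
  have "AE c in P. stopping_time c < \<infinity>" using assms by (simp add: traffic_plan_def)
  then show "AE c in P. fin c" using AE_space
    by eventually_elim (rule stopping_time_finite_iff[of _ X, THEN iffD1], simp_all only: curve_plan.space_P[OF p])
qed

text \<open>A family of curves with the prescribed coupling becomes an admissible plan, whose energy
  is computed on the index space. The index space is general because the surgery adds a coin to
  \<open>P\<close>.\<close>

lemma TP_distr:
  fixes X :: "'a::euclidean_space set"
  assumes X: "compact X" and M: "finite_measure M" and \<Phi>: "\<Phi> \<in> measurable M (Lip1_borel X)"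
    and f: "AE w in M. fin (\<Phi> w)"
    and \<pi>: "distr M borel (\<lambda>w. (e0 (\<Phi> w), einf (\<Phi> w))) = \<pi>"
  shows "distr M (Lip1_borel X) \<Phi> \<in> TP X \<pi>" (is "?Q \<in> _")
    and "energy \<alpha> (distr M (Lip1_borel X) \<Phi>) = (\<integral>\<^sup>+w. lint (\<Phi> w) (\<lambda>y. weight \<alpha> (enn2real (mass M \<Phi> y))) \<partial>M)"
proof -
  interpret M: finite_measure M by fact
  interpret Q: finite_measure ?Q by (rule M.finite_measure_distr[OF \<Phi>])
  interpret Q: curve_plan X ?Q by standard (use X in auto)
  have "AE c in ?Q. fin c"
  proof (subst AE_distr_iff[OF \<Phi>])
    show "{x \<in> space (Lip1_borel X). fin x} \<in> sets (Lip1_borel X)" using sets_fin[of X] by simp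
  qed (rule f)
  then have "AE c in ?Q. stopping_time c < \<infinity>" using AE_space
    by eventually_elim (rule stopping_time_finite_iff[of _ X, THEN iffD2], simp_all only: Q.space_P)
  then have "traffic_plan X ?Q"
    unfolding traffic_plan_def
    by (auto simp: Q.finite_measure_axioms intro!: Lip1_inner_regular[OF X])
  moreover have "coupling ?Q = \<pi>"
  proof -
    have "(\<lambda>c. (e0 c, einf c)) \<in> borel_measurable (Lip1_borel X)"
      by (intro borel_measurable_Pair measurable_e0 measurable_einf)
    from distr_distr[OF this \<Phi>] show ?thesis unfolding coupling_def by (simp add: o_def \<pi>)
  qed
  ultimately show "?Q \<in> TP X \<pi>" by (simp add: TP_def)
  have th: "Q.th y = enn2real (mass M \<Phi> y)" for y
  proof -
    have "mass ?Q (\<lambda>c. c) y = mass M \<Phi> y" unfolding mass_def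
      by (subst nn_integral_distr[OF \<Phi>]) (auto intro!: measurable_ctrace_indicator[of _ _ X])
    then have "ennreal (Q.th y) = mass M \<Phi> y" by (simp add: Q.ennreal_th)
    then show ?thesis by (metis enn2real_ennreal Q.th_nonneg)
  qed
  have m: "(\<lambda>y. weight \<alpha> (enn2real (mass M \<Phi> y))) \<in> borel_measurable borel"
    unfolding th[symmetric] by measurable
  show "energy \<alpha> ?Q = (\<integral>\<^sup>+w. lint (\<Phi> w) (\<lambda>y. weight \<alpha> (enn2real (mass M \<Phi> y))) \<partial>M)"
    unfolding Q.energy_eq th
    by (rule nn_integral_distr[OF \<Phi>]) (auto intro!: measurable_lint_fixed[of _ _ X] m)
qed

lemma nn_integral_eq_imp_AE_eq:
  assumes [measurable]: "f \<in> borel_measurable M" "g \<in> borel_measurable M"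
    and le: "AE x in M. f x \<le> g x" and i: "nn_integral M g \<le> nn_integral M f" "nn_integral M f < \<infinity>"
  shows "AE x in M. f x = g x"
proof -
  have "(\<integral>\<^sup>+x. g x - f x \<partial>M) = nn_integral M g - nn_integral M f"
    by (rule nn_integral_diff) (use le i in auto)
  also have "\<dots> = 0"
  proof -
    have "nn_integral M g < top" using order_le_less_trans[OF i] by simp
    then show ?thesis using i(1) by (simp add: diff_eq_0_iff_ennreal)
  qed
  finally have "AE x in M. g x - f x = 0" by (subst (asm) nn_integral_0_iff_AE) auto
  moreover have "AE x in M. f x \<noteq> \<infinity>" by (rule nn_integral_PInf_AE) (use i in auto)
  ultimately show ?thesis using le
  proof eventually_elim
    case (elim x)
    then show ?case by (auto simp: diff_eq_0_iff_ennreal less_top[symmetric] intro: antisym)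
  qed
qed

lemma lint_eq_imp_AE_eq:
  assumes g: "c \<in> Lip1 X" and m: "f \<in> borel_measurable borel" "h \<in> borel_measurable borel"
    and le: "AE t in lborel. 0 \<le> t \<longrightarrow> 0 < sp c t \<longrightarrow> f (c t) \<le> h (c t)"
    and i: "lint c h \<le> lint c f" "lint c f < \<infinity>"
  shows "AE t in lborel. 0 \<le> t \<longrightarrow> 0 < sp c t \<longrightarrow> f (c t) = h (c t)"
proof -
  have "AE t in lborel. f (c t) * ennreal (sp c t) * indicator {0..} t = h (c t) * ennreal (sp c t) * indicator {0..} t"
  proof (rule nn_integral_eq_imp_AE_eq)
    show "AE t in lborel. f (c t) * ennreal (sp c t) * indicator {0..} t \<le> h (c t) * ennreal (sp c t) * indicator {0..} t"
      using le
    proof eventually_elim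
      case (elim t)
      then show ?case using sp_nonneg[of c t]
        by (cases "sp c t = 0") (auto simp: indicator_def intro!: mult_right_mono)
    qed
  qed (use i measurable_line_integrand[OF g m(1), of "{0..}"] measurable_line_integrand[OF g m(2), of "{0..}"]
      in \<open>auto simp: lint_def\<close>)
  then show ?thesis
  proof eventually_elim
    case (elim t)
    show ?case
    proof (intro impI)
      assume t: "0 \<le> t" "0 < sp c t"
      then have "f (c t) * ennreal (sp c t) = h (c t) * ennreal (sp c t)" using elim by simp
      then have "f (c t) * ennreal (sp c t) / ennreal (sp c t) = h (c t) * ennreal (sp c t) / ennreal (sp c t)" by simp
      then show "f (c t) = h (c t)" using t(2) by (simp add: ennreal_mult_divide_eq)
    qed
  qed
qed

lemma (in curve_plan) coupling_eq:
  assumes \<Phi>: "\<Phi> \<in> measurable P (Lip1_borel X)" and e: "AE c in P. \<Phi> c 0 = c 0 \<and> einf (\<Phi> c) = einf c"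
  shows "distr P borel (\<lambda>c. (e0 (\<Phi> c), einf (\<Phi> c))) = coupling P"
  unfolding coupling_def
proof (rule distr_cong_AE)
  have m: "(\<lambda>c. (e0 c, einf c)) \<in> borel_measurable (Lip1_borel X)"
    by (intro borel_measurable_Pair measurable_e0 measurable_einf)
  then show "(\<lambda>c. (e0 c, einf c)) \<in> borel_measurable P" by (simp add: measurable_P_iff)
  from measurable_compose[OF \<Phi> m] show "(\<lambda>c. (e0 (\<Phi> c), einf (\<Phi> c))) \<in> borel_measurable P" .
  show "AE c in P. (e0 (\<Phi> c), einf (\<Phi> c)) = (e0 c, einf c)"
    using e by eventually_elim (simp add: e0_def)
qed auto

lemma mass_le_th:
  assumes "curve_plan X P" and \<Phi>: "\<Phi> \<in> measurable P (Lip1_borel X)" and sub: "AE c in P. ctrace (\<Phi> c) \<subseteq> ctrace c"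
  shows "mass P \<Phi> y \<le> ennreal (curve_plan.th P y)"
proof -
  interpret curve_plan X P by fact
  show ?thesis unfolding ennreal_th mass_def
    by (rule nn_integral_mono_AE, use sub in eventually_elim) (auto simp: indicator_def)
qed

lemma weight_antimono: "0 \<le> u \<Longrightarrow> u \<le> v \<Longrightarrow> \<alpha> < 1 \<Longrightarrow> weight \<alpha> v \<le> weight \<alpha> u"
  by (cases "u = 0") (auto simp: weight_def intro!: ennreal_leI powr_mono2')

text \<open>Finite energy is assumed here and discharged at the end by the dyadic competitor of
  \<open>exists_finite_energy\<close>; as \<open>P\<close> is minimal, a single competitor of finite
  energy is enough.\<close>

locale optimal_plan = curve_plan X P for X :: "'a::euclidean_space set" and P +
  fixes \<alpha> :: real
  assumes \<alpha>: "0 < \<alpha>" "\<alpha> < 1" and AE_fin: "AE c in P. fin c"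
    and opt: "\<And>Q. Q \<in> TP X (coupling P) \<Longrightarrow> energy \<alpha> P \<le> energy \<alpha> Q"
    and fin_energy: "energy \<alpha> P < \<infinity>"
begin

definition W :: "'a \<Rightarrow> ennreal" where "W y = weight \<alpha> (th y)"

lemma measurable_W [measurable]: "W \<in> borel_measurable borel"
  unfolding W_def[abs_def] by measurable

lemma W_pos: "0 < th y \<Longrightarrow> W y = ennreal (th y powr (\<alpha> - 1))"
  by (simp add: W_def weight_def)

lemma energy_W: "energy \<alpha> P = (\<integral>\<^sup>+c. lint c W \<partial>P)"
  unfolding energy_eq W_def[abs_def] ..

lemmas AE_pos = AE_moving_pos(1)[OF fin_energy]

lemma AE_W_fin: "AE c in P. lint c W < \<infinity>"
  using AE_moving_pos(2)[OF fin_energy] unfolding W_def[abs_def] .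

definition Mt :: real where "Mt = measure P (space P)"

text \<open>The factor \<open>2 powr (1 - \<alpha>)\<close> by which the weight grows when the
  multiplicity is halved.\<close>

definition cc :: ennreal where "cc = ennreal ((1 / 2) powr (\<alpha> - 1))"

text \<open>Multiplicities are at most the total mass and the weight is decreasing; in this way
  energy controls length.\<close>

lemma W_ge: "ennreal (Mt powr (\<alpha> - 1)) \<le> W y"
proof (cases "th y = 0")
  case False
  then have "0 < th y" "th y \<le> Mt" using th_nonneg[of y] th_le[of y] by (auto simp: Mt_def order_less_le)
  then show ?thesis using \<alpha> by (simp add: W_pos powr_mono2' ennreal_leI)
qed (simp add: W_def weight_def)

lemma weight_half_le: "th y \<le> m \<Longrightarrow> weight \<alpha> (m / 2) \<le> cc * W y"
proof (cases "th y = 0")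
  case True then show ?thesis by (simp add: W_def weight_def cc_def ennreal_mult_top)
next
  case False
  assume m: "th y \<le> m"
  have p: "0 < th y" using False th_nonneg[of y] by (simp add: order_less_le)
  have "weight \<alpha> (m / 2) \<le> weight \<alpha> (1 / 2 * th y)"
    using m p by (intro weight_antimono \<alpha>) auto
  also have "\<dots> = ennreal ((1 / 2 * th y) powr (\<alpha> - 1))" using p by (simp add: weight_def)
  also have "(1 / 2 * th y) powr (\<alpha> - 1) = (1 / 2) powr (\<alpha> - 1) * th y powr (\<alpha> - 1)"
    by (rule powr_mult)
  also have "ennreal \<dots> = cc * W y" using p unfolding cc_def W_pos[OF p] by (intro ennreal_mult) auto
  finally show ?thesis .
qed

text \<open>For positive \<open>u\<close> the left side is \<open>u powr \<alpha> / v\<close>, and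
  the right side is \<open>v powr \<alpha> / v\<close>; the equality case is strict monotonicity of
  the power.\<close>

lemma weight_ratio_le:
  assumes u: "0 \<le> u" "u \<le> v"
  shows "weight \<alpha> u * ennreal (1 / v) * ennreal u \<le> weight \<alpha> v"
    and "0 < v \<Longrightarrow> weight \<alpha> u * ennreal (1 / v) * ennreal u = weight \<alpha> v \<Longrightarrow> u = v"
proof -
  have e: "weight \<alpha> u * ennreal (1 / v) * ennreal u = ennreal (u powr \<alpha> / v)" if "0 < u"
  proof -
    have "weight \<alpha> u * ennreal (1 / v) * ennreal u = ennreal (u powr (\<alpha> - 1) * (1 / v) * u)"
      using that u by (simp add: weight_def ennreal_mult[symmetric])
    also have "u powr (\<alpha> - 1) * (1 / v) * u = u powr \<alpha> / v"
      using that by (simp add: powr_diff)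
    finally show ?thesis .
  qed
  have v: "v powr (\<alpha> - 1) = v powr \<alpha> / v" if "0 < v" using that by (simp add: powr_diff)
  show "weight \<alpha> u * ennreal (1 / v) * ennreal u \<le> weight \<alpha> v"
  proof (cases "u = 0")
    case False
    then have "0 < u" "0 < v" using u by auto
    then show ?thesis using u \<alpha> by (simp add: e) (simp add: weight_def v divide_right_mono powr_mono2)
  qed simp
  assume v0: "0 < v" and eq: "weight \<alpha> u * ennreal (1 / v) * ennreal u = weight \<alpha> v"
  show "u = v"
  proof (cases "u = 0")
    case True
    then show ?thesis using eq v0 by (simp add: weight_def)
  next
    case False
    then have "0 < u" using u by auto
    then have "u powr \<alpha> / v = v powr \<alpha> / v" using eq v0 by (simp add: e) (simp add: weight_def v)
    then have "u powr \<alpha> = v powr \<alpha>" using v0 by simp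
    then show ?thesis using \<open>0 < u\<close> v0 \<alpha>(1)
      by (metis powr_less_mono2 less_imp_le linorder_neqE_linordered_idom order_less_irrefl)
  qed
qed

text \<open>Erasing loops lowers the multiplicity and so raises the weight on what remains; the gain
  is not evident. By exchange the energy of the erased plan is at most \<open>A\<close>, which is at
  most the energy of \<open>P\<close>. Optimality forces equality throughout, hence an unchanged
  multiplicity along the curves; and at equal weight strictly shorter curves would be
  cheaper.\<close>

lemma AE_simple: "AE \<gamma> in P. simple_curve \<gamma>"
proof -
  obtain er where er: "er \<in> measurable (Lip1_borel X) (Lip1_borel X)"
    "\<And>\<gamma>. \<gamma> \<in> Lip1 X \<Longrightarrow> fin \<gamma> \<Longrightarrow> simple_curve (er \<gamma>) \<and> fin (er \<gamma>) \<and> er \<gamma> 0 = \<gamma> 0 \<and> einf (er \<gamma>) = einf \<gamma> \<and>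
       ctrace (er \<gamma>) \<subseteq> ctrace \<gamma> \<and> (\<not> simple_curve \<gamma> \<longrightarrow> lint (er \<gamma>) (\<lambda>_. 1) < lint \<gamma> (\<lambda>_. 1))"
    using loop_erasure[OF X] by blast
  have erP: "er \<in> measurable P (Lip1_borel X)" using er(1) by (simp add: measurable_P_iff)
  have AE: "AE \<gamma> in P. \<gamma> \<in> Lip1 X \<and> fin \<gamma> \<and> er \<gamma> \<in> Lip1 X \<and> simple_curve (er \<gamma>) \<and> fin (er \<gamma>) \<and> er \<gamma> 0 = \<gamma> 0 \<and> einf (er \<gamma>) = einf \<gamma> \<and>
       ctrace (er \<gamma>) \<subseteq> ctrace \<gamma> \<and> (\<not> simple_curve \<gamma> \<longrightarrow> lint (er \<gamma>) (\<lambda>_. 1) < lint \<gamma> (\<lambda>_. 1))"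
    using AE_fin AE_space
  proof eventually_elim
    case (elim \<gamma>)
    then have g: "\<gamma> \<in> Lip1 X" by (simp add: space_P)
    moreover have "er \<gamma> \<in> Lip1 X" using measurable_space[OF er(1), of \<gamma>] g by simp
    ultimately show ?case using er(2)[OF g elim(1)] elim(1) by blast
  qed
  define th' where "th' y = enn2real (mass P er y)" for y
  have sf: "sigma_finite_measure P" by (rule sigma_finite_measure_axioms)
  have massm: "mass P er \<in> borel_measurable borel" by (rule measurable_mass[OF erP sf])
  have [measurable]: "th' \<in> borel_measurable borel" unfolding th'_def[abs_def] using massm by measurable
  have mle: "mass P er y \<le> ennreal (th y)" for y
    by (rule mass_le_th[OF curve_plan_axioms erP]) (use AE in \<open>auto elim: eventually_mono\<close>)
  have th': "mass P er y = ennreal (th' y)" "0 \<le> th' y" "th' y \<le> th y" for y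
  proof -
    show 1: "mass P er y = ennreal (th' y)" unfolding th'_def
      using mle[of y] by (simp add: ennreal_enn2real order_le_less_trans)
    show "0 \<le> th' y" by (simp add: th'_def)
    show "th' y \<le> th y" using mle[of y] unfolding 1 by simp
  qed
  have le: "lint (er \<gamma>) f \<le> lint \<gamma> f"
    if g: "\<gamma> \<in> Lip1 X" "er \<gamma> \<in> Lip1 X" "simple_curve (er \<gamma>)" "fin (er \<gamma>)" "ctrace (er \<gamma>) \<subseteq> ctrace \<gamma>" and f: "f \<in> borel_measurable borel" for \<gamma> f
  proof -
    have "lint (er \<gamma>) f \<le> lint (er \<gamma>) (\<lambda>y. f y * indicator (ctrace \<gamma>) y)"
    proof (rule lint_mono)
      fix t :: real assume "0 \<le> t"
      then have "er \<gamma> t \<in> ctrace \<gamma>" using g(5) by (auto simp: ctrace_def)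
      then show "f (er \<gamma> t) \<le> f (er \<gamma> t) * indicator (ctrace \<gamma>) (er \<gamma> t)" by simp
    qed
    also have "\<dots> \<le> lint \<gamma> (\<lambda>y. f y * indicator (ctrace (er \<gamma>)) y)"
      by (rule lint_trace_le[OF g(2,3,4,1) f])
    also have "\<dots> \<le> lint \<gamma> f" by (rule lint_mono) (simp add: indicator_def)
    finally show ?thesis .
  qed
  define E' where "E' = (\<integral>\<^sup>+\<gamma>. lint (er \<gamma>) (\<lambda>y. weight \<alpha> (th' y)) \<partial>P)"
  have opt': "energy \<alpha> P \<le> E'"
  proof -
    have c: "distr P borel (\<lambda>\<gamma>. (e0 (er \<gamma>), einf (er \<gamma>))) = coupling P"
      by (rule coupling_eq[OF erP]) (use AE in \<open>auto elim: eventually_mono\<close>)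
    have f: "AE \<gamma> in P. fin (er \<gamma>)" using AE by (auto elim: eventually_mono)
    show ?thesis using opt[OF TP_distr(1)[OF X finite_measure_axioms erP f c]]
      unfolding TP_distr(2)[OF X finite_measure_axioms erP f c] E'_def th'_def .
  qed
  have AEpos': "AE \<gamma> in P. AE t in lborel. 0 \<le> t \<longrightarrow> 0 < sp (er \<gamma>) t \<longrightarrow> 0 < th (er \<gamma> t)"
    using AE AE_pos
  proof eventually_elim
    case (elim \<gamma>)
    have m: "indicator {y. th y = 0} \<in> borel_measurable borel" by measurable
    have "lint \<gamma> (indicator {y. th y = 0}) = 0"
      using elim by (subst lint_eq_0_iff[OF _ m]) (auto elim!: eventually_mono simp: indicator_def)
    then have "lint (er \<gamma>) (indicator {y. th y = 0}) = 0"
      using le[of \<gamma> "indicator {y. th y = 0}"] elim(1) m by (metis le_zero_eq)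
    then have "AE t in lborel. 0 \<le> t \<longrightarrow> 0 < sp (er \<gamma>) t \<longrightarrow> (indicator {y. th y = 0} (er \<gamma> t) :: ennreal) = 0"
      using elim(1) m by (subst (asm) lint_eq_0_iff) auto
    then show ?case
    proof eventually_elim
      case (elim t)
      then show ?case using th_nonneg[of "er \<gamma> t"] by (auto simp: indicator_def order_less_le split: if_splits)
    qed
  qed
  \<comment> \<open>Prepared for the exchange: where \<open>th\<close> is positive, \<open>F\<close>
    times \<open>th\<close> is the weight of the erased plan, and exchanging replaces the factor
    \<open>th\<close> by \<open>th'\<close>.\<close>
  define F where "F y = weight \<alpha> (th' y) * ennreal (1 / th y)" for y
  have [measurable]: "F \<in> borel_measurable borel" unfolding F_def[abs_def] by measurable
  define A where "A = (\<integral>\<^sup>+\<gamma>. lint \<gamma> (\<lambda>y. F y * ennreal (th' y)) \<partial>P)"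
  have EA: "E' \<le> A"
  proof -
    have "E' \<le> (\<integral>\<^sup>+\<gamma>. lint (er \<gamma>) (\<lambda>y. F y * mass P (\<lambda>\<gamma>. \<gamma>) y) \<partial>P)"
      unfolding E'_def
    proof (rule nn_integral_mono_AE, use AEpos' in eventually_elim)
      case (elim \<gamma>)
      show ?case
      proof (rule lint_mono_AE, use elim in eventually_elim)
        case (elim t)
        show ?case
        proof (intro impI)
          assume "0 \<le> t" "0 < sp (er \<gamma>) t"
          then have p: "0 < th (er \<gamma> t)" using elim by simp
          have "ennreal (1 / th (er \<gamma> t)) * ennreal (th (er \<gamma> t)) = 1"
            using p by (simp add: ennreal_mult''[symmetric])
          then show "weight \<alpha> (th' (er \<gamma> t)) \<le> F (er \<gamma> t) * mass P (\<lambda>\<gamma>. \<gamma>) (er \<gamma> t)"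
            by (simp add: F_def ennreal_th[symmetric] mult.assoc)
        qed
      qed
    qed
    also have "\<dots> \<le> (\<integral>\<^sup>+\<eta>. lint \<eta> (\<lambda>y. F y * mass P er y) \<partial>P)"
      by (rule lint_mass_le_fixed[OF sf sf erP id_P]) (use AE in \<open>auto elim: eventually_mono\<close>)
    finally show ?thesis unfolding A_def th'(1) .
  qed
  have FW: "F y * ennreal (th' y) \<le> W y" for y
    unfolding F_def W_def by (rule weight_ratio_le(1)) (use th' in auto)
  have mA: "(\<lambda>\<gamma>. lint \<gamma> (\<lambda>y. F y * ennreal (th' y))) \<in> borel_measurable P"
    by (rule measurable_lint_fixed[OF id_P]) measurable
  have mW: "(\<lambda>\<gamma>. lint \<gamma> W) \<in> borel_measurable P" by (rule measurable_lint_fixed[OF id_P]) measurable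
  have AE_eq: "AE \<gamma> in P. lint \<gamma> (\<lambda>y. F y * ennreal (th' y)) = lint \<gamma> W"
  proof (rule nn_integral_eq_imp_AE_eq[OF mA mW])
    show "AE \<gamma> in P. lint \<gamma> (\<lambda>y. F y * ennreal (th' y)) \<le> lint \<gamma> W" by (intro AE_I2 lint_mono FW)
    show "(\<integral>\<^sup>+\<gamma>. lint \<gamma> W \<partial>P) \<le> (\<integral>\<^sup>+\<gamma>. lint \<gamma> (\<lambda>y. F y * ennreal (th' y)) \<partial>P)"
      using order_trans[OF opt' EA] unfolding energy_W A_def .
    have "A \<le> (\<integral>\<^sup>+\<gamma>. lint \<gamma> W \<partial>P)" unfolding A_def by (intro nn_integral_mono lint_mono FW)
    then show "(\<integral>\<^sup>+\<gamma>. lint \<gamma> (\<lambda>y. F y * ennreal (th' y)) \<partial>P) < \<infinity>"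
      using fin_energy unfolding energy_W A_def by (rule order_le_less_trans)
  qed
  have AE_th: "AE \<gamma> in P. lint \<gamma> (indicator {y. th' y \<noteq> th y}) = 0"
    using AE_eq AE_W_fin AE_pos AE
  proof eventually_elim
    case (elim \<gamma>)
    have g: "\<gamma> \<in> Lip1 X" using elim by blast
    have "AE t in lborel. 0 \<le> t \<longrightarrow> 0 < sp \<gamma> t \<longrightarrow> F (\<gamma> t) * ennreal (th' (\<gamma> t)) = W (\<gamma> t)"
      by (rule lint_eq_imp_AE_eq[OF g]) (use elim FW in auto)
    then have "AE t in lborel. 0 \<le> t \<longrightarrow> 0 < sp \<gamma> t \<longrightarrow> (indicator {y. th' y \<noteq> th y} (\<gamma> t) :: ennreal) = 0"
      using elim(3)
    proof eventually_elim
      case (elim t)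
      show ?case
      proof (intro impI)
        assume t: "0 \<le> t" "0 < sp \<gamma> t"
        have "th' (\<gamma> t) = th (\<gamma> t)"
          by (rule weight_ratio_le(2)) (use elim t th' in \<open>auto simp: F_def W_def\<close>)
        then show "(indicator {y. th' y \<noteq> th y} (\<gamma> t) :: ennreal) = 0" by simp
      qed
    qed
    then show ?case by (subst lint_eq_0_iff[OF g]) auto
  qed
  have EW: "energy \<alpha> P \<le> (\<integral>\<^sup>+\<gamma>. lint (er \<gamma>) W \<partial>P)"
  proof (rule order_trans[OF opt'])
    show "E' \<le> (\<integral>\<^sup>+\<gamma>. lint (er \<gamma>) W \<partial>P)" unfolding E'_def
    proof (rule nn_integral_mono_AE, use AE_th AE in eventually_elim)
      case (elim \<gamma>)
      have m: "(indicator {y. th' y \<noteq> th y} :: 'a \<Rightarrow> ennreal) \<in> borel_measurable borel" by measurable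
      have "lint (er \<gamma>) (indicator {y. th' y \<noteq> th y}) = 0"
        using le[of \<gamma> "indicator {y. th' y \<noteq> th y}"] elim m by (metis le_zero_eq)
      then have "AE t in lborel. 0 \<le> t \<longrightarrow> 0 < sp (er \<gamma>) t \<longrightarrow> (indicator {y. th' y \<noteq> th y} (er \<gamma> t) :: ennreal) = 0"
        using elim m by (subst (asm) lint_eq_0_iff) auto
      then show ?case
        by (intro lint_mono_AE) (auto elim!: eventually_mono simp: W_def indicator_def split: if_splits)
    qed
  qed
  have merW: "(\<lambda>\<gamma>. lint (er \<gamma>) W) \<in> borel_measurable P" by (rule measurable_lint_fixed[OF erP]) measurable
  have AE_eqW: "AE \<gamma> in P. lint (er \<gamma>) W = lint \<gamma> W"
  proof (rule nn_integral_eq_imp_AE_eq[OF merW mW])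
    show leW: "AE \<gamma> in P. lint (er \<gamma>) W \<le> lint \<gamma> W" using AE by eventually_elim (auto intro!: le)
    show "(\<integral>\<^sup>+\<gamma>. lint \<gamma> W \<partial>P) \<le> (\<integral>\<^sup>+\<gamma>. lint (er \<gamma>) W \<partial>P)" using EW unfolding energy_W .
    have "(\<integral>\<^sup>+\<gamma>. lint (er \<gamma>) W \<partial>P) \<le> (\<integral>\<^sup>+\<gamma>. lint \<gamma> W \<partial>P)" by (rule nn_integral_mono_AE[OF leW])
    then show "(\<integral>\<^sup>+\<gamma>. lint (er \<gamma>) W \<partial>P) < \<infinity>" using fin_energy unfolding energy_W by (rule order_le_less_trans)
  qed
  show ?thesis
  proof (cases "Mt = 0")
    case True
    then have "emeasure P (space P) = 0" by (simp add: Mt_def emeasure_eq_measure)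
    then have "space P \<in> null_sets P" by auto
    then show ?thesis by (rule AE_I') auto
  next
    case False
    then have Mt: "0 < Mt" by (simp add: Mt_def order_less_le)
    define c where "c = ennreal (Mt powr (\<alpha> - 1))"
    have c: "c \<noteq> 0" "c \<noteq> \<infinity>" using Mt by (auto simp: c_def)
    have cW: "c \<le> W y" for y unfolding c_def by (rule W_ge)
    \<comment> \<open>Strict decrease is known for the length only. The constant lower bound
      \<open>c\<close> of the weight is therefore split off; the integral of the remainder does not
      increase under erasure.\<close>
    have dW: "W y = c * 1 + (W y - c)" for y using cW[of y] by (simp add: add_diff_inverse_ennreal)
    show ?thesis using AE_eqW AE_W_fin AE
    proof eventually_elim
      case (elim \<gamma>)
      have g: "\<gamma> \<in> Lip1 X" "er \<gamma> \<in> Lip1 X" using elim by auto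
      have s: "lint \<eta> W = c * lint \<eta> (\<lambda>_. 1) + lint \<eta> (\<lambda>y. W y - c)" if "\<eta> \<in> Lip1 X" for \<eta>
      proof -
        have "lint \<eta> W = lint \<eta> (\<lambda>y. c * 1 + (W y - c))" by (simp only: dW[symmetric])
        also have "\<dots> = lint \<eta> (\<lambda>y. c * 1) + lint \<eta> (\<lambda>y. W y - c)" by (rule lint_add[OF that]) auto
        also have "lint \<eta> (\<lambda>y. c * 1) = c * lint \<eta> (\<lambda>_. 1)" by (rule lint_cmult[OF that]) auto
        finally show ?thesis .
      qed
      have l1: "lint (er \<gamma>) (\<lambda>y. W y - c) \<le> lint \<gamma> (\<lambda>y. W y - c)" using elim by (intro le) auto
      have fin: "lint \<gamma> (\<lambda>y. W y - c) < \<infinity>" using elim(2) s[OF g(1)] by (simp add: less_top[symmetric])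
      show "simple_curve \<gamma>"
      proof (rule ccontr)
        assume "\<not> simple_curve \<gamma>"
        then have "lint (er \<gamma>) (\<lambda>_. 1) < lint \<gamma> (\<lambda>_. 1)" using elim by blast
        then have "c * lint (er \<gamma>) (\<lambda>_. 1) < c * lint \<gamma> (\<lambda>_. 1)"
          by (rule ennreal_mult_strict_left_mono) (use c in \<open>auto simp: less_top[symmetric] zero_less_iff_neq_zero\<close>)
        then have "lint \<gamma> (\<lambda>y. W y - c) + c * lint (er \<gamma>) (\<lambda>_. 1) < lint \<gamma> (\<lambda>y. W y - c) + c * lint \<gamma> (\<lambda>_. 1)"
          using fin by (simp add: ennreal_add_left_cancel_less)
        moreover have "lint (er \<gamma>) W \<le> lint \<gamma> (\<lambda>y. W y - c) + c * lint (er \<gamma>) (\<lambda>_. 1)"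
          unfolding s[OF g(2)] using l1 by (simp add: add.commute add_left_mono)
        ultimately have "lint (er \<gamma>) W < lint \<gamma> (\<lambda>y. W y - c) + c * lint \<gamma> (\<lambda>_. 1)"
          by (rule order_le_less_trans[rotated])
        then have "lint (er \<gamma>) W < lint \<gamma> W"
          unfolding s[OF g(1)] by (simp only: add.commute)
        then show False using elim(1) by simp
      qed
    qed
  qed
qed

lemma AE_good: "AE c in P. simple_curve c \<and> fin c"
  using AE_simple AE_fin by eventually_elim simp

lemmas AE_swap' = AE_swap[OF AE_good AE_pos]

end

section \<open>Dyadic paths\<close>

text \<open>Jensen's inequality for the concave power, obtained by bounding each term by the tangent
  at the mean value \<open>s = m / n\<close>.\<close>

lemma sum_powr_le:
  fixes a :: "'i \<Rightarrow> real"
  assumes I: "finite I" "real (card I) \<le> n" "0 < n" and a: "\<And>i. i \<in> I \<Longrightarrow> 0 \<le> a i" and \<alpha>: "0 < \<alpha>" "\<alpha> < 1"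
    and m: "(\<Sum>i\<in>I. a i) \<le> m"
  shows "(\<Sum>i\<in>I. a i powr \<alpha>) \<le> n powr (1 - \<alpha>) * m powr \<alpha>"
proof (cases "m = 0")
  case True
  have "0 \<le> (\<Sum>i\<in>I. a i)" by (rule sum_nonneg) (rule a)
  then have "(\<Sum>i\<in>I. a i) = 0" using m True by linarith
  then have "\<forall>i\<in>I. a i = 0" using sum_nonneg_eq_0_iff[where f=a, OF I(1) a] by simp
  then show ?thesis using True by simp
next
  case False
  have "0 \<le> (\<Sum>i\<in>I. a i)" by (rule sum_nonneg) (rule a)
  then have "0 \<le> m" using m by linarith
  then have m0: "0 < m" using False by simp
  define s where "s = m / n"
  have s: "0 < s" using m0 I by (simp add: s_def)
  have y: "x powr \<alpha> \<le> \<alpha> * x * s powr (\<alpha> - 1) + (1 - \<alpha>) * s powr \<alpha>" if "0 \<le> x" for x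
  proof (cases "x = 0")
    case False
    then have x: "0 < x" using that by simp
    have "x powr \<alpha> * s powr (1 - \<alpha>) \<le> \<alpha> * x + (1 - \<alpha>) * s"
      using Youngs_inequality_0[of \<alpha> "1 - \<alpha>" x s] \<alpha> x s by simp
    then have "x powr \<alpha> * s powr (1 - \<alpha>) * s powr (\<alpha> - 1) \<le> (\<alpha> * x + (1 - \<alpha>) * s) * s powr (\<alpha> - 1)"
      by (rule mult_right_mono) simp
    moreover have "s powr (1 - \<alpha>) * s powr (\<alpha> - 1) = 1" using s by (simp add: powr_add[symmetric])
    moreover have "s * s powr (\<alpha> - 1) = s powr \<alpha>" using s by (simp add: powr_diff)
    ultimately show ?thesis by (simp add: algebra_simps)
  qed (use \<alpha> s in simp)
  have "(\<Sum>i\<in>I. a i powr \<alpha>) \<le> (\<Sum>i\<in>I. \<alpha> * a i * s powr (\<alpha> - 1) + (1 - \<alpha>) * s powr \<alpha>)"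
    by (intro sum_mono y a)
  also have "\<dots> = \<alpha> * s powr (\<alpha> - 1) * (\<Sum>i\<in>I. a i) + (1 - \<alpha>) * s powr \<alpha> * real (card I)"
    by (simp add: sum.distrib sum_distrib_left sum_distrib_right mult_ac)
  also have "\<dots> \<le> \<alpha> * s powr (\<alpha> - 1) * m + (1 - \<alpha>) * s powr \<alpha> * n"
    using m I \<alpha> by (intro add_mono mult_left_mono) auto
  also have "m = s * n" using I by (simp add: s_def)
  also have "\<alpha> * s powr (\<alpha> - 1) * (s * n) + (1 - \<alpha>) * s powr \<alpha> * n = s powr \<alpha> * n"
    using s by (simp add: powr_diff field_simps)
  also have "\<dots> = n powr (1 - \<alpha>) * m powr \<alpha>"
    using s I m0 by (simp add: s_def powr_divide powr_diff)
  finally show ?thesis by (simp add: s_def)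
qed

lemma measurable_finite_range:
  assumes u[measurable]: "u \<in> borel_measurable M" and V: "finite V" "\<And>w. w \<in> space M \<Longrightarrow> u w \<in> V"
    and h: "\<And>v. v \<in> V \<Longrightarrow> h v \<in> space N"
  shows "(\<lambda>w. h (u w :: 'a::euclidean_space)) \<in> measurable M N"
proof (rule measurable_compose_countable'[where I=V and f="\<lambda>v _. h v"])
  show "u \<in> measurable M (count_space V)"
    unfolding measurable_count_space_eq2[OF V(1)] using V(2) by auto
qed (use V h in \<open>auto intro: countable_finite\<close>)

lemma nn_integral_finite_range:
  assumes u[measurable]: "u \<in> borel_measurable M" and V: "finite V" "\<And>\<omega>. \<omega> \<in> space M \<Longrightarrow> u \<omega> \<in> V"
  shows "(\<integral>\<^sup>+\<omega>. h (u \<omega> :: 'a::euclidean_space) \<partial>M) = (\<Sum>v\<in>V. h v * emeasure M {\<omega>\<in>space M. u \<omega> = v})"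
proof -
  have "(\<integral>\<^sup>+\<omega>. h (u \<omega>) \<partial>M) = (\<integral>\<^sup>+\<omega>. (\<Sum>v\<in>V. h v * indicator {\<omega>\<in>space M. u \<omega> = v} \<omega>) \<partial>M)"
  proof (rule nn_integral_cong)
    fix \<omega> assume w: "\<omega> \<in> space M"
    have "(\<Sum>v\<in>V. h v * indicator {\<omega>\<in>space M. u \<omega> = v} \<omega>) = (\<Sum>v\<in>V. if v = u \<omega> then h v else 0)"
      by (intro sum.cong) (use w in \<open>auto simp: indicator_def\<close>)
    then show "h (u \<omega>) = (\<Sum>v\<in>V. h v * indicator {\<omega>\<in>space M. u \<omega> = v} \<omega>)"
      using V w by simp
  qed
  also have "\<dots> = (\<Sum>v\<in>V. h v * emeasure M {\<omega>\<in>space M. u \<omega> = v})"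
    by (subst nn_integral_sum) (auto simp: nn_integral_cmult_indicator)
  finally show ?thesis .
qed

lemma ennreal_le_suminf: "f i \<le> (\<Sum>i. f i :: ennreal)"
  using sum_le_suminf[of f "{i}"] by simp

locale dyadic =
  fixes X :: "'a::euclidean_space set" and B \<alpha> :: real
  assumes convX: "convex X" and B: "0 < B" "\<And>x b. x \<in> X \<Longrightarrow> b \<in> Basis \<Longrightarrow> \<bar>x \<bullet> b\<bar> < B"
    and \<alpha>d: "1 - 1 / real DIM('a) < \<alpha>" and \<alpha>1: "\<alpha> < 1"
begin

text \<open>The integer coordinates of the dyadic cube of side \<open>2 * B / 2 ^ k\<close> that
  contains \<open>x\<close>, counted from the corner of the cube with all coordinates in
  \<open>[-B, B)\<close>.\<close>

definition cell :: "nat \<Rightarrow> 'a \<Rightarrow> 'a" where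
  "cell k x = (\<Sum>b\<in>Basis. of_int \<lfloor>2 ^ k * ((x \<bullet> b + B) / (2 * B))\<rfloor> *\<^sub>R b)"

lemma cell_inner: "b \<in> Basis \<Longrightarrow> cell k x \<bullet> b = of_int \<lfloor>2 ^ k * ((x \<bullet> b + B) / (2 * B))\<rfloor>"
  by (simp add: cell_def inner_sum_left inner_Basis if_distrib[of "\<lambda>c. _ * c"] sum.delta cong: if_cong)

lemma cell_eq_iff: "cell k x = cell k y \<longleftrightarrow>
    (\<forall>b\<in>Basis. \<lfloor>2 ^ k * ((x \<bullet> b + B) / (2 * B))\<rfloor> = \<lfloor>2 ^ k * ((y \<bullet> b + B) / (2 * B))\<rfloor>)"
  unfolding euclidean_eq_iff[of "cell k x"] by (simp add: cell_inner)

lemma cell_Suc: "cell (Suc k) x = cell (Suc k) y \<Longrightarrow> cell k x = cell k y"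
proof -
  have h: "\<lfloor>u\<rfloor> = \<lfloor>2 * u\<rfloor> div 2" for u :: real
    using floor_divide_real_eq_div[of 2 "2 * u"] by simp
  have h2: "\<lfloor>2 ^ k * u\<rfloor> = \<lfloor>2 ^ Suc k * u\<rfloor> div 2" for u :: real
    using h[of "2 ^ k * u"] by (simp add: mult.assoc)
  assume e: "cell (Suc k) x = cell (Suc k) y"
  show "cell k x = cell k y"
  proof (rule iffD2[OF cell_eq_iff], rule ballI)
    fix b :: 'a assume "b \<in> Basis"
    then have "\<lfloor>2 ^ Suc k * ((x \<bullet> b + B) / (2 * B))\<rfloor> = \<lfloor>2 ^ Suc k * ((y \<bullet> b + B) / (2 * B))\<rfloor>"
      using e cell_eq_iff by blast
    then show "\<lfloor>2 ^ k * ((x \<bullet> b + B) / (2 * B))\<rfloor> = \<lfloor>2 ^ k * ((y \<bullet> b + B) / (2 * B))\<rfloor>" by (simp only: h2)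
  qed
qed

definition K :: real where "K = 2 * B * real DIM('a)"

lemma K_pos: "0 < K" using B by (simp add: K_def)

lemma cell_dist: "cell k x = cell k y \<Longrightarrow> dist x y \<le> K / 2 ^ k"
proof -
  assume e: "cell k x = cell k y"
  have "\<bar>(x - y) \<bullet> b\<bar> \<le> 2 * B / 2 ^ k" if b: "b \<in> Basis" for b
  proof -
    let ?u = "2 ^ k * ((x \<bullet> b + B) / (2 * B))" and ?v = "2 ^ k * ((y \<bullet> b + B) / (2 * B))"
    have "\<lfloor>?u\<rfloor> = \<lfloor>?v\<rfloor>" using e b by (simp only: cell_eq_iff)
    then have "\<bar>?u - ?v\<bar> \<le> 1"
      using of_int_floor_le[of ?u] of_int_floor_le[of ?v] real_of_int_floor_add_one_ge[of ?u] real_of_int_floor_add_one_ge[of ?v]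
      by linarith
    moreover have "?u - ?v = ((x - y) \<bullet> b) * (2 ^ k / (2 * B))"
      using B(1) by (simp add: inner_diff_left field_simps)
    moreover have p: "0 < 2 ^ k / (2 * B)" using B(1) by simp
    ultimately have "\<bar>(x - y) \<bullet> b\<bar> * (2 ^ k / (2 * B)) \<le> 1"
      by (simp only: abs_mult abs_of_pos[OF p])
    then show ?thesis using B(1) by (simp add: field_simps)
  qed
  then have "(\<Sum>b\<in>Basis. \<bar>(x - y) \<bullet> b\<bar>) \<le> (\<Sum>b\<in>(Basis :: 'a set). 2 * B / 2 ^ k)" by (rule sum_mono)
  moreover have "norm (x - y) \<le> (\<Sum>b\<in>Basis. \<bar>(x - y) \<bullet> b\<bar>)" by (rule norm_le_l1)
  moreover have "(\<Sum>b\<in>(Basis :: 'a set). 2 * B / 2 ^ k) = K / 2 ^ k" by (simp add: K_def)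
  ultimately show "dist x y \<le> K / 2 ^ k" by (simp only: dist_norm)
qed

definition cells :: "nat \<Rightarrow> 'a set" where
  "cells k = (\<lambda>f. \<Sum>b\<in>Basis. of_int (f b) *\<^sub>R b) ` (Basis \<rightarrow>\<^sub>E {0..<2 ^ k})"

lemma cells: "finite (cells k)" "card (cells k) \<le> (2 ^ k) ^ DIM('a)" "x \<in> X \<Longrightarrow> cell k x \<in> cells k"
proof -
  have f: "finite ((Basis :: 'a set) \<rightarrow>\<^sub>E {0..<(2::int) ^ k})" by (intro finite_PiE) auto
  then show "finite (cells k)" by (simp add: cells_def)
  have "card (cells k) \<le> card ((Basis :: 'a set) \<rightarrow>\<^sub>E {0..<(2::int) ^ k})"
    unfolding cells_def by (rule card_image_le[OF f])
  also have "\<dots> = (2 ^ k) ^ DIM('a)" by (simp add: card_PiE nat_power_eq)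
  finally show "card (cells k) \<le> (2 ^ k) ^ DIM('a)" .
  assume x: "x \<in> X"
  show "cell k x \<in> cells k" unfolding cells_def
  proof (rule image_eqI)
    show "cell k x = (\<Sum>b\<in>Basis. of_int ((\<lambda>b\<in>Basis. \<lfloor>2 ^ k * ((x \<bullet> b + B) / (2 * B))\<rfloor>) b) *\<^sub>R b)"
      unfolding cell_def by (rule sum.cong) auto
    show "(\<lambda>b\<in>Basis. \<lfloor>2 ^ k * ((x \<bullet> b + B) / (2 * B))\<rfloor>) \<in> Basis \<rightarrow>\<^sub>E {0..<2 ^ k}"
    proof (intro restrict_PiE_iff[THEN iffD2] ballI)
      fix b :: 'a assume b: "b \<in> Basis"
      define u where "u = (x \<bullet> b + B) / (2 * B)"
      have "0 \<le> u" "u < 1"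
        unfolding u_def using B(1) B(2)[OF x b] by (auto simp: field_simps)
      then have "0 \<le> 2 ^ k * u" "2 ^ k * u < 2 ^ k"
        using mult_strict_left_mono[of u 1 "2 ^ k"] by simp_all
      then show "\<lfloor>2 ^ k * ((x \<bullet> b + B) / (2 * B))\<rfloor> \<in> {0..<2 ^ k}"
        unfolding u_def[symmetric] by (auto simp: floor_less_iff)
    qed
  qed
qed

lemma measurable_cell [measurable]: "cell k \<in> borel_measurable borel"
  unfolding cell_def[abs_def] by measurable

text \<open>A point of \<open>X\<close> in the cell serves as its node, since the center of the cube
  need not belong to \<open>X\<close>.\<close>

definition rep :: "nat \<Rightarrow> 'a \<Rightarrow> 'a" where "rep k v = (SOME y. y \<in> X \<and> cell k y = v)"

definition zz :: "nat \<Rightarrow> 'a \<Rightarrow> 'a" where "zz k x = rep k (cell k x)"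

lemma zz: assumes "x \<in> X" shows "zz k x \<in> X" "cell k (zz k x) = cell k x"
proof -
  have "\<exists>y. y \<in> X \<and> cell k y = cell k x" using assms by blast
  from someI_ex[OF this] show "zz k x \<in> X" "cell k (zz k x) = cell k x" by (auto simp: zz_def rep_def)
qed

lemma zz_dist: "x \<in> X \<Longrightarrow> dist x (zz k x) \<le> K / 2 ^ k"
  using cell_dist[of k x "zz k x"] zz by simp

lemma zz_dist_Suc: "x \<in> X \<Longrightarrow> dist (zz (Suc k) x) (zz k x) \<le> K / 2 ^ k"
  using cell_dist[of k "zz (Suc k) x" "zz k x"] zz[of x k] cell_Suc[OF zz(2)[of x "Suc k"]] by simp

text \<open>The step from level \<open>Suc j\<close> to level \<open>j\<close> is given the time
  \<open>K / 2 ^ j\<close>, and \<open>tk k\<close> is the sum of these times over all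
  \<open>j \<ge> k\<close>.\<close>

definition tk :: "nat \<Rightarrow> real" where "tk k = 2 * K / 2 ^ k"

lemma tk_pos: "0 < tk k" using K_pos by (simp add: tk_def)

lemma tk_diff: "tk k - tk (Suc k) = K / 2 ^ k" "tk (Suc k) < tk k"
  using K_pos by (simp_all add: tk_def field_simps)

lemma tk_mono: "m \<le> n \<Longrightarrow> tk n \<le> tk m"
  by (rule lift_Suc_antimono_le[of tk]) (use tk_diff in \<open>auto intro: less_imp_le\<close>)

lemma tk_small: assumes "0 < e" shows "\<exists>n. tk n < e"
proof -
  obtain n where "2 * K / e < 2 ^ n" using real_arch_pow[of 2 "2 * K / e"] by auto
  then show ?thesis using assms by (intro exI[of _ n]) (simp add: tk_def field_simps)
qed

definition lev :: "real \<Rightarrow> nat" where "lev t = (LEAST k. tk (Suc k) < t)"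

text \<open>Starting at \<open>p\<close>, the path passes the nodes of its cells from infinitely
  fine to coarse: it is at \<open>zz k p\<close> at time \<open>tk k\<close> and runs along a
  segment between consecutive such times. Paths of points in a common cell of level
  \<open>Suc k\<close> coincide once that level is reached, which is how mass is merged.\<close>

definition dfun :: "'a \<Rightarrow> real \<Rightarrow> 'a" where
  "dfun p t = (if t \<le> 0 then p else
     zz (Suc (lev t)) p + ((t - tk (Suc (lev t))) / (K / 2 ^ lev t)) *\<^sub>R (zz (lev t) p - zz (Suc (lev t)) p))"

lemma lev_eq: "tk (Suc k) < t \<Longrightarrow> t \<le> tk k \<Longrightarrow> lev t = k"
  unfolding lev_def
proof (rule Least_equality)
  fix j assume t: "t \<le> tk k" "tk (Suc j) < t"
  show "k \<le> j"
  proof (rule ccontr)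
    assume "\<not> k \<le> j"
    then have "tk k \<le> tk (Suc j)" by (intro tk_mono) simp
    then show False using t by simp
  qed
qed

lemma lev_ex: assumes "0 < t" "t \<le> tk k0" shows "\<exists>k\<ge>k0. tk (Suc k) < t \<and> t \<le> tk k"
proof -
  obtain n where n: "tk n < t" using tk_small[OF assms(1)] by blast
  then have n': "tk (Suc n) < t" using tk_diff(2)[of n] by simp
  let ?k = "LEAST k. tk (Suc k) < t"
  have 1: "tk (Suc ?k) < t" by (rule LeastI[of _ n]) (rule n')
  have "k0 \<le> ?k"
  proof (rule ccontr)
    assume "\<not> k0 \<le> ?k"
    then have "tk k0 \<le> tk (Suc ?k)" by (intro tk_mono) simp
    then show False using 1 assms by simp
  qed
  have "t \<le> tk ?k"
  proof (cases "?k")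
    case 0 then show ?thesis using assms(2) tk_mono[of 0 k0] by simp
  next
    case (Suc j)
    then have "\<not> tk (Suc j) < t" using not_less_Least[of j "\<lambda>k. tk (Suc k) < t"] by simp
    then show ?thesis using Suc by simp
  qed
  then show ?thesis using 1 \<open>k0 \<le> ?k\<close> by blast
qed

lemma dfun_level: "tk (Suc k) < t \<Longrightarrow> t \<le> tk k \<Longrightarrow>
   dfun p t = zz (Suc k) p + ((t - tk (Suc k)) / (K / 2 ^ k)) *\<^sub>R (zz k p - zz (Suc k) p)"
  using lev_eq[of k t] tk_pos[of "Suc k"] by (simp add: dfun_def)

lemma dfun_tk: "dfun p (tk k) = zz k p"
  using dfun_level[of k "tk k" p] tk_diff[of k] K_pos by simp

lemma dfun_level_closed: "tk (Suc k) \<le> t \<Longrightarrow> t \<le> tk k \<Longrightarrow>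
   dfun p t = zz (Suc k) p + ((t - tk (Suc k)) / (K / 2 ^ k)) *\<^sub>R (zz k p - zz (Suc k) p)"
  using dfun_level[of k t p] by (cases "t = tk (Suc k)") (simp add: dfun_tk, simp only: order_less_le simp_thms)

lemma dfun_lip_level:
  assumes p: "p \<in> X" and st: "tk (Suc k) \<le> s" "s \<le> t" "t \<le> tk k" shows "dist (dfun p s) (dfun p t) \<le> t - s"
proof -
  let ?h = "K / 2 ^ k"
  have h: "0 < ?h" using K_pos by simp
  have e: "dfun p t = zz (Suc k) p + ((t - tk (Suc k)) / ?h) *\<^sub>R (zz k p - zz (Suc k) p)"
    "dfun p s = zz (Suc k) p + ((s - tk (Suc k)) / ?h) *\<^sub>R (zz k p - zz (Suc k) p)"
    by (rule dfun_level_closed; use st in linarith)+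
  have "(t - tk (Suc k)) / ?h - (s - tk (Suc k)) / ?h = (t - s) / ?h"
    by (simp only: diff_divide_distrib)
  then have "dfun p t - dfun p s = ((t - s) / ?h) *\<^sub>R (zz k p - zz (Suc k) p)"
    unfolding e by (simp only: add_diff_cancel_left scaleR_diff_left[symmetric])
  then have "dist (dfun p s) (dfun p t) = ((t - s) / ?h) * dist (zz (Suc k) p) (zz k p)"
    using st K_pos by (simp add: dist_norm norm_minus_commute[of "dfun p s"] norm_minus_commute[of "zz k p"])
  also have "\<dots> \<le> ((t - s) / ?h) * ?h" using zz_dist_Suc[OF p, of k] st h
    by (intro mult_left_mono divide_nonneg_pos) auto
  also have "\<dots> = t - s" using K_pos by simp
  finally show ?thesis .
qed

lemma dfun_lip_n:
  assumes p: "p \<in> X" shows "tk n \<le> s \<Longrightarrow> s \<le> t \<Longrightarrow> t \<le> tk 0 \<Longrightarrow> dist (dfun p s) (dfun p t) \<le> t - s"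
proof (induction n arbitrary: s t)
  case 0
  then have "s = t" by linarith
  then show ?case by simp
next
  case (Suc n)
  consider "tk n \<le> s" | "t \<le> tk n" | "s < tk n" "tk n < t" by linarith
  then show ?case
  proof cases
    case 1 then show ?thesis using Suc by blast
  next
    case 2 then show ?thesis using Suc.prems dfun_lip_level[OF p, of n s t] by simp
  next
    case 3
    then have "dist (dfun p s) (dfun p (tk n)) \<le> tk n - s" "dist (dfun p (tk n)) (dfun p t) \<le> t - tk n"
      using Suc dfun_lip_level[OF p, of n s "tk n"] by auto
    then show ?thesis using dist_triangle[of "dfun p s" "dfun p t" "dfun p (tk n)"] by linarith
  qed
qed

lemma dfun_lip:
  assumes p: "p \<in> X" and st: "0 \<le> s" "s \<le> t" "t \<le> tk 0" shows "dist (dfun p s) (dfun p t) \<le> t - s"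
proof (cases "0 < s")
  case True
  then obtain n where "tk n < s" using tk_small by blast
  then show ?thesis using dfun_lip_n[OF p, of n s t] st by simp
next
  case False
  then have s: "s = 0" using st by simp
  show ?thesis
  proof (cases "0 < t")
    case True
    then obtain n where n: "tk n < t" using tk_small by blast
    have "dist (dfun p (tk n)) (dfun p t) \<le> t - tk n" using dfun_lip_n[OF p, of n "tk n" t] n st by simp
    moreover have "dist (dfun p 0) (dfun p (tk n)) \<le> tk n"
    proof -
      have "dist (dfun p 0) (dfun p (tk n)) = dist p (zz n p)" by (simp only: dfun_tk) (simp add: dfun_def)
      also have "\<dots> \<le> K / 2 ^ n" by (rule zz_dist[OF p])
      also have "\<dots> \<le> tk n" using K_pos by (simp add: tk_def field_simps)
      finally show ?thesis .
    qed
    ultimately show ?thesis using s dist_triangle[of "dfun p 0" "dfun p t" "dfun p (tk n)"] by simp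
  next
    case False
    then have "s = t" using st by linarith
    then show ?thesis by simp
  qed
qed

lemma dfun_in: assumes p: "p \<in> X" and t: "0 \<le> t" "t \<le> tk 0" shows "dfun p t \<in> X"
proof (cases "t = 0")
  case False
  then obtain k where k: "tk (Suc k) < t" "t \<le> tk k" using lev_ex[of t 0] t by auto
  let ?u = "(t - tk (Suc k)) / (K / 2 ^ k)"
  have h: "0 < K / 2 ^ k" using K_pos by simp
  have u: "0 \<le> ?u" "?u \<le> 1"
  proof -
    show "0 \<le> ?u" by (rule divide_nonneg_pos) (use k h in linarith)+
    have "t - tk (Suc k) \<le> 1 * (K / 2 ^ k)" using k tk_diff(1)[of k] by linarith
    then show "?u \<le> 1" by (simp only: pos_divide_le_eq[OF h])
  qed
  have "dfun p t = (1 - ?u) *\<^sub>R zz (Suc k) p + ?u *\<^sub>R zz k p"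
    using k by (simp add: dfun_level algebra_simps)
  also have "\<dots> \<in> X" using u zz(1)[OF p] by (intro convexD_alt[OF convX, of "zz (Suc k) p" "zz k p"]) auto
  finally show ?thesis .
qed (simp add: dfun_def p)

lemma dfun_cong:
  assumes "cell (Suc k) p = cell (Suc k) q" "tk (Suc k) < t" "t \<le> tk k" shows "dfun p t = dfun q t"
  using assms cell_Suc[OF assms(1)] by (simp add: dfun_level zz_def)

definition dpath :: "nat \<Rightarrow> 'a \<Rightarrow> real \<Rightarrow> 'a" where
  "dpath k0 p = (\<lambda>t\<in>{0..}. dfun p (min t (tk k0)))"

lemma dpath_Lip1: assumes p: "p \<in> X" shows "dpath k0 p \<in> Lip1 X"
proof (rule Lip1_I)
  have k: "tk k0 \<le> tk 0" by (rule tk_mono) simp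
  fix t :: real assume "0 \<le> t"
  then show "dpath k0 p t \<in> X" using k tk_pos[of k0] by (auto simp: dpath_def intro!: dfun_in[OF p])
next
  have k: "tk k0 \<le> tk 0" by (rule tk_mono) simp
  fix s t :: real assume st: "0 \<le> s" "s \<le> t"
  have "dist (dfun p (min s (tk k0))) (dfun p (min t (tk k0))) \<le> min t (tk k0) - min s (tk k0)"
    by (rule dfun_lip[OF p]) (use st k tk_pos[of k0] in auto)
  also have "\<dots> \<le> t - s" using st by auto
  finally show "dist (dpath k0 p s) (dpath k0 p t) \<le> t - s" using st by (simp add: dpath_def)
qed (simp add: dpath_def)

lemma dpath_0: "dpath k0 p 0 = p" using tk_pos[of k0] by (simp add: dpath_def dfun_def)

lemma dpath_end: "tk k0 \<le> t \<Longrightarrow> dpath k0 p t = zz k0 p"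
  using tk_pos[of k0] by (simp add: dpath_def dfun_tk min_def)

lemma measurable_zz:
  assumes g: "g \<in> borel_measurable M" and gX: "\<And>w. w \<in> space M \<Longrightarrow> g w \<in> X"
  shows "(\<lambda>w. zz k (g w)) \<in> borel_measurable M"
  unfolding zz_def
  by (rule measurable_finite_range[where V="cells k"])
    (use cells gX measurable_compose[OF g measurable_cell] in auto)

lemma measurable_dpath:
  assumes g: "g \<in> borel_measurable M" and gX: "\<And>w. w \<in> space M \<Longrightarrow> g w \<in> X"
  shows "(\<lambda>w. dpath k0 (g w)) \<in> measurable M (Lip1_borel X)"
proof (rule measurable_into_Lip1)
  fix t :: real assume t: "0 \<le> t"
  note [measurable] = g measurable_zz[OF g gX]
  have "(\<lambda>w. dfun (g w) (min t (tk k0))) \<in> borel_measurable M" unfolding dfun_def by measurable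
  then show "(\<lambda>w. dpath k0 (g w) t) \<in> borel_measurable M" using t by (simp add: dpath_def)
qed (simp add: dpath_Lip1 gX)

text \<open>The ratio of the costs of consecutive levels: a finer level has
  \<open>2 ^ DIM('a)\<close> times as many cells, which enters with exponent
  \<open>1 - \<alpha>\<close>, and half the length. The lower bound on \<alpha> makes it less than
  1.\<close>

definition qq :: real where "qq = 2 powr (real DIM('a) * (1 - \<alpha>) - 1)"

lemma qq: "0 < qq" "qq < 1"
proof -
  have "1 - \<alpha> < 1 / real DIM('a)" using \<alpha>d by simp
  then have "real DIM('a) * (1 - \<alpha>) < 1" by (simp add: pos_less_divide_eq mult.commute)
  then show "qq < 1" unfolding qq_def using powr_less_mono[of "real DIM('a) * (1 - \<alpha>) - 1" 0 2] by simp
qed (simp add: qq_def)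

text \<open>The sum of the geometric series of level costs from level \<open>k0\<close> on, for unit
  mass and \<open>\<kappa> = 1\<close>.\<close>

definition \<delta> :: "nat \<Rightarrow> real" where "\<delta> k0 = K * 2 powr (real DIM('a) * (1 - \<alpha>)) / (1 - qq) * qq ^ k0"

lemma \<delta>_nonneg: "0 \<le> \<delta> k0" using K_pos qq by (simp add: \<delta>_def)

lemma \<delta>_tendsto: "\<delta> \<longlonglongrightarrow> 0"
  unfolding \<delta>_def[abs_def] using qq by (intro tendsto_mult_right_zero LIMSEQ_realpow_zero) auto

lemma \<alpha>0: "0 < \<alpha>"
proof -
  have "1 / real DIM('a) \<le> 1" by (simp add: divide_le_eq_1)
  then show ?thesis using \<alpha>d by linarith
qed

text \<open>Between the nodes of level \<open>Suc k\<close> and \<open>k\<close> the multiplicity is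
  at least the mass of the cell of level \<open>Suc k\<close>. Integration over the starting points
  produces the sum of the cell masses to the power \<alpha>, which \<open>sum_powr_le\<close> bounds
  through the number of cells. The factor \<open>\<kappa>\<close> accommodates competitors that keep
  only a fraction of this multiplicity.\<close>

lemma dpath_cost:
  fixes M :: "'b measure"
  assumes M: "finite_measure M" and g[measurable]: "g \<in> borel_measurable M" and gX: "\<And>\<omega>. \<omega> \<in> space M \<Longrightarrow> g \<omega> \<in> X"
    and \<kappa>: "0 < \<kappa>"
  shows "(\<integral>\<^sup>+\<omega>. (\<integral>\<^sup>+t\<in>{0..tk k0}. weight \<alpha> (\<kappa> * measure M {\<omega>'\<in>space M. dpath k0 (g \<omega>) t \<in> ctrace (dpath k0 (g \<omega>'))}) \<partial>lborel) \<partial>M)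
     \<le> ennreal (\<kappa> powr (\<alpha> - 1) * \<delta> k0 * measure M (space M) powr \<alpha>)"
proof -
  interpret finite_measure M by fact
  let ?m = "measure M (space M)"
  have dm: "(\<lambda>\<omega>. dpath k0 (g \<omega>)) \<in> measurable M (Lip1_borel X)" by (rule measurable_dpath[OF g gX])
  define A where "A j v = {\<omega>\<in>space M. cell j (g \<omega>) = v}" for j v
  have A[measurable]: "A j v \<in> sets M" for j v unfolding A_def by measurable
  have inner: "(\<integral>\<^sup>+t\<in>{0..tk k0}. weight \<alpha> (\<kappa> * measure M {\<omega>'\<in>space M. dpath k0 (g \<omega>) t \<in> ctrace (dpath k0 (g \<omega>'))}) \<partial>lborel)
     \<le> (\<Sum>i. ennreal (K / 2 ^ (k0 + i)) * weight \<alpha> (\<kappa> * measure M (A (Suc (k0 + i)) (cell (Suc (k0 + i)) (g \<omega>)))))" for \<omega>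
  proof -
    let ?w = "\<lambda>i. weight \<alpha> (\<kappa> * measure M (A (Suc (k0 + i)) (cell (Suc (k0 + i)) (g \<omega>))))"
    let ?I = "\<lambda>i. {tk (Suc (k0 + i))<..tk (k0 + i)}"
    have "(\<integral>\<^sup>+t\<in>{0..tk k0}. weight \<alpha> (\<kappa> * measure M {\<omega>'\<in>space M. dpath k0 (g \<omega>) t \<in> ctrace (dpath k0 (g \<omega>'))}) \<partial>lborel)
      \<le> (\<integral>\<^sup>+t. (\<Sum>i. ?w i * indicator (?I i) t) \<partial>lborel)"
    proof (rule nn_integral_mono_AE, use AE_lborel_singleton[of "0::real"] in eventually_elim)
      fix t :: real assume t0: "t \<noteq> 0"
      show "weight \<alpha> (\<kappa> * measure M {\<omega>'\<in>space M. dpath k0 (g \<omega>) t \<in> ctrace (dpath k0 (g \<omega>'))}) * indicator {0..tk k0} t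
         \<le> (\<Sum>i. ?w i * indicator (?I i) t)"
      proof (cases "t \<in> {0..tk k0}")
        case True
        then obtain k where k: "k0 \<le> k" "tk (Suc k) < t" "t \<le> tk k" using lev_ex[of t k0] t0 by auto
        define i where "i = k - k0"
        have ki: "k = k0 + i" using k by (simp add: i_def)
        have "measure M (A (Suc k) (cell (Suc k) (g \<omega>))) \<le> measure M {\<omega>'\<in>space M. dpath k0 (g \<omega>) t \<in> ctrace (dpath k0 (g \<omega>'))}"
        proof (rule finite_measure_mono)
          show "{\<omega>'\<in>space M. dpath k0 (g \<omega>) t \<in> ctrace (dpath k0 (g \<omega>'))} \<in> sets M"
            by (rule measurable_ctrace_pred[OF dm]) simp
          show "A (Suc k) (cell (Suc k) (g \<omega>)) \<subseteq> {\<omega>'\<in>space M. dpath k0 (g \<omega>) t \<in> ctrace (dpath k0 (g \<omega>'))}"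
          proof
            fix \<omega>' assume a: "\<omega>' \<in> A (Suc k) (cell (Suc k) (g \<omega>))"
            then have "cell (Suc k) (g \<omega>) = cell (Suc k) (g \<omega>')" by (simp add: A_def)
            from dfun_cong[OF this k(2,3)] have "dpath k0 (g \<omega>) t = dpath k0 (g \<omega>') t" using True by (simp add: dpath_def)
            then show "\<omega>' \<in> {\<omega>'\<in>space M. dpath k0 (g \<omega>) t \<in> ctrace (dpath k0 (g \<omega>'))}"
              using a True by (auto simp: A_def ctrace_def)
          qed
        qed
        then have "weight \<alpha> (\<kappa> * measure M {\<omega>'\<in>space M. dpath k0 (g \<omega>) t \<in> ctrace (dpath k0 (g \<omega>'))}) \<le> ?w i"
          unfolding ki by (intro weight_antimono \<alpha>1 mult_left_mono mult_nonneg_nonneg) (use \<kappa> in auto)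
        also have "\<dots> = ?w i * indicator (?I i) t" using k ki by simp
        also have "\<dots> \<le> (\<Sum>i. ?w i * indicator (?I i) t)"
          by (rule ennreal_le_suminf[of "\<lambda>i. ?w i * indicator (?I i) t"])
        finally show ?thesis using True by simp
      qed simp
    qed
    also have "\<dots> = (\<Sum>i. \<integral>\<^sup>+t. ?w i * indicator (?I i) t \<partial>lborel)"
      by (rule nn_integral_suminf) measurable
    also have "\<dots> = (\<Sum>i. ennreal (K / 2 ^ (k0 + i)) * ?w i)"
    proof (rule suminf_cong)
      fix i
      have "emeasure lborel (?I i) = ennreal (K / 2 ^ (k0 + i))"
        using tk_diff[of "k0 + i"] by simp
      then show "(\<integral>\<^sup>+t. ?w i * indicator (?I i) t \<partial>lborel) = ennreal (K / 2 ^ (k0 + i)) * ?w i"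
        by (subst nn_integral_cmult_indicator) (auto simp: mult.commute)
    qed
    finally show ?thesis .
  qed
  have level: "(\<integral>\<^sup>+\<omega>. weight \<alpha> (\<kappa> * measure M (A j (cell j (g \<omega>)))) \<partial>M) \<le> ennreal (\<kappa> powr (\<alpha> - 1) * ((2 powr (real j * real DIM('a))) powr (1 - \<alpha>) * ?m powr \<alpha>))" for j
  proof -
    have cg: "(\<lambda>\<omega>. cell j (g \<omega>)) \<in> borel_measurable M" by measurable
    have "(\<integral>\<^sup>+\<omega>. weight \<alpha> (\<kappa> * measure M (A j (cell j (g \<omega>)))) \<partial>M) =
       (\<Sum>v\<in>cells j. weight \<alpha> (\<kappa> * measure M (A j v)) * emeasure M {\<omega>\<in>space M. cell j (g \<omega>) = v})"
      by (rule nn_integral_finite_range[OF cg cells(1)]) (use cells(3) gX in auto)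
    also have "\<dots> = (\<Sum>v\<in>cells j. ennreal (\<kappa> powr (\<alpha> - 1) * measure M (A j v) powr \<alpha>))"
    proof (rule sum.cong[OF refl])
      fix v
      show "weight \<alpha> (\<kappa> * measure M (A j v)) * emeasure M {\<omega>\<in>space M. cell j (g \<omega>) = v} = ennreal (\<kappa> powr (\<alpha> - 1) * measure M (A j v) powr \<alpha>)"
        unfolding A_def[symmetric] emeasure_eq_measure
      proof (cases "measure M (A j v) = 0")
        case False
        then have p: "0 < measure M (A j v)" by (simp add: order_less_le)
        then have "weight \<alpha> (\<kappa> * measure M (A j v)) * ennreal (measure M (A j v)) = ennreal ((\<kappa> * measure M (A j v)) powr (\<alpha> - 1) * measure M (A j v))"
          using \<kappa> by (simp add: weight_def ennreal_mult)
        also have "(\<kappa> * measure M (A j v)) powr (\<alpha> - 1) * measure M (A j v) = \<kappa> powr (\<alpha> - 1) * measure M (A j v) powr \<alpha>"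
          using p \<kappa> by (simp add: powr_mult powr_diff)
        finally show "weight \<alpha> (\<kappa> * measure M (A j v)) * ennreal (measure M (A j v)) = ennreal (\<kappa> powr (\<alpha> - 1) * measure M (A j v) powr \<alpha>)" .
      qed simp
    qed
    also have "\<dots> = ennreal (\<kappa> powr (\<alpha> - 1) * (\<Sum>v\<in>cells j. measure M (A j v) powr \<alpha>))"
      by (subst sum_ennreal) (auto simp: sum_distrib_left)
    also have "\<dots> \<le> ennreal (\<kappa> powr (\<alpha> - 1) * ((2 powr (real j * real DIM('a))) powr (1 - \<alpha>) * ?m powr \<alpha>))"
    proof (intro ennreal_leI mult_left_mono sum_powr_le[OF cells(1)] \<alpha>0 \<alpha>1)
      have "real (card (cells j)) \<le> real ((2 ^ j) ^ DIM('a))" using cells(2)[of j] by (rule of_nat_mono)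
      also have "\<dots> = 2 powr (real j * real DIM('a))" by (simp add: powr_realpow[symmetric] powr_powr)
      finally show "real (card (cells j)) \<le> 2 powr (real j * real DIM('a))" .
      have "(\<Sum>v\<in>cells j. measure M (A j v)) = measure M (\<Union>v\<in>cells j. A j v)"
        by (rule finite_measure_finite_Union[symmetric]) (auto simp: cells disjoint_family_on_def A_def)
      also have "\<dots> \<le> ?m" by (rule bounded_measure)
      finally show "(\<Sum>v\<in>cells j. measure M (A j v)) \<le> ?m" .
    qed auto
    finally show ?thesis .
  qed
  have "(\<integral>\<^sup>+\<omega>. (\<integral>\<^sup>+t\<in>{0..tk k0}. weight \<alpha> (\<kappa> * measure M {\<omega>'\<in>space M. dpath k0 (g \<omega>) t \<in> ctrace (dpath k0 (g \<omega>'))}) \<partial>lborel) \<partial>M)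
    \<le> (\<integral>\<^sup>+\<omega>. (\<Sum>i. ennreal (K / 2 ^ (k0 + i)) * weight \<alpha> (\<kappa> * measure M (A (Suc (k0 + i)) (cell (Suc (k0 + i)) (g \<omega>))))) \<partial>M)"
    by (intro nn_integral_mono inner)
  also have "\<dots> = (\<Sum>i. ennreal (K / 2 ^ (k0 + i)) * (\<integral>\<^sup>+\<omega>. weight \<alpha> (\<kappa> * measure M (A (Suc (k0 + i)) (cell (Suc (k0 + i)) (g \<omega>)))) \<partial>M))"
  proof -
    have m: "(\<lambda>\<omega>. weight \<alpha> (\<kappa> * measure M (A j (cell j (g \<omega>))))) \<in> borel_measurable M" for j
      by (rule measurable_finite_range[where u="\<lambda>\<omega>. cell j (g \<omega>)" and V="cells j" and h="\<lambda>v. weight \<alpha> (\<kappa> * measure M (A j v))"])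
        (use cells gX in auto)
    show ?thesis by (subst nn_integral_suminf) (auto simp: nn_integral_cmult m intro!: borel_measurable_times_ennreal)
  qed
  also have "\<dots> \<le> (\<Sum>i. ennreal (K / 2 ^ (k0 + i)) * ennreal (\<kappa> powr (\<alpha> - 1) * ((2 powr (real (Suc (k0 + i)) * real DIM('a))) powr (1 - \<alpha>) * ?m powr \<alpha>)))"
    by (intro suminf_le mult_left_mono level) auto
  also have "\<dots> = (\<Sum>i. ennreal (\<kappa> powr (\<alpha> - 1) * (K * 2 powr (real DIM('a) * (1 - \<alpha>)) * qq ^ k0) * ?m powr \<alpha> * qq ^ i))"
  proof (rule suminf_cong)
    fix i
    have e: "(2 powr (real (Suc (k0 + i)) * real DIM('a))) powr (1 - \<alpha>) / 2 ^ (k0 + i) = 2 powr (real DIM('a) * (1 - \<alpha>)) * qq ^ k0 * qq ^ i"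
    proof -
      have "qq ^ k0 * qq ^ i = qq powr real (k0 + i)" using qq
        by (simp only: power_add[symmetric] powr_realpow)
      also have "\<dots> = 2 powr ((real DIM('a) * (1 - \<alpha>) - 1) * real (k0 + i))" unfolding qq_def by (simp add: powr_powr)
      also have "2 powr (real DIM('a) * (1 - \<alpha>)) * \<dots> = 2 powr (real (Suc (k0 + i)) * real DIM('a) * (1 - \<alpha>) - real (k0 + i))"
        by (simp add: powr_add[symmetric] algebra_simps)
      also have "\<dots> = (2 powr (real (Suc (k0 + i)) * real DIM('a))) powr (1 - \<alpha>) / 2 ^ (k0 + i)"
        by (simp only: powr_diff[of 2 "real (Suc (k0 + i)) * real DIM('a) * (1 - \<alpha>)" "real (k0 + i)"]
            powr_powr powr_realpow[OF zero_less_numeral])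
      finally show ?thesis by (simp add: mult.assoc)
    qed
    have "ennreal (K / 2 ^ (k0 + i)) * ennreal (\<kappa> powr (\<alpha> - 1) * ((2 powr (real (Suc (k0 + i)) * real DIM('a))) powr (1 - \<alpha>) * ?m powr \<alpha>))
      = ennreal (K / 2 ^ (k0 + i) * (\<kappa> powr (\<alpha> - 1) * ((2 powr (real (Suc (k0 + i)) * real DIM('a))) powr (1 - \<alpha>) * ?m powr \<alpha>)))"
      using K_pos by (intro ennreal_mult[symmetric]) auto
    also have "K / 2 ^ (k0 + i) * (\<kappa> powr (\<alpha> - 1) * ((2 powr (real (Suc (k0 + i)) * real DIM('a))) powr (1 - \<alpha>) * ?m powr \<alpha>))
      = K * \<kappa> powr (\<alpha> - 1) * ?m powr \<alpha> * ((2 powr (real (Suc (k0 + i)) * real DIM('a))) powr (1 - \<alpha>) / 2 ^ (k0 + i))" by simp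
    also have "\<dots> = \<kappa> powr (\<alpha> - 1) * (K * 2 powr (real DIM('a) * (1 - \<alpha>)) * qq ^ k0) * ?m powr \<alpha> * qq ^ i"
      unfolding e by (simp add: mult_ac)
    finally show "ennreal (K / 2 ^ (k0 + i)) * ennreal (\<kappa> powr (\<alpha> - 1) * ((2 powr (real (Suc (k0 + i)) * real DIM('a))) powr (1 - \<alpha>) * ?m powr \<alpha>))
      = ennreal (\<kappa> powr (\<alpha> - 1) * (K * 2 powr (real DIM('a) * (1 - \<alpha>)) * qq ^ k0) * ?m powr \<alpha> * qq ^ i)" .
  qed
  also have "\<dots> = ennreal (\<Sum>i. \<kappa> powr (\<alpha> - 1) * (K * 2 powr (real DIM('a) * (1 - \<alpha>)) * qq ^ k0) * ?m powr \<alpha> * qq ^ i)"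
    using K_pos qq by (intro suminf_ennreal2 summable_mult summable_geometric) auto
  also have "(\<Sum>i. \<kappa> powr (\<alpha> - 1) * (K * 2 powr (real DIM('a) * (1 - \<alpha>)) * qq ^ k0) * ?m powr \<alpha> * qq ^ i) = \<kappa> powr (\<alpha> - 1) * \<delta> k0 * ?m powr \<alpha>"
    using qq by (subst suminf_mult) (auto intro!: summable_geometric simp: suminf_geometric \<delta>_def)
  finally show ?thesis .
qed

end

section \<open>Plans of finite energy\<close>

text \<open>Dyadic paths are estimated by integrals over time without the speed, for which reversal
  is a plain substitution.\<close>

lemma nn_integral_rev_curve:
  assumes c: "c \<in> Lip1 X" and L: "0 \<le> L" and f[measurable]: "f \<in> borel_measurable borel"
  shows "(\<integral>\<^sup>+t\<in>{0..L}. f (rev_curve L c t) \<partial>lborel) = (\<integral>\<^sup>+t\<in>{0..L}. f (c t) \<partial>lborel)"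
proof -
  note [measurable] = measurable_Lip1_max[OF c]
  have "(\<integral>\<^sup>+t\<in>{0..L}. f (c t) \<partial>lborel) = (\<integral>\<^sup>+t. f (c (max 0 t)) * indicator {0..L} t \<partial>lborel)"
    by (rule nn_integral_cong) (auto simp: indicator_def max_def)
  also have "\<dots> = ennreal \<bar>-1\<bar> * (\<integral>\<^sup>+t. f (c (max 0 (L + (-1) * t))) * indicator {0..L} (L + (-1) * t) \<partial>lborel)"
    by (rule nn_integral_real_affine) auto
  also have "\<dots> = (\<integral>\<^sup>+t\<in>{0..L}. f (rev_curve L c t) \<partial>lborel)"
    by (simp, rule nn_integral_cong) (auto simp: indicator_def rev_curve_def)
  finally show ?thesis by simp
qed

lemma rev_curve_const: "L \<le> t \<Longrightarrow> 0 \<le> L \<Longrightarrow> rev_curve L c t = c 0"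
  by (simp add: rev_curve_def)

lemma ctrace_rev_curve:
  assumes L: "0 \<le> L" and c: "\<And>t. L \<le> t \<Longrightarrow> c t = c L"
  shows "ctrace (rev_curve L c) = ctrace c"
proof
  show "ctrace (rev_curve L c) \<subseteq> ctrace c" by (auto simp: ctrace_def rev_curve_def)
  show "ctrace c \<subseteq> ctrace (rev_curve L c)"
  proof
    fix y assume "y \<in> ctrace c"
    then obtain t where t: "0 \<le> t" "y = c t" by (auto simp: ctrace_def)
    have "y = c (min t L)" using t c[of t] by (auto simp: min_def)
    then have "y = rev_curve L c (L - min t L)" using t L by (simp add: rev_curve_def)
    then show "y \<in> ctrace (rev_curve L c)" using t L by (auto simp: ctrace_def)
  qed
qed

lemma einf_in: assumes "c \<in> Lip1 X" shows "einf c \<in> X"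
proof -
  have "0 \<le> stopping_time c" unfolding stopping_time_def by (rule Inf_greatest) auto
  then have "0 \<le> real_of_ereal (stopping_time c)" by (rule real_of_ereal_pos)
  then show ?thesis unfolding einf_def by (rule Lip1_in[OF assms])
qed

lemma enn2real_mass:
  assumes M: "finite_measure M" and c: "c \<in> measurable M (Lip1_borel X)"
  shows "enn2real (mass M c y) = measure M {w\<in>space M. y \<in> ctrace (c w)}"
  unfolding mass_eq_emeasure[OF c] measure_def ..

lemma measurable_mass_real:
  assumes M: "finite_measure M" and c: "c \<in> measurable M (Lip1_borel X)"
  shows "(\<lambda>y. measure M {w\<in>space M. y \<in> ctrace (c w)}) \<in> borel_measurable borel"
proof -
  have "sigma_finite_measure M" using M unfolding finite_measure_def by blast
  from measurable_mass[OF c this] show ?thesis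
    unfolding enn2real_mass[OF M c, symmetric] by measurable
qed

context dyadic
begin

lemma dpath_cost_le:
  assumes M: "finite_measure M" and g: "g \<in> borel_measurable M" and gX: "\<And>w. w \<in> space M \<Longrightarrow> g w \<in> X"
    and \<kappa>: "0 < \<kappa>" and m[measurable]: "m \<in> borel_measurable borel"
    and ge: "\<And>y. \<kappa> * measure M {w'\<in>space M. y \<in> ctrace (dpath k0 (g w'))} \<le> m y"
  shows "(\<integral>\<^sup>+w. lint (dpath k0 (g w)) (\<lambda>y. weight \<alpha> (m y)) \<partial>M) \<le> ennreal (\<kappa> powr (\<alpha> - 1) * \<delta> k0 * measure M (space M) powr \<alpha>)"
    and "(\<integral>\<^sup>+w. lint (rev_curve (tk k0) (dpath k0 (g w))) (\<lambda>y. weight \<alpha> (m y)) \<partial>M) \<le> ennreal (\<kappa> powr (\<alpha> - 1) * \<delta> k0 * measure M (space M) powr \<alpha>)"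
proof -
  have wm: "(\<lambda>y. weight \<alpha> (m y)) \<in> borel_measurable borel" unfolding weight_def by measurable
  have I: "(\<integral>\<^sup>+t\<in>{0..tk k0}. weight \<alpha> (m (dpath k0 (g w) t)) \<partial>lborel) \<le>
    (\<integral>\<^sup>+t\<in>{0..tk k0}. weight \<alpha> (\<kappa> * measure M {w'\<in>space M. dpath k0 (g w) t \<in> ctrace (dpath k0 (g w'))}) \<partial>lborel)" for w
    by (intro nn_integral_mono mult_right_mono weight_antimono ge \<alpha>1) (use \<kappa> in auto)
  have k: "0 \<le> tk k0" using tk_pos[of k0] by simp
  have "lint (dpath k0 (g w)) (\<lambda>y. weight \<alpha> (m y)) \<le> (\<integral>\<^sup>+t\<in>{0..tk k0}. weight \<alpha> (m (dpath k0 (g w) t)) \<partial>lborel)"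
    if "w \<in> space M" for w
    by (rule lint_le_of_const[OF dpath_Lip1[OF gX[OF that]] k]) (simp add: dpath_end)
  then show "(\<integral>\<^sup>+w. lint (dpath k0 (g w)) (\<lambda>y. weight \<alpha> (m y)) \<partial>M) \<le> ennreal (\<kappa> powr (\<alpha> - 1) * \<delta> k0 * measure M (space M) powr \<alpha>)"
    by (intro order_trans[OF nn_integral_mono dpath_cost[OF M g gX \<kappa>]]) (auto intro: order_trans[OF _ I])
  have "lint (rev_curve (tk k0) (dpath k0 (g w))) (\<lambda>y. weight \<alpha> (m y)) \<le> (\<integral>\<^sup>+t\<in>{0..tk k0}. weight \<alpha> (m (dpath k0 (g w) t)) \<partial>lborel)"
    if "w \<in> space M" for w
    unfolding nn_integral_rev_curve[OF dpath_Lip1[OF gX[OF that]] k wm, symmetric]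
    by (rule lint_le_of_const[OF rev_curve_Lip1[OF dpath_Lip1[OF gX[OF that]]] k]) (simp add: rev_curve_const k)
  then show "(\<integral>\<^sup>+w. lint (rev_curve (tk k0) (dpath k0 (g w))) (\<lambda>y. weight \<alpha> (m y)) \<partial>M) \<le> ennreal (\<kappa> powr (\<alpha> - 1) * \<delta> k0 * measure M (space M) powr \<alpha>)"
    by (intro order_trans[OF nn_integral_mono dpath_cost[OF M g gX \<kappa>]]) (auto intro: order_trans[OF _ I])
qed

lemma cell_0: "x \<in> X \<Longrightarrow> cell 0 x = 0"
proof (rule euclidean_eqI)
  fix b :: 'a assume x: "x \<in> X" and b: "b \<in> Basis"
  have "0 \<le> (x \<bullet> b + B) / (2 * B)" "(x \<bullet> b + B) / (2 * B) < 1"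
    using B(1) B(2)[OF x b] by (auto simp: field_simps)
  then have "\<lfloor>(x \<bullet> b + B) / (2 * B)\<rfloor> = 0" by (simp add: floor_eq_iff)
  then show "cell 0 x \<bullet> b = 0 \<bullet> b" by (simp add: cell_inner[OF b])
qed

text \<open>All of \<open>X\<close> lies in the single cell of level 0. So each curve can be
  replaced by the dyadic path from its starting point to the common node, followed by a reversed
  dyadic path to its end point.\<close>

lemma exists_finite_energy:
  assumes "traffic_plan X P" "compact X"
  shows "\<exists>Q\<in>TP X (coupling P). energy \<alpha> Q < \<infinity>"
proof -
  interpret curve_plan X P by (rule traffic_planD(1)[OF assms])
  have e0m: "(\<lambda>\<gamma>. \<gamma> 0) \<in> borel_measurable P" by (rule measurable_Lip1_eval_compose[OF id_P]) simp
  have eim: "einf \<in> borel_measurable P" using measurable_einf by (simp add: measurable_P_iff)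
  have e0X: "\<gamma> 0 \<in> X" and eiX: "einf \<gamma> \<in> X" if "\<gamma> \<in> space P" for \<gamma>
    using that by (auto simp: space_P Lip1_in einf_in)
  let ?T = "tk 0"
  have T: "0 \<le> ?T" using tk_pos[of 0] by simp
  define c1 where "c1 \<gamma> = dpath 0 (\<gamma> 0)" for \<gamma> :: "real \<Rightarrow> 'a"
  define d2 where "d2 \<gamma> = dpath 0 (einf \<gamma>)" for \<gamma> :: "real \<Rightarrow> 'a"
  define c2 where "c2 \<gamma> = rev_curve ?T (d2 \<gamma>)" for \<gamma> :: "real \<Rightarrow> 'a"
  define \<Phi> where "\<Phi> \<gamma> = join ?T (c1 \<gamma>) (c2 \<gamma>)" for \<gamma>
  have m1: "c1 \<in> measurable P (Lip1_borel X)" unfolding c1_def[abs_def] by (rule measurable_dpath[where g="\<lambda>\<gamma>. \<gamma> 0", OF e0m]) (rule e0X)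
  have m2: "d2 \<in> measurable P (Lip1_borel X)" unfolding d2_def[abs_def] by (rule measurable_dpath[where g=einf, OF eim]) (rule eiX)
  have m3: "c2 \<in> measurable P (Lip1_borel X)" unfolding c2_def[abs_def] by (rule measurable_rev_curve[OF m2])
  have L: "c1 \<gamma> \<in> Lip1 X" "c2 \<gamma> \<in> Lip1 X" "c1 \<gamma> ?T = c2 \<gamma> 0" "fin (c2 \<gamma>)" "einf (c2 \<gamma>) = einf \<gamma>"
    "\<And>t. ?T \<le> t \<Longrightarrow> c1 \<gamma> t = c1 \<gamma> ?T" "ctrace (c2 \<gamma>) = ctrace (d2 \<gamma>)" if g: "\<gamma> \<in> space P" for \<gamma>
  proof -
    show 1: "c1 \<gamma> \<in> Lip1 X" "c2 \<gamma> \<in> Lip1 X" using measurable_space[OF m1 g] measurable_space[OF m3 g] by auto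
    show "c1 \<gamma> ?T = c2 \<gamma> 0" using T e0X[OF g] eiX[OF g]
      by (simp add: c1_def c2_def d2_def rev_curve_def dpath_end zz_def cell_0)
    have c: "c2 \<gamma> t = einf \<gamma>" if "?T \<le> t" for t
      using that T by (simp add: c2_def d2_def rev_curve_const dpath_0)
    show "fin (c2 \<gamma>)" unfolding fin_def by (intro exI[of _ ?T]) (simp add: T c)
    show "einf (c2 \<gamma>) = einf \<gamma>" by (rule einf_eqI[OF 1(2) T c])
    show "\<And>t. ?T \<le> t \<Longrightarrow> c1 \<gamma> t = c1 \<gamma> ?T" by (simp add: c1_def dpath_end)
    show "ctrace (c2 \<gamma>) = ctrace (d2 \<gamma>)" unfolding c2_def by (rule ctrace_rev_curve[OF T]) (simp add: d2_def dpath_end)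
  qed
  have m: "\<Phi> \<in> measurable P (Lip1_borel X)" unfolding \<Phi>_def[abs_def]
    by (rule measurable_join[OF m1 m3]) (use T L(3) in auto)
  have f: "AE \<gamma> in P. fin (\<Phi> \<gamma>)" unfolding \<Phi>_def
    by (intro AE_I2 einf_join(2)[OF L(1,2) T L(3,4)])
  have ei: "einf (\<Phi> \<gamma>) = einf \<gamma>" if g: "\<gamma> \<in> space P" for \<gamma>
    unfolding \<Phi>_def using einf_join(1)[OF L(1,2)[OF g] T L(3,4)[OF g]] L(5)[OF g] by simp
  have st: "\<Phi> \<gamma> 0 = \<gamma> 0" for \<gamma> unfolding \<Phi>_def using T by (simp add: join_0 c1_def dpath_0)
  have c: "distr P borel (\<lambda>\<gamma>. (e0 (\<Phi> \<gamma>), einf (\<Phi> \<gamma>))) = coupling P"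
    by (rule coupling_eq[OF m]) (intro AE_I2 conjI st ei)
  note fm = finite_measure_axioms
  have tr: "ctrace (\<Phi> \<gamma>) = ctrace (c1 \<gamma>) \<union> ctrace (d2 \<gamma>)" if g: "\<gamma> \<in> space P" for \<gamma>
    unfolding \<Phi>_def L(7)[OF g, symmetric] by (rule trace_join[where L="tk 0"]) (rule T, rule L(3)[OF g], rule L(6)[OF g])
  let ?m = "\<lambda>y. measure P {\<gamma>\<in>space P. y \<in> ctrace (\<Phi> \<gamma>)}"
  have mm: "?m \<in> borel_measurable borel" by (rule measurable_mass_real[OF fm m])
  have wm: "(\<lambda>y. weight \<alpha> (?m y)) \<in> borel_measurable borel" using mm unfolding weight_def by measurable
  have pm: "{\<gamma>\<in>space P. y \<in> ctrace (\<Phi> \<gamma>)} \<in> sets P" for y by (rule measurable_ctrace_pred[OF m]) simp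
  have ge1: "1 * measure P {\<gamma>\<in>space P. y \<in> ctrace (dpath 0 (\<gamma> 0))} \<le> ?m y" for y
    using pm[of y] tr by (auto simp: c1_def intro!: finite_measure_mono)
  have ge2: "1 * measure P {\<gamma>\<in>space P. y \<in> ctrace (dpath 0 (einf \<gamma>))} \<le> ?m y" for y
    using pm[of y] tr by (auto simp: d2_def intro!: finite_measure_mono)
  have "energy \<alpha> (distr P (Lip1_borel X) \<Phi>) = (\<integral>\<^sup>+\<gamma>. lint (\<Phi> \<gamma>) (\<lambda>y. weight \<alpha> (?m y)) \<partial>P)"
    unfolding TP_distr(2)[OF assms(2) fm m f c] enn2real_mass[OF fm m] ..
  also have "\<dots> = (\<integral>\<^sup>+\<gamma>. lint (c1 \<gamma>) (\<lambda>y. weight \<alpha> (?m y)) + lint (c2 \<gamma>) (\<lambda>y. weight \<alpha> (?m y)) \<partial>P)"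
    unfolding \<Phi>_def
    by (rule nn_integral_cong) (rule lint_join[OF L(1,2) T L(3,6)], use wm in \<open>auto simp: \<Phi>_def\<close>)
  also have "\<dots> = (\<integral>\<^sup>+\<gamma>. lint (c1 \<gamma>) (\<lambda>y. weight \<alpha> (?m y)) \<partial>P) + (\<integral>\<^sup>+\<gamma>. lint (c2 \<gamma>) (\<lambda>y. weight \<alpha> (?m y)) \<partial>P)"
    by (intro nn_integral_add measurable_lint_fixed[OF m1 wm] measurable_lint_fixed[OF m3 wm])
  also have "\<dots> \<le> ennreal (1 powr (\<alpha> - 1) * \<delta> 0 * measure P (space P) powr \<alpha>) + ennreal (1 powr (\<alpha> - 1) * \<delta> 0 * measure P (space P) powr \<alpha>)"
    unfolding c1_def c2_def d2_def
    by (intro add_mono dpath_cost_le(1)[where g="\<lambda>\<gamma>. \<gamma> 0" and \<kappa>=1 and m="?m", OF fm e0m _ _ mm ge1] dpath_cost_le(2)[where g=einf and \<kappa>=1 and m="?m", OF fm eim _ _ mm ge2]) (auto intro: e0X eiX)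
  also have "\<dots> < \<infinity>" by simp
  finally show ?thesis using TP_distr(1)[OF assms(2) fm m f c] by blast
qed

end

section \<open>The surgery inequality\<close>

text \<open>A fair coin, independent of the curve, decides whether the curve is rerouted; this
  splits the plan into two copies of half the mass.\<close>

definition coin :: "bool measure" where "coin = point_measure UNIV (\<lambda>_. ennreal (1 / 2))"

lemma nn_integral_coin: "(\<integral>\<^sup>+b. f b \<partial>coin) = ennreal (1 / 2) * f True + ennreal (1 / 2) * f False"
  unfolding coin_def by (simp add: nn_integral_point_measure_finite UNIV_bool add.commute)

lemma sets_coin [simp]: "sets coin = UNIV" "space coin = UNIV"
  by (simp_all add: coin_def sets_point_measure space_point_measure)

lemma half_add_half: "ennreal (1 / 2) + ennreal (1 / 2) = 1"
proof -
  have "ennreal (1 / 2) + ennreal (1 / 2) = ennreal (1 / 2 + 1 / 2)" by (rule ennreal_plus[symmetric]) simp_all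
  also have "(1 / 2 + 1 / 2 :: real) = 1" by simp
  finally show ?thesis by simp
qed

lemma ennreal_average:
  assumes "0 \<le> p" "0 \<le> q"
  shows "ennreal (1 / 2) * ennreal p + ennreal (1 / 2) * ennreal q = ennreal ((q + p) / 2)"
proof -
  have 1: "ennreal (1 / 2 * p) = ennreal (1 / 2) * ennreal p" "ennreal (1 / 2 * q) = ennreal (1 / 2) * ennreal q"
    by (rule ennreal_mult; use assms in simp)+
  have "ennreal ((q + p) / 2) = ennreal (1 / 2 * p + 1 / 2 * q)"
    by (rule arg_cong[where f=ennreal]) (simp add: field_simps)
  also have "\<dots> = ennreal (1 / 2 * p) + ennreal (1 / 2 * q)"
    by (rule ennreal_plus) (use assms in simp_all)
  finally show ?thesis unfolding 1 by simp
qed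

lemma ennreal_mult3: "0 \<le> a \<Longrightarrow> 0 \<le> b \<Longrightarrow> 0 \<le> c \<Longrightarrow> ennreal (a * b * c) = ennreal a * ennreal b * ennreal c"
  by (simp add: ennreal_mult)

lemma ennreal_two: "0 \<le> x \<Longrightarrow> ennreal (2 * x) = 2 * ennreal x"
  using ennreal_mult[of 2 x] by simp

lemma emeasure_coin: "emeasure coin UNIV = 1"
proof -
  have "emeasure coin UNIV = (\<integral>\<^sup>+b. indicator UNIV b \<partial>coin)" by (rule nn_integral_indicator[symmetric]) simp
  also have "\<dots> = ennreal (1 / 2) + ennreal (1 / 2)" by (simp only: nn_integral_coin) simp
  also have "\<dots> = 1" by (rule half_add_half)
  finally show ?thesis .
qed

lemma finite_measure_coin: "finite_measure coin"
  by (rule finite_measureI) (simp add: emeasure_coin)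

lemma nn_integral_pair_coin:
  assumes f: "f \<in> borel_measurable (P \<Otimes>\<^sub>M coin)"
  shows "(\<integral>\<^sup>+w. f w \<partial>(P \<Otimes>\<^sub>M coin)) = (\<integral>\<^sup>+x. ennreal (1 / 2) * f (x, True) + ennreal (1 / 2) * f (x, False) \<partial>P)"
proof -
  interpret C: finite_measure coin by (rule finite_measure_coin)
  show ?thesis by (subst C.nn_integral_fst[OF f, symmetric]) (simp only: nn_integral_coin)
qed

lemma AE_pair_coin_fst:
  assumes "AE x in P. Q x" shows "AE w in P \<Otimes>\<^sub>M coin. Q (fst w)"
proof -
  interpret C: finite_measure coin by (rule finite_measure_coin)
  obtain N where N: "{x\<in>space P. \<not> Q x} \<subseteq> N" "emeasure P N = 0" "N \<in> sets P" using assms by (rule AE_E)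
  have "N \<times> UNIV \<in> null_sets (P \<Otimes>\<^sub>M coin)"
    using C.emeasure_pair_measure_Times[of N P UNIV] N by (auto simp: null_sets_def)
  then show ?thesis by (rule AE_I') (use N(1) in \<open>auto simp: space_pair_measure\<close>)
qed

lemma distr_pair_coin_fst: "distr (P \<Otimes>\<^sub>M coin) P fst = P"
proof (rule measure_eqI)
  interpret C: finite_measure coin by (rule finite_measure_coin)
  fix A assume "A \<in> sets (distr (P \<Otimes>\<^sub>M coin) P fst)"
  then have A: "A \<in> sets P" by simp
  have "fst -` A \<inter> space (P \<Otimes>\<^sub>M coin) = A \<times> UNIV"
    using sets.sets_into_space[OF A] by (auto simp: space_pair_measure)
  then show "emeasure (distr (P \<Otimes>\<^sub>M coin) P fst) A = emeasure P A"
    using A C.emeasure_pair_measure_Times[of A P UNIV] by (simp add: emeasure_distr emeasure_coin)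
qed simp

text \<open>Concavity of the power, in the form of Young's inequality.\<close>

lemma powr_tangent_le:
  assumes "0 < \<alpha>" "\<alpha> < 1" "0 < u" "0 < (v::real)"
  shows "u powr \<alpha> \<le> v powr \<alpha> + \<alpha> * v powr (\<alpha> - 1) * (u - v)"
proof -
  have "u powr \<alpha> * v powr (1 - \<alpha>) \<le> \<alpha> * u + (1 - \<alpha>) * v"
    using Youngs_inequality_0[of \<alpha> "1 - \<alpha>" u v] assms by simp
  then have "u powr \<alpha> * v powr (1 - \<alpha>) * v powr (\<alpha> - 1) \<le> (\<alpha> * u + (1 - \<alpha>) * v) * v powr (\<alpha> - 1)"
    by (rule mult_right_mono) simp
  moreover have "v powr (1 - \<alpha>) * v powr (\<alpha> - 1) = 1" using assms by (simp add: powr_add[symmetric])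
  moreover have "v * v powr (\<alpha> - 1) = v powr \<alpha>" using assms by (simp add: powr_diff)
  ultimately show ?thesis by (simp add: algebra_simps)
qed

lemma lint_seg_le:
  assumes g: "c \<in> Lip1 X" and ab: "0 \<le> a" "a \<le> b" and f: "f \<in> borel_measurable borel"
  shows "lint (seg a b c) f \<le> lint c f"
  unfolding lint_pre_seg_suf[OF g ab f] by (simp add: add.commute add.left_commute add_increasing)

context optimal_plan
begin

lemma AE_pos_seg:
  assumes ab: "\<And>c. c \<in> space P \<Longrightarrow> 0 \<le> a c" "\<And>c. c \<in> space P \<Longrightarrow> a c \<le> b c"
  shows "AE c in P. AE t in lborel. 0 \<le> t \<longrightarrow> 0 < sp (seg (a c) (b c) c) t \<longrightarrow> 0 < th (seg (a c) (b c) c t)"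
  using AE_pos AE_space
proof eventually_elim
  case (elim c)
  have g: "c \<in> Lip1 X" using elim by (simp add: space_P)
  note s = seg_Lip1[OF g ab[OF elim(2)]]
  have m: "(indicator {y. th y = 0} :: 'a \<Rightarrow> ennreal) \<in> borel_measurable borel" by measurable
  have "lint c (indicator {y. th y = 0}) = 0"
    using elim by (subst lint_eq_0_iff[OF g m]) (auto elim!: eventually_mono simp: indicator_def)
  then have "lint (seg (a c) (b c) c) (indicator {y. th y = 0}) = 0"
    using lint_seg_le[OF g ab[OF elim(2)] m] by (metis le_zero_eq)
  then show ?case unfolding lint_eq_0_iff[OF s m]
    by eventually_elim (use th_nonneg in \<open>auto simp: indicator_def order_less_le split: if_splits\<close>)
qed

text \<open>The factor \<alpha> comes from concavity: removing the mass \<open>s\<close> at a point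
  of multiplicity \<open>\<theta>\<close> lowers \<open>\<theta> powr \<alpha>\<close> by at least
  \<open>\<alpha> * s * \<theta> powr (\<alpha> - 1)\<close>. The estimates are kept free of
  subtractions, as the integrals are extended reals and the cost of the new paths may be
  infinite.\<close>

theorem surgery_inequality:
  assumes a[measurable]: "a \<in> borel_measurable P" and b[measurable]: "b \<in> borel_measurable P" and \<Lambda>[measurable]: "\<Lambda> \<in> borel_measurable P"
    and \<pi>: "\<pi> \<in> measurable P (Lip1_borel X)"
    and ab: "\<And>\<gamma>. \<gamma> \<in> space P \<Longrightarrow> 0 \<le> a \<gamma>" "\<And>\<gamma>. \<gamma> \<in> space P \<Longrightarrow> a \<gamma> \<le> b \<gamma>" "\<And>\<gamma>. \<gamma> \<in> space P \<Longrightarrow> 0 \<le> \<Lambda> \<gamma>"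
    and \<pi>0: "\<And>\<gamma>. \<gamma> \<in> space P \<Longrightarrow> \<pi> \<gamma> 0 = \<gamma> (a \<gamma>)"
    and \<pi>1: "\<And>\<gamma> t. \<gamma> \<in> space P \<Longrightarrow> \<Lambda> \<gamma> \<le> t \<Longrightarrow> \<pi> \<gamma> t = \<gamma> (b \<gamma>)"
  shows "ennreal \<alpha> * (\<integral>\<^sup>+\<gamma>. lint (seg (a \<gamma>) (b \<gamma>) \<gamma>) W \<partial>P)
    \<le> (\<integral>\<^sup>+\<gamma>. lint (\<pi> \<gamma>) (\<lambda>y. weight \<alpha> (max (th y) (measure P {\<gamma>\<in>space P. y \<in> ctrace (\<pi> \<gamma>)}) / 2)) \<partial>P)"
proof -
  note fm = finite_measure_axioms and sf = sigma_finite_measure_axioms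
  define sg where "sg \<gamma> = seg (a \<gamma>) (b \<gamma>) \<gamma>" for \<gamma>
  have gL: "\<gamma> \<in> Lip1 X" if "\<gamma> \<in> space P" for \<gamma> using that by (simp add: space_P)
  have sgm: "sg \<in> measurable P (Lip1_borel X)" unfolding sg_def[abs_def] by (rule measurable_seg[OF id_P a b ab(1,2)])
  have pm: "(\<lambda>\<gamma>. pre (a \<gamma>) \<gamma>) \<in> measurable P (Lip1_borel X)" by (rule measurable_pre[OF id_P a ab(1)])
  have bn: "0 \<le> b \<gamma>" if "\<gamma> \<in> space P" for \<gamma> using ab(1,2)[OF that] by simp
  have sm: "(\<lambda>\<gamma>. suf (b \<gamma>) \<gamma>) \<in> measurable P (Lip1_borel X)" by (rule measurable_suf[OF id_P b bn])
  define jn where "jn \<gamma> = join (\<Lambda> \<gamma>) (\<pi> \<gamma>) (suf (b \<gamma>) \<gamma>)" for \<gamma>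
  define \<Phi> where "\<Phi> \<gamma> = join (a \<gamma>) (pre (a \<gamma>) \<gamma>) (jn \<gamma>)" for \<gamma>
  have j1: "\<pi> \<gamma> (\<Lambda> \<gamma>) = suf (b \<gamma>) \<gamma> 0" if "\<gamma> \<in> space P" for \<gamma> using \<pi>1[OF that order_refl] by (simp add: suf_def)
  have jm: "jn \<in> measurable P (Lip1_borel X)" unfolding jn_def[abs_def] by (rule measurable_join[OF \<pi> sm \<Lambda> ab(3) j1])
  have j2: "pre (a \<gamma>) \<gamma> (a \<gamma>) = jn \<gamma> 0" if "\<gamma> \<in> space P" for \<gamma>
    using \<pi>0[OF that] ab[OF that] by (simp add: pre_def jn_def join_0)
  have m: "\<Phi> \<in> measurable P (Lip1_borel X)" unfolding \<Phi>_def[abs_def] by (rule measurable_join[OF pm jm a ab(1) j2])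
  have L: "pre (a \<gamma>) \<gamma> \<in> Lip1 X" "suf (b \<gamma>) \<gamma> \<in> Lip1 X" "\<pi> \<gamma> \<in> Lip1 X" "jn \<gamma> \<in> Lip1 X" "\<Phi> \<gamma> \<in> Lip1 X" if g: "\<gamma> \<in> space P" for \<gamma>
    using measurable_space[OF pm g] measurable_space[OF sm g] measurable_space[OF \<pi> g] measurable_space[OF jm g] measurable_space[OF m g] by auto
  have pc: "pre (a \<gamma>) \<gamma> t = pre (a \<gamma>) \<gamma> (a \<gamma>)" if "\<gamma> \<in> space P" "a \<gamma> \<le> t" for \<gamma> t
    using that(2) ab(1)[OF that(1)] by (simp add: pre_def)
  have \<pi>c: "\<pi> \<gamma> t = \<pi> \<gamma> (\<Lambda> \<gamma>)" if "\<gamma> \<in> space P" "\<Lambda> \<gamma> \<le> t" for \<gamma> t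
    using \<pi>1[OF that] \<pi>1[OF that(1) order_refl] by simp
  have lP: "lint (\<Phi> \<gamma>) f = lint (pre (a \<gamma>) \<gamma>) f + (lint (\<pi> \<gamma>) f + lint (suf (b \<gamma>) \<gamma>) f)"
    if g: "\<gamma> \<in> space P" and f: "f \<in> borel_measurable borel" for \<gamma> f
  proof -
    have "lint (\<Phi> \<gamma>) f = lint (pre (a \<gamma>) \<gamma>) f + lint (jn \<gamma>) f"
      unfolding \<Phi>_def by (rule lint_join[OF L(1,4)[OF g] ab(1)[OF g] j2[OF g] _ f]) (rule pc[OF g])
    also have "lint (jn \<gamma>) f = lint (\<pi> \<gamma>) f + lint (suf (b \<gamma>) \<gamma>) f"
      unfolding jn_def by (rule lint_join[OF L(3,2)[OF g] ab(3)[OF g] j1[OF g] _ f]) (rule \<pi>c[OF g])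
    finally show ?thesis .
  qed
  have tP: "ctrace (\<Phi> \<gamma>) = ctrace (pre (a \<gamma>) \<gamma>) \<union> (ctrace (\<pi> \<gamma>) \<union> ctrace (suf (b \<gamma>) \<gamma>))" if g: "\<gamma> \<in> space P" for \<gamma>
  proof -
    have "ctrace (\<Phi> \<gamma>) = ctrace (pre (a \<gamma>) \<gamma>) \<union> ctrace (jn \<gamma>)"
      unfolding \<Phi>_def by (rule trace_join) (rule ab(1)[OF g], rule j2[OF g], rule pc[OF g])
    also have "ctrace (jn \<gamma>) = ctrace (\<pi> \<gamma>) \<union> ctrace (suf (b \<gamma>) \<gamma>)"
      unfolding jn_def by (rule trace_join) (rule ab(3)[OF g], rule j1[OF g], rule \<pi>c[OF g])
    finally show ?thesis .
  qed
  have fP: "fin (\<Phi> \<gamma>)" "einf (\<Phi> \<gamma>) = einf \<gamma>" if g: "\<gamma> \<in> space P" and f: "fin \<gamma>" for \<gamma>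
  proof -
    note fs = fin_suf[OF f bn[OF g]]
    note e1 = einf_join[OF L(3,2)[OF g] ab(3)[OF g] j1[OF g] fs, folded jn_def]
    note e2 = einf_join[OF L(1,4)[OF g] ab(1)[OF g] j2[OF g] e1(2), folded \<Phi>_def]
    show "fin (\<Phi> \<gamma>)" by (rule e2)
    show "einf (\<Phi> \<gamma>) = einf \<gamma>" using e1 e2 einf_suf[OF gL[OF g] f bn[OF g]] by simp
  qed
  have sP: "\<Phi> \<gamma> 0 = \<gamma> 0" if g: "\<gamma> \<in> space P" for \<gamma>
    unfolding \<Phi>_def using ab(1)[OF g] by (simp add: join_0 pre_def)
  have tsub: "ctrace \<gamma> \<subseteq> ctrace (\<Phi> \<gamma>) \<union> ctrace (sg \<gamma>)" if g: "\<gamma> \<in> space P" for \<gamma>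
    using trace_pre_seg_suf[OF gL[OF g] ab(1,2)[OF g]] tP[OF g] by (auto simp: sg_def)
  let ?M = "P \<Otimes>\<^sub>M coin"
  interpret C: finite_measure coin by (rule finite_measure_coin)
  have fM: "finite_measure ?M" by (rule finite_measure_pair_measure) (rule fm finite_measure_coin)+
  define \<Psi> where "\<Psi> w = (if snd w then \<Phi> (fst w) else fst w)" for w :: "(real \<Rightarrow> 'a) \<times> bool"
  have [measurable]: "fst \<in> measurable ?M (Lip1_borel X)"
    using measurable_compose[OF measurable_fst[of P coin] id_P] by simp
  have \<Psi>m: "\<Psi> \<in> measurable ?M (Lip1_borel X)" unfolding \<Psi>_def[abs_def]
  proof (rule measurable_If)
    show "(\<lambda>w. \<Phi> (fst w)) \<in> measurable ?M (Lip1_borel X)" by (rule measurable_compose[OF measurable_fst m])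
    show "{w \<in> space ?M. snd w} \<in> sets ?M"
    proof -
      have "{w \<in> space ?M. snd w} = space P \<times> {True}" by (auto simp: space_pair_measure)
      then show ?thesis by simp
    qed
  qed measurable
  have AEs: "AE w in ?M. fst w \<in> space P \<and> fin (fst w)"
    by (rule AE_pair_coin_fst) (use AE_fin AE_space in eventually_elim, simp)
  have \<Psi>f: "AE w in ?M. fin (\<Psi> w)" using AEs by eventually_elim (simp add: \<Psi>_def fP)
  have pairm: "(\<lambda>\<gamma>. (e0 \<gamma>, einf \<gamma>)) \<in> borel_measurable (Lip1_borel X)"
    by (intro borel_measurable_Pair measurable_e0 measurable_einf)
  have \<Psi>c: "distr ?M borel (\<lambda>w. (e0 (\<Psi> w), einf (\<Psi> w))) = coupling P"
  proof -
    have "distr ?M borel (\<lambda>w. (e0 (\<Psi> w), einf (\<Psi> w))) = distr ?M borel (\<lambda>w. (e0 (fst w), einf (fst w)))"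
    proof (rule distr_cong_AE)
      show "AE w in ?M. (e0 (\<Psi> w), einf (\<Psi> w)) = (e0 (fst w), einf (fst w))"
        using AEs by eventually_elim (simp add: \<Psi>_def fP e0_def sP)
      show "(\<lambda>w. (e0 (\<Psi> w), einf (\<Psi> w))) \<in> borel_measurable ?M" by (rule measurable_compose[OF \<Psi>m pairm])
      show "(\<lambda>w. (e0 (fst w), einf (fst w))) \<in> borel_measurable ?M"
        by (rule measurable_compose[OF \<open>fst \<in> measurable ?M (Lip1_borel X)\<close> pairm])
    qed auto
    also have "\<dots> = distr (distr ?M P fst) borel (\<lambda>\<gamma>. (e0 \<gamma>, einf \<gamma>))"
      using pairm by (subst distr_distr) (auto simp: measurable_P_iff o_def)
    finally show ?thesis unfolding distr_pair_coin_fst coupling_def .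
  qed
  define tP' where "tP' y = measure P {\<gamma>\<in>space P. y \<in> ctrace (\<Phi> \<gamma>)}" for y
  define tr where "tr y = measure P {\<gamma>\<in>space P. y \<in> ctrace (sg \<gamma>)}" for y
  define tp where "tp y = measure P {\<gamma>\<in>space P. y \<in> ctrace (\<pi> \<gamma>)}" for y
  have [measurable]: "tP' \<in> borel_measurable borel" "tr \<in> borel_measurable borel" "tp \<in> borel_measurable borel"
    unfolding tP'_def[abs_def] tr_def[abs_def] tp_def[abs_def] by (rule measurable_mass_real[OF fm] m sgm \<pi>)+
  have pmm: "{\<gamma>\<in>space P. y \<in> ctrace (\<Phi> \<gamma>)} \<in> sets P" "{\<gamma>\<in>space P. y \<in> ctrace (sg \<gamma>)} \<in> sets P" for y
    by (rule measurable_ctrace_pred[OF m], simp) (rule measurable_ctrace_pred[OF sgm], simp)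
  have mas: "mass P \<Phi> y = ennreal (tP' y)" "mass P sg y = ennreal (tr y)" for y
    unfolding mass_eq_emeasure[OF m] mass_eq_emeasure[OF sgm] tP'_def tr_def by (simp_all add: emeasure_eq_measure)
  have th_le_sum: "th y \<le> tP' y + tr y" for y
  proof -
    have "th y \<le> measure P ({\<gamma>\<in>space P. y \<in> ctrace (\<Phi> \<gamma>)} \<union> {\<gamma>\<in>space P. y \<in> ctrace (sg \<gamma>)})"
      unfolding th_eq using tsub pmm by (intro finite_measure_mono) auto
    also have "\<dots> \<le> tP' y + tr y" unfolding tP'_def tr_def by (rule measure_Un_le[OF pmm])
    finally show ?thesis .
  qed
  have tr_le: "tr y \<le> th y" for y
    unfolding th_eq tr_def using sets_hit trace_pre_seg_suf[OF gL ab(1,2)] by (intro finite_measure_mono) (auto simp: sg_def)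
  have tp_le: "tp y \<le> tP' y" for y
    unfolding tp_def tP'_def using pmm tP by (intro finite_measure_mono) auto
  define t' where "t' y = (th y + tP' y) / 2" for y
  have [measurable]: "t' \<in> borel_measurable borel" unfolding t'_def[abs_def] by measurable
  have t'0: "0 \<le> t' y" for y unfolding t'_def tP'_def by simp
  have masM: "enn2real (mass ?M \<Psi> y) = t' y" for y
  proof -
    have "mass ?M \<Psi> y = (\<integral>\<^sup>+\<gamma>. ennreal (1 / 2) * indicator (ctrace (\<Phi> \<gamma>)) y + ennreal (1 / 2) * indicator (ctrace \<gamma>) y \<partial>P)"
      unfolding mass_def
      by (subst nn_integral_pair_coin, rule measurable_ctrace_indicator[OF \<Psi>m]) (auto simp: \<Psi>_def)
    also have "\<dots> = ennreal (1 / 2) * mass P \<Phi> y + ennreal (1 / 2) * mass P (\<lambda>\<gamma>. \<gamma>) y"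
      unfolding mass_def using measurable_ctrace_indicator[OF m, of "\<lambda>_. y"] measurable_ctrace_indicator[OF id_P, of "\<lambda>_. y"]
      by (subst nn_integral_add) (simp_all add: nn_integral_cmult)
    also have "\<dots> = ennreal (t' y)"
      unfolding mas ennreal_th[symmetric] t'_def by (rule ennreal_average) (simp_all add: tP'_def)
    finally show ?thesis using t'0 by simp
  qed
  define w' where "w' y = weight \<alpha> (t' y)" for y
  \<comment> \<open>\<open>th - tr / 2\<close> bounds the new multiplicity from below: a curve that
    misses \<open>y\<close> after rerouting met it on its removed segment, and only half of the mass
    is rerouted.\<close>
  define f where "f y = weight \<alpha> (th y - tr y / 2)" for y
  define V where "V y = weight \<alpha> (max (th y) (tp y) / 2)" for y
  have [measurable]: "w' \<in> borel_measurable borel" "f \<in> borel_measurable borel" "V \<in> borel_measurable borel"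
    unfolding w'_def[abs_def] f_def[abs_def] V_def[abs_def] weight_def by measurable
  have w'f: "w' y \<le> f y" for y
    unfolding w'_def f_def
  proof (rule weight_antimono[OF _ _ \<alpha>(2)])
    show "0 \<le> th y - tr y / 2" using tr_le[of y] th_nonneg[of y] by linarith
    show "th y - tr y / 2 \<le> t' y" using th_le_sum[of y] by (simp add: t'_def field_simps)
  qed
  have w'V: "w' y \<le> V y" for y
    unfolding w'_def V_def
  proof (rule weight_antimono[OF _ _ \<alpha>(2)])
    have "0 \<le> tp y" "0 \<le> tP' y" by (simp_all add: tp_def tP'_def)
    then have "0 \<le> max (th y) (tp y)" "max (th y) (tp y) \<le> th y + tP' y"
      using th_nonneg[of y] tp_le[of y] by linarith+
    then show "0 \<le> max (th y) (tp y) / 2" "max (th y) (tp y) / 2 \<le> t' y"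
      unfolding t'_def by (simp_all only: divide_right_mono divide_nonneg_pos zero_less_numeral zero_le_numeral)
  qed
  define E where "E = energy \<alpha> P"
  define F where "F = (\<integral>\<^sup>+\<gamma>. lint \<gamma> f \<partial>P)"
  define R1 where "R1 = (\<integral>\<^sup>+\<gamma>. lint (sg \<gamma>) f \<partial>P)"
  define R2 where "R2 = (\<integral>\<^sup>+\<gamma>. lint (sg \<gamma>) W \<partial>P)"
  define RP where "RP = (\<integral>\<^sup>+\<gamma>. lint (\<pi> \<gamma>) V \<partial>P)"
  have lm: "(\<lambda>\<gamma>. lint (c \<gamma>) h) \<in> borel_measurable P" if "c \<in> measurable P (Lip1_borel X)" "h \<in> borel_measurable borel" for c h
    by (rule measurable_lint_fixed[OF that])
  note lmi = lm[OF id_P]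
  have half: "ennreal (1 / 2) * x + ennreal (1 / 2) * x = x" for x
    by (simp only: distrib_right[symmetric] half_add_half mult_1)
  have [measurable]: "(\<lambda>\<gamma>. lint (\<Phi> \<gamma>) w') \<in> borel_measurable P" "(\<lambda>\<gamma>. lint \<gamma> w') \<in> borel_measurable P"
    by (rule lm[OF m] lmi; measurable)+
  have E'1: "2 * energy \<alpha> (distr ?M (Lip1_borel X) \<Psi>) = (\<integral>\<^sup>+\<gamma>. lint (\<Phi> \<gamma>) w' \<partial>P) + (\<integral>\<^sup>+\<gamma>. lint \<gamma> w' \<partial>P)"
  proof -
    have "energy \<alpha> (distr ?M (Lip1_borel X) \<Psi>) = (\<integral>\<^sup>+w. lint (\<Psi> w) w' \<partial>?M)"
      unfolding TP_distr(2)[OF X fM \<Psi>m \<Psi>f \<Psi>c] masM w'_def ..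
    also have "\<dots> = (\<integral>\<^sup>+\<gamma>. ennreal (1 / 2) * lint (\<Phi> \<gamma>) w' + ennreal (1 / 2) * lint \<gamma> w' \<partial>P)"
      by (subst nn_integral_pair_coin, rule measurable_lint_fixed[OF \<Psi>m]) (auto simp: \<Psi>_def)
    also have "\<dots> = ennreal (1 / 2) * (\<integral>\<^sup>+\<gamma>. lint (\<Phi> \<gamma>) w' \<partial>P) + ennreal (1 / 2) * (\<integral>\<^sup>+\<gamma>. lint \<gamma> w' \<partial>P)"
      by (subst nn_integral_add) (auto simp: nn_integral_cmult)
    finally have e: "energy \<alpha> (distr ?M (Lip1_borel X) \<Psi>) = ennreal (1 / 2) * (\<integral>\<^sup>+\<gamma>. lint (\<Phi> \<gamma>) w' \<partial>P) + ennreal (1 / 2) * (\<integral>\<^sup>+\<gamma>. lint \<gamma> w' \<partial>P)" .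
    have two: "2 * (ennreal (1 / 2) * x) = x" for x
      using half[of x] by (simp only: mult_2)
    show ?thesis unfolding e by (simp only: distrib_left two)
  qed
  have E'2: "2 * E \<le> 2 * energy \<alpha> (distr ?M (Lip1_borel X) \<Psi>)"
    unfolding E_def by (intro mult_left_mono opt TP_distr(1)[OF X fM \<Psi>m \<Psi>f \<Psi>c]) simp
  \<comment> \<open>Optimality against the competitor, doubled to clear the halves. The removed
    segments enter on the left as \<open>R1\<close>, so that the old parts of the rerouted curves
    complete to whole curves in \<open>F\<close>.\<close>
  have I1: "2 * E + R1 \<le> 2 * F + RP"
  proof -
    have "(\<integral>\<^sup>+\<gamma>. lint (\<Phi> \<gamma>) w' \<partial>P) + R1 = (\<integral>\<^sup>+\<gamma>. lint (\<Phi> \<gamma>) w' + lint (sg \<gamma>) f \<partial>P)"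
      unfolding R1_def by (subst nn_integral_add) (auto intro: lm[OF m] lm[OF sgm])
    also have "\<dots> \<le> (\<integral>\<^sup>+\<gamma>. lint \<gamma> f + lint (\<pi> \<gamma>) V \<partial>P)"
    proof (rule nn_integral_mono)
      fix \<gamma> assume g: "\<gamma> \<in> space P"
      have "lint (\<Phi> \<gamma>) w' \<le> lint (pre (a \<gamma>) \<gamma>) f + (lint (\<pi> \<gamma>) V + lint (suf (b \<gamma>) \<gamma>) f)"
        unfolding lP[OF g \<open>w' \<in> borel_measurable borel\<close>] by (intro add_mono lint_mono w'f w'V)
      then have "lint (\<Phi> \<gamma>) w' + lint (sg \<gamma>) f \<le> lint (pre (a \<gamma>) \<gamma>) f + (lint (\<pi> \<gamma>) V + lint (suf (b \<gamma>) \<gamma>) f) + lint (sg \<gamma>) f"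
        by (rule add_right_mono)
      also have "\<dots> = lint \<gamma> f + lint (\<pi> \<gamma>) V"
        unfolding lint_pre_seg_suf[OF gL[OF g] ab(1,2)[OF g] \<open>f \<in> borel_measurable borel\<close>] sg_def by (simp add: ac_simps)
      finally show "lint (\<Phi> \<gamma>) w' + lint (sg \<gamma>) f \<le> lint \<gamma> f + lint (\<pi> \<gamma>) V" .
    qed
    also have "\<dots> = F + RP" unfolding F_def RP_def by (subst nn_integral_add) (auto intro: lmi lm[OF \<pi>])
    finally have 1: "(\<integral>\<^sup>+\<gamma>. lint (\<Phi> \<gamma>) w' \<partial>P) + R1 \<le> F + RP" .
    have 2: "(\<integral>\<^sup>+\<gamma>. lint \<gamma> w' \<partial>P) \<le> F" unfolding F_def by (intro nn_integral_mono lint_mono w'f)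
    have "2 * E + R1 \<le> (\<integral>\<^sup>+\<gamma>. lint (\<Phi> \<gamma>) w' \<partial>P) + (\<integral>\<^sup>+\<gamma>. lint \<gamma> w' \<partial>P) + R1"
      using E'2 unfolding E'1 by (rule add_right_mono)
    also have "\<dots> = ((\<integral>\<^sup>+\<gamma>. lint (\<Phi> \<gamma>) w' \<partial>P) + R1) + (\<integral>\<^sup>+\<gamma>. lint \<gamma> w' \<partial>P)" by (simp add: ac_simps)
    also have "\<dots> \<le> (F + RP) + F" by (rule add_mono[OF 1 2])
    also have "\<dots> = 2 * F + RP" by (simp only: mult_2 add.assoc add.commute add.left_commute)
    finally show ?thesis .
  qed
  have AEsg: "AE \<gamma> in P. simple_curve (sg \<gamma>) \<and> fin (sg \<gamma>)"
    using AE_good AE_space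
    by eventually_elim (simp add: sg_def simple_seg[OF _ ab(1,2)] fin_seg[OF ab(1,2)])
  define iv where "iv y = ennreal (1 / th y)" for y
  have [measurable]: "iv \<in> borel_measurable borel" unfolding iv_def[abs_def] by measurable
  \<comment> \<open>The exchange inequality, once in each direction, expresses integrals along the
    segments by the density \<open>tr / th\<close> along whole curves: a lower bound for
    \<open>R1\<close> here, an upper bound for \<open>R2\<close> below.\<close>
  have R1': "(\<integral>\<^sup>+\<gamma>. lint \<gamma> (\<lambda>y. f y * iv y * ennreal (tr y)) \<partial>P) \<le> R1"
  proof -
    have "(\<integral>\<^sup>+\<gamma>. lint \<gamma> (\<lambda>y. (f y * iv y) * mass P sg y) \<partial>P) \<le> (\<integral>\<^sup>+\<gamma>. lint (sg \<gamma>) (\<lambda>y. (f y * iv y) * mass P (\<lambda>\<gamma>. \<gamma>) y) \<partial>P)"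
      by (rule lint_mass_le_fixed[OF sf sf id_P sgm AE_good]) measurable
    also have "\<dots> \<le> R1" unfolding R1_def
    proof (intro nn_integral_mono lint_mono)
      fix y
      have "iv y * ennreal (th y) \<le> 1"
        unfolding iv_def by (cases "th y = 0") (auto simp: ennreal_mult[symmetric])
      then have "f y * (iv y * ennreal (th y)) \<le> f y * 1" by (rule mult_left_mono) simp
      then show "(f y * iv y) * mass P (\<lambda>\<gamma>. \<gamma>) y \<le> f y" by (simp add: ennreal_th mult.assoc)
    qed
    finally show ?thesis unfolding mas .
  qed
  have AEps: "AE \<gamma> in P. AE t in lborel. 0 \<le> t \<longrightarrow> 0 < sp (sg \<gamma>) t \<longrightarrow> 0 < th (sg \<gamma> t)"
    unfolding sg_def by (rule AE_pos_seg) (auto intro: ab)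
  have R2': "R2 \<le> (\<integral>\<^sup>+\<gamma>. lint \<gamma> (\<lambda>y. W y * iv y * ennreal (tr y)) \<partial>P)"
  proof -
    have "R2 \<le> (\<integral>\<^sup>+\<gamma>. lint (sg \<gamma>) (\<lambda>y. (W y * iv y) * mass P (\<lambda>\<gamma>. \<gamma>) y) \<partial>P)"
      unfolding R2_def
    proof (rule nn_integral_mono_AE, use AEps in eventually_elim)
      case (elim \<gamma>)
      show ?case
      proof (rule lint_mono_AE, use elim in eventually_elim)
        case (elim t)
        show ?case
        proof (intro impI)
          assume "0 \<le> t" "0 < sp (sg \<gamma>) t"
          then have p: "0 < th (sg \<gamma> t)" using elim by simp
          have "iv (sg \<gamma> t) * ennreal (th (sg \<gamma> t)) = 1"
            using p by (simp add: iv_def ennreal_mult[symmetric])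
          then show "W (sg \<gamma> t) \<le> (W (sg \<gamma> t) * iv (sg \<gamma> t)) * mass P (\<lambda>\<gamma>. \<gamma>) (sg \<gamma> t)"
            by (simp add: ennreal_th[symmetric] mult.assoc)
        qed
      qed
    qed
    also have "\<dots> \<le> (\<integral>\<^sup>+\<gamma>. lint \<gamma> (\<lambda>y. (W y * iv y) * mass P sg y) \<partial>P)"
      by (rule lint_mass_le_fixed[OF sf sf sgm id_P AEsg]) measurable
    finally show ?thesis unfolding mas .
  qed
  \<comment> \<open>Concavity at a point: the tangent at \<open>v\<close> bounds the power at
    \<open>u = v - s / 2\<close>, and the result is divided by \<open>v\<close>.\<close>
  have pt: "2 * f y + ennreal \<alpha> * (W y * iv y * ennreal (tr y)) \<le> 2 * W y + f y * iv y * ennreal (tr y)" for y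
  proof (cases "th y = 0")
    case True then show ?thesis by (simp add: W_def weight_def ennreal_mult_top)
  next
    case False
    define v where "v = th y" define s where "s = tr y"
    have v: "0 < v" using False th_nonneg[of y] by (simp add: v_def order_less_le)
    have s: "0 \<le> s" "s \<le> v" using tr_le[of y] by (auto simp: s_def v_def tr_def)
    define u where "u = v - s / 2"
    have u: "0 < u" using v s by (simp add: u_def)
    have "u powr \<alpha> \<le> v powr \<alpha> + \<alpha> * v powr (\<alpha> - 1) * (u - v)"
      by (rule powr_tangent_le[OF \<alpha> u v])
    moreover have "u powr \<alpha> = u powr (\<alpha> - 1) * u" "v powr \<alpha> = v powr (\<alpha> - 1) * v" using u v by (simp_all add: powr_diff)
    ultimately have "2 * (u powr (\<alpha> - 1) * (v - s / 2)) \<le> 2 * (v powr (\<alpha> - 1) * v + \<alpha> * v powr (\<alpha> - 1) * (- s / 2))"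
      by (simp add: u_def)
    then have "2 * u powr (\<alpha> - 1) * v + \<alpha> * v powr (\<alpha> - 1) * s \<le> 2 * v powr (\<alpha> - 1) * v + u powr (\<alpha> - 1) * s"
      by (simp add: algebra_simps)
    then have "(2 * u powr (\<alpha> - 1) * v + \<alpha> * v powr (\<alpha> - 1) * s) / v \<le> (2 * v powr (\<alpha> - 1) * v + u powr (\<alpha> - 1) * s) / v"
      using v by (intro divide_right_mono) auto
    then have r: "2 * u powr (\<alpha> - 1) + \<alpha> * (v powr (\<alpha> - 1) * (1 / v) * s) \<le> 2 * v powr (\<alpha> - 1) + u powr (\<alpha> - 1) * (1 / v) * s"
      using v by (simp add: add_divide_distrib)
    have fy: "f y = ennreal (u powr (\<alpha> - 1))" using u by (simp add: f_def u_def v_def s_def weight_def)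
    have Wy: "W y = ennreal (v powr (\<alpha> - 1))" using v W_pos[of y] by (simp add: v_def)
    have ivy: "iv y = ennreal (1 / v)" by (simp add: iv_def v_def)
    have "2 * f y + ennreal \<alpha> * (W y * iv y * ennreal (tr y)) = ennreal (2 * u powr (\<alpha> - 1)) + ennreal (\<alpha> * (v powr (\<alpha> - 1) * (1 / v) * s))"
      unfolding fy Wy ivy s_def[symmetric]
      by (rule arg_cong2[where f="(+)", OF ennreal_two[symmetric] trans[OF ennreal_mult arg_cong[where f="\<lambda>x. ennreal \<alpha> * x", OF ennreal_mult3], symmetric]])
        (use v s \<alpha> in auto)
    also have "\<dots> = ennreal (2 * u powr (\<alpha> - 1) + \<alpha> * (v powr (\<alpha> - 1) * (1 / v) * s))"
      by (rule ennreal_plus[symmetric]) (use v s \<alpha> in auto)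
    also have "\<dots> \<le> ennreal (2 * v powr (\<alpha> - 1) + u powr (\<alpha> - 1) * (1 / v) * s)" using r by (rule ennreal_leI)
    also have "\<dots> = ennreal (2 * v powr (\<alpha> - 1)) + ennreal (u powr (\<alpha> - 1) * (1 / v) * s)"
      by (rule ennreal_plus) (use v s in auto)
    also have "\<dots> = 2 * W y + f y * iv y * ennreal (tr y)"
      unfolding fy Wy ivy s_def[symmetric]
      by (rule arg_cong2[where f="(+)", OF ennreal_two ennreal_mult3]) (use v s in auto)
    finally show ?thesis .
  qed
  have I2: "2 * F + ennreal \<alpha> * R2 \<le> 2 * E + R1"
  proof -
    let ?G = "\<lambda>y. W y * iv y * ennreal (tr y)" and ?H = "\<lambda>y. f y * iv y * ennreal (tr y)"
    have mG: "?G \<in> borel_measurable borel" "?H \<in> borel_measurable borel" by measurable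
    note [measurable] = lmi[OF mG(1)] lmi[OF mG(2)] lmi[OF \<open>f \<in> borel_measurable borel\<close>] lmi[OF measurable_W]
    have "2 * F + ennreal \<alpha> * R2 \<le> 2 * F + ennreal \<alpha> * (\<integral>\<^sup>+\<gamma>. lint \<gamma> ?G \<partial>P)"
      by (intro add_left_mono mult_left_mono R2') simp
    also have "\<dots> = (\<integral>\<^sup>+\<gamma>. 2 * lint \<gamma> f + ennreal \<alpha> * lint \<gamma> ?G \<partial>P)"
      unfolding F_def by (subst nn_integral_add) (auto simp: nn_integral_cmult)
    also have "\<dots> = (\<integral>\<^sup>+\<gamma>. lint \<gamma> (\<lambda>y. 2 * f y + ennreal \<alpha> * ?G y) \<partial>P)"
      by (rule nn_integral_cong) (use mG in \<open>simp add: lint_add[OF gL] lint_cmult[OF gL]\<close>)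
    also have "\<dots> \<le> (\<integral>\<^sup>+\<gamma>. lint \<gamma> (\<lambda>y. 2 * W y + ?H y) \<partial>P)"
      by (intro nn_integral_mono lint_mono pt)
    also have "\<dots> = (\<integral>\<^sup>+\<gamma>. 2 * lint \<gamma> W + lint \<gamma> ?H \<partial>P)"
      by (rule nn_integral_cong) (use mG in \<open>simp add: lint_add[OF gL] lint_cmult[OF gL]\<close>)
    also have "\<dots> = 2 * E + (\<integral>\<^sup>+\<gamma>. lint \<gamma> ?H \<partial>P)"
      unfolding E_def energy_W by (subst nn_integral_add) (auto simp: nn_integral_cmult)
    also have "\<dots> \<le> 2 * E + R1" by (rule add_left_mono[OF R1'])
    finally show ?thesis .
  qed
  \<comment> \<open>Needed to cancel \<open>2 * E + R1\<close>. It holds because \<open>tr\<close>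
    is at most \<open>th\<close>, so at least half of the multiplicity remains and \<open>f\<close>
    is at most \<open>cc * W\<close>.\<close>
  have "R1 < \<infinity>"
  proof -
    have fc: "f y \<le> cc * W y" for y
    proof -
      have e: "2 * (th y - tr y / 2) / 2 = th y - tr y / 2" by simp
      have "th y \<le> 2 * (th y - tr y / 2)" using tr_le[of y] by simp
      from weight_half_le[OF this] show ?thesis unfolding e f_def .
    qed
    have "R1 \<le> (\<integral>\<^sup>+\<gamma>. lint \<gamma> f \<partial>P)" unfolding R1_def sg_def
      by (intro nn_integral_mono lint_seg_le[where X=X] gL ab) auto
    also have "\<dots> \<le> (\<integral>\<^sup>+\<gamma>. lint \<gamma> (\<lambda>y. cc * W y) \<partial>P)" by (intro nn_integral_mono lint_mono fc)
    also have "\<dots> = (\<integral>\<^sup>+\<gamma>. cc * lint \<gamma> W \<partial>P)" by (rule nn_integral_cong) (simp add: lint_cmult[OF gL])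
    also have "\<dots> = cc * energy \<alpha> P" unfolding energy_W by (simp add: nn_integral_cmult lmi)
    also have "\<dots> < \<infinity>" using fin_energy by (simp add: cc_def ennreal_mult_less_top)
    finally show ?thesis .
  qed
  then have fin: "2 * E + R1 \<noteq> \<infinity>" using fin_energy by (auto simp: E_def ennreal_mult_eq_top_iff)
  have "(2 * E + R1) + ennreal \<alpha> * R2 \<le> (2 * F + RP) + ennreal \<alpha> * R2" by (rule add_right_mono[OF I1])
  also have "\<dots> = (2 * F + ennreal \<alpha> * R2) + RP" by (simp add: ac_simps)
  also have "\<dots> \<le> (2 * E + R1) + RP" by (rule add_right_mono[OF I2])
  finally have "ennreal \<alpha> * R2 \<le> RP" using fin by (simp only: ennreal_add_left_cancel_le) auto
  then show ?thesis unfolding R2_def RP_def sg_def V_def tp_def .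
qed

end

section \<open>Connecting two points of an optimal plan\<close>

text \<open>The first time with the default value 0 off the trace, which makes it nonnegative on
  \<open>Lip1 X\<close> and measurable jointly with the point.\<close>

definition ft :: "'a::euclidean_space \<Rightarrow> (real \<Rightarrow> 'a) \<Rightarrow> real" where
  "ft y c = (if y \<in> ctrace c then first_time y c else 0)"

lemma ft:
  assumes "c \<in> Lip1 X"
  shows "0 \<le> ft y c" "y \<in> ctrace c \<Longrightarrow> c (ft y c) = y" "0 \<le> t \<Longrightarrow> c t = y \<Longrightarrow> ft y c \<le> t"
  using first_time_props[OF assms] by (auto simp: ft_def ctrace_def)

lemma ctrace_pre: "0 \<le> c \<Longrightarrow> ctrace (pre c \<gamma>) = \<gamma> ` {0..c}"
proof
  assume c: "0 \<le> c"
  show "ctrace (pre c \<gamma>) \<subseteq> \<gamma> ` {0..c}" using c by (auto simp: ctrace_def pre_def)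
  show "\<gamma> ` {0..c} \<subseteq> ctrace (pre c \<gamma>)"
  proof
    fix x assume "x \<in> \<gamma> ` {0..c}"
    then obtain t where t: "0 \<le> t" "t \<le> c" "x = \<gamma> t" by auto
    then have "x = pre c \<gamma> t" by (simp add: pre_def)
    then show "x \<in> ctrace (pre c \<gamma>)" using t by (auto simp: ctrace_def)
  qed
qed

lemma ft_le_iff:
  assumes g: "\<gamma> \<in> Lip1 X" and y: "y \<in> ctrace \<gamma>" and c: "0 \<le> c"
  shows "ft y \<gamma> \<le> c \<longleftrightarrow> y \<in> ctrace (pre c \<gamma>)"
proof
  assume l: "ft y \<gamma> \<le> c"
  have "y = \<gamma> (ft y \<gamma>)" using ft(2)[OF g y] by simp
  then show "y \<in> ctrace (pre c \<gamma>)" using l ft(1)[OF g] unfolding ctrace_pre[OF c] by auto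
next
  assume "y \<in> ctrace (pre c \<gamma>)"
  then obtain t where "0 \<le> t" "t \<le> c" "\<gamma> t = y" unfolding ctrace_pre[OF c] by auto
  then show "ft y \<gamma> \<le> c" using ft(3)[OF g, of t y] by simp
qed

lemma measurable_ft:
  assumes f: "f \<in> measurable N (Lip1_borel X)" and y: "y \<in> borel_measurable N"
  shows "(\<lambda>\<omega>. ft (y \<omega>) (f \<omega>)) \<in> borel_measurable N"
proof (rule borel_measurable_iff_le[THEN iffD2], rule allI)
  fix c :: real
  have L: "f \<omega> \<in> Lip1 X" if "\<omega> \<in> space N" for \<omega> using measurable_space[OF f that] by simp
  show "{\<omega>\<in>space N. ft (y \<omega>) (f \<omega>) \<le> c} \<in> sets N"
  proof (cases "0 \<le> c")
    case True
    have p: "(\<lambda>\<omega>. pre c (f \<omega>)) \<in> measurable N (Lip1_borel X)"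
      by (rule measurable_pre[OF f]) (use True in auto)
    have "{\<omega>\<in>space N. ft (y \<omega>) (f \<omega>) \<le> c} =
      {\<omega>\<in>space N. y \<omega> \<in> ctrace (pre c (f \<omega>))} \<union> (space N - {\<omega>\<in>space N. y \<omega> \<in> ctrace (f \<omega>)})" (is "?A = ?B")
    proof (rule set_eqI)
      fix \<omega>
      show "\<omega> \<in> ?A \<longleftrightarrow> \<omega> \<in> ?B"
      proof (cases "\<omega> \<in> space N \<and> y \<omega> \<in> ctrace (f \<omega>)")
        case w: True
        then show ?thesis using ft_le_iff[OF L, of \<omega> "y \<omega>" c] True by auto
      next
        case False
        have "ctrace (pre c (f \<omega>)) \<subseteq> ctrace (f \<omega>)" unfolding ctrace_pre[OF True] by (auto simp: ctrace_def)
        then show ?thesis using False True by (auto simp: ft_def)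
      qed
    qed
    then show ?thesis using measurable_ctrace_pred[OF p y] measurable_ctrace_pred[OF f y] by auto
  next
    case False
    have "{\<omega>\<in>space N. ft (y \<omega>) (f \<omega>) \<le> c} = {}"
      using False ft(1)[OF L] by (auto simp: not_le intro: order_less_le_trans)
    then show ?thesis by (simp only: sets.empty_sets)
  qed
qed

text \<open>Failure of simplicity is a countable union of conditions stable under limits: times
  bounded by \<open>n\<close> and an excursion of size at least \<open>1 / real (Suc n)\<close>. The
  excursion is bounded away from zero, so weak inequalities between the three times suffice.\<close>

lemma sets_simple_curve:
  fixes X :: "'a::euclidean_space set"
  assumes X: "compact X" shows "{\<gamma>\<in>Lip1 X. simple_curve \<gamma>} \<in> sets (Lip1_borel X)"
proof -
  define S where "S n = {\<gamma>\<in>Lip1 X. \<exists>t1 t2 t3. 0 \<le> t1 \<and> t1 \<le> t2 \<and> t2 \<le> t3 \<and> t3 \<le> real n \<and> \<gamma> t1 = \<gamma> t3 \<and> 1 / real (Suc n) \<le> dist (\<gamma> t3) (\<gamma> t2)}" for n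
  have S: "S n \<in> sets (Lip1_borel X)" for n
  proof (rule seq_closed_sets_Lip1[OF X])
    show "S n \<subseteq> Lip1 X" by (auto simp: S_def)
    fix g \<gamma> assume g: "\<And>k::nat. g k \<in> S n" and \<gamma>: "\<gamma> \<in> Lip1 X" and lim: "\<And>t. 0 \<le> t \<Longrightarrow> (\<lambda>k. g k t) \<longlonglongrightarrow> \<gamma> t"
    have "\<forall>k. \<exists>t1 t2 t3. 0 \<le> t1 \<and> t1 \<le> t2 \<and> t2 \<le> t3 \<and> t3 \<le> real n \<and> g k t1 = g k t3 \<and> 1 / real (Suc n) \<le> dist (g k t3) (g k t2)"
      using g by (auto simp: S_def)
    then obtain a b c where abc: "\<And>k. 0 \<le> a k" "\<And>k. a k \<le> b k" "\<And>k. b k \<le> c k" "\<And>k. c k \<le> real n" "\<And>k. g k (a k) = g k (c k)"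
      "\<And>k. 1 / real (Suc n) \<le> dist (g k (c k)) (g k (b k))" by metis
    have gL: "g k \<in> Lip1 X" for k using g[of k] by (simp add: S_def)
    have sc: "seq_compact ({0..real n} \<times> {0..real n} \<times> {0..real n})"
      by (intro compact_imp_seq_compact compact_Times compact_Icc)
    have mem: "(a k, b k, c k) \<in> {0..real n} \<times> {0..real n} \<times> {0..real n}" for k
      using abc(1-4)[of k] by auto
    obtain l r where lr: "strict_mono (r :: nat \<Rightarrow> nat)" "((\<lambda>k. (a k, b k, c k)) \<circ> r) \<longlonglongrightarrow> l"
      by (rule seq_compactE[where f="\<lambda>k. (a k, b k, c k)", OF sc]) (use mem in auto)
    define a' where "a' = fst l" define b' where "b' = fst (snd l)" define c' where "c' = snd (snd l)"
    have lim3: "(\<lambda>k. a (r k)) \<longlonglongrightarrow> a'" "(\<lambda>k. b (r k)) \<longlonglongrightarrow> b'" "(\<lambda>k. c (r k)) \<longlonglongrightarrow> c'"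
      using tendsto_fst[OF lr(2)] tendsto_fst[OF tendsto_snd[OF lr(2)]] tendsto_snd[OF tendsto_snd[OF lr(2)]]
      by (simp_all add: o_def a'_def b'_def c'_def)
    have ev: "(\<lambda>k. g (r k) (s k)) \<longlonglongrightarrow> \<gamma> s'" if s: "s \<longlonglongrightarrow> s'" "\<And>k. 0 \<le> s k" for s s'
    proof -
      have s': "0 \<le> s'" by (rule LIMSEQ_le_const[OF s(1)]) (use s(2) in auto)
      have 1: "(\<lambda>k. g (r k) s') \<longlonglongrightarrow> \<gamma> s'" using LIMSEQ_subseq_LIMSEQ[OF lim[OF s'] lr(1)] by (simp add: o_def)
      have "(\<lambda>k. g (r k) (s k) - g (r k) s') \<longlonglongrightarrow> 0"
      proof (rule Lim_null_comparison)
        show "eventually (\<lambda>k. norm (g (r k) (s k) - g (r k) s') \<le> \<bar>s k - s'\<bar>) sequentially"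
          using Lip1_dist[OF gL s(2) s'] by (simp add: dist_norm)
        show "(\<lambda>k. \<bar>s k - s'\<bar>) \<longlonglongrightarrow> 0" using tendsto_rabs[OF tendsto_diff[OF s(1) tendsto_const[of s']]] by simp
      qed
      from tendsto_add[OF this 1] show ?thesis by simp
    qed
    have n0: "0 \<le> b k" "0 \<le> c k" for k using abc(1-3)[of k] by auto
    have e: "(\<lambda>k. g (r k) (a (r k))) \<longlonglongrightarrow> \<gamma> a'" "(\<lambda>k. g (r k) (b (r k))) \<longlonglongrightarrow> \<gamma> b'" "(\<lambda>k. g (r k) (c (r k))) \<longlonglongrightarrow> \<gamma> c'"
      by (rule ev, rule lim3, use abc(1) n0 in simp)+
    have "0 \<le> a'" by (rule LIMSEQ_le_const[OF lim3(1)]) (use abc in auto)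
    moreover have "a' \<le> b'" by (rule LIMSEQ_le[OF lim3(1,2)]) (use abc in auto)
    moreover have "b' \<le> c'" by (rule LIMSEQ_le[OF lim3(2,3)]) (use abc in auto)
    moreover have "c' \<le> real n" by (rule LIMSEQ_le_const2[OF lim3(3)]) (use abc in auto)
    moreover have "\<gamma> a' = \<gamma> c'" by (rule LIMSEQ_unique[OF e(1)]) (use e(3) abc(5) in simp)
    moreover have "1 / real (Suc n) \<le> dist (\<gamma> c') (\<gamma> b')"
      by (rule LIMSEQ_le_const[OF tendsto_dist[OF e(3,2)]]) (use abc(6) in blast)
    ultimately show "\<gamma> \<in> S n" using \<gamma> unfolding S_def by blast
  qed
  have "{\<gamma>\<in>Lip1 X. simple_curve \<gamma>} = space (Lip1_borel X) - (\<Union>n. S n)"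
  proof (intro equalityI subsetI)
    fix \<gamma> assume g: "\<gamma> \<in> {\<gamma>\<in>Lip1 X. simple_curve \<gamma>}"
    have "\<gamma> \<notin> S n" for n
    proof
      assume "\<gamma> \<in> S n"
      then obtain t1 t2 t3 where t: "0 \<le> t1" "t1 \<le> t2" "t2 \<le> t3" "\<gamma> t1 = \<gamma> t3" "1 / real (Suc n) \<le> dist (\<gamma> t3) (\<gamma> t2)"
        by (auto simp: S_def)
      have "0 < 1 / real (Suc n)" by simp
      then have ne: "\<gamma> t3 \<noteq> \<gamma> t2" using t(5) by (auto simp del: divide_less_eq)
      then have "t1 \<noteq> t2" "t2 \<noteq> t3" using t(4) by auto
      then have "t1 < t2" "t2 < t3" using t by auto
      then show False using g t(1,4) ne unfolding simple_curve_def by blast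
    qed
    then show "\<gamma> \<in> space (Lip1_borel X) - (\<Union>n. S n)" using g by simp
  next
    fix \<gamma> assume g: "\<gamma> \<in> space (Lip1_borel X) - (\<Union>n. S n)"
    have "simple_curve \<gamma>"
    proof (rule ccontr)
      assume "\<not> simple_curve \<gamma>"
      then obtain t1 t2 t3 where t: "0 \<le> t1" "t1 < t2" "t2 < t3" "\<gamma> t1 = \<gamma> t3" "\<gamma> t3 \<noteq> \<gamma> t2"
        unfolding simple_curve_def by blast
      obtain m :: nat where m: "t3 \<le> real m" using real_arch_simple by blast
      obtain k :: nat where k: "1 / real (Suc k) < dist (\<gamma> t3) (\<gamma> t2)" using nat_approx_posE[of "dist (\<gamma> t3) (\<gamma> t2)"] t(5) by auto
      let ?n = "max m k"
      have "1 / real (Suc ?n) \<le> 1 / real (Suc k)" by (intro divide_left_mono) auto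
      then have "1 / real (Suc ?n) \<le> dist (\<gamma> t3) (\<gamma> t2)" "t3 \<le> real ?n" using k m by auto
      then have "\<gamma> \<in> S ?n" unfolding S_def using t g by (intro CollectI conjI exI[of _ t1] exI[of _ t2] exI[of _ t3]) auto
      then show False using g by auto
    qed
    then show "\<gamma> \<in> {\<gamma>\<in>Lip1 X. simple_curve \<gamma>}" using g by simp
  qed
  also have "\<dots> \<in> sets (Lip1_borel X)" by (intro sets.Diff sets.top sets.countable_UN) (use S in auto)
  finally show ?thesis .
qed

text \<open>If \<open>y\<close> were first met before every visit to \<open>x\<close>, a passage
  from \<open>x\<close> to a later visit to \<open>y\<close> would close a loop. On a simple curve
  the order of the first times therefore decides.\<close>

lemma passing_eq:
  "passing X x y = {c\<in>Lip1 X. simple_curve c \<and> x \<in> ctrace c \<and> y \<in> ctrace c \<and> ft x c \<le> ft y c}"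
proof (intro equalityI subsetI)
  fix c assume "c \<in> passing X x y"
  then obtain t1 t2 where g: "c \<in> Lip1 X" "simple_curve c" and t: "0 \<le> t1" "t1 \<le> t2" "c t1 = x" "c t2 = y"
    by (auto simp: passing_def)
  have tr: "x \<in> ctrace c" "y \<in> ctrace c" using t by (auto simp: ctrace_def)
  have "ft x c \<le> ft y c"
  proof (rule ccontr)
    assume "\<not> ft x c \<le> ft y c"
    then have 1: "ft y c < t1" using ft(3)[OF g(1) t(1) t(3)] by simp
    have 2: "x \<noteq> y" using \<open>\<not> ft x c \<le> ft y c\<close> by auto
    then have 3: "t1 < t2" using t by (auto simp: order_less_le)
    show False using g(2) 1 2 3 ft(1)[OF g(1), of y] ft(2)[OF g(1) tr(2)] t unfolding simple_curve_def by metis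
  qed
  then show "c \<in> {c\<in>Lip1 X. simple_curve c \<and> x \<in> ctrace c \<and> y \<in> ctrace c \<and> ft x c \<le> ft y c}" using g tr by simp
next
  fix c assume g: "c \<in> {c\<in>Lip1 X. simple_curve c \<and> x \<in> ctrace c \<and> y \<in> ctrace c \<and> ft x c \<le> ft y c}"
  then show "c \<in> passing X x y" unfolding passing_def using ft(1,2)[of c X]
    by (intro CollectI conjI exI[of _ "ft x c"] exI[of _ "ft y c"]) auto
qed

lemma measure_eq_0_AE: assumes "AE x in M. x \<notin> A" shows "measure M A = 0"
proof (cases "A \<in> sets M")
  case True
  then have "{x\<in>space M. \<not> x \<notin> A} = A" using sets.sets_into_space by auto
  then have "emeasure M A = 0" using assms AE_iff_measurable[OF True, of "\<lambda>x. x \<notin> A"] by blast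
  then show ?thesis by (simp add: measure_def)
qed (simp add: measure_notin_sets)

text \<open>Both orders of \<open>y\<close> and \<open>z\<close> are covered at once, as
  \<open>Gamma_between\<close> is a union over the two directions.\<close>

definition btw :: "'a::euclidean_space \<Rightarrow> 'a \<Rightarrow> 'a \<Rightarrow> (real \<Rightarrow> 'a) \<Rightarrow> bool" where
  "btw x0 y z c \<longleftrightarrow> y \<in> ctrace c \<and> z \<in> ctrace c \<and>
     x0 \<in> c ` {min (ft y c) (ft z c)..max (ft y c) (ft z c)}"

lemma lint_seg_mono:
  assumes g: "c \<in> Lip1 X" and ab: "0 \<le> a" "a \<le> s" "s \<le> t" "t \<le> b" and f: "f \<in> borel_measurable borel"
  shows "lint (seg s t c) f \<le> lint (seg a b c) f"
proof -
  have "0 \<le> s" "a \<le> b" using ab by auto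
  then show ?thesis using ab
    unfolding lint_seg[OF g \<open>0 \<le> s\<close> ab(3) f] lint_seg[OF g ab(1) \<open>a \<le> b\<close> f]
    by (intro nn_integral_mono mult_left_mono) (auto simp: indicator_def)
qed

lemma simple_rev_curve:
  assumes "simple_curve c" shows "simple_curve (rev_curve L c)"
  unfolding simple_curve_def
proof (rule notI, elim exE conjE)
  fix t1 t2 t3 :: real assume t: "0 \<le> t1" "t1 < t2" "t2 < t3" "rev_curve L c t1 = rev_curve L c t3" "rev_curve L c t3 \<noteq> rev_curve L c t2"
  define u where "u t = max 0 (L - t)" for t
  have r: "rev_curve L c t1 = c (u t1)" "rev_curve L c t2 = c (u t2)" "rev_curve L c t3 = c (u t3)"
    using t by (simp_all add: rev_curve_def u_def)
  have le: "0 \<le> u t3" "u t3 \<le> u t2" "u t2 \<le> u t1" using t by (simp_all add: u_def)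
  have "u t3 \<noteq> u t2" "u t2 \<noteq> u t1" using t(4,5) unfolding r by auto
  then show False using assms le t(4,5) unfolding r simple_curve_def by (metis order_less_le)
qed

text \<open>\<open>sp\<close> is built from right difference quotients, so no substitution is made;
  the reversed curve is simple with the same trace, and the two-curve inequality applies.\<close>

lemma lint_rev_curve_le:
  assumes c: "c \<in> Lip1 X" "simple_curve c" and L: "0 \<le> L" "\<And>t. L \<le> t \<Longrightarrow> c t = c L" and f: "f \<in> borel_measurable borel"
  shows "lint (rev_curve L c) f \<le> lint c f"
proof -
  let ?r = "rev_curve L c"
  have tr: "ctrace ?r = ctrace c" by (rule ctrace_rev_curve[OF L(1)]) (rule L(2))
  have fr: "fin ?r" unfolding fin_def using L(1) by (intro exI[of _ L]) (simp add: rev_curve_const)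
  have "lint ?r f \<le> lint ?r (\<lambda>y. f y * indicator (ctrace c) y)"
  proof (rule lint_mono)
    fix t :: real assume "0 \<le> t"
    then have "?r t \<in> ctrace c" unfolding tr[symmetric] by (auto simp: ctrace_def)
    then show "f (?r t) \<le> f (?r t) * indicator (ctrace c) (?r t)" by simp
  qed
  also have "\<dots> \<le> lint c (\<lambda>y. f y * indicator (ctrace ?r) y)"
    by (rule lint_trace_le[OF rev_curve_Lip1[OF c(1)] simple_rev_curve[OF c(2)] fr c(1) f])
  also have "\<dots> \<le> lint c f" by (rule lint_mono) (simp add: indicator_def)
  finally show ?thesis .
qed

lemma pre_0_eq_cst: "pre 0 c = cst (c 0)"
  by (rule ext) (simp add: pre_def cst_def restrict_def)

lemma seg_at: "0 \<le> u \<Longrightarrow> u \<le> v \<Longrightarrow> seg u v \<sigma> 0 = \<sigma> u" "0 \<le> u \<Longrightarrow> u \<le> v \<Longrightarrow> v - u \<le> t \<Longrightarrow> seg u v \<sigma> t = \<sigma> v"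
  by (auto simp: seg_def pre_def suf_def min_def)

section \<open>Connecting sets in terms of first times\<close>

context curve_plan
begin

lemma measurable_ft_P: "(\<lambda>c. ft y c) \<in> borel_measurable P"
  by (rule measurable_ft[OF id_P]) simp

lemma sets_passing: "passing X x y \<in> sets P"
proof -
  have s: "{c\<in>space P. simple_curve c} \<in> sets P" using sets_simple_curve[OF X] unfolding sets_P space_P .
  have f: "{c\<in>space P. ft x c \<le> ft y c} \<in> sets P"
    using measurable_ft_P[of x] measurable_ft_P[of y] by measurable
  have "passing X x y = {c\<in>space P. simple_curve c} \<inter> ({c\<in>space P. x \<in> ctrace c} \<inter> ({c\<in>space P. y \<in> ctrace c} \<inter> {c\<in>space P. ft x c \<le> ft y c}))"
    unfolding passing_eq by (auto simp: space_P)
  then show ?thesis using s f sets_hit[of x] sets_hit[of y] by auto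
qed

text \<open>Turns the restricted and pushed-forward plan into an event for \<open>P\<close>. On
  \<open>passing X x y\<close> the map \<open>res\<close> is evaluation at the time clamped between
  \<open>ft x c\<close> and \<open>ft y c\<close>, a form in which its measurability is
  visible.\<close>

lemma multiplicity_between:
  "multiplicity_at (plan_between X P x y) p = measure P {c\<in>passing X x y. p \<in> c ` {ft x c..ft y c}}"
proof -
  let ?A = "passing X x y" and ?\<Phi> = "\<lambda>c. res (first_time x c) (first_time y c) c"
  let ?R = "restrict_space P ?A"
  define \<Psi> where "\<Psi> c = (\<lambda>t\<in>{0..}. c (max (ft x c) (min t (ft y c))))" for c :: "real \<Rightarrow> 'a"
  have A: "?A \<inter> space P \<in> sets P" using sets_passing by auto
  have Asub: "?A \<subseteq> space P" by (rule sets.sets_into_space[OF sets_passing])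
  have spR: "space ?R = ?A" using Asub by (auto simp: space_restrict_space)
  have eq: "?\<Phi> c = \<Psi> c" if "c \<in> ?A" for c
  proof -
    have "x \<in> ctrace c" "y \<in> ctrace c" "ft x c \<le> ft y c" using that by (auto simp: passing_eq)
    then show ?thesis by (auto simp: \<Psi>_def res_def ft_def fun_eq_iff restrict_def max_def min_def)
  qed
  have L: "c \<in> Lip1 X" if "c \<in> ?A" for c using that by (simp add: passing_eq)
  have idR: "(\<lambda>c. c) \<in> measurable ?R (Lip1_borel X)" by (rule measurable_restrict_space1[OF id_P])
  have \<Psi>m: "\<Psi> \<in> measurable ?R (Lip1_borel X)"
  proof (rule measurable_into_Lip1)
    fix c assume "c \<in> space ?R"
    then have g: "c \<in> Lip1 X" using L spR by blast
    show "\<Psi> c \<in> Lip1 X"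
    proof (rule Lip1_I)
      fix t :: real assume "0 \<le> t"
      then show "\<Psi> c t \<in> X" using ft(1)[OF g, of x] by (auto simp: \<Psi>_def intro!: Lip1_in[OF g])
    next
      fix s t :: real assume st: "0 \<le> s" "s \<le> t"
      have "dist (\<Psi> c s) (\<Psi> c t) \<le> \<bar>max (ft x c) (min s (ft y c)) - max (ft x c) (min t (ft y c))\<bar>"
        using st ft(1)[OF g, of x] Lip1_dist[OF g] by (simp add: \<Psi>_def le_max_iff_disj)
      also have "\<dots> \<le> t - s" using st by (auto simp: max_def min_def)
      finally show "dist (\<Psi> c s) (\<Psi> c t) \<le> t - s" .
    qed (simp add: \<Psi>_def)
  next
    fix t :: real assume t: "0 \<le> t"
    have [measurable]: "(\<lambda>c. ft x c) \<in> borel_measurable ?R" "(\<lambda>c. ft y c) \<in> borel_measurable ?R"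
      by (rule measurable_restrict_space1[OF measurable_ft_P])+
    have "(\<lambda>c. c (max (ft x c) (min t (ft y c)))) \<in> borel_measurable ?R"
      by (rule measurable_Lip1_joint[OF idR]) (use ft(1)[OF L] spR in \<open>auto simp: le_max_iff_disj\<close>)
    then show "(\<lambda>c. \<Psi> c t) \<in> borel_measurable ?R" using t by (simp add: \<Psi>_def)
  qed
  have \<Phi>m: "?\<Phi> \<in> measurable ?R (Lip1_borel X)"
    using \<Psi>m measurable_cong[of ?R ?\<Phi> \<Psi> "Lip1_borel X"] eq spR by blast
  have tr: "ctrace (\<Psi> c) = c ` {ft x c..ft y c}" if "c \<in> ?A" for c
  proof -
    have le: "0 \<le> ft x c" "ft x c \<le> ft y c" using that ft(1)[OF L[OF that]] by (auto simp: passing_eq)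
    show ?thesis
    proof (intro equalityI subsetI)
      fix p assume "p \<in> ctrace (\<Psi> c)"
      then obtain t where "0 \<le> t" "p = c (max (ft x c) (min t (ft y c)))" by (auto simp: ctrace_def \<Psi>_def)
      then show "p \<in> c ` {ft x c..ft y c}" using le by (intro image_eqI) auto
    next
      fix p assume "p \<in> c ` {ft x c..ft y c}"
      then obtain t where t: "ft x c \<le> t" "t \<le> ft y c" "p = c t" by auto
      then have "p = \<Psi> c t" using le by (simp add: \<Psi>_def max_def min_def)
      then show "p \<in> ctrace (\<Psi> c)" using t le by (auto simp: ctrace_def)
    qed
  qed
  have hitm: "{c\<in>space (Lip1_borel X). p \<in> ctrace c} \<in> sets (Lip1_borel X)"
    using sets_hit[of p] unfolding sets_P by (simp add: space_P)
  have "multiplicity_at (plan_between X P x y) p = measure (distr ?R (Lip1_borel X) ?\<Phi>) {c\<in>space (Lip1_borel X). p \<in> ctrace c}"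
    unfolding multiplicity_at_def plan_between_def by (rule arg_cong[where f="measure _"]) (auto simp: ctrace_def)
  also have "\<dots> = measure ?R (?\<Phi> -` {c\<in>space (Lip1_borel X). p \<in> ctrace c} \<inter> space ?R)"
    by (rule measure_distr[OF \<Phi>m hitm])
  also have "?\<Phi> -` {c\<in>space (Lip1_borel X). p \<in> ctrace c} \<inter> space ?R = {c\<in>?A. p \<in> c ` {ft x c..ft y c}}"
    using eq tr measurable_space[OF \<Phi>m] unfolding spR by auto
  also have "measure ?R \<dots> = measure P {c\<in>?A. p \<in> c ` {ft x c..ft y c}}"
    by (rule measure_restrict_space[OF A]) auto
  finally show ?thesis .
qed

lemma Gamma_between_avoids:
  assumes "AE c in P. \<not> btw x0 y z c" shows "x0 \<notin> Gamma_between X P y z"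
proof -
  have "measure P {c\<in>passing X y z. x0 \<in> c ` {ft y c..ft z c}} = 0"
    by (rule measure_eq_0_AE, use assms in eventually_elim) (auto simp: btw_def passing_eq)
  moreover have "measure P {c\<in>passing X z y. x0 \<in> c ` {ft z c..ft y c}} = 0"
    by (rule measure_eq_0_AE, use assms in eventually_elim) (auto simp: btw_def passing_eq)
  ultimately show ?thesis by (simp add: Gamma_between_def multiplicity_between)
qed

lemma Gamma_between_subset: "Gamma_between X P y z \<subseteq> X"
proof
  fix p assume p: "p \<in> Gamma_between X P y z"
  show "p \<in> X"
  proof (rule ccontr)
    assume np: "p \<notin> X"
    have "{c\<in>passing X y z. p \<in> c ` {ft y c..ft z c}} = {}" for y z
    proof -
      have "c t \<noteq> p" if g: "c \<in> passing X y z" and t: "ft y c \<le> t" for c t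
      proof -
        have gL: "c \<in> Lip1 X" using g by (simp add: passing_eq)
        show ?thesis using Lip1_in[OF gL, of t] t ft(1)[OF gL, of y] np by force
      qed
      then show ?thesis by fastforce
    qed
    then have "multiplicity_at (plan_between X P y z) p = 0" for y z by (simp only: multiplicity_between measure_empty)
    then show False using p by (simp add: Gamma_between_def)
  qed
qed

text \<open>The mass of the curves through both points, written as an integral so that measurability
  in the pair \<open>(y, z)\<close> is inherited from the integrand.\<close>

definition q :: "'a \<Rightarrow> 'a \<Rightarrow> ennreal" where
  "q y z = (\<integral>\<^sup>+c. indicator (ctrace c) y * indicator (ctrace c) z \<partial>P)"

lemma q_eq_0_iff: "q y z = 0 \<longleftrightarrow> (AE c in P. \<not> (y \<in> ctrace c \<and> z \<in> ctrace c))"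
proof -
  have "(\<lambda>c. indicator (ctrace c) y * indicator (ctrace c) z :: ennreal) \<in> borel_measurable P"
    using measurable_ctrace_indicator[OF id_P, of "\<lambda>_. y"] measurable_ctrace_indicator[OF id_P, of "\<lambda>_. z"] by simp
  then have "q y z = 0 \<longleftrightarrow> (AE c in P. indicator (ctrace c) y * indicator (ctrace c) z = (0::ennreal))"
    unfolding q_def by (rule nn_integral_0_iff_AE)
  also have "\<dots> \<longleftrightarrow> (AE c in P. \<not> (y \<in> ctrace c \<and> z \<in> ctrace c))"
    by (rule arg_cong[where f="\<lambda>Q. eventually Q (ae_filter P)"]) (auto simp: indicator_def fun_eq_iff)
  finally show ?thesis .
qed

lemma measurable_q: "(\<lambda>(y, z). q y z) \<in> borel_measurable (borel \<Otimes>\<^sub>M borel)"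
proof -
  have m: "(\<lambda>w. indicator (ctrace (snd w)) (h (fst w)) :: ennreal) \<in> borel_measurable ((borel \<Otimes>\<^sub>M borel) \<Otimes>\<^sub>M P)"
    if "h \<in> borel_measurable (borel \<Otimes>\<^sub>M borel)" for h
    by (rule measurable_ctrace_indicator[OF measurable_compose[OF measurable_snd id_P] measurable_compose[OF measurable_fst that]])
  have "(\<lambda>(p, c). indicator (ctrace c) (fst p) * indicator (ctrace c) (snd p) :: ennreal) \<in> borel_measurable ((borel \<Otimes>\<^sub>M borel) \<Otimes>\<^sub>M P)"
    unfolding split_beta' by (intro borel_measurable_times_ennreal m measurable_fst measurable_snd)
  from borel_measurable_nn_integral[OF this] show ?thesis by (simp add: q_def split_beta')
qed

end

lemma passing_starts: "{c\<in>passing X y z. y \<in> c ` {ft y c..ft z c}} = passing X y z"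
proof -
  have "y \<in> c ` {ft y c..ft z c}" if "c \<in> passing X y z" for c
    by (rule image_eqI[of _ _ "ft y c"]) (use that in \<open>auto simp: passing_eq ft(2)\<close>)
  then show ?thesis by blast
qed

section \<open>Links and chains along the curves of an optimal plan\<close>

context optimal_plan
begin

lemma lint_W_ge:
  assumes g: "c \<in> Lip1 X" and st: "0 \<le> a" "a \<le> s" "s \<le> t" "t \<le> b"
  shows "ennreal (Mt powr (\<alpha> - 1)) * ennreal (dist (c s) (c t)) \<le> lint (seg a b c) W"
proof -
  have s: "0 \<le> s" using st by simp
  have L: "seg s t c \<in> Lip1 X" by (rule seg_Lip1[OF g s st(3)])
  have "ennreal (Mt powr (\<alpha> - 1)) * ennreal (dist (c s) (c t)) \<le> ennreal (Mt powr (\<alpha> - 1)) * lint (seg s t c) (\<lambda>_. 1)"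
    by (intro mult_left_mono lint_ge_dist[OF g s st(3)]) simp
  also have "\<dots> = lint (seg s t c) (\<lambda>_. ennreal (Mt powr (\<alpha> - 1)) * 1)" by (rule lint_cmult[OF L, symmetric]) simp
  also have "\<dots> \<le> lint (seg s t c) W" by (rule lint_mono) (simp add: W_ge)
  also have "\<dots> \<le> lint (seg a b c) W" by (rule lint_seg_mono[OF g st measurable_W])
  finally show ?thesis .
qed

lemma sets_btw: "{c\<in>space P. btw x0 y z c} \<in> sets P"
proof -
  note [measurable] = measurable_ft_P
  have L: "c \<in> Lip1 X" if "c \<in> space P" for c using that by (simp add: space_P)
  have n: "0 \<le> min (ft y c) (ft z c)" if "c \<in> space P" for c using ft(1)[OF L[OF that]] by simp
  have "(\<lambda>c. seg (min (ft y c) (ft z c)) (max (ft y c) (ft z c)) c) \<in> measurable P (Lip1_borel X)"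
    by (rule measurable_seg[OF id_P _ _ n]) auto
  then have "{c\<in>space P. x0 \<in> ctrace (seg (min (ft y c) (ft z c)) (max (ft y c) (ft z c)) c)} \<in> sets P"
    by (rule measurable_ctrace_pred) simp
  moreover have "{c\<in>space P. btw x0 y z c} = {c\<in>space P. y \<in> ctrace c} \<inter> ({c\<in>space P. z \<in> ctrace c} \<inter>
    {c\<in>space P. x0 \<in> ctrace (seg (min (ft y c) (ft z c)) (max (ft y c) (ft z c)) c)})" (is "_ = ?R")
  proof -
    have "ctrace (seg (min (ft y c) (ft z c)) (max (ft y c) (ft z c)) c) = c ` {min (ft y c) (ft z c)..max (ft y c) (ft z c)}"
      if "c \<in> space P" for c
      by (rule trace_seg[OF n[OF that]]) simp
    then show ?thesis unfolding btw_def by blast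
  qed
  moreover have "?R \<in> sets P" using sets_hit[of y] sets_hit[of z] calculation(1) by blast
  ultimately show ?thesis by simp
qed

text \<open>If a positive amount of mass went from \<open>y\<close> to \<open>z\<close> through \<open>x0\<close>, sending it along the cheap
  segment of \<open>\<sigma>\<close> instead would lower the energy.\<close>

lemma bad_pair:
  assumes \<sigma>: "\<sigma> \<in> Lip1 X" "simple_curve \<sigma>" and uv: "0 \<le> u" "u \<le> v"
    and d: "cc * lint (seg u v \<sigma>) W < ennreal (\<alpha> * (Mt powr (\<alpha> - 1) * dist (\<sigma> u) x0))"
  shows "AE c in P. \<not> btw x0 (\<sigma> u) (\<sigma> v) c"
proof -
  define y where "y = \<sigma> u"
  define z where "z = \<sigma> v"
  define c1 where "c1 = seg u v \<sigma>"
  define c2 where "c2 = rev_curve (v - u) c1"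
  define B where "B = {c\<in>space P. btw x0 y z c}"
  define a where "a c = (if c \<in> B then min (ft y c) (ft z c) else 0)" for c
  define b where "b c = (if c \<in> B then max (ft y c) (ft z c) else 0)" for c
  \<comment> \<open>Curves that meet \<open>z\<close> first take the segment in reverse. Curves
    outside \<open>B\<close> get a resting path together with \<open>a c = b c = 0\<close>, so that
    the surgery does not alter them.\<close>
  define \<pi> where "\<pi> c = (if c \<in> B then if ft y c \<le> ft z c then c1 else c2 else pre 0 c)" for c
  have vu: "0 \<le> v - u" using uv by simp
  have c1: "c1 \<in> Lip1 X" "simple_curve c1" "c1 0 = y" "\<And>t. v - u \<le> t \<Longrightarrow> c1 t = z"
    unfolding c1_def y_def z_def using seg_Lip1[OF \<sigma>(1) uv] simple_seg[OF \<sigma>(2) uv] seg_at[OF uv] by auto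
  have c2: "c2 \<in> Lip1 X" "c2 0 = z" "\<And>t. v - u \<le> t \<Longrightarrow> c2 t = y"
    unfolding c2_def using rev_curve_Lip1[OF c1(1)] c1(3) c1(4)[OF order_refl] vu
    by (auto simp: rev_curve_const) (simp add: rev_curve_def)
  have cl: "lint c2 f \<le> lint c1 f" if "f \<in> borel_measurable borel" for f
    unfolding c2_def by (rule lint_rev_curve_le[OF c1(1,2) vu _ that]) (simp add: c1(4))
  have Bm[measurable]: "B \<in> sets P" unfolding B_def by (rule sets_btw)
  note [measurable] = measurable_ft_P
  have L: "c \<in> Lip1 X" if "c \<in> space P" for c using that by (simp add: space_P)
  have am: "a \<in> borel_measurable P" "b \<in> borel_measurable P" unfolding a_def[abs_def] b_def[abs_def] by measurable
  have ab: "0 \<le> a c" "a c \<le> b c" if "c \<in> space P" for c using ft(1)[OF L[OF that]] by (auto simp: a_def b_def)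
  have \<pi>m: "\<pi> \<in> measurable P (Lip1_borel X)" unfolding \<pi>_def[abs_def]
  proof (intro measurable_If measurable_const)
    show "c1 \<in> space (Lip1_borel X)" "c2 \<in> space (Lip1_borel X)" using c1 c2 by auto
    show "(\<lambda>c. pre 0 c) \<in> measurable P (Lip1_borel X)" by (rule measurable_pre[OF id_P]) auto
    show "{x \<in> space P. x \<in> B} \<in> sets P" by measurable
    show "{x \<in> space P. ft y x \<le> ft z x} \<in> sets P" by measurable
  qed
  have onB: "y \<in> ctrace c" "z \<in> ctrace c" "c (ft y c) = y" "c (ft z c) = z" if "c \<in> B" for c
    using that ft(2)[of c X] by (auto simp: B_def btw_def space_P)
  have p0: "\<pi> c 0 = c (a c)" for c
    using onB[of c] c1(3) c2(2) by (auto simp: \<pi>_def a_def min_def pre_def)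
  have p1: "\<pi> c t = c (b c)" if "v - u \<le> t" for c t
    using onB[of c] c1(4)[OF that] c2(3)[OF that] that vu by (auto simp: \<pi>_def b_def max_def pre_def)
  define V where "V y = weight \<alpha> (max (th y) (measure P {c\<in>space P. y \<in> ctrace (\<pi> c)}) / 2)" for y
  have sur: "ennreal \<alpha> * (\<integral>\<^sup>+c. lint (seg (a c) (b c) c) W \<partial>P) \<le> (\<integral>\<^sup>+c. lint (\<pi> c) V \<partial>P)"
    unfolding V_def by (rule surgery_inequality[OF am(1,2) _ \<pi>m, of "\<lambda>_. v - u"]) (use ab vu p0 p1 in auto)
  define k where "k = ennreal (Mt powr (\<alpha> - 1)) * ennreal (dist y x0)"
  define Z where "Z = cc * lint c1 W"
  \<comment> \<open>On its removed part each curve in \<open>B\<close> travels between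
    \<open>y\<close> and \<open>x0\<close>, at a weight of at least
    \<open>Mt powr (\<alpha> - 1)\<close>.\<close>
  have lo: "k * emeasure P B \<le> (\<integral>\<^sup>+c. lint (seg (a c) (b c) c) W \<partial>P)"
  proof -
    have "k * emeasure P B = (\<integral>\<^sup>+c. k * indicator B c \<partial>P)" by (simp add: nn_integral_cmult_indicator)
    also have "\<dots> \<le> (\<integral>\<^sup>+c. lint (seg (a c) (b c) c) W \<partial>P)"
    proof (rule nn_integral_mono)
      fix c assume g: "c \<in> space P"
      show "k * indicator B c \<le> lint (seg (a c) (b c) c) W"
      proof (cases "c \<in> B")
        case True
        then obtain t where t: "a c \<le> t" "t \<le> b c" "c t = x0" by (auto simp: B_def btw_def a_def b_def)
        have s: "a c \<le> ft y c" "ft y c \<le> b c" using True by (auto simp: a_def b_def)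
        have "k \<le> lint (seg (a c) (b c) c) W"
        proof (cases "ft y c \<le> t")
          case True
          show ?thesis using lint_W_ge[OF L[OF g] ab(1)[OF g] s(1) True t(2)] onB(3)[OF \<open>c \<in> B\<close>] t(3) by (simp add: k_def)
        next
          case False
          show ?thesis using lint_W_ge[OF L[OF g] ab(1)[OF g] t(1) _ s(2)] False onB(3)[OF \<open>c \<in> B\<close>] t(3) by (simp add: k_def dist_commute)
        qed
        then show ?thesis using True by simp
      qed simp
    qed
    finally show ?thesis .
  qed
  have up: "(\<integral>\<^sup>+c. lint (\<pi> c) V \<partial>P) \<le> Z * emeasure P B"
  proof -
    have Vm: "V \<in> borel_measurable borel" unfolding V_def[abs_def] weight_def
      using measurable_mass_real[OF finite_measure_axioms \<pi>m] by measurable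
    have VW: "V y \<le> cc * W y" for y unfolding V_def by (rule weight_half_le) simp
    have c1V: "lint c1 V \<le> Z"
    proof -
      have "lint c1 V \<le> lint c1 (\<lambda>y. cc * W y)" by (rule lint_mono) (rule VW)
      also have "\<dots> = Z" unfolding Z_def by (rule lint_cmult[OF c1(1) measurable_W])
      finally show ?thesis .
    qed
    have "(\<integral>\<^sup>+c. lint (\<pi> c) V \<partial>P) \<le> (\<integral>\<^sup>+c. Z * indicator B c \<partial>P)"
    proof (rule nn_integral_mono)
      fix c
      show "lint (\<pi> c) V \<le> Z * indicator B c"
        using c1V order_trans[OF cl[OF Vm] c1V] by (auto simp: \<pi>_def pre_0_eq_cst lint_cst)
    qed
    also have "\<dots> = Z * emeasure P B" by (simp add: nn_integral_cmult_indicator)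
    finally show ?thesis .
  qed
  have main: "ennreal \<alpha> * k * emeasure P B \<le> Z * emeasure P B"
  proof -
    have "ennreal \<alpha> * (k * emeasure P B) \<le> ennreal \<alpha> * (\<integral>\<^sup>+c. lint (seg (a c) (b c) c) W \<partial>P)"
      by (rule mult_left_mono[OF lo]) simp
    then show ?thesis using order_trans[OF order_trans[OF _ sur] up] by (simp add: mult.assoc)
  qed
  have Zk: "Z < ennreal \<alpha> * k"
    using d \<alpha> unfolding Z_def c1_def k_def y_def by (simp add: ennreal_mult)
  have "emeasure P B = 0"
  proof (rule ccontr)
    assume n: "emeasure P B \<noteq> 0"
    have "emeasure P B * Z < emeasure P B * (ennreal \<alpha> * k)"
      by (rule ennreal_mult_strict_left_mono[OF Zk]) (use n in \<open>auto simp: zero_less_iff_neq_zero less_top[symmetric]\<close>)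
    then show False using main by (simp add: mult.commute)
  qed
  then show ?thesis using AE_iff_measurable[OF Bm, of "\<lambda>c. \<not> btw x0 y z c"] unfolding y_def z_def B_def by auto
qed

text \<open>A simple curve through both points passes from one to the other in some direction, and
  the multiplicity at the starting point is the whole mass of the curves passing in that
  direction.\<close>

lemma Gamma_between_nonempty:
  assumes q: "q y z \<noteq> 0" shows "Gamma_between X P y z \<noteq> {}"
proof
  assume e: "Gamma_between X P y z = {}"
  have 1: "measure P (passing X y z) = 0"
  proof -
    have "{c\<in>passing X y z. y \<in> c ` {ft y c..ft z c}} = passing X y z"
      by (rule passing_starts)
    then have "measure P (passing X y z) = multiplicity_at (plan_between X P y z) y" by (simp add: multiplicity_between)
    also have "\<not> 0 < \<dots>" using e by (auto simp: Gamma_between_def)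
    finally show ?thesis using measure_nonneg[of P "passing X y z"] by linarith
  qed
  have 2: "measure P (passing X z y) = 0"
  proof -
    have "{c\<in>passing X z y. z \<in> c ` {ft z c..ft y c}} = passing X z y"
      by (rule passing_starts)
    then have "measure P (passing X z y) = multiplicity_at (plan_between X P z y) z" by (simp add: multiplicity_between)
    also have "\<not> 0 < \<dots>" using e by (auto simp: Gamma_between_def)
    finally show ?thesis using measure_nonneg[of P "passing X z y"] by linarith
  qed
  have "AE c in P. c \<notin> passing X y z" "AE c in P. c \<notin> passing X z y"
    using 1 2 sets_passing by (auto intro!: AE_not_in simp: null_sets_def emeasure_eq_measure)
  then have "AE c in P. \<not> (y \<in> ctrace c \<and> z \<in> ctrace c)"
    using AE_simple AE_space
    by eventually_elim (auto simp: passing_eq space_P)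
  then show False using q q_eq_0_iff by blast
qed

lemma link:
  assumes \<sigma>: "\<sigma> \<in> Lip1 X" "simple_curve \<sigma>" and uv: "0 \<le> u" "u \<le> v"
    and d: "cc * lint (seg u v \<sigma>) W < ennreal (\<alpha> * (Mt powr (\<alpha> - 1) * dist (\<sigma> u) x0))"
    and q: "q (\<sigma> u) (\<sigma> v) \<noteq> 0"
  shows "connected_via X P (UNIV - {x0}) (\<sigma> u) (\<sigma> v)"
  unfolding connected_via_def
  using Gamma_between_nonempty[OF q] Gamma_between_avoids[OF bad_pair[OF \<sigma> uv d]]
  by (intro exI[of _ "[\<sigma> u, \<sigma> v]"]) auto

lemma q_commute: "q y z = q z y" by (simp add: q_def mult.commute)

text \<open>Times whose point shares positive mass with almost every moving point of the curve. Two
  good times can be linked through a common third point even when \<open>q\<close> vanishes for the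
  pair itself.\<close>

definition "good c = {s. 0 \<le> s \<and> (AE t in lborel. 0 \<le> t \<longrightarrow> 0 < sp c t \<longrightarrow> q (c s) (c t) \<noteq> 0)}"

text \<open>If \<open>q y z = 0\<close>, almost no curve hits both points; \<open>AE_swap\<close>
  makes this uniform in \<open>z\<close> along the curve, with \<open>y\<close> fixed.\<close>

lemma AE_q: "AE c in P. y \<in> ctrace c \<longrightarrow> (AE t in lborel. 0 \<le> t \<longrightarrow> 0 < sp c t \<longrightarrow> q y (c t) \<noteq> 0)"
proof -
  define V where "V = {(c, z). c \<in> space P \<and> y \<in> ctrace c \<and> q y z = 0}"
  have qm: "{z. q y z = 0} \<in> sets borel"
  proof -
    have "(\<lambda>z. q y z) \<in> borel_measurable borel"
      using measurable_compose[OF measurable_Pair1' measurable_q, of y] by simp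
    then show ?thesis by measurable
  qed
  have "V = {c\<in>space P. y \<in> ctrace c} \<times> {z. q y z = 0}" by (auto simp: V_def)
  then have V: "V \<in> sets (P \<Otimes>\<^sub>M borel)" using qm sets_hit[of y] by auto
  have "AE c in P. z \<in> ctrace c \<longrightarrow> (c, z) \<notin> V" for z
  proof (cases "q y z = 0")
    case True
    then have "AE c in P. \<not> (y \<in> ctrace c \<and> z \<in> ctrace c)" by (simp only: q_eq_0_iff)
    then show ?thesis by eventually_elim (auto simp: V_def)
  qed (simp add: V_def)
  from AE_swap'[OF V this] AE_space show ?thesis
    by eventually_elim (auto simp: V_def elim: eventually_mono)
qed

lemma AE_good_start: "AE c in P. y \<in> ctrace c \<longrightarrow> ft y c \<in> good c"
  using AE_q[of y] AE_space
  by eventually_elim (simp add: good_def space_P ft)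

text \<open>\<open>AE_q\<close> concerns a fixed starting point. A second swap, for the set
  \<open>V\<close> of curves and points that violate it, lets the starting point move along the
  curve.\<close>

lemma AE_good_moving: "AE c in P. AE s in lborel. 0 \<le> s \<longrightarrow> 0 < sp c s \<longrightarrow> s \<in> good c"
proof -
  define F where "F \<omega> w = (indicator {0} (q (snd \<omega>) w) :: ennreal)" for \<omega> :: "(real \<Rightarrow> 'a) \<times> 'a" and w
  define V where "V = {\<omega>\<in>space (P \<Otimes>\<^sub>M borel). lint (fst \<omega>) (F \<omega>) \<noteq> 0}"
  have "(\<lambda>x. q (snd (fst x)) (snd x)) \<in> borel_measurable ((P \<Otimes>\<^sub>M borel) \<Otimes>\<^sub>M borel)"
    using measurable_compose[OF _ measurable_q, of "\<lambda>x. (snd (fst x), snd x)" "(P \<Otimes>\<^sub>M borel) \<Otimes>\<^sub>M borel"] by simp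
  then have Fm: "(\<lambda>(\<omega>, w). F \<omega> w) \<in> borel_measurable ((P \<Otimes>\<^sub>M borel) \<Otimes>\<^sub>M borel)"
    unfolding F_def split_beta' by measurable
  have "(\<lambda>\<omega>. lint (fst \<omega>) (F \<omega>)) \<in> borel_measurable (P \<Otimes>\<^sub>M borel)"
    by (rule measurable_lint[OF measurable_compose[OF measurable_fst id_P] Fm])
  then have V: "V \<in> sets (P \<Otimes>\<^sub>M borel)" unfolding V_def by measurable
  have Vin: "(c, z) \<notin> V \<longleftrightarrow> (AE t in lborel. 0 \<le> t \<longrightarrow> 0 < sp c t \<longrightarrow> q z (c t) \<noteq> 0)" if g: "c \<in> space P" for c z
  proof -
    have "(\<lambda>w. q z w) \<in> borel_measurable borel"
      using measurable_compose[OF measurable_Pair1' measurable_q, of z] by simp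
    then have m: "F (c, z) \<in> borel_measurable borel" unfolding F_def[abs_def] by simp measurable
    have "(c, z) \<notin> V \<longleftrightarrow> lint c (F (c, z)) = 0" using g by (simp add: V_def space_pair_measure)
    also have "\<dots> \<longleftrightarrow> (AE t in lborel. 0 \<le> t \<longrightarrow> 0 < sp c t \<longrightarrow> F (c, z) (c t) = 0)"
      by (rule lint_eq_0_iff[OF _ m]) (use g in \<open>simp add: space_P\<close>)
    also have "\<dots> \<longleftrightarrow> (AE t in lborel. 0 \<le> t \<longrightarrow> 0 < sp c t \<longrightarrow> q z (c t) \<noteq> 0)"
      by (rule arg_cong[where f="\<lambda>Q. eventually Q (ae_filter lborel)"]) (auto simp: F_def indicator_def fun_eq_iff)
    finally show ?thesis .
  qed
  have "AE c in P. z \<in> ctrace c \<longrightarrow> (c, z) \<notin> V" for z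
    using AE_q[of z] AE_space by eventually_elim (simp add: Vin)
  from AE_swap'[OF V this] AE_space show ?thesis
  proof eventually_elim
    case (elim c)
    from elim(1) show ?case
      by eventually_elim (simp add: Vin[OF elim(2)] good_def)
  qed
qed

end

text \<open>Serves to cut a curve at prescribed amounts of energy.\<close>

lemma nn_integral_interval_ivt:
  fixes h :: "real \<Rightarrow> ennreal"
  assumes h: "(\<lambda>x. h x * indicator {s..t} x) \<in> borel_measurable borel" and st: "s \<le> t"
    and Z: "(\<integral>\<^sup>+x\<in>{s..t}. h x \<partial>lborel) = ennreal Z" and c: "0 \<le> c" "c \<le> Z"
  shows "\<exists>v\<ge>s. v \<le> t \<and> (\<integral>\<^sup>+x\<in>{s..v}. h x \<partial>lborel) = ennreal c"
proof -
  define g where "g x = enn2real (h x * indicator {s..t} x)" for x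
  have gm: "g \<in> borel_measurable borel" unfolding g_def[abs_def] using h by measurable
  have g0: "0 \<le> g x" for x by (simp add: g_def)
  have "AE x in lborel. h x * indicator {s..t} x \<noteq> \<infinity>"
    by (rule nn_integral_noteq_infinite) (use h Z in auto)
  then have ae: "AE x in lborel. ennreal (g x) = h x * indicator {s..t} x"
    by eventually_elim (simp add: g_def less_top)
  have "(\<integral>\<^sup>+x. ennreal (g x) \<partial>lborel) = ennreal Z"
    using nn_integral_cong_AE[OF ae] Z by simp
  then have "integrable lborel g" using gm g0 by (intro integrableI_nonneg) auto
  then have gi: "g integrable_on A" if "A \<in> {{s..v} | v. True}" for A
    using that integrable_on_subinterval[OF integrable_on_lborel, of g] by auto
  define F where "F v = integral {s..v} g" for v
  have FI: "(\<integral>\<^sup>+x\<in>{s..v}. h x \<partial>lborel) = ennreal (F v)" if "v \<le> t" for v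
  proof -
    have "ennreal (F v) = (\<integral>\<^sup>+x. indicator {s..v} x * g x \<partial>lborel)"
      unfolding F_def by (rule nn_integral_has_integral_lebesgue[symmetric]) (use g0 gi in \<open>auto intro!: integrable_integral\<close>)
    also have "\<dots> = (\<integral>\<^sup>+x\<in>{s..v}. h x \<partial>lborel)"
      by (rule nn_integral_cong_AE, use ae in eventually_elim) (use that in \<open>auto simp: indicator_def split: if_splits\<close>)
    finally show ?thesis by simp
  qed
  have F0: "0 \<le> F v" for v unfolding F_def by (rule integral_nonneg) (use g0 gi in auto)
  have "\<exists>v\<ge>s. v \<le> t \<and> F v = c"
  proof (rule IVT')
    show "F s \<le> c" using c by (simp add: F_def)
    have "0 \<le> Z" using c by simp
    then show "c \<le> F t" using FI[of t] Z F0[of t] c by simp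
    show "continuous_on {s..t} F" unfolding F_def using gi by (intro indefinite_integral_continuous_1) auto
  qed (rule st)
  then show ?thesis using FI by auto
qed

lemma connected_via_refl: "connected_via X P U x x"
  unfolding connected_via_def by (intro exI[of _ "[x]"]) auto

lemma exists_moving_time:
  assumes g: "c \<in> Lip1 X" and v: "0 \<le> v1" "v1 \<le> v2" and f: "f \<in> borel_measurable borel"
    and pos: "lint (seg v1 v2 c) f \<noteq> 0" and R: "AE r in lborel. 0 \<le> r \<longrightarrow> 0 < sp c r \<longrightarrow> R r"
  shows "\<exists>r. v1 \<le> r \<and> r \<le> v2 \<and> R r"
proof (rule ccontr)
  assume n: "\<nexists>r. v1 \<le> r \<and> r \<le> v2 \<and> R r"
  have "lint (seg v1 v2 c) f = (\<integral>\<^sup>+(t::real). 0 \<partial>lborel)"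
    unfolding lint_seg[OF g v f]
  proof (rule nn_integral_cong_AE, use R in eventually_elim)
    case (elim t)
    have "sp c t = 0" if "v1 \<le> t" "t \<le> v2"
    proof (rule ccontr)
      assume "sp c t \<noteq> 0"
      then have "0 < sp c t" using sp_nonneg[of c t] by (simp add: order_less_le)
      then show False using elim n that v by auto
    qed
    then show ?case by (auto simp: indicator_def)
  qed
  then show False using pos by simp
qed

lemma same_side:
  assumes g: "\<gamma> \<in> Lip1 X" "simple_curve \<gamma>" and pq: "0 \<le> p" "p \<le> q" and ne: "\<gamma> p \<noteq> x" "\<gamma> q \<noteq> x"
    and c: "x \<in> ctrace \<gamma> \<Longrightarrow> q < ft x \<gamma> \<or> ft x \<gamma> < p"
  shows "x \<notin> \<gamma> ` {p..q}"
proof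
  assume "x \<in> \<gamma> ` {p..q}"
  then obtain u where u: "p \<le> u" "u \<le> q" "\<gamma> u = x" by auto
  have tr: "x \<in> ctrace \<gamma>" using u pq by (auto simp: ctrace_def)
  have le: "ft x \<gamma> \<le> u" using ft(3)[OF g(1), of u x] u pq by simp
  have up: "p < u" using u ne by (auto simp: order_less_le)
  have "ft x \<gamma> < p" using c[OF tr] le u by auto
  moreover have "0 \<le> ft x \<gamma>" "\<gamma> (ft x \<gamma>) = x" using ft(1,2)[OF g(1)] tr by auto
  ultimately show False using g(2) up u ne unfolding simple_curve_def by metis
qed

text \<open>A point passed with positive speed is visited only once, so beyond the null set of bad
  times the first visit is the only time to exclude.\<close>

lemma AE_moving_ne:
  assumes g: "c \<in> Lip1 X" "simple_curve c"
  shows "AE t in lborel. 0 \<le> t \<longrightarrow> 0 < sp c t \<longrightarrow> c t \<noteq> x"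
  using Lip1_AE_speed[OF g(1)] AE_lborel_singleton[of "ft x c"]
proof eventually_elim
  case (elim t)
  show ?case
  proof (intro impI notI)
    assume t: "0 \<le> t" "0 < sp c t" "c t = x"
    then obtain D where D: "(c has_vector_derivative D) (at t)" "sp c t = norm D" using elim by blast
    have tr: "x \<in> ctrace c" using t by (auto simp: ctrace_def)
    have "ft x c = t"
      by (rule simple_moving_unique[OF g(2) D(1) _ t(1)]) (use D t ft[OF g(1)] tr in auto)
    then show False using elim by simp
  qed
qed

context optimal_plan
begin

text \<open>A segment may be too costly for a single link. It is cut at a good time in the middle
  third of its cost, so both parts cost at most two thirds; this is the factor \<open>3 / 2\<close>
  per induction step.\<close>

lemma chain_connect:
  assumes g: "\<gamma> \<in> Lip1 X" "simple_curve \<gamma>" "lint \<gamma> W < \<infinity>" and G: "AE r in lborel. 0 \<le> r \<longrightarrow> 0 < sp \<gamma> r \<longrightarrow> r \<in> good \<gamma>"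
    and M: "0 < Mt" and e: "0 < \<epsilon>" "cc * ennreal \<epsilon> < ennreal (\<alpha> * (Mt powr (\<alpha> - 1) * d))"
  shows "s \<in> good \<gamma> \<Longrightarrow> t \<in> good \<gamma> \<Longrightarrow> s \<le> t \<Longrightarrow> (\<And>r. s \<le> r \<Longrightarrow> r \<le> t \<Longrightarrow> d \<le> dist (\<gamma> r) x0) \<Longrightarrow>
    lint (seg s t \<gamma>) W \<le> ennreal (\<epsilon> * (3 / 2) ^ n) \<Longrightarrow> connected_via X P (UNIV - {x0}) (\<gamma> s) (\<gamma> t)"
proof (induction n arbitrary: s t)
  case 0
  note st = 0(1-3) and dd = 0(4)
  have s0: "0 \<le> s" using st by (simp add: good_def)
  have ze: "lint (seg s t \<gamma>) W \<le> ennreal \<epsilon>" using 0(5) by simp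
  have lk: "connected_via X P (UNIV - {x0}) (\<gamma> u) (\<gamma> v)" if uv: "s \<le> u" "u \<le> v" "v \<le> t" and q: "q (\<gamma> u) (\<gamma> v) \<noteq> 0" for u v
  proof (rule link[OF g(1,2) _ uv(2) _ q])
    show "0 \<le> u" using s0 uv by simp
    have "cc * lint (seg u v \<gamma>) W \<le> cc * ennreal \<epsilon>"
      by (intro mult_left_mono order_trans[OF lint_seg_mono[OF g(1) s0 uv measurable_W] ze]) simp
    also have "\<dots> < ennreal (\<alpha> * (Mt powr (\<alpha> - 1) * d))" by (rule e(2))
    also have "\<dots> \<le> ennreal (\<alpha> * (Mt powr (\<alpha> - 1) * dist (\<gamma> u) x0))"
      using dd[of u] uv \<alpha> by (intro ennreal_leI mult_left_mono) auto
    finally show "cc * lint (seg u v \<gamma>) W < ennreal (\<alpha> * (Mt powr (\<alpha> - 1) * dist (\<gamma> u) x0))" .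
  qed
  show ?case
  proof (cases "lint (seg s t \<gamma>) W = 0")
    case True
    have "ennreal (Mt powr (\<alpha> - 1)) * ennreal (dist (\<gamma> s) (\<gamma> t)) \<le> 0"
      using lint_W_ge[OF g(1) s0 order_refl st(3) order_refl] True by simp
    then have "\<gamma> s = \<gamma> t" using M by simp
    then show ?thesis by (simp add: connected_via_refl)
  next
    case False
    \<comment> \<open>\<open>q (\<gamma> s) (\<gamma> t)\<close> may vanish. A moving time
      \<open>r\<close> in between that shares mass with both ends yields two links instead of
      one.\<close>
    have "AE r in lborel. 0 \<le> r \<longrightarrow> 0 < sp \<gamma> r \<longrightarrow> q (\<gamma> s) (\<gamma> r) \<noteq> 0 \<and> q (\<gamma> t) (\<gamma> r) \<noteq> 0"
      using st(1,2) unfolding good_def mem_Collect_eq by (auto elim: eventually_elim2)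
    from exists_moving_time[OF g(1) s0 st(3) measurable_W False this]
    obtain r where r: "s \<le> r" "r \<le> t" "q (\<gamma> s) (\<gamma> r) \<noteq> 0" "q (\<gamma> t) (\<gamma> r) \<noteq> 0" by blast
    show ?thesis
      by (rule connected_via_trans[OF lk[OF order_refl r(1,2,3)] lk[OF r(1,2) order_refl]]) (use r(4) in \<open>simp add: q_commute\<close>)
  qed
next
  case (Suc n)
  note st = Suc.prems(1-3) and dd = Suc.prems(4)
  have s0: "0 \<le> s" using st by (simp add: good_def)
  define Z where "Z = enn2real (lint (seg s t \<gamma>) W)"
  have "lint (seg s t \<gamma>) W < \<infinity>" using lint_seg_le[OF g(1) s0 st(3) measurable_W] g(3) by (rule order_le_less_trans)
  then have Z: "lint (seg s t \<gamma>) W = ennreal Z" by (simp add: Z_def)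
  have Z0: "0 \<le> Z" by (simp add: Z_def)
  have Zle: "Z \<le> \<epsilon> * (3 / 2) ^ Suc n" using Suc.prems(5) e unfolding Z by (simp add: ennreal_le_iff)
  show ?case
  proof (cases "Z = 0")
    case True
    then show ?thesis using Suc.IH[OF st dd] Z by simp
  next
    case False
    then have Zp: "0 < Z" using Z0 by simp
    have hm: "(\<lambda>x. W (\<gamma> x) * ennreal (sp \<gamma> x) * indicator {s..t} x) \<in> borel_measurable borel"
      using measurable_line_integrand[OF g(1) measurable_W, of "{s..t}"] s0 by auto
    have iv: "\<exists>v\<ge>s. v \<le> t \<and> lint (seg s v \<gamma>) W = ennreal c" if c: "0 \<le> c" "c \<le> Z" for c
    proof -
      obtain v where v: "s \<le> v" "v \<le> t" "(\<integral>\<^sup>+x\<in>{s..v}. W (\<gamma> x) * ennreal (sp \<gamma> x) \<partial>lborel) = ennreal c"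
        using nn_integral_interval_ivt[OF hm st(3) _ c] Z lint_seg[OF g(1) s0 st(3) measurable_W] by auto
      then show ?thesis using lint_seg[OF g(1) s0 v(1) measurable_W] by auto
    qed
    obtain v1 where v1: "s \<le> v1" "v1 \<le> t" "lint (seg s v1 \<gamma>) W = ennreal (Z / 3)" using iv[of "Z / 3"] Z0 by auto
    obtain v2 where v2: "s \<le> v2" "v2 \<le> t" "lint (seg s v2 \<gamma>) W = ennreal (2 * Z / 3)" using iv[of "2 * Z / 3"] Z0 by auto
    have v12: "v1 \<le> v2"
    proof (rule ccontr)
      assume "\<not> v1 \<le> v2"
      then have "ennreal (2 * Z / 3) \<le> ennreal (Z / 3)"
        using lint_seg_mono[OF g(1) s0 order_refl v2(1) _ measurable_W, of v1] v1 v2 by simp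
      then show False using Zp by (simp add: ennreal_le_iff)
    qed
    have v10: "0 \<le> v1" using s0 v1 by simp
    have ne: "lint (seg v1 v2 \<gamma>) W \<noteq> 0"
    proof
      assume "lint (seg v1 v2 \<gamma>) W = 0"
      then have "ennreal (2 * Z / 3) = ennreal (Z / 3)"
        using lint_seg_add[OF g(1) s0 v1(1) v12 measurable_W] v1 v2 by simp
      then show False using Zp by (simp add: ennreal_inj)
    qed
    obtain r where r: "v1 \<le> r" "r \<le> v2" "r \<in> good \<gamma>"
      using exists_moving_time[OF g(1) v10 v12 measurable_W ne G] by blast
    have b: "2 * Z / 3 \<le> \<epsilon> * (3 / 2) ^ n" using Zle by simp
    have sr: "s \<le> r" "r \<le> t" using r v1 v2 by auto
    have 1: "lint (seg s r \<gamma>) W \<le> ennreal (\<epsilon> * (3 / 2) ^ n)"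
      using lint_seg_mono[OF g(1) s0 order_refl sr(1) r(2) measurable_W] v2(3) ennreal_leI[OF b] by (auto intro: order_trans)
    have 2: "lint (seg r t \<gamma>) W \<le> ennreal (\<epsilon> * (3 / 2) ^ n)"
    proof -
      have "ennreal (Z / 3) + lint (seg v1 t \<gamma>) W = ennreal Z"
        using lint_seg_add[OF g(1) s0 v1(1,2) measurable_W] v1(3) Z by simp
      also have "\<dots> = ennreal (Z / 3) + ennreal (2 * Z / 3)"
        using Z0 by (subst ennreal_plus[symmetric]) auto
      finally have "lint (seg v1 t \<gamma>) W = ennreal (2 * Z / 3)" by (simp add: ennreal_add_left_cancel)
      then show ?thesis
        using lint_seg_mono[OF g(1) v10 r(1) sr(2) order_refl measurable_W] ennreal_leI[OF b] by (auto intro: order_trans)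
    qed
    show ?thesis
    proof (rule connected_via_trans)
      show "connected_via X P (UNIV - {x0}) (\<gamma> s) (\<gamma> r)"
        by (rule Suc.IH[OF st(1) r(3) sr(1) _ 1]) (use dd sr in auto)
      show "connected_via X P (UNIV - {x0}) (\<gamma> r) (\<gamma> t)"
        by (rule Suc.IH[OF r(3) st(2) sr(2) _ 2]) (use dd sr in auto)
    qed
  qed
qed

text \<open>By compactness the segment keeps a distance \<open>d\<close> from \<open>x0\<close>.
  Then \<open>\<epsilon>\<close> is chosen such that parts of cost at most \<open>\<epsilon>\<close>
  meet the smallness condition of \<open>link\<close>, and \<open>n\<close> from the total
  cost.\<close>

lemma connect_along:
  assumes g: "c \<in> Lip1 X" "simple_curve c" "lint c W < \<infinity>" and G: "AE r in lborel. 0 \<le> r \<longrightarrow> 0 < sp c r \<longrightarrow> r \<in> good c"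
    and M: "0 < Mt" and st: "s \<in> good c" "t \<in> good c" "s \<le> t" and x0: "x0 \<notin> c ` {s..t}"
  shows "connected_via X P (UNIV - {x0}) (c s) (c t)"
proof -
  have s0: "0 \<le> s" using st by (simp add: good_def)
  have "continuous_on {s..t} c" by (rule continuous_on_subset[OF Lip1_continuous_on[OF g(1)]]) (use s0 in auto)
  then have "continuous_on {s..t} (\<lambda>r. dist (c r) x0)" by (intro continuous_intros)
  then obtain r where r: "r \<in> {s..t}" "\<forall>u\<in>{s..t}. dist (c r) x0 \<le> dist (c u) x0"
    using continuous_attains_inf[of "{s..t}" "\<lambda>r. dist (c r) x0"] st(3) by auto
  define d where "d = dist (c r) x0"
  have d: "0 < d" using r x0 by (auto simp: d_def)
  define k where "k = (1 / 2 :: real) powr (\<alpha> - 1)"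
  have k: "0 < k" by (simp add: k_def)
  define A where "A = \<alpha> * (Mt powr (\<alpha> - 1) * d)"
  have A: "0 < A" using \<alpha> M d by (simp add: A_def)
  define \<epsilon> where "\<epsilon> = A / (2 * k)"
  have e: "0 < \<epsilon>" using A k by (simp add: \<epsilon>_def)
  have "k * \<epsilon> < A" using A k by (simp add: \<epsilon>_def)
  then have ce: "cc * ennreal \<epsilon> < ennreal A"
    unfolding cc_def k_def[symmetric] using k e by (simp add: ennreal_mult[symmetric] ennreal_less_iff)
  define Z where "Z = enn2real (lint (seg s t c) W)"
  have "lint (seg s t c) W < \<infinity>" using lint_seg_le[OF g(1) s0 st(3) measurable_W] g(3) by (rule order_le_less_trans)
  then have Z: "lint (seg s t c) W = ennreal Z" by (simp add: Z_def)
  obtain n where n: "Z / \<epsilon> < (3 / 2) ^ n" using real_arch_pow[of "3 / 2" "Z / \<epsilon>"] by auto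
  have le: "lint (seg s t c) W \<le> ennreal (\<epsilon> * (3 / 2) ^ n)"
    unfolding Z using n e by (intro ennreal_leI) (simp add: field_simps)
  show ?thesis
    by (rule chain_connect[OF g G M e ce[unfolded A_def] st _ le]) (use r in \<open>auto simp: d_def\<close>)
qed

lemma AE_props: "AE c in P. c \<in> Lip1 X \<and> simple_curve c \<and> fin c \<and> lint c W < \<infinity> \<and>
   (AE r in lborel. 0 \<le> r \<longrightarrow> 0 < sp c r \<longrightarrow> r \<in> good c) \<and> (AE r in lborel. 0 \<le> r \<longrightarrow> 0 < sp c r \<longrightarrow> 0 < th (c r))"
  using AE_good AE_W_fin AE_good_moving AE_pos AE_space by eventually_elim (simp add: space_P)

section \<open>The two sides of a point on a curve\<close>

definition after :: "'a \<Rightarrow> 'a \<Rightarrow> (real \<Rightarrow> 'a) \<Rightarrow> bool" where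
  "after x y c \<longleftrightarrow> x \<in> ctrace c \<and> ft x c < ft y c"

lemma connect_same_side:
  assumes p: "c \<in> Lip1 X \<and> simple_curve c \<and> fin c \<and> lint c W < \<infinity> \<and>
   (AE r in lborel. 0 \<le> r \<longrightarrow> 0 < sp c r \<longrightarrow> r \<in> good c) \<and> (AE r in lborel. 0 \<le> r \<longrightarrow> 0 < sp c r \<longrightarrow> 0 < th (c r))"
   and M: "0 < Mt" and st: "s \<in> good c" "t \<in> good c" "c s \<noteq> x0" "c t \<noteq> x0"
   and side: "x0 \<in> ctrace c \<Longrightarrow> (ft x0 c < s \<and> ft x0 c < t) \<or> (s < ft x0 c \<and> t < ft x0 c)"
 shows "connected_via X P (UNIV - {x0}) (c s) (c t)"
proof -
  have g: "c \<in> Lip1 X" "simple_curve c" "lint c W < \<infinity>" "AE r in lborel. 0 \<le> r \<longrightarrow> 0 < sp c r \<longrightarrow> r \<in> good c" using p by auto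
  have nn: "0 \<le> s" "0 \<le> t" using st by (auto simp: good_def)
  show ?thesis
  proof (cases "s \<le> t")
    case True
    have "x0 \<notin> c ` {s..t}" by (rule same_side[OF g(1,2) nn(1) True st(3,4)]) (use side in auto)
    then show ?thesis by (rule connect_along[OF g M st(1,2) True])
  next
    case False
    then have ts: "t \<le> s" by simp
    have "x0 \<notin> c ` {t..s}" by (rule same_side[OF g(1,2) nn(2) ts st(4,3)]) (use side in auto)
    then show ?thesis by (intro connected_via_sym[OF connect_along[OF g M st(2,1) ts]])
  qed
qed

lemma not_after:
  assumes g: "c \<in> Lip1 X" and y: "y \<in> ctrace c" "y \<noteq> x0" "\<not> after x0 y c" "x0 \<in> ctrace c"
  shows "ft y c < ft x0 c"
proof -
  have "ft y c \<noteq> ft x0 c" using ft(2)[OF g y(1)] ft(2)[OF g y(4)] y(2) by auto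
  then show ?thesis using y by (auto simp: after_def)
qed

text \<open>Almost surely the first visits to \<open>y\<close> and \<open>z\<close> are good times,
  and good times on the same side of \<open>x0\<close> give connected points. Being after
  \<open>x0\<close> or not takes two values, so a curve meets at most two of several pairwise
  unconnected points.\<close>

lemma AE_separated:
  assumes M: "0 < Mt" and yz: "y \<noteq> x0" "z \<noteq> x0" and nc: "\<not> connected_via X P (UNIV - {x0}) y z"
  shows "AE c in P. y \<in> ctrace c \<and> z \<in> ctrace c \<longrightarrow> after x0 y c \<noteq> after x0 z c"
  using AE_props AE_good_start[of y] AE_good_start[of z]
proof eventually_elim
  case (elim c)
  show ?case
  proof (intro impI notI)
    assume tr: "y \<in> ctrace c \<and> z \<in> ctrace c" and eq: "after x0 y c = after x0 z c"
    have g: "c \<in> Lip1 X" using elim by blast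
    have v: "c (ft y c) = y" "c (ft z c) = z" using ft(2)[OF g] tr by auto
    have "connected_via X P (UNIV - {x0}) (c (ft y c)) (c (ft z c))"
    proof (rule connect_same_side[OF elim(1) M])
      show "ft y c \<in> good c" "ft z c \<in> good c" using elim tr by auto
      show "c (ft y c) \<noteq> x0" "c (ft z c) \<noteq> x0" using v yz by auto
      assume x: "x0 \<in> ctrace c"
      show "ft x0 c < ft y c \<and> ft x0 c < ft z c \<or> ft y c < ft x0 c \<and> ft z c < ft x0 c"
        using eq not_after[OF g, of y x0] not_after[OF g, of z x0] tr yz x by (auto simp: after_def)
    qed
    then show False using nc v by simp
  qed
qed

text \<open>\<open>pa\<close> and \<open>pb\<close> delimit the piece of the curve on the side of
  \<open>x0\<close> on which \<open>y\<close> lies, or the whole curve if it misses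
  \<open>x0\<close>. A piece that reaches the end is closed at \<open>stop_nat\<close>; the maximum
  in \<open>pb\<close> ensures \<open>pa \<le> pb\<close> on \<open>Lip1 X\<close>.\<close>

definition pa :: "'a \<Rightarrow> 'a \<Rightarrow> (real \<Rightarrow> 'a) \<Rightarrow> real" where
  "pa x y c = (if after x y c then ft x c else 0)"

definition pb :: "'a \<Rightarrow> 'a \<Rightarrow> (real \<Rightarrow> 'a) \<Rightarrow> real" where
  "pb x y c = (if x \<in> ctrace c \<and> \<not> after x y c then ft x c else max (ft x c) (real (stop_nat c)))"

lemma pa_pb: assumes "c \<in> Lip1 X" shows "0 \<le> pa x y c" "pa x y c \<le> pb x y c"
  using ft(1)[OF assms, of x] by (auto simp: pa_def pb_def)

lemma AE_piece:
  assumes M: "0 < Mt" and y: "y \<noteq> x0"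
  shows "AE c in P. y \<in> ctrace c \<longrightarrow> (AE t in lborel. 0 \<le> t \<longrightarrow> 0 < sp c t \<longrightarrow> pa x0 y c \<le> t \<and> t \<le> pb x0 y c \<longrightarrow>
    connected_via X P (UNIV - {x0}) y (c t) \<and> 0 < th (c t))"
  using AE_props AE_good_start[of y]
proof eventually_elim
  case (elim c)
  have g: "c \<in> Lip1 X" "simple_curve c" using elim by auto
  have G: "AE r in lborel. 0 \<le> r \<longrightarrow> 0 < sp c r \<longrightarrow> r \<in> good c" "AE r in lborel. 0 \<le> r \<longrightarrow> 0 < sp c r \<longrightarrow> 0 < th (c r)" using elim by auto
  show ?case
  proof
    assume tr: "y \<in> ctrace c"
    have v: "c (ft y c) = y" using ft(2)[OF g(1) tr] .
    show "AE t in lborel. 0 \<le> t \<longrightarrow> 0 < sp c t \<longrightarrow> pa x0 y c \<le> t \<and> t \<le> pb x0 y c \<longrightarrow>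
      connected_via X P (UNIV - {x0}) y (c t) \<and> 0 < th (c t)"
      using G AE_moving_ne[OF g, of x0] AE_lborel_singleton[of "ft x0 c"]
    proof eventually_elim
      case (elim t)
      note e2 = elim
      show ?case
      proof (intro impI conjI)
        assume t: "0 \<le> t" "0 < sp c t" "pa x0 y c \<le> t \<and> t \<le> pb x0 y c"
        show "0 < th (c t)" using e2 t by blast
        have "connected_via X P (UNIV - {x0}) (c (ft y c)) (c t)"
        proof (rule connect_same_side[OF \<open>c \<in> Lip1 X \<and> _\<close> M])
          show "ft y c \<in> good c" using \<open>y \<in> ctrace c \<longrightarrow> _\<close> tr by blast
          show "t \<in> good c" "c t \<noteq> x0" using e2 t by blast+
          show "c (ft y c) \<noteq> x0" using v y by simp
          assume x: "x0 \<in> ctrace c"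
          show "ft x0 c < ft y c \<and> ft x0 c < t \<or> ft y c < ft x0 c \<and> t < ft x0 c"
          proof (cases "after x0 y c")
            case True
            then show ?thesis using t e2 by (auto simp: after_def pa_def)
          next
            case False
            then show ?thesis using t e2 x not_after[OF g(1) tr y False x] by (auto simp: pb_def)
          qed
        qed
        then show "connected_via X P (UNIV - {x0}) y (c t)" using v by simp
      qed
    qed
  qed
qed

text \<open>The piece has length at least \<open>C\<close>: it is the whole curve, or it joins
  \<open>x0\<close> to an end point, which is far away. Its moving points lie in the component of
  \<open>y\<close>, so \<open>big\<close> bounds their multiplicity by \<open>2 * th y\<close> and
  the weight from below.\<close>

lemma AE_piece_cost:
  assumes M: "0 < Mt" and y: "y \<noteq> x0" "0 < th y"
    and big: "\<And>z. 0 < th z \<Longrightarrow> connected_via X P (UNIV - {x0}) y z \<Longrightarrow> th z \<le> 2 * th y"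
    and far: "AE \<gamma> in P. C \<le> dist (\<gamma> 0) x0 \<and> C \<le> dist (einf \<gamma>) x0"
    and len: "AE \<gamma> in P. ennreal C \<le> lint \<gamma> (\<lambda>_. 1)"
  shows "AE \<gamma> in P. y \<in> ctrace \<gamma> \<longrightarrow>
     ennreal ((2 * th y) powr (\<alpha> - 1)) * ennreal C \<le> lint (seg (pa x0 y \<gamma>) (pb x0 y \<gamma>) \<gamma>) W"
  using AE_piece[OF M y(1)] AE_props far len
proof eventually_elim
  case (elim \<gamma>)
  have g: "\<gamma> \<in> Lip1 X" "fin \<gamma>" using elim by auto
  note ab = pa_pb[OF g(1), of x0 y]
  let ?c = "ennreal ((2 * th y) powr (\<alpha> - 1))"
  have L: "seg (pa x0 y \<gamma>) (pb x0 y \<gamma>) \<gamma> \<in> Lip1 X" by (rule seg_Lip1[OF g(1) ab])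
  show ?case
  proof
    assume tr: "y \<in> ctrace \<gamma>"
    have 1: "ennreal C \<le> lint (seg (pa x0 y \<gamma>) (pb x0 y \<gamma>) \<gamma>) (\<lambda>_. 1)"
    proof (cases "x0 \<in> ctrace \<gamma>")
      case False
      then have e: "pa x0 y \<gamma> = 0" "pb x0 y \<gamma> = real (stop_nat \<gamma>)" by (auto simp: pa_def pb_def after_def ft_def)
      have "lint (seg 0 (real (stop_nat \<gamma>)) \<gamma>) (\<lambda>_. 1) = lint \<gamma> (\<lambda>_. 1)"
        by (rule lint_seg_all[OF g(1), where c="einf \<gamma>"]) (auto intro: stop_nat[OF g])
      then show ?thesis using elim e by simp
    next
      case True
      have v: "\<gamma> (ft x0 \<gamma>) = x0" by (rule ft(2)[OF g(1) True])
      have "ennreal C \<le> ennreal (dist (\<gamma> (pa x0 y \<gamma>)) (\<gamma> (pb x0 y \<gamma>)))"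
      proof (cases "after x0 y \<gamma>")
        case True
        have "\<gamma> (pb x0 y \<gamma>) = einf \<gamma>" by (rule stop_nat[OF g]) (simp add: pb_def True)
        then show ?thesis using elim v True by (intro ennreal_leI) (simp add: pa_def dist_commute)
      next
        case False
        then show ?thesis using elim v \<open>x0 \<in> ctrace \<gamma>\<close> by (intro ennreal_leI) (simp add: pa_def pb_def)
      qed
      also have "\<dots> \<le> lint (seg (pa x0 y \<gamma>) (pb x0 y \<gamma>) \<gamma>) (\<lambda>_. 1)" by (rule lint_ge_dist[OF g(1) ab])
      finally show ?thesis .
    qed
    have "?c * ennreal C \<le> ?c * lint (seg (pa x0 y \<gamma>) (pb x0 y \<gamma>) \<gamma>) (\<lambda>_. 1)" by (rule mult_left_mono[OF 1]) simp
    also have "\<dots> = lint (seg (pa x0 y \<gamma>) (pb x0 y \<gamma>) \<gamma>) (\<lambda>_. ?c * 1)" by (rule lint_cmult[OF L, symmetric]) simp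
    also have "\<dots> = (\<integral>\<^sup>+t\<in>{pa x0 y \<gamma>..pb x0 y \<gamma>}. (?c * 1) * ennreal (sp \<gamma> t) \<partial>lborel)"
      by (rule lint_seg[OF g(1) ab]) simp
    also have "\<dots> \<le> (\<integral>\<^sup>+t\<in>{pa x0 y \<gamma>..pb x0 y \<gamma>}. W (\<gamma> t) * ennreal (sp \<gamma> t) \<partial>lborel)"
    proof (rule nn_integral_mono_AE, use elim(1)[rule_format, OF tr] in eventually_elim)
      case (elim t)
      show ?case
      proof (cases "t \<in> {pa x0 y \<gamma>..pb x0 y \<gamma>} \<and> 0 < sp \<gamma> t")
        case True
        then have "connected_via X P (UNIV - {x0}) y (\<gamma> t)" "0 < th (\<gamma> t)" using elim ab by auto
        then have "(2 * th y) powr (\<alpha> - 1) \<le> th (\<gamma> t) powr (\<alpha> - 1)"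
          using big[of "\<gamma> t"] \<alpha> by (intro powr_mono2') auto
        then have "?c \<le> W (\<gamma> t)" using \<open>0 < th (\<gamma> t)\<close> by (simp add: W_pos ennreal_leI)
        then show ?thesis by (auto intro!: mult_right_mono)
      next
        case False
        then have "t \<notin> {pa x0 y \<gamma>..pb x0 y \<gamma>} \<or> sp \<gamma> t = 0" using sp_nonneg[of \<gamma> t] by (auto simp: order_less_le)
        then show ?thesis by auto
      qed
    qed
    also have "\<dots> = lint (seg (pa x0 y \<gamma>) (pb x0 y \<gamma>) \<gamma>) W" by (rule lint_seg[OF g(1) ab measurable_W, symmetric])
    finally show "?c * ennreal C \<le> lint (seg (pa x0 y \<gamma>) (pb x0 y \<gamma>) \<gamma>) W" .
  qed
qed

end

section \<open>A lower bound for the multiplicity\<close>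

lemma join_end:
  assumes "0 \<le> L" "0 < L2" "\<And>t. L2 \<le> t \<Longrightarrow> c2 t = e" "L + L2 \<le> t" shows "join L c1 c2 t = e"
  using assms(1,2,4) assms(3)[of "t - L"] by (simp add: join_def)

locale dyadic_plan = optimal_plan X P \<alpha> + dyadic X Bd \<alpha>
  for X :: "'a::euclidean_space set" and P Bd \<alpha>
begin

lemma measurable_pa: "pa x y \<in> borel_measurable P" and measurable_pb: "pb x y \<in> borel_measurable P"
proof -
  note [measurable] = measurable_ft_P
  have [measurable]: "{c\<in>space P. x \<in> ctrace c} \<in> sets P" by (rule sets_hit)
  have [measurable]: "(\<lambda>c. real (stop_nat c)) \<in> borel_measurable P"
    using measurable_compose[OF measurable_stop_nat, of real borel] by (simp add: measurable_P_iff)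
  have [measurable]: "Measurable.pred P (\<lambda>c. x \<in> ctrace c)" unfolding pred_def by measurable
  have [measurable]: "Measurable.pred P (after x y)" unfolding after_def by measurable
  show "pa x y \<in> borel_measurable P" "pb x y \<in> borel_measurable P"
    unfolding pa_def[abs_def] pb_def[abs_def] by measurable
qed

text \<open>The competitor leaves each curve through \<open>y\<close> at the two ends of its piece, merges with the others
  along dyadic paths, and then follows one of finitely many fixed curves of the plan, whose cost is
  proportional to \<open>th y\<close>, whereas the saved cost is of order \<open>(th y) powr \<alpha>\<close>.\<close>

lemma component_lower_bound:
  assumes C: "0 < C" and far: "AE \<gamma> in P. C \<le> dist (\<gamma> 0) x0 \<and> C \<le> dist (einf \<gamma>) x0"
    and len: "AE \<gamma> in P. ennreal C \<le> lint \<gamma> (\<lambda>_. 1)"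
  shows "\<exists>\<beta>>0. \<forall>y. y \<noteq> x0 \<longrightarrow> 0 < th y \<longrightarrow>
    (\<forall>z. 0 < th z \<longrightarrow> connected_via X P (UNIV - {x0}) y z \<longrightarrow> th z \<le> 2 * th y) \<longrightarrow> \<beta> \<le> th y"
proof -
  \<comment> \<open>The left side of the surgery inequality will be at least
    \<open>A * th y powr \<alpha>\<close>: the factor \<alpha>, the length \<open>C\<close>, the
    weight \<open>(2 * th y) powr (\<alpha> - 1)\<close> and the mass \<open>th y\<close>.\<close>
  define A where "A = \<alpha> * C * 2 powr (\<alpha> - 1)"
  have A: "0 < A" using \<alpha> C by (simp add: A_def)
  define \<kappa> where "\<kappa> = (1 / 2 :: real) powr (\<alpha> - 1)"
  have \<kappa>: "0 < \<kappa>" by (simp add: \<kappa>_def)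
  \<comment> \<open>Each rerouted curve uses four dyadic paths, each with the factor
    \<open>\<kappa>\<close> from halving the multiplicity; this level keeps their total cost within
    half of the saving.\<close>
  have "eventually (\<lambda>k. \<delta> k < A / (8 * \<kappa>)) sequentially"
    by (rule order_tendstoD(2)[OF \<delta>_tendsto]) (use A \<kappa> in simp)
  then obtain k0 where "\<delta> k0 < A / (8 * \<kappa>)" by (auto simp: eventually_sequentially)
  then have k0: "4 * (\<kappa> * \<delta> k0) \<le> A / 2" using \<kappa> by (simp add: field_simps)
  \<comment> \<open>A pair \<open>v\<close> of cells is served by some curve of finite cost that
    passes from the first cell to the second. The witnesses are fixed before \<open>y\<close> is
    given, which makes \<open>Zs\<close>, and with it \<open>\<beta>\<close>, independent of
    \<open>y\<close>.\<close>
  define wit where "wit v w \<longleftrightarrow> fst w \<in> space P \<and> lint (fst w) W < \<infinity> \<and> 0 \<le> fst (snd w) \<and> fst (snd w) \<le> snd (snd w) \<and>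
    cell k0 (fst w (fst (snd w))) = fst v \<and> cell k0 (fst w (snd (snd w))) = snd v" for v :: "'a \<times> 'a" and w :: "(real \<Rightarrow> 'a) \<times> real \<times> real"
  define VS where "VS = {v\<in>cells k0 \<times> cells k0. \<exists>w. wit v w}"
  have VSf: "finite VS" unfolding VS_def using cells(1) by auto
  define sw where "sw v = (SOME w. wit v w)" for v
  define cu where "cu v = fst (sw v)" for v
  define s1 where "s1 v = fst (snd (sw v))" for v
  define s2 where "s2 v = snd (snd (sw v))" for v
  have wit: "cu v \<in> Lip1 X" "lint (cu v) W < \<infinity>" "0 \<le> s1 v" "s1 v \<le> s2 v" "0 \<le> s2 v"
    "cell k0 (cu v (s1 v)) = fst v" "cell k0 (cu v (s2 v)) = snd v" if "v \<in> VS" for v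
  proof -
    have "\<exists>w. wit v w" using that by (simp add: VS_def)
    from someI_ex[OF this] have "wit v (sw v)" unfolding sw_def .
    then show "cu v \<in> Lip1 X" "lint (cu v) W < \<infinity>" "0 \<le> s1 v" "s1 v \<le> s2 v" "0 \<le> s2 v"
      "cell k0 (cu v (s1 v)) = fst v" "cell k0 (cu v (s2 v)) = snd v"
      unfolding wit_def cu_def[symmetric] s1_def[symmetric] s2_def[symmetric] space_P by auto
  qed
  define Zs where "Zs = (\<Sum>v\<in>VS. enn2real (lint (cu v) W))"
  have Zs0: "0 \<le> Zs" unfolding Zs_def by (intro sum_nonneg) simp
  have Zs: "lint (cu v) W \<le> ennreal Zs" if "v \<in> VS" for v
  proof -
    have "enn2real (lint (cu v) W) \<le> Zs" unfolding Zs_def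
      by (rule member_le_sum[OF that _ VSf]) simp
    then have "ennreal (enn2real (lint (cu v) W)) \<le> ennreal Zs" by (rule ennreal_leI)
    then show ?thesis using wit(2)[OF that] by simp
  qed
  let ?T = "tk k0"
  have T: "0 < ?T" "0 \<le> ?T" using tk_pos[of k0] by auto
  define D where "D = \<kappa> * Zs + 1"
  have D: "0 < D" using \<kappa> Zs0 by (simp add: D_def add_nonneg_pos)
  \<comment> \<open>The positive solution \<open>b\<close> of
    \<open>A / 2 * b powr \<alpha> = D * b\<close>; the summand 1 in \<open>D\<close> keeps the
    quotient meaningful when \<open>Zs\<close> is 0.\<close>
  define \<beta> where "\<beta> = (A / (2 * D)) powr (1 / (1 - \<alpha>))"
  have \<beta>: "0 < \<beta>" using A D by (simp add: \<beta>_def)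
  have "\<beta> \<le> th y" if y: "y \<noteq> x0" "0 < th y" and big: "\<And>z. 0 < th z \<Longrightarrow> connected_via X P (UNIV - {x0}) y z \<Longrightarrow> th z \<le> 2 * th y" for y
  proof -
    have M: "0 < Mt" using y th_le[of y] by (simp add: Mt_def)
    define B where "B = {\<gamma>\<in>space P. y \<in> ctrace \<gamma> \<and> lint \<gamma> W < \<infinity>}"
    have Wm: "(\<lambda>\<gamma>. lint \<gamma> W) \<in> borel_measurable P" by (rule measurable_lint_fixed[OF id_P measurable_W])
    have Bm[measurable]: "B \<in> sets P"
    proof -
      have "{\<gamma>\<in>space P. lint \<gamma> W < \<infinity>} \<in> sets P" using Wm by measurable
      moreover have "B = {\<gamma>\<in>space P. y \<in> ctrace \<gamma>} \<inter> {\<gamma>\<in>space P. lint \<gamma> W < \<infinity>}" by (auto simp: B_def)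
      ultimately show ?thesis using sets_hit[of y] by simp
    qed
    have Bsub: "B \<subseteq> space P" by (auto simp: B_def)
    define b where "b = th y"
    have PB: "measure P B = b"
    proof -
      have "measure P B = measure P {\<gamma>\<in>space P. y \<in> ctrace \<gamma>}"
        by (rule finite_measure_eq_AE) (use AE_W_fin AE_space sets_hit[of y] Bm in \<open>auto simp: B_def elim!: eventually_elim2\<close>)
      then show ?thesis by (simp add: b_def th_eq)
    qed
    have eB: "emeasure P B = ennreal b" by (simp add: emeasure_eq_measure PB)
    have b: "0 < b" using y by (simp add: b_def)
    obtain \<gamma>0 where \<gamma>0: "\<gamma>0 \<in> B" using PB b by (metis all_not_in_conv less_irrefl measure_empty)
    have L: "\<gamma> \<in> Lip1 X" if "\<gamma> \<in> space P" for \<gamma> using that by (simp add: space_P)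
    define a where "a \<gamma> = (if \<gamma> \<in> B then pa x0 y \<gamma> else 0)" for \<gamma>
    define e where "e \<gamma> = (if \<gamma> \<in> B then pb x0 y \<gamma> else 0)" for \<gamma>
    \<comment> \<open>Off \<open>B\<close> a fixed curve of \<open>B\<close> stands in, so that the
      end points, cells and paths below are meaningful and measurable on the whole space;
      \<open>\<pi>\<close> uses them only on \<open>B\<close>.\<close>
    define pick where "pick \<gamma> = (if \<gamma> \<in> B then \<gamma> else \<gamma>0)" for \<gamma>
    have pickB: "pick \<gamma> \<in> B" for \<gamma> using \<gamma>0 by (simp add: pick_def)
    have pickL: "pick \<gamma> \<in> Lip1 X" for \<gamma> using pickB Bsub L by blast
    define p where "p \<gamma> = pick \<gamma> (pa x0 y (pick \<gamma>))" for \<gamma>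
    define p' where "p' \<gamma> = pick \<gamma> (pb x0 y (pick \<gamma>))" for \<gamma>
    have n: "0 \<le> pa x0 y \<gamma>" "pa x0 y \<gamma> \<le> pb x0 y \<gamma>" "0 \<le> pb x0 y \<gamma>" if "\<gamma> \<in> Lip1 X" for \<gamma>
      using pa_pb[OF that, of x0 y] by auto
    have pX: "p \<gamma> \<in> X" "p' \<gamma> \<in> X" for \<gamma>
      unfolding p_def p'_def by (intro Lip1_in[OF pickL] n pickL)+
    note [measurable] = measurable_pa measurable_pb
    have am: "a \<in> borel_measurable P" "e \<in> borel_measurable P" unfolding a_def[abs_def] e_def[abs_def] by measurable
    have pm[measurable]: "p \<in> borel_measurable P" "p' \<in> borel_measurable P"
    proof -
      have [measurable]: "(\<lambda>\<gamma>. \<gamma> (pa x0 y \<gamma>)) \<in> borel_measurable P" "(\<lambda>\<gamma>. \<gamma> (pb x0 y \<gamma>)) \<in> borel_measurable P"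
        by (rule measurable_Lip1_joint[OF id_P]; use n L measurable_pa measurable_pb in auto)+
      have "p = (\<lambda>\<gamma>. if \<gamma> \<in> B then \<gamma> (pa x0 y \<gamma>) else \<gamma>0 (pa x0 y \<gamma>0))" "p' = (\<lambda>\<gamma>. if \<gamma> \<in> B then \<gamma> (pb x0 y \<gamma>) else \<gamma>0 (pb x0 y \<gamma>0))"
        by (auto simp: p_def p'_def pick_def)
      then show "p \<in> borel_measurable P" "p' \<in> borel_measurable P" by simp_all
    qed
    define u where "u \<gamma> = (cell k0 (p \<gamma>), cell k0 (p' \<gamma>))" for \<gamma>
    have um: "u \<in> borel_measurable P" unfolding u_def[abs_def] by measurable
    \<comment> \<open>The picked curve itself witnesses that its pair of cells is served.\<close>
    have uV: "u \<gamma> \<in> VS" for \<gamma>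
    proof -
      have "wit (u \<gamma>) (pick \<gamma>, pa x0 y (pick \<gamma>), pb x0 y (pick \<gamma>))"
        unfolding wit_def u_def p_def p'_def using pickB[of \<gamma>] n[OF pickL] by (auto simp: B_def)
      then show ?thesis unfolding VS_def using cells(3)[OF pX(1)] cells(3)[OF pX(2)] by (auto simp: u_def)
    qed
    define g2 where "g2 \<gamma> = cu (u \<gamma>) (s1 (u \<gamma>))" for \<gamma>
    define g3 where "g3 \<gamma> = cu (u \<gamma>) (s2 (u \<gamma>))" for \<gamma>
    have gX: "g2 \<gamma> \<in> X" "g3 \<gamma> \<in> X" for \<gamma> unfolding g2_def g3_def by (intro Lip1_in wit uV)+
    have gm: "g2 \<in> borel_measurable P" "g3 \<in> borel_measurable P"
      unfolding g2_def[abs_def] g3_def[abs_def]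
      by (rule measurable_finite_range[where h="\<lambda>v. cu v (s1 v)", OF um VSf], use uV in auto)
         (rule measurable_finite_range[where h="\<lambda>v. cu v (s2 v)", OF um VSf], use uV in auto)
    have zzeq: "zz k0 (g2 \<gamma>) = zz k0 (p \<gamma>)" "zz k0 (g3 \<gamma>) = zz k0 (p' \<gamma>)" for \<gamma>
      using wit(6,7)[OF uV[of \<gamma>]] by (auto simp: zz_def g2_def g3_def u_def)
    \<comment> \<open>The five parts of the detour: from \<open>p\<close> to the node of its cell,
      out to the point \<open>g2\<close> of the fixed curve in the same cell, along the fixed curve
      to \<open>g3\<close>, to the node of that cell, and out to \<open>p'\<close>.\<close>
    define c1 where "c1 \<gamma> = dpath k0 (p \<gamma>)" for \<gamma>
    define c2 where "c2 \<gamma> = rev_curve ?T (dpath k0 (g2 \<gamma>))" for \<gamma>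
    define c3 where "c3 \<gamma> = seg (s1 (u \<gamma>)) (s2 (u \<gamma>)) (cu (u \<gamma>))" for \<gamma>
    define c4 where "c4 \<gamma> = dpath k0 (g3 \<gamma>)" for \<gamma>
    define c5 where "c5 \<gamma> = rev_curve ?T (dpath k0 (p' \<gamma>))" for \<gamma>
    define L3 where "L3 \<gamma> = s2 (u \<gamma>) - s1 (u \<gamma>)" for \<gamma>
    have cm: "c1 \<in> measurable P (Lip1_borel X)" "c2 \<in> measurable P (Lip1_borel X)" "c3 \<in> measurable P (Lip1_borel X)"
      "c4 \<in> measurable P (Lip1_borel X)" "c5 \<in> measurable P (Lip1_borel X)"
    proof -
      show "c1 \<in> measurable P (Lip1_borel X)" unfolding c1_def[abs_def] by (rule measurable_dpath[where g=p, OF pm(1)]) (rule pX)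
      show "c2 \<in> measurable P (Lip1_borel X)" unfolding c2_def[abs_def]
        by (rule measurable_rev_curve, rule measurable_dpath[where g=g2, OF gm(1)]) (rule gX)
      show "c3 \<in> measurable P (Lip1_borel X)" unfolding c3_def[abs_def]
        by (rule measurable_finite_range[where h="\<lambda>v. seg (s1 v) (s2 v) (cu v)", OF um VSf]) (use uV wit in \<open>auto intro!: seg_Lip1\<close>)
      show "c4 \<in> measurable P (Lip1_borel X)" unfolding c4_def[abs_def] by (rule measurable_dpath[where g=g3, OF gm(2)]) (rule gX)
      show "c5 \<in> measurable P (Lip1_borel X)" unfolding c5_def[abs_def]
        by (rule measurable_rev_curve, rule measurable_dpath[where g=p', OF pm(2)]) (rule pX)
    qed
    have L3m: "L3 \<in> borel_measurable P" unfolding L3_def[abs_def]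
      by (rule measurable_finite_range[where h="\<lambda>v. s2 v - s1 v", OF um VSf]) (use uV in auto)
    have L30: "0 \<le> L3 \<gamma>" for \<gamma> using wit(4)[OF uV[of \<gamma>]] by (simp add: L3_def)
    have cL: "c1 \<gamma> \<in> Lip1 X" "c2 \<gamma> \<in> Lip1 X" "c3 \<gamma> \<in> Lip1 X" "c4 \<gamma> \<in> Lip1 X" "c5 \<gamma> \<in> Lip1 X" for \<gamma>
      unfolding c1_def c2_def c3_def c4_def c5_def by (intro rev_curve_Lip1 dpath_Lip1 pX gX seg_Lip1 wit uV)+
    have c1e: "c1 \<gamma> 0 = p \<gamma>" "\<And>t. ?T \<le> t \<Longrightarrow> c1 \<gamma> t = zz k0 (p \<gamma>)" for \<gamma> by (simp_all add: c1_def dpath_0 dpath_end)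
    have c2e: "c2 \<gamma> 0 = zz k0 (p \<gamma>)" "\<And>t. ?T \<le> t \<Longrightarrow> c2 \<gamma> t = g2 \<gamma>" for \<gamma>
      using T by (auto simp: c2_def rev_curve_const dpath_0) (simp add: rev_curve_def dpath_end zzeq)
    have c3e: "c3 \<gamma> 0 = g2 \<gamma>" "\<And>t. L3 \<gamma> \<le> t \<Longrightarrow> c3 \<gamma> t = g3 \<gamma>" for \<gamma>
      using seg_at[OF wit(3,4)[OF uV]] by (auto simp: c3_def g2_def g3_def L3_def)
    have c4e: "c4 \<gamma> 0 = g3 \<gamma>" "\<And>t. ?T \<le> t \<Longrightarrow> c4 \<gamma> t = zz k0 (p' \<gamma>)" for \<gamma> by (simp_all add: c4_def dpath_0 dpath_end zzeq)
    have c5e: "c5 \<gamma> 0 = zz k0 (p' \<gamma>)" "\<And>t. ?T \<le> t \<Longrightarrow> c5 \<gamma> t = p' \<gamma>" for \<gamma>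
      using T by (auto simp: c5_def rev_curve_const dpath_0) (simp add: rev_curve_def dpath_end)
    define j4 where "j4 \<gamma> = join ?T (c4 \<gamma>) (c5 \<gamma>)" for \<gamma>
    define j3 where "j3 \<gamma> = join (L3 \<gamma>) (c3 \<gamma>) (j4 \<gamma>)" for \<gamma>
    define j2 where "j2 \<gamma> = join ?T (c2 \<gamma>) (j3 \<gamma>)" for \<gamma>
    define j1 where "j1 \<gamma> = join ?T (c1 \<gamma>) (j2 \<gamma>)" for \<gamma>
    have jc4: "c4 \<gamma> ?T = c5 \<gamma> 0" for \<gamma> by (simp add: c4e c5e)
    have jc3: "c3 \<gamma> (L3 \<gamma>) = j4 \<gamma> 0" for \<gamma> using T by (simp add: j4_def join_0 c4e c3e)
    have jc2: "c2 \<gamma> ?T = j3 \<gamma> 0" for \<gamma> using L30 by (simp add: j3_def join_0 c3e c2e)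
    have jc1: "c1 \<gamma> ?T = j2 \<gamma> 0" for \<gamma> using T by (simp add: j2_def join_0 c2e c1e)
    have j4m: "j4 \<in> measurable P (Lip1_borel X)" unfolding j4_def[abs_def] by (rule measurable_join[OF cm(4,5)]) (use T jc4 in auto)
    have j3m: "j3 \<in> measurable P (Lip1_borel X)" unfolding j3_def[abs_def] by (rule measurable_join[OF cm(3) j4m L3m]) (use L30 jc3 in auto)
    have j2m: "j2 \<in> measurable P (Lip1_borel X)" unfolding j2_def[abs_def] by (rule measurable_join[OF cm(2) j3m]) (use T jc2 in auto)
    have j1m: "j1 \<in> measurable P (Lip1_borel X)" unfolding j1_def[abs_def] by (rule measurable_join[OF cm(1) j2m]) (use T jc1 in auto)
    have jL: "j4 \<gamma> \<in> Lip1 X" "j3 \<gamma> \<in> Lip1 X" "j2 \<gamma> \<in> Lip1 X" for \<gamma>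
    proof -
      show 4: "j4 \<gamma> \<in> Lip1 X" unfolding j4_def by (rule join_Lip1[OF cL(4,5) T(2) jc4])
      show 3: "j3 \<gamma> \<in> Lip1 X" unfolding j3_def by (rule join_Lip1[OF cL(3) 4 L30 jc3])
      show "j2 \<gamma> \<in> Lip1 X" unfolding j2_def by (rule join_Lip1[OF cL(2) 3 T(2) jc2])
    qed
    define \<pi> where "\<pi> \<gamma> = (if \<gamma> \<in> B then j1 \<gamma> else pre 0 \<gamma>)" for \<gamma>
    define \<Lambda> where "\<Lambda> \<gamma> = ?T + (?T + (L3 \<gamma> + (?T + ?T)))" for \<gamma>
    have \<Lambda>m: "\<Lambda> \<in> borel_measurable P" unfolding \<Lambda>_def[abs_def] using L3m by measurable
    have \<pi>m: "\<pi> \<in> measurable P (Lip1_borel X)" unfolding \<pi>_def[abs_def]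
    proof (rule measurable_If[OF j1m])
      show "(\<lambda>\<gamma>. pre 0 \<gamma>) \<in> measurable P (Lip1_borel X)" by (rule measurable_pre[OF id_P]) auto
      show "{x \<in> space P. x \<in> B} \<in> sets P" by measurable
    qed
    have j1e: "j1 \<gamma> t = p' \<gamma>" if t: "\<Lambda> \<gamma> \<le> t" for \<gamma> t
    proof -
      have 4: "j4 \<gamma> t = p' \<gamma>" if "?T + ?T \<le> t" for t unfolding j4_def by (rule join_end[OF T(2) T(1) _ that]) (rule c5e)
      have 3: "j3 \<gamma> t = p' \<gamma>" if "L3 \<gamma> + (?T + ?T) \<le> t" for t
        unfolding j3_def by (rule join_end[OF L30 _ _ that]) (use T 4 in auto)
      have 2: "j2 \<gamma> t = p' \<gamma>" if "?T + (L3 \<gamma> + (?T + ?T)) \<le> t" for t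
        unfolding j2_def by (rule join_end[OF T(2) _ _ that]) (use T L30[of \<gamma>] 3 in auto)
      show ?thesis unfolding j1_def
        by (rule join_end[OF T(2) _ _ t[unfolded \<Lambda>_def]]) (use T L30[of \<gamma>] 2 in auto)
    qed
    have \<pi>0: "\<pi> \<gamma> 0 = \<gamma> (a \<gamma>)" for \<gamma>
      using T by (simp add: \<pi>_def a_def j1_def join_0 c1e p_def pick_def) (simp add: pre_def)
    have \<pi>1: "\<pi> \<gamma> t = \<gamma> (e \<gamma>)" if "\<Lambda> \<gamma> \<le> t" for \<gamma> t
      using j1e[OF that] that T L30[of \<gamma>] by (auto simp: \<pi>_def e_def p'_def pick_def pre_def \<Lambda>_def)
    have tj: "ctrace (j1 \<gamma>) = ctrace (dpath k0 (p \<gamma>)) \<union> (ctrace (dpath k0 (g2 \<gamma>)) \<union> (ctrace (c3 \<gamma>) \<union> (ctrace (dpath k0 (g3 \<gamma>)) \<union> ctrace (dpath k0 (p' \<gamma>)))))" for \<gamma>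
    proof -
      have r: "ctrace (rev_curve ?T (dpath k0 x)) = ctrace (dpath k0 x)" for x
        by (rule ctrace_rev_curve[OF T(2)]) (simp add: dpath_end)
      have 4: "ctrace (j4 \<gamma>) = ctrace (c4 \<gamma>) \<union> ctrace (c5 \<gamma>)" unfolding j4_def
        by (rule trace_join) (rule T(2), rule jc4, simp add: c4e)
      have 3: "ctrace (j3 \<gamma>) = ctrace (c3 \<gamma>) \<union> ctrace (j4 \<gamma>)" unfolding j3_def
        by (rule trace_join) (rule L30, rule jc3, simp add: c3e)
      have 2: "ctrace (j2 \<gamma>) = ctrace (c2 \<gamma>) \<union> ctrace (j3 \<gamma>)" unfolding j2_def
        by (rule trace_join) (rule T(2), rule jc2, simp add: c2e)
      have 1: "ctrace (j1 \<gamma>) = ctrace (c1 \<gamma>) \<union> ctrace (j2 \<gamma>)" unfolding j1_def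
        by (rule trace_join) (rule T(2), rule jc1, simp add: c1e)
      show ?thesis unfolding 1 2 3 4 unfolding c1_def c2_def c4_def c5_def r ..
    qed
    have lj: "lint (j1 \<gamma>) f = lint (c1 \<gamma>) f + (lint (c2 \<gamma>) f + (lint (c3 \<gamma>) f + (lint (c4 \<gamma>) f + lint (c5 \<gamma>) f)))"
      if f: "f \<in> borel_measurable borel" for \<gamma> f
    proof -
      have 4: "lint (j4 \<gamma>) f = lint (c4 \<gamma>) f + lint (c5 \<gamma>) f" unfolding j4_def
        by (rule lint_join[OF cL(4,5) T(2) jc4 _ f]) (simp add: c4e)
      have 3: "lint (j3 \<gamma>) f = lint (c3 \<gamma>) f + lint (j4 \<gamma>) f" unfolding j3_def
        by (rule lint_join[OF cL(3) jL(1) L30 jc3 _ f]) (simp add: c3e)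
      have 2: "lint (j2 \<gamma>) f = lint (c2 \<gamma>) f + lint (j3 \<gamma>) f" unfolding j2_def
        by (rule lint_join[OF cL(2) jL(2) T(2) jc2 _ f]) (simp add: c2e)
      have 1: "lint (j1 \<gamma>) f = lint (c1 \<gamma>) f + lint (j2 \<gamma>) f" unfolding j1_def
        by (rule lint_join[OF cL(1) jL(3) T(2) jc1 _ f]) (simp add: c1e)
      show ?thesis unfolding 1 2 3 4 ..
    qed
    define tp where "tp w = measure P {\<gamma>\<in>space P. w \<in> ctrace (\<pi> \<gamma>)}" for w
    define m where "m w = max (th w) (tp w) / 2" for w
    define V where "V w = weight \<alpha> (m w)" for w
    have sur: "ennreal \<alpha> * (\<integral>\<^sup>+\<gamma>. lint (seg (a \<gamma>) (e \<gamma>) \<gamma>) W \<partial>P) \<le> (\<integral>\<^sup>+\<gamma>. lint (\<pi> \<gamma>) V \<partial>P)"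
      unfolding V_def m_def tp_def
      by (rule surgery_inequality[OF am \<Lambda>m \<pi>m]) (use n L T L30 \<pi>0 \<pi>1 in \<open>auto simp: a_def e_def \<Lambda>_def\<close>)
    have pc: "AE \<gamma> in P. y \<in> ctrace \<gamma> \<longrightarrow>
        ennreal ((2 * th y) powr (\<alpha> - 1)) * ennreal C \<le> lint (seg (pa x0 y \<gamma>) (pb x0 y \<gamma>) \<gamma>) W"
      by (rule AE_piece_cost[OF M y _ far len]) (rule big)
    have lo: "ennreal ((2 * b) powr (\<alpha> - 1)) * ennreal C * ennreal b \<le> (\<integral>\<^sup>+\<gamma>. lint (seg (a \<gamma>) (e \<gamma>) \<gamma>) W \<partial>P)"
    proof -
      let ?k = "ennreal ((2 * b) powr (\<alpha> - 1)) * ennreal C"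
      have "?k * ennreal b = (\<integral>\<^sup>+\<gamma>. ?k * indicator B \<gamma> \<partial>P)" unfolding eB[symmetric] by (rule nn_integral_cmult_indicator[symmetric]) simp
      also have "\<dots> \<le> (\<integral>\<^sup>+\<gamma>. lint (seg (a \<gamma>) (e \<gamma>) \<gamma>) W \<partial>P)"
      proof (rule nn_integral_mono_AE, use pc in eventually_elim)
        case (elim \<gamma>)
        show ?case
        proof (cases "\<gamma> \<in> B")
          case True
          then have "y \<in> ctrace \<gamma>" by (simp add: B_def)
          then show ?thesis using elim True by (simp add: a_def e_def b_def)
        qed simp
      qed
      finally show ?thesis .
    qed
    let ?R = "restrict_space P B"
    have BP: "B \<inter> space P \<in> sets P" by simp
    have Rf: "finite_measure ?R" by (rule finite_measure_restrict_space[OF finite_measure_axioms Bm])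
    have spR: "space ?R = B" using Bsub by (auto simp: space_restrict_space)
    have mR: "measure ?R (space ?R) = b" unfolding spR using measure_restrict_space[OF BP order_refl] PB by simp
    have mm[measurable]: "m \<in> borel_measurable borel" unfolding m_def[abs_def] tp_def
      using measurable_mass_real[OF finite_measure_axioms \<pi>m] by measurable
    have Vm: "V \<in> borel_measurable borel" unfolding V_def[abs_def] weight_def by measurable
    have pim: "{\<gamma>\<in>space P. w \<in> ctrace (\<pi> \<gamma>)} \<in> sets P" for w by (rule measurable_ctrace_pred[OF \<pi>m]) simp
    \<comment> \<open>Each family of dyadic paths lies on the traces of the detours, so its mass is
      a lower bound for \<open>tp\<close>. The factor is the \<open>1 / 2\<close> in the definition
      of \<open>m\<close>.\<close>
    have ge: "1 / 2 * measure ?R {\<omega>'\<in>space ?R. w \<in> ctrace (dpath k0 (h \<omega>'))} \<le> m w"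
      if h: "\<And>\<gamma>. ctrace (dpath k0 (h \<gamma>)) \<subseteq> ctrace (j1 \<gamma>)" for h w
    proof -
      have "measure ?R {\<omega>'\<in>space ?R. w \<in> ctrace (dpath k0 (h \<omega>'))} = measure P {\<omega>'\<in>B. w \<in> ctrace (dpath k0 (h \<omega>'))}"
        unfolding spR by (rule measure_restrict_space[OF BP]) auto
      also have "\<dots> \<le> tp w" unfolding tp_def
        by (rule finite_measure_mono[OF _ pim]) (use h Bsub in \<open>auto simp: \<pi>_def\<close>)
      finally show ?thesis by (simp add: m_def)
    qed
    define Q where "Q = ennreal (\<kappa> * \<delta> k0 * b powr \<alpha>)"
    have half: "0 < (1 / 2 :: real)" by simp
    have Rm: "h \<in> borel_measurable ?R" if "h \<in> borel_measurable P" for h :: "(real \<Rightarrow> 'a) \<Rightarrow> 'a"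
      by (rule measurable_restrict_space1[OF that])
    have cost1: "(\<integral>\<^sup>+\<gamma>. lint (dpath k0 (h \<gamma>)) V \<partial>?R) \<le> Q" and cost2: "(\<integral>\<^sup>+\<gamma>. lint (rev_curve ?T (dpath k0 (h \<gamma>))) V \<partial>?R) \<le> Q"
      if h: "h \<in> borel_measurable P" "\<And>\<gamma>. h \<gamma> \<in> X" "\<And>\<gamma>. ctrace (dpath k0 (h \<gamma>)) \<subseteq> ctrace (j1 \<gamma>)" for h
      using dpath_cost_le[where g=h and M="?R" and \<kappa>="1/2" and m=m and ?k0.0=k0, OF Rf Rm[OF h(1)] h(2) half mm ge[OF h(3)]]
      unfolding mR V_def Q_def \<kappa>_def by auto
    have Q: "(\<integral>\<^sup>+\<gamma>. lint (c1 \<gamma>) V \<partial>?R) \<le> Q" "(\<integral>\<^sup>+\<gamma>. lint (c2 \<gamma>) V \<partial>?R) \<le> Q" "(\<integral>\<^sup>+\<gamma>. lint (c4 \<gamma>) V \<partial>?R) \<le> Q" "(\<integral>\<^sup>+\<gamma>. lint (c5 \<gamma>) V \<partial>?R) \<le> Q"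
      unfolding c1_def c2_def c4_def c5_def
      by (rule cost1[of p], auto simp: pm pX tj) (rule cost2[of g2], auto simp: gm gX tj, rule cost1[of g3], auto simp: gm gX tj, rule cost2[of p'], auto simp: pm pX tj)
    \<comment> \<open>Along the fixed curves the old multiplicity is what bounds the weight: half of
      it survives, so \<open>V\<close> is at most \<open>cc * W\<close>.\<close>
    have c3V: "lint (c3 \<gamma>) V \<le> ennreal (\<kappa> * Zs)" for \<gamma>
    proof -
      have "lint (c3 \<gamma>) V \<le> lint (c3 \<gamma>) (\<lambda>w. cc * W w)"
        by (rule lint_mono) (unfold V_def m_def, rule weight_half_le, simp)
      also have "\<dots> = cc * lint (c3 \<gamma>) W" by (rule lint_cmult[OF cL(3) measurable_W])
      also have "\<dots> \<le> cc * ennreal Zs"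
      proof (rule mult_left_mono)
        have "lint (c3 \<gamma>) W \<le> lint (cu (u \<gamma>)) W"
          unfolding c3_def by (rule lint_seg_le[OF wit(1,3,4)[OF uV] measurable_W])
        then show "lint (c3 \<gamma>) W \<le> ennreal Zs" using Zs[OF uV] by (rule order_trans)
      qed simp
      also have "\<dots> = ennreal (\<kappa> * Zs)" unfolding cc_def \<kappa>_def using Zs0 by (simp add: ennreal_mult)
      finally show ?thesis .
    qed
    have c3Q: "(\<integral>\<^sup>+\<gamma>. lint (c3 \<gamma>) V \<partial>?R) \<le> ennreal (\<kappa> * Zs) * ennreal b"
    proof -
      have "(\<integral>\<^sup>+\<gamma>. lint (c3 \<gamma>) V \<partial>?R) \<le> (\<integral>\<^sup>+\<gamma>. ennreal (\<kappa> * Zs) \<partial>?R)" by (rule nn_integral_mono) (rule c3V)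
      also have "\<dots> = ennreal (\<kappa> * Zs) * emeasure ?R (space ?R)" by simp
      also have "emeasure ?R (space ?R) = ennreal b" unfolding spR using emeasure_restrict_space[OF BP order_refl] eB by simp
      finally show ?thesis .
    qed
    have up: "(\<integral>\<^sup>+\<gamma>. lint (\<pi> \<gamma>) V \<partial>P) \<le> Q + (Q + (ennreal (\<kappa> * Zs) * ennreal b + (Q + Q)))"
    proof -
      have lm[measurable]: "(\<lambda>\<gamma>. lint (c \<gamma>) V) \<in> borel_measurable ?R" if "c \<in> measurable P (Lip1_borel X)" for c
        by (rule measurable_restrict_space1[OF measurable_lint_fixed[OF that Vm]])
      note [measurable] = lm[OF cm(1)] lm[OF cm(2)] lm[OF cm(3)] lm[OF cm(4)] lm[OF cm(5)]
      have "(\<integral>\<^sup>+\<gamma>. lint (\<pi> \<gamma>) V \<partial>P) = (\<integral>\<^sup>+\<gamma>. lint (j1 \<gamma>) V * indicator B \<gamma> \<partial>P)"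
        by (rule nn_integral_cong) (simp add: \<pi>_def pre_0_eq_cst lint_cst)
      also have "\<dots> = (\<integral>\<^sup>+\<gamma>. lint (j1 \<gamma>) V \<partial>?R)" by (rule nn_integral_restrict_space[OF BP, symmetric])
      also have "\<dots> = (\<integral>\<^sup>+\<gamma>. lint (c1 \<gamma>) V \<partial>?R) + ((\<integral>\<^sup>+\<gamma>. lint (c2 \<gamma>) V \<partial>?R) + ((\<integral>\<^sup>+\<gamma>. lint (c3 \<gamma>) V \<partial>?R) + ((\<integral>\<^sup>+\<gamma>. lint (c4 \<gamma>) V \<partial>?R) + (\<integral>\<^sup>+\<gamma>. lint (c5 \<gamma>) V \<partial>?R))))"
        unfolding lj[OF Vm] by (simp add: nn_integral_add)
      also have "\<dots> \<le> Q + (Q + (ennreal (\<kappa> * Zs) * ennreal b + (Q + Q)))" by (intro add_mono Q c3Q)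
      finally show ?thesis .
    qed
    have "ennreal \<alpha> * (ennreal ((2 * b) powr (\<alpha> - 1)) * ennreal C * ennreal b) \<le> Q + (Q + (ennreal (\<kappa> * Zs) * ennreal b + (Q + Q)))"
      using order_trans[OF mult_left_mono[OF lo, of "ennreal \<alpha>"] order_trans[OF sur up]] by simp
    moreover have "ennreal \<alpha> * (ennreal ((2 * b) powr (\<alpha> - 1)) * ennreal C * ennreal b) = ennreal (\<alpha> * ((2 * b) powr (\<alpha> - 1) * C * b))"
      using \<alpha> C b by (simp add: ennreal_mult)
    moreover have q0: "0 \<le> \<kappa> * \<delta> k0 * b powr \<alpha>" "0 \<le> \<kappa> * Zs * b" using \<kappa> \<delta>_nonneg[of k0] Zs0 b by simp_all
    have "Q + (Q + (ennreal (\<kappa> * Zs) * ennreal b + (Q + Q))) = ennreal (\<kappa> * \<delta> k0 * b powr \<alpha> + (\<kappa> * \<delta> k0 * b powr \<alpha> + (\<kappa> * Zs * b + (\<kappa> * \<delta> k0 * b powr \<alpha> + \<kappa> * \<delta> k0 * b powr \<alpha>))))"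
    proof -
      have z: "ennreal (\<kappa> * Zs) * ennreal b = ennreal (\<kappa> * Zs * b)"
        by (rule ennreal_mult[symmetric]) (use \<kappa> Zs0 b in auto)
      show ?thesis unfolding Q_def z using q0 by (simp only: ennreal_plus add_nonneg_nonneg)
    qed
    ultimately have "\<alpha> * ((2 * b) powr (\<alpha> - 1) * C * b) \<le> \<kappa> * \<delta> k0 * b powr \<alpha> + (\<kappa> * \<delta> k0 * b powr \<alpha> + (\<kappa> * Zs * b + (\<kappa> * \<delta> k0 * b powr \<alpha> + \<kappa> * \<delta> k0 * b powr \<alpha>)))"
      using q0 by (simp only: ennreal_le_iff add_nonneg_nonneg)
    moreover have "\<alpha> * ((2 * b) powr (\<alpha> - 1) * C * b) = A * b powr \<alpha>"
      using b by (simp add: A_def powr_mult powr_diff)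
    ultimately have "A * b powr \<alpha> \<le> 4 * (\<kappa> * \<delta> k0) * b powr \<alpha> + \<kappa> * Zs * b" by (simp add: mult_ac)
    also have "\<dots> \<le> A / 2 * b powr \<alpha> + D * b"
      using k0 b by (intro add_mono mult_right_mono) (auto simp: D_def)
    finally have f: "A / 2 * b powr \<alpha> \<le> D * b" by (simp add: field_simps)
    have "A / (2 * D) \<le> b powr (1 - \<alpha>)"
    proof -
      have "A / 2 \<le> D * (b / b powr \<alpha>)" using f b by (simp add: field_simps)
      also have "b / b powr \<alpha> = b powr (1 - \<alpha>)" using b by (simp add: powr_diff)
      finally show ?thesis using D by (simp add: field_simps)
    qed
    then have "\<beta> \<le> (b powr (1 - \<alpha>)) powr (1 / (1 - \<alpha>))" unfolding \<beta>_def
      using A D \<alpha> by (intro powr_mono2) auto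
    also have "\<dots> = b" using b \<alpha> by (simp add: powr_powr)
    finally show "\<beta> \<le> th y" by (simp add: b_def)
  qed
  then show ?thesis using \<beta> by blast
qed

end

section \<open>Finiteness of the number of components\<close>

context optimal_plan
begin

lemma Gamma_plan_eq: "Gamma_plan P = {y. 0 < th y}"
  by (simp add: Gamma_plan_def th_def)

text \<open>A curve meets at most two of the points chosen in different components, so their
  multiplicities add up to at most \<open>2 * Mt\<close>, while each of them is at least
  \<open>\<beta>\<close>.\<close>

lemma finite_components:
  assumes \<beta>: "0 < \<beta>" "\<And>y. y \<noteq> x0 \<Longrightarrow> 0 < th y \<Longrightarrow>
    (\<And>z. 0 < th z \<Longrightarrow> connected_via X P (UNIV - {x0}) y z \<Longrightarrow> th z \<le> 2 * th y) \<Longrightarrow> \<beta> \<le> th y"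
  shows "finite (connected_components X P (UNIV - {x0}))"
proof (rule ccontr)
  let ?r = "connection_rel X P (UNIV - {x0})"
  assume inf: "infinite (connected_components X P (UNIV - {x0}))"
  have eq: "equiv (Gamma_plan P) ?r" by (rule equiv_connection_rel)
  \<comment> \<open>The class of \<open>x0\<close>, if there is one, is set aside, since the lower
    bound is stated for points other than \<open>x0\<close>.\<close>
  define CC where "CC = {F\<in>Gamma_plan P // ?r. x0 \<notin> F}"
  have "Gamma_plan P // ?r - CC \<subseteq> {?r `` {x0}}"
  proof
    fix F assume "F \<in> Gamma_plan P // ?r - CC"
    then have F: "F \<in> Gamma_plan P // ?r" "x0 \<in> F" by (auto simp: CC_def)
    have "x0 \<in> Gamma_plan P" using F eq in_quotient_imp_subset by blast
    then have "?r `` {x0} \<in> Gamma_plan P // ?r" "x0 \<in> ?r `` {x0}"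
      using quotientI equiv_class_self[OF eq] by auto
    then show "F \<in> {?r `` {x0}}" using quotient_disj[OF eq F(1)] F(2) by blast
  qed
  then have "infinite CC" using inf unfolding connected_components_def
    by (metis finite.emptyI finite_insert finite_subset Diff_infinite_finite Diff_subset double_diff rev_finite_subset finite_Diff2)
  have cls: "z \<in> F" if F: "F \<in> CC" and y: "y \<in> F" and z: "0 < th z" "connected_via X P (UNIV - {x0}) y z" for F y z
  proof -
    have "y \<in> Gamma_plan P" using F y in_quotient_imp_subset[OF eq] by (auto simp: CC_def)
    then have "(y, z) \<in> ?r" using z by (simp add: connection_rel_def Gamma_plan_eq)
    then show ?thesis using in_quotient_imp_closed[OF eq _ y] F by (auto simp: CC_def)
  qed
  \<comment> \<open>The supremum of \<open>th\<close> on a component need not be attained; a point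
    above half of it is enough and accounts for the factor 2.\<close>
  have "\<exists>y\<in>F. \<forall>z\<in>F. th z \<le> 2 * th y" if F: "F \<in> CC" for F
  proof -
    have F': "F \<in> Gamma_plan P // ?r" using F by (simp add: CC_def)
    obtain y0 where y0: "y0 \<in> F" using in_quotient_imp_non_empty[OF eq F'] by blast
    then have p: "0 < th y0" using in_quotient_imp_subset[OF eq F'] by (auto simp: Gamma_plan_eq)
    have bd: "bdd_above (th ` F)" unfolding bdd_above_def using th_le by blast
    have S: "th y0 \<le> Sup (th ` F)" by (rule cSup_upper[OF _ bd]) (use y0 in auto)
    then have s: "Sup (th ` F) / 2 < Sup (th ` F)" using p by simp
    obtain y where y: "y \<in> F" "Sup (th ` F) / 2 < th y" using less_cSupD[OF _ s] y0 by blast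
    have "th z \<le> 2 * th y" if "z \<in> F" for z
      using cSup_upper[OF imageI[OF that, of th] bd] y by simp
    then show ?thesis using y by blast
  qed
  then obtain f where f: "\<And>F. F \<in> CC \<Longrightarrow> f F \<in> F" "\<And>F z. F \<in> CC \<Longrightarrow> z \<in> F \<Longrightarrow> th z \<le> 2 * th (f F)" by metis
  have fG: "0 < th (f F)" "f F \<noteq> x0" if "F \<in> CC" for F
    using in_quotient_imp_subset[OF eq, of F] f(1)[OF that] that by (auto simp: CC_def Gamma_plan_eq)
  have fb: "\<beta> \<le> th (f F)" if F: "F \<in> CC" for F
    by (rule \<beta>(2)[OF fG(2,1)[OF F]]) (rule f(2)[OF F], rule cls[OF F f(1)[OF F]])
  have nc: "\<not> connected_via X P (UNIV - {x0}) (f F) (f G)" if F: "F \<in> CC" and G: "G \<in> CC" and ne: "F \<noteq> G" for F G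
  proof
    assume "connected_via X P (UNIV - {x0}) (f F) (f G)"
    then have "f G \<in> F" using cls[OF F f(1)[OF F] fG(1)[OF G]] by simp
    then show False using quotient_disj[OF eq, of F G] F G ne f(1)[OF G] by (auto simp: CC_def)
  qed
  obtain n :: nat where n: "2 * Mt / \<beta> < real n" using reals_Archimedean2 by blast
  obtain T where T: "T \<subseteq> CC" "finite T" "card T = Suc n" using infinite_arbitrarily_large[OF \<open>infinite CC\<close>] by blast
  have M: "0 < Mt"
  proof -
    obtain F where "F \<in> T" using T by fastforce
    then show ?thesis using fG(1)[of F] T th_le[of "f F"] by (auto simp: Mt_def)
  qed
  have "AE \<gamma> in P. \<forall>F\<in>T. \<forall>G\<in>T. F \<noteq> G \<longrightarrow> f F \<in> ctrace \<gamma> \<and> f G \<in> ctrace \<gamma> \<longrightarrow> after x0 (f F) \<gamma> \<noteq> after x0 (f G) \<gamma>"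
  proof (intro AE_finite_allI T(2))
    fix F G assume "F \<in> T" "G \<in> T"
    then have FG: "F \<in> CC" "G \<in> CC" using T by auto
    show "AE \<gamma> in P. F \<noteq> G \<longrightarrow> f F \<in> ctrace \<gamma> \<and> f G \<in> ctrace \<gamma> \<longrightarrow> after x0 (f F) \<gamma> \<noteq> after x0 (f G) \<gamma>"
    proof (cases "F = G")
      case False
      show ?thesis using AE_separated[OF M fG(2)[OF FG(1)] fG(2)[OF FG(2)] nc[OF FG False]] by simp
    qed simp
  qed
  then have AE2: "AE \<gamma> in P. (\<Sum>F\<in>T. indicator (ctrace \<gamma>) (f F)) \<le> (2::ennreal)"
  proof eventually_elim
    case (elim \<gamma>)
    let ?S = "{F\<in>T. f F \<in> ctrace \<gamma>}"
    \<comment> \<open>The side of \<open>x0\<close> is a Boolean that distinguishes the chosen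
      points on one curve.\<close>
    have "inj_on (\<lambda>F. after x0 (f F) \<gamma>) ?S" using elim by (auto simp: inj_on_def)
    then have "card ?S \<le> card (UNIV :: bool set)" by (rule card_inj_on_le) auto
    then have c: "card ?S \<le> 2" by simp
    have "(\<Sum>F\<in>T. indicator (ctrace \<gamma>) (f F)) = (\<Sum>F\<in>T. if f F \<in> ctrace \<gamma> then 1 else 0 :: ennreal)"
      by (rule sum.cong) (auto simp: indicator_def)
    also have "\<dots> = of_nat (card ?S)" using T(2) by (simp add: sum.If_cases Int_def)
    also have "\<dots> \<le> of_nat 2" using c by (simp only: of_nat_le_iff)
    finally show ?case by simp
  qed
  have "(\<Sum>F\<in>T. ennreal (th (f F))) = (\<integral>\<^sup>+\<gamma>. (\<Sum>F\<in>T. indicator (ctrace \<gamma>) (f F)) \<partial>P)"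
    unfolding ennreal_th mass_def
    by (rule nn_integral_sum[symmetric]) (rule measurable_ctrace_indicator[OF id_P], simp)
  also have "\<dots> \<le> (\<integral>\<^sup>+\<gamma>. 2 \<partial>P)" by (rule nn_integral_mono_AE[OF AE2])
  also have "\<dots> = ennreal (2 * Mt)" by (simp add: Mt_def emeasure_eq_measure ennreal_mult)
  finally have "ennreal (\<Sum>F\<in>T. th (f F)) \<le> ennreal (2 * Mt)" by (simp add: sum_ennreal)
  then have 1: "(\<Sum>F\<in>T. th (f F)) \<le> 2 * Mt" using M by (simp add: ennreal_le_iff)
  have "real (Suc n) * \<beta> = (\<Sum>F\<in>T. \<beta>)" using T by simp
  also have "\<dots> \<le> (\<Sum>F\<in>T. th (f F))" by (rule sum_mono) (use fb T in auto)
  finally have "real (Suc n) * \<beta> \<le> 2 * Mt" using 1 by simp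
  moreover have "2 * Mt < real n * \<beta>" using n \<beta>(1) by (simp add: field_simps)
  ultimately show False using \<beta>(1) by (simp add: algebra_simps)
qed

end

text \<open>The connecting sets are contained in \<open>X\<close>, so a chain cannot notice the
  removal of a point outside \<open>X\<close>.\<close>

lemma (in curve_plan) connected_components_outside:
  assumes "x0 \<notin> X"
  shows "connected_components X P (UNIV - {x0}) = connected_components X P UNIV"
proof -
  have "Gamma_between X P y z \<subseteq> UNIV - {x0}" for y z using Gamma_between_subset[of y z] assms by blast
  then show ?thesis by (simp add: connected_components_def connection_rel_def connected_via_def)
qed

lemma AE_far_from_support:
  assumes m: "h \<in> borel_measurable P" and x: "x \<notin> supp (distr P borel h)"
  shows "\<exists>r>0. AE c in P. r \<le> dist (h c) x"
proof -
  obtain U where U: "open U" "x \<in> U" "emeasure (distr P borel h) U = 0"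
    using x by (auto simp: supp_def not_less zero_less_iff_neq_zero)
  obtain r where r: "0 < r" "ball x r \<subseteq> U" using U openE by blast
  have "AE z in distr P borel h. z \<notin> U" using U by (intro AE_not_in) (auto simp: null_sets_def)
  moreover have "{z \<in> space borel. z \<notin> U} \<in> sets borel"
    using borel_comp[OF borel_open[OF U(1)]] by (simp add: Compl_eq)
  ultimately have "AE c in P. h c \<notin> U" by (simp only: AE_distr_iff[OF m])
  then have "AE c in P. r \<le> dist (h c) x"
    by eventually_elim (use r in \<open>auto simp: subset_iff dist_commute not_less[symmetric]\<close>)
  then show ?thesis using r by blast
qed

text \<open>The common source of both claims: \<open>x0\<close> has to keep a positive distance from
  the end points of almost all curves, which holds off the two supports and also for points outside
  \<open>X\<close>.\<close>

lemma finitely_many_components: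
  fixes X :: "'a::euclidean_space set" and P :: "(real \<Rightarrow> 'a) measure" and \<alpha> C :: real
  assumes X: "compact X" "convex X" and \<alpha>: "1 - 1 / real DIM('a) < \<alpha>" "\<alpha> < 1"
    and P: "P \<in> OTP X \<alpha> (coupling P)" and C: "C > 0"
    and len: "AE \<gamma> in P. ennreal C \<le> (\<integral>\<^sup>+t\<in>{0..}. ennreal (speed \<gamma> t) \<partial>lborel)"
    and far: "0 < r" "AE \<gamma> in P. r \<le> dist (\<gamma> 0) x0 \<and> r \<le> dist (einf \<gamma>) x0"
  shows "finite (connected_components X P (UNIV - {x0}))"
proof -
  obtain b where b: "\<And>x. x \<in> X \<Longrightarrow> norm x \<le> b" using compact_imp_bounded[OF X(1)] bounded_iff by blast
  define Bd where "Bd = \<bar>b\<bar> + 1"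
  have dy: "dyadic X Bd \<alpha>"
  proof
    show "0 < Bd" by (simp add: Bd_def)
    fix x k :: 'a assume "x \<in> X" "k \<in> Basis"
    then show "\<bar>x \<bullet> k\<bar> < Bd" using b[of x] Basis_le_norm[of k x] by (simp add: Bd_def)
  qed (use X \<alpha> in auto)
  interpret dyadic X Bd \<alpha> by (rule dy)
  have tp: "traffic_plan X P" using P by (simp add: OTP_def TP_def)
  interpret curve_plan X P by (rule traffic_planD(1)[OF tp X(1)])
  have fin: "AE \<gamma> in P. fin \<gamma>" by (rule traffic_planD(2)[OF tp X(1)])
  have opt: "energy \<alpha> P \<le> energy \<alpha> Q" if "Q \<in> TP X (coupling P)" for Q using P that by (simp add: OTP_def)
  obtain Q where Q: "Q \<in> TP X (coupling P)" "energy \<alpha> Q < \<infinity>" using exists_finite_energy[OF tp X(1)] by blast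
  have fe: "energy \<alpha> P < \<infinity>" using opt[OF Q(1)] Q(2) by (rule order_le_less_trans)
  interpret optimal_plan X P \<alpha>
    by unfold_locales (use \<alpha>0 \<alpha>(2) fin opt fe in auto)
  interpret dyadic_plan X P Bd \<alpha> by unfold_locales
  define c where "c = min C r"
  have c: "0 < c" using C far by (simp add: c_def)
  have f: "AE \<gamma> in P. c \<le> dist (\<gamma> 0) x0 \<and> c \<le> dist (einf \<gamma>) x0"
    using far(2) by eventually_elim (auto simp: c_def min_le_iff_disj)
  have l: "AE \<gamma> in P. ennreal c \<le> lint \<gamma> (\<lambda>_. 1)"
    using len AE_space
  proof eventually_elim
    case (elim \<gamma>)
    have g: "\<gamma> \<in> Lip1 X" using elim by (simp add: space_P)
    have "(\<integral>\<^sup>+t\<in>{0..}. ennreal (speed \<gamma> t) \<partial>lborel) = lint \<gamma> (\<lambda>_. 1)"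
      unfolding lint_def
      by (rule nn_integral_cong_AE, use Lip1_AE_speed[OF g] in eventually_elim) (auto simp: indicator_def)
    moreover have "ennreal c \<le> ennreal C" by (rule ennreal_leI) (simp add: c_def)
    ultimately show ?case using elim by auto
  qed
  obtain \<beta> where "0 < \<beta>" "\<And>y. y \<noteq> x0 \<Longrightarrow> 0 < th y \<Longrightarrow>
    (\<And>z. 0 < th z \<Longrightarrow> connected_via X P (UNIV - {x0}) y z \<Longrightarrow> th z \<le> 2 * th y) \<Longrightarrow> \<beta> \<le> th y"
    using component_lower_bound[OF c f l] by blast
  then show ?thesis by (rule finite_components)
qed

theorem theorem5p2:
  fixes X :: "'a::euclidean_space set" and P :: "(real \<Rightarrow> 'a) measure" and \<alpha> C :: real
  assumes "compact X" and "convex X"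
    and "1 - 1 / real DIM('a) < \<alpha>" and "\<alpha> < 1"
    and "P \<in> OTP X \<alpha> (coupling P)"
    and "C > 0"
    and "AE \<gamma> in P. ennreal C \<le> (\<integral>\<^sup>+t\<in>{0..}. ennreal (speed \<gamma> t) \<partial>lborel)"
  shows "(\<forall>x. x \<notin> supp (mu_minus P) \<union> supp (mu_plus P) \<longrightarrow>
            finite (connected_components X P (UNIV - {x}))) \<and>
         finite (connected_components X P UNIV)"
proof -
  have "traffic_plan X P" using assms(5) by (simp add: OTP_def TP_def)
  then interpret curve_plan X P by (rule traffic_planD(1)[OF _ assms(1)])
  have m: "e0 \<in> borel_measurable P" "einf \<in> borel_measurable P"
    using measurable_e0 measurable_einf by (auto simp: measurable_P_iff)
  have "finite (connected_components X P (UNIV - {x}))" if x: "x \<notin> supp (mu_minus P) \<union> supp (mu_plus P)" for x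
  proof -
    obtain r1 where r1: "0 < r1" "AE \<gamma> in P. r1 \<le> dist (e0 \<gamma>) x"
      using AE_far_from_support[OF m(1)] x by (auto simp: mu_minus_def)
    obtain r2 where r2: "0 < r2" "AE \<gamma> in P. r2 \<le> dist (einf \<gamma>) x"
      using AE_far_from_support[OF m(2)] x by (auto simp: mu_plus_def)
    show ?thesis
    proof (rule finitely_many_components[OF assms, of "min r1 r2"])
      show "0 < min r1 r2" using r1 r2 by simp
      show "AE \<gamma> in P. min r1 r2 \<le> dist (\<gamma> 0) x \<and> min r1 r2 \<le> dist (einf \<gamma>) x"
        using r1(2) r2(2) by eventually_elim (auto simp: e0_def min_le_iff_disj)
    qed
  qed
  moreover have "finite (connected_components X P UNIV)"
  proof -
    obtain b where b: "\<And>x. x \<in> X \<Longrightarrow> norm x \<le> b" using compact_imp_bounded[OF assms(1)] bounded_iff by blast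
    obtain x0 :: 'a where x0: "norm x0 = \<bar>b\<bar> + 1" using vector_choose_size[of "\<bar>b\<bar> + 1"] by auto
    have d: "1 \<le> dist x x0" if "x \<in> X" for x
      using b[OF that] x0 norm_triangle_ineq2[of x0 x] by (simp add: dist_norm norm_minus_commute)
    have "finite (connected_components X P (UNIV - {x0}))"
    proof (rule finitely_many_components[OF assms, of 1])
      show "AE \<gamma> in P. 1 \<le> dist (\<gamma> 0) x0 \<and> 1 \<le> dist (einf \<gamma>) x0"
        using AE_space by eventually_elim (simp add: space_P d Lip1_in einf_in)
    qed simp
    moreover have "x0 \<notin> X" using d[of x0] by auto
    ultimately show ?thesis by (simp add: connected_components_outside)
  qed
  ultimately show ?thesis by blast
qed

end
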